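(* Let $n\ge 2$, let $M$ be an $(n-1)$-space group, and let $\Delta$ be the infinite dihedral $1$-space group generated by the reflections $\delta_1=-I'$ (that is, $x\mapsto -x$) and $\delta_2=1-I'$ (that is, $x\mapsto 1-x$) of $E^1$. Let $[\Gamma,N]\in\mathrm{Iso}(\Delta,M)$, let $V=\mathrm{Span}(N)$, and let $\alpha:V\to E^{n-1}$ be an affinity such that $\alpha\overline N\alpha^{-1}=M$. Let $\{N\gamma_1,N\gamma_2\}$ be a set of Coxeter generators of $\Gamma/N$, and let $\beta:\Delta\to\Gamma/N$ be the isomorphism defined by $\beta(\delta_i)=N\gamma_i$ for $i=1,2$. Let $\Xi:\Gamma/N\to\mathrm{Isom}(V/N)$ be the homomorphism induced by the action of $\Gamma/N$ on $V/N$. Write $\gamma_i=b_i+B_i$ with $b_i\in E^n$ and $B_i\in\mathrm O(n)$ for $i=1,2$, and let $E_i$ be the $(-1)$-eigenspace of $B_i$ restricted to $\mathrm{Span}(Z(N))$ for $i=1,2$. Then: (a) $[\alpha_\sharp\Xi\beta]\in\psi^{-1}([\Gamma,N])$, and $[\alpha_\sharp\Xi\beta]$ corresponds to the conjugacy class of the pair of elements $\{(\alpha\overline\gamma_1\alpha^{-1})_\star,(\alpha\overline\gamma_2\alpha^{-1})_\star\}$ of $\mathrm{Aff}(M)$. (b) $\psi^{-1}([\Gamma,N])$ is the set of all the elements of $\mathrm{Aff}(\Delta,M)$ that correspond to the conjugacy class of a pair of elements $\{(\alpha\overline\gamma_1\alpha^{-1})_\star,(\alpha(v+\overline I)\overline\gamma_2\alpha^{-1})_\star\}$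 of $\mathrm{Aff}(M)$ for any $v\in E_1\cap E_2$ (i.e. as $v$ ranges over $E_1\cap E_2$). (c) In particular, if $E_1\cap E_2=\{0\}$, then $\psi^{-1}([\Gamma,N])=\{[\alpha_\sharp\Xi\beta]\}$.
   Context: Conventions. $E^k$ is Euclidean $k$-space. The map $x\mapsto a+Ax$ is written $a+A$; it is an affinity of $E^k$ if $a\in E^k$, $A\in\mathrm{GL}(k,\mathbb R)$, and an isometry iff $A\in\mathrm O(k)$. $I'$ is the identity map of $E^1$, and $\overline I$ is the identity map of $V$. A $k$-space group is a discrete group of isometries of $E^k$ with compact orbit space. For a group $G$ of isometries of $E^k$, $\mathrm{Span}(G)$ is the linear span of $\{a:a+I\in G\}$; $Z(G)$ is the center of $G$. A set of Coxeter generators of an infinite dihedral group is a pair of elements of order $2$ that generate it. Restricted actions. Let $N$ be a normal subgroup of an $n$-space group $\Gamma$ with $\Gamma/N$ infinite dihedral, and $V=\mathrm{Span}(N)$. Each $\gamma\in\Gamma$ acts diagonally on $E^n=V\times V^\perp$ as $\gamma(v,w)=(\overline\gamma v,\gamma'w)$ with $\overline\gamma\in\mathrm{Isom}(V)$, $\gamma'\in\mathrm{Isom}(V^\perp)$. Put $\overline N=\{\overline\nu:\nu\in N\}$; it is a space group of isometries of $V$, isomorphic to $N$, and $V/N=V/\overline N$. The homomorphism $\Xi$ is $\Xi(N\gamma)=\overline\gamma_\star$, where $\overline\gamma_\star(Nv)=N\overline\gamma(v)$. Affinities of orbifolds. If $M_1,M_2$ are space groups of isometries of Euclidean spaces $W_1,W_2$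 and $\phi:W_1\to W_2$ is an affinity with $\phi M_1\phi^{-1}=M_2$, then $\phi_\star:W_1/M_1\to W_2/M_2$ is $\phi_\star(M_1x)=M_2\phi(x)$; maps of this form are the affinities. $\mathrm{Aff}(M)=\mathrm{Aff}(E^{n-1}/M)$ is the group of affinities of $E^{n-1}/M$ to itself, and $\phi_\sharp:\mathrm{Aff}(W_1/M_1)\to\mathrm{Aff}(W_2/M_2)$ is $\phi_\sharp(\xi)=\phi_\star\xi\phi_\star^{-1}$. The homomorphism $\Omega:\mathrm{Aff}(M)\to\mathrm{Out}(M)$ sends $\tilde\xi_\star$ to the class of $\mu\mapsto\tilde\xi\mu\tilde\xi^{-1}$. The set $\mathrm{Aff}(\Delta,M)$. $\mathrm{Hom}_f(\Delta,\mathrm{Aff}(M))$ is the set of homomorphisms $\eta:\Delta\to\mathrm{Aff}(M)$ such that $\Omega\eta$ has finite image. $\mathrm{Aff}(M)$ acts on it on the left by conjugation and $\mathrm{Aut}(\Delta)$ on the right by precomposition; $\mathrm{Inn}(\Delta)$ acts trivially on the set of $\mathrm{Aff}(M)$-orbits, and $\mathrm{Aff}(\Delta,M)=(\mathrm{Aff}(M)\backslash\mathrm{Hom}_f(\Delta,\mathrm{Aff}(M)))/\mathrm{Out}(\Delta)$, with $[\eta]$ the class of $\eta$. The element $[\eta]$ corresponds to the conjugacy class, under $\mathrm{Aff}(M)$, of the unordered pair $\{\eta(\delta_1),\eta(\delta_2)\}$; this is a one-to-one correspondence between $\mathrm{Aff}(\Delta,M)$ and the conjugacy classes of unordered pairs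 of elements of $\mathrm{Aff}(M)$ of order $1$ or $2$ whose product has image of finite order under $\Omega$. The set $\mathrm{Iso}(\Delta,M)$. It is the set of isomorphism classes $[\Gamma,N]$ of pairs $(\Gamma,N)$, where $N$ is a normal subgroup of an $n$-space group $\Gamma$ with $N\cong M$ and $\Gamma/N\cong\Delta$; $(\Gamma_1,N_1)\cong(\Gamma_2,N_2)$ if some isomorphism $\Gamma_1\to\Gamma_2$ maps $N_1$ onto $N_2$. The map $\psi$. Given $\eta\in\mathrm{Hom}_f(\Delta,\mathrm{Aff}(M))$, there is $C\in\mathrm{GL}(n-1,\mathbb R)$ such that $CMC^{-1}$ is an $(n-1)$-space group and $C_\sharp\eta(\Delta)\subseteq\mathrm{Isom}(E^{n-1}/CMC^{-1})$. Write $E^n=E^{n-1}\times E^1$, and let $N$ be $CMC^{-1}$ extended to $E^n$ so as to act trivially on the factor $E^1$. There is an $n$-space group $\Gamma$ containing $N$ as a normal subgroup, each of whose elements acts diagonally as $\gamma=(\overline\gamma,\gamma')$ on $E^{n-1}\times E^1$, such that $N$ is the kernel of $\gamma\mapsto\gamma'$, $\{\gamma':\gamma\in\Gamma\}=\Delta$, and $\overline\gamma_\star=C_\sharp(\eta(\gamma'))$ for all $\gamma\in\Gamma$. Then $\psi([\eta])=[\Gamma,N]$; this gives a well-defined surjection $\psi:\mathrm{Aff}(\Delta,M)\to\mathrm{Iso}(\Delta,M)$. *)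

theory Defs
  imports
    "HOL-Analysis.Analysis"
    "HOL-Algebra.Bij"
    "HOL-Algebra.Generated_Groups"
    "HOL-Algebra.Multiplicative_Group"
begin

section \<open>Groups of transformations\<close>

text \<open>
  A Euclidean space is a subspace \<open>W\<close> of a type of class \<^class>\<open>euclidean_space\<close> (often
  \<^term>\<open>UNIV\<close>). Maps on \<open>W\<close> are extensional, so that equality of maps is equality on \<open>W\<close>;
  a group \<open>G\<close> of transformations of \<open>W\<close> is given by its set of elements.
\<close>

definition trans_group :: "'a set \<Rightarrow> ('a \<Rightarrow> 'a) set \<Rightarrow> ('a \<Rightarrow> 'a) monoid" where
  "trans_group W G = (BijGroup W)\<lparr>carrier := G\<rparr>"

definition isometries :: "('a::euclidean_space \<Rightarrow> 'a) set" where
  "isometries = {f \<in> Bij UNIV. \<forall>x y. dist (f x) (f y) = dist x y}"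

definition orbit :: "('a \<Rightarrow> 'a) set \<Rightarrow> 'a \<Rightarrow> 'a set" where
  "orbit G x = (\<lambda>g. g x) ` G"

definition orbit_space :: "'a set \<Rightarrow> ('a \<Rightarrow> 'a) set \<Rightarrow> 'a set set" where
  "orbit_space W G = orbit G ` W"

definition orbit_topology :: "('a::topological_space \<Rightarrow> 'a) set \<Rightarrow> 'a set topology" where
  "orbit_topology G = topology (\<lambda>U. U \<subseteq> orbit_space UNIV G \<and> open (orbit G -` U))"

lemma openin_orbit_topology:
  "openin (orbit_topology G) U \<longleftrightarrow> U \<subseteq> orbit_space UNIV G \<and> open (orbit G -` U)"
proof -
  have "istopology (\<lambda>U. U \<subseteq> orbit_space UNIV G \<and> open (orbit G -` U))"
    unfolding istopology_def by (auto simp: vimage_Union)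
  then show ?thesis
    unfolding orbit_topology_def by (simp add: topology_inverse')
qed

lemma topspace_orbit_topology: "topspace (orbit_topology G) = orbit_space UNIV G"
proof -
  have "orbit G -` orbit_space UNIV G = UNIV"
    by (auto simp: orbit_space_def)
  then have "openin (orbit_topology G) (orbit_space UNIV G)"
    by (simp add: openin_orbit_topology)
  then show ?thesis
    by (metis openin_orbit_topology openin_subset openin_topspace subset_antisym)
qed

lemma quotient_map_orbit: "quotient_map euclidean (orbit_topology G) (orbit G)"
  unfolding quotient_map_def topspace_orbit_topology openin_orbit_topology
  by (auto simp: orbit_space_def vimage_def)

text \<open>
  \<^const>\<open>discrete\<close> refers to the topology of pointwise convergence on \<^typ>\<open>'a \<Rightarrow> 'a\<close>, which on
  isometries agrees with the compact-open topology, and with the topology of pairs \<open>(a, A)\<close>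
  for \<open>a + A\<close>.
\<close>

definition space_group :: "('a::euclidean_space \<Rightarrow> 'a) set \<Rightarrow> bool" where
  "space_group G \<longleftrightarrow> subgroup G (BijGroup UNIV) \<and> G \<subseteq> isometries \<and> discrete G
     \<and> compact_space (orbit_topology G)"

definition Span :: "('a::euclidean_space \<Rightarrow> 'a) set \<Rightarrow> 'a set" where
  "Span G = span {a. (\<lambda>x. a + x) \<in> G}"

definition centre :: "('g, 'm) monoid_scheme \<Rightarrow> 'g set" where
  "centre G = {z \<in> carrier G. \<forall>g \<in> carrier G. z \<otimes>\<^bsub>G\<^esub> g = g \<otimes>\<^bsub>G\<^esub> z}"

definition Inn :: "('g, 'm) monoid_scheme \<Rightarrow> ('g \<Rightarrow> 'g) set" where
  "Inn G = {(\<lambda>x \<in> carrier G. g \<otimes>\<^bsub>G\<^esub> x \<otimes>\<^bsub>G\<^esub> inv\<^bsub>G\<^esub> g) | g. g \<in> carrier G}"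

definition Out :: "('g, 'm) monoid_scheme \<Rightarrow> ('g \<Rightarrow> 'g) set monoid" where
  "Out G = AutoGroup G Mod Inn G"


section \<open>Affinities of flat orbifolds\<close>

definition affinities :: "'a::euclidean_space set \<Rightarrow> 'b::euclidean_space set \<Rightarrow> ('a \<Rightarrow> 'b) set" where
  "affinities W1 W2 = {f \<in> extensional W1. bij_betw f W1 W2
     \<and> (\<exists>a A. linear A \<and> (\<forall>x\<in>W1. f x = a + A x))}"

text \<open>The map \<open>\<phi> f \<phi>\<^sup>-\<^sup>1\<close> on \<open>W2\<close>, for a bijection \<open>\<phi>\<close> from \<open>W1\<close> to \<open>W2\<close> and a map \<open>f\<close> on \<open>W1\<close>.\<close>

definition conj_map :: "'a set \<Rightarrow> 'b set \<Rightarrow> ('a \<Rightarrow> 'b) \<Rightarrow> ('a \<Rightarrow> 'a) \<Rightarrow> 'b \<Rightarrow> 'b" where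
  "conj_map W1 W2 \<phi> f = (\<lambda>y\<in>W2. \<phi> (f (inv_into W1 \<phi> y)))"

text \<open>The induced map \<open>\<phi>\<^sub>\<star>\<close> on \<open>W1/M1\<close>; see \<open>star_orbit\<close> below for \<open>\<phi>\<^sub>\<star>(M1 x) = M2 \<phi>(x)\<close>.\<close>

definition star :: "'a set \<Rightarrow> ('a \<Rightarrow> 'a) set \<Rightarrow> ('a \<Rightarrow> 'b) \<Rightarrow> 'a set \<Rightarrow> 'b set" where
  "star W1 M1 \<phi> = (\<lambda>X \<in> orbit_space W1 M1. \<phi> ` X)"

lemma star_orbit:
  assumes "bij_betw \<phi> W1 W2" and "conj_map W1 W2 \<phi> ` M1 = M2" and "x \<in> W1"
  shows "star W1 M1 \<phi> (orbit M1 x) = orbit M2 (\<phi> x)"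
proof -
  have "inv_into W1 \<phi> (\<phi> x) = x" "\<phi> x \<in> W2"
    using assms by (auto simp: bij_betw_def)
  then have "conj_map W1 W2 \<phi> \<mu> (\<phi> x) = \<phi> (\<mu> x)" for \<mu>
    by (simp add: conj_map_def)
  then show ?thesis
    using assms by (auto simp: star_def orbit_def orbit_space_def image_iff)
qed

definition normalizing_affinities :: "('a::euclidean_space \<Rightarrow> 'a) set \<Rightarrow> ('a \<Rightarrow> 'a) set" where
  "normalizing_affinities M = {\<phi> \<in> affinities UNIV UNIV. conj_map UNIV UNIV \<phi> ` M = M}"

definition Aff :: "('a::euclidean_space \<Rightarrow> 'a) set \<Rightarrow> ('a set \<Rightarrow> 'a set) monoid" where
  "Aff M = trans_group (orbit_space UNIV M) (star UNIV M ` normalizing_affinities M)"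

definition sharp ::
  "'a set \<Rightarrow> ('a \<Rightarrow> 'a) set \<Rightarrow> 'b set \<Rightarrow> ('b \<Rightarrow> 'b) set \<Rightarrow> ('a \<Rightarrow> 'b)
     \<Rightarrow> ('a set \<Rightarrow> 'a set) \<Rightarrow> 'b set \<Rightarrow> 'b set" where
  "sharp W1 M1 W2 M2 \<phi> \<xi> =
     conj_map (orbit_space W1 M1) (orbit_space W2 M2) (star W1 M1 \<phi>) \<xi>"

text \<open>\<^const>\<open>setdist\<close> on orbits is the orbit metric.\<close>

definition orbifold_isometries :: "('a::euclidean_space \<Rightarrow> 'a) set \<Rightarrow> ('a set \<Rightarrow> 'a set) set" where
  "orbifold_isometries M = {\<xi> \<in> Bij (orbit_space UNIV M).
     \<forall>X \<in> orbit_space UNIV M. \<forall>Y \<in> orbit_space UNIV M. setdist (\<xi> X) (\<xi> Y) = setdist X Y}"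

text \<open>The description is unique because the coset does not depend on the lift \<open>\<phi>\<close> of \<open>\<xi>\<close>.\<close>

definition Omega :: "('a::euclidean_space \<Rightarrow> 'a) set \<Rightarrow> ('a set \<Rightarrow> 'a set) \<Rightarrow> (('a \<Rightarrow> 'a) \<Rightarrow> 'a \<Rightarrow> 'a) set" where
  "Omega M \<xi> = (THE c. \<exists>\<phi> \<in> normalizing_affinities M. \<xi> = star UNIV M \<phi> \<and>
     c = Inn (trans_group UNIV M) #>\<^bsub>AutoGroup (trans_group UNIV M)\<^esub> (\<lambda>\<mu>\<in>M. conj_map UNIV UNIV \<phi> \<mu>))"


section \<open>The sets of classes \<open>Aff(\<Delta>, M)\<close> and \<open>Iso(\<Delta>, M)\<close>\<close>

definition delta1 :: "real \<Rightarrow> real" where "delta1 = (\<lambda>x. - x)"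
definition delta2 :: "real \<Rightarrow> real" where "delta2 = (\<lambda>x. 1 - x)"

definition Delta :: "(real \<Rightarrow> real) set" where
  "Delta = generate (BijGroup UNIV) {delta1, delta2}"

abbreviation Delta_group :: "(real \<Rightarrow> real) monoid" where
  "Delta_group \<equiv> trans_group UNIV Delta"

definition Hom_f :: "('a::euclidean_space \<Rightarrow> 'a) set \<Rightarrow> ((real \<Rightarrow> real) \<Rightarrow> 'a set \<Rightarrow> 'a set) set" where
  "Hom_f M = {\<eta> \<in> hom Delta_group (Aff M) \<inter> extensional Delta. finite (Omega M ` \<eta> ` Delta)}"

definition Aff_conj :: "('a::euclidean_space \<Rightarrow> 'a) set \<Rightarrow> ('a set \<Rightarrow> 'a set) \<Rightarrow> ('a set \<Rightarrow> 'a set) \<Rightarrow> 'a set \<Rightarrow> 'a set" where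
  "Aff_conj M \<xi> a = \<xi> \<otimes>\<^bsub>Aff M\<^esub> a \<otimes>\<^bsub>Aff M\<^esub> inv\<^bsub>Aff M\<^esub> \<xi>"

definition Aff_orbit :: "('a::euclidean_space \<Rightarrow> 'a) set \<Rightarrow> ((real \<Rightarrow> real) \<Rightarrow> 'a set \<Rightarrow> 'a set)
    \<Rightarrow> ((real \<Rightarrow> real) \<Rightarrow> 'a set \<Rightarrow> 'a set) set" where
  "Aff_orbit M \<eta> = (\<lambda>\<xi>. \<lambda>\<delta>\<in>Delta. Aff_conj M \<xi> (\<eta> \<delta>)) ` carrier (Aff M)"

text \<open>
  The right action of \<open>g \<in> Out(\<Delta>)\<close>, a coset of \<open>Inn(\<Delta>)\<close>, on an \<open>Aff(M)\<close>-orbit \<open>X\<close>: as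
  \<open>Inn(\<Delta>)\<close> acts trivially on the orbits, this is \<open>X \<sigma>\<close> for each \<open>\<sigma> \<in> g\<close>.
\<close>

definition Out_act :: "((real \<Rightarrow> real) \<Rightarrow> 'c) set \<Rightarrow> ((real \<Rightarrow> real) \<Rightarrow> real \<Rightarrow> real) set
    \<Rightarrow> ((real \<Rightarrow> real) \<Rightarrow> 'c) set" where
  "Out_act X g = {compose Delta \<eta> \<sigma> | \<eta> \<sigma>. \<eta> \<in> X \<and> \<sigma> \<in> g}"

definition Aff_class :: "('a::euclidean_space \<Rightarrow> 'a) set \<Rightarrow> ((real \<Rightarrow> real) \<Rightarrow> 'a set \<Rightarrow> 'a set)
    \<Rightarrow> ((real \<Rightarrow> real) \<Rightarrow> 'a set \<Rightarrow> 'a set) set set" where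
  "Aff_class M \<eta> = Out_act (Aff_orbit M \<eta>) ` carrier (Out Delta_group)"

definition Aff_Delta :: "('a::euclidean_space \<Rightarrow> 'a) set \<Rightarrow> ((real \<Rightarrow> real) \<Rightarrow> 'a set \<Rightarrow> 'a set) set set set" where
  "Aff_Delta M = Aff_class M ` Hom_f M"

text \<open>
  The conjugacy class of the unordered pair \<open>{a, b}\<close>, and the correspondence between elements
  of \<open>Aff(\<Delta>, M)\<close> and such classes, as a relation.
\<close>

definition pair_conj_class :: "('a::euclidean_space \<Rightarrow> 'a) set \<Rightarrow> ('a set \<Rightarrow> 'a set) set
    \<Rightarrow> ('a set \<Rightarrow> 'a set) set set" where
  "pair_conj_class M P = (\<lambda>\<xi>. Aff_conj M \<xi> ` P) ` carrier (Aff M)"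

definition corresponds :: "('a::euclidean_space \<Rightarrow> 'a) set
    \<Rightarrow> ((real \<Rightarrow> real) \<Rightarrow> 'a set \<Rightarrow> 'a set) set set \<Rightarrow> ('a set \<Rightarrow> 'a set) set set \<Rightarrow> bool" where
  "corresponds M c K \<longleftrightarrow> (\<exists>\<eta> \<in> Hom_f M. c = Aff_class M \<eta> \<and> K = pair_conj_class M {\<eta> delta1, \<eta> delta2})"

text \<open>With \<open>E\<^sup>n\<^sup>-\<^sup>1\<close> the type \<^typ>\<open>'a\<close>, the space \<open>E\<^sup>n = E\<^sup>n\<^sup>-\<^sup>1 \<times> E\<^sup>1\<close> is \<^typ>\<open>'a \<times> real\<close>.\<close>

type_synonym 'a transf = "'a \<times> real \<Rightarrow> 'a \<times> real"

definition space_pairs :: "('a::euclidean_space \<Rightarrow> 'a) set \<Rightarrow> ('a transf set \<times> 'a transf set) set" where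
  "space_pairs M = {(\<Gamma>, N). space_group \<Gamma> \<and> N \<lhd> trans_group UNIV \<Gamma>
     \<and> trans_group UNIV N \<cong> trans_group UNIV M
     \<and> (trans_group UNIV \<Gamma> Mod N) \<cong> Delta_group}"

definition pair_iso :: "('a::euclidean_space \<Rightarrow> 'a) set
    \<Rightarrow> (('a transf set \<times> 'a transf set) \<times> ('a transf set \<times> 'a transf set)) set" where
  "pair_iso M = {((\<Gamma>1, N1), (\<Gamma>2, N2)). (\<Gamma>1, N1) \<in> space_pairs M \<and> (\<Gamma>2, N2) \<in> space_pairs M
     \<and> (\<exists>f \<in> iso (trans_group UNIV \<Gamma>1) (trans_group UNIV \<Gamma>2). f ` N1 = N2)}"

definition Iso_class :: "('a::euclidean_space \<Rightarrow> 'a) set \<Rightarrow> 'a transf set \<Rightarrow> 'a transf set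
    \<Rightarrow> ('a transf set \<times> 'a transf set) set" where
  "Iso_class M \<Gamma> N = pair_iso M `` {(\<Gamma>, N)}"

definition Iso_Delta :: "('a::euclidean_space \<Rightarrow> 'a) set \<Rightarrow> ('a transf set \<times> 'a transf set) set set" where
  "Iso_Delta M = space_pairs M // pair_iso M"


section \<open>The map \<open>\<psi>\<close>\<close>

definition fst_part :: "'a transf \<Rightarrow> 'a \<Rightarrow> 'a" where
  "fst_part \<gamma> = (\<lambda>x. fst (\<gamma> (x, 0)))"

definition snd_part :: "'a::zero transf \<Rightarrow> real \<Rightarrow> real" where
  "snd_part \<gamma> = (\<lambda>t. snd (\<gamma> (0, t)))"

text \<open>\<open>(\<Gamma>, N)\<close> is a pair constructed from \<open>\<eta>\<close> by means of \<open>C\<close>; here \<open>M'\<close> is \<open>C M C\<^sup>-\<^sup>1\<close>.\<close>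

definition constructed_from :: "('a::euclidean_space \<Rightarrow> 'a) set \<Rightarrow> ((real \<Rightarrow> real) \<Rightarrow> 'a set \<Rightarrow> 'a set)
    \<Rightarrow> ('a \<Rightarrow> 'a) \<Rightarrow> 'a transf set \<Rightarrow> 'a transf set \<Rightarrow> bool" where
  "constructed_from M \<eta> C \<Gamma> N \<longleftrightarrow>
     linear C \<and> bij C \<and>
     (let M' = conj_map UNIV UNIV C ` M in
        space_group M' \<and>
        sharp UNIV M UNIV M' C ` \<eta> ` Delta \<subseteq> orbifold_isometries M' \<and>
        N = (\<lambda>\<mu>. map_prod \<mu> id) ` M' \<and>
        space_group \<Gamma> \<and> N \<lhd> trans_group UNIV \<Gamma> \<and>
        (\<forall>\<gamma>\<in>\<Gamma>. \<gamma> = map_prod (fst_part \<gamma>) (snd_part \<gamma>)) \<and>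
        N = {\<gamma> \<in> \<Gamma>. snd_part \<gamma> = id} \<and>
        snd_part ` \<Gamma> = Delta \<and>
        (\<forall>\<gamma>\<in>\<Gamma>. star UNIV M' (fst_part \<gamma>) = sharp UNIV M UNIV M' C (\<eta> (snd_part \<gamma>))))"

text \<open>
  The description is unique: the class \<open>[\<Gamma>, N]\<close> depends neither on the representative \<open>\<eta>\<close> of \<open>c\<close>
  nor on \<open>C\<close>.
\<close>

definition psi :: "('a::euclidean_space \<Rightarrow> 'a) set \<Rightarrow> ((real \<Rightarrow> real) \<Rightarrow> 'a set \<Rightarrow> 'a set) set set
    \<Rightarrow> ('a transf set \<times> 'a transf set) set" where
  "psi M c = (THE d. d \<in> Iso_Delta M \<and> (\<exists>\<eta> \<in> Hom_f M. c = Aff_class M \<eta> \<and>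
     (\<exists>C \<Gamma> N. constructed_from M \<eta> C \<Gamma> N \<and> d = Iso_class M \<Gamma> N)))"

definition psi_fibre :: "('a::euclidean_space \<Rightarrow> 'a) set \<Rightarrow> ('a transf set \<times> 'a transf set) set
    \<Rightarrow> ((real \<Rightarrow> real) \<Rightarrow> 'a set \<Rightarrow> 'a set) set set set" where
  "psi_fibre M d = {c \<in> Aff_Delta M. psi M c = d}"


section \<open>Restricted actions\<close>

text \<open>
  \<open>\<gamma>(v, w) = (bar V \<gamma> v, \<gamma>' w)\<close> in \<open>V \<times> V\<^sup>\<bottom>\<close>, so \<open>bar V \<gamma> v\<close> is the component in \<open>V\<close> of
  \<open>\<gamma>(v, 0)\<close>.
\<close>

definition bar :: "'a::euclidean_space set \<Rightarrow> ('a \<Rightarrow> 'a) \<Rightarrow> 'a \<Rightarrow> 'a" where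
  "bar V \<gamma> = (\<lambda>v\<in>V. THE u. u \<in> V \<and> \<gamma> v - u \<in> V\<^sup>\<bottom>)"

definition bar_group :: "('a::euclidean_space \<Rightarrow> 'a) set \<Rightarrow> ('a \<Rightarrow> 'a) set" where
  "bar_group N = bar (Span N) ` N"

definition Xi :: "('a::euclidean_space \<Rightarrow> 'a) set \<Rightarrow> ('a \<Rightarrow> 'a) set \<Rightarrow> ('a \<Rightarrow> 'a) set \<Rightarrow> 'a set \<Rightarrow> 'a set" where
  "Xi \<Gamma> N X = (THE \<xi>. \<exists>\<gamma>\<in>\<Gamma>. X = N #>\<^bsub>trans_group UNIV \<Gamma>\<^esub> \<gamma> \<and>
     \<xi> = star (Span N) (bar_group N) (bar (Span N) \<gamma>))"

definition Coxeter_generators :: "('g, 'm) monoid_scheme \<Rightarrow> 'g set \<Rightarrow> bool" where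
  "Coxeter_generators G S \<longleftrightarrow> (\<exists>x y. x \<in> carrier G \<and> y \<in> carrier G \<and> S = {x, y} \<and>
     group.ord G x = 2 \<and> group.ord G y = 2 \<and> generate G S = carrier G)"

definition neg_eigenspace :: "'a::real_vector set \<Rightarrow> ('a \<Rightarrow> 'a) \<Rightarrow> 'a set" where
  "neg_eigenspace S B = {x \<in> S. B x = - x}"

end

theory Submission
  imports Defs
begin

text \<open>
  Conjugating by \<open>C \<times> id\<close> shows that \<open>\<psi>([\<eta>])\<close> is the class of the fibre product of the
  normalizer of \<open>M\<close> in the affine group and of \<open>\<Delta>\<close> over \<open>Aff(M)\<close>; so \<open>\<psi>([\<eta>]) = [\<Gamma>, N]\<close> just says
  that this fibre product, with its normal subgroup \<open>M\<close>, is isomorphic to \<open>(\<Gamma>, N)\<close>. Since \<open>N\<close>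
  acts trivially on \<open>V\<^sup>\<bottom>\<close>, the affinity \<open>\<alpha>\<close> and an affine coordinate on the line \<open>V\<^sup>\<bottom>\<close> conjugate
  \<open>(\<Gamma>, N)\<close> itself to the fibre product of \<open>\<alpha>\<^sub>\<sharp>\<Xi>\<beta>\<close>, which gives (a).

  By Bieberbach rigidity an isomorphism of fibre products is affine on \<open>M\<close>. After a conjugation in
  \<open>Aff(M)\<close> it is the identity there, and then it can change the lifts of \<open>\<eta>(\<delta>\<^sub>i)\<close> only by elements
  of the centralizer of \<open>M\<close>, that is by translations \<open>v\<^sub>i\<close> in \<open>Span(Z(M))\<close>, which satisfy
  \<open>B\<^sub>i v\<^sub>i = - v\<^sub>i\<close>. Conjugation by a translation in \<open>Span(Z(M))\<close> makes \<open>v\<^sub>1 = 0\<close> and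
  \<open>v\<^sub>2 \<in> E\<^sub>1 \<inter> E\<^sub>2\<close>. Conversely, the change by \<open>v \<in> E\<^sub>1 \<inter> E\<^sub>2\<close> is conjugation by the shear
  \<open>(x, t) \<mapsto> (x + t v, t)\<close>.

  Bieberbach's first theorem is not needed in general: \<open>\<alpha>\<close> carries the translations of \<open>N\<close>, which
  span \<open>V\<close> by definition, to translations of \<open>M\<close> that span the space, so the point group of \<open>M\<close> is
  finite as it preserves a lattice.
\<close>

text \<open>Three obstacles shape the work. \<open>Omega\<close>, \<open>psi\<close> and
  \<open>Xi\<close> are definite descriptions, so each must be shown well defined before it can be
  computed. For \<open>psi\<close> this includes the existence of some C for every \<eta>: because
  \<Omega>\<eta> has finite image, the linear parts of the lifts form a finite group, and a finite
  linear group is conjugate to an orthogonal one. Next, an affinity of an orbifold is only a map of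
  orbits. That two affinities with the same effect on orbits differ by one element of M, the same
  for all points, is not algebra; it is obtained from the countability of M and the Baire category
  theorem. Finally, the elements of N could a priori reflect the line
  \<open>V\<^sup>\<bottom>\<close>; that they act trivially there is extracted from the infinite
  quotient. The same circle of arguments shows that \<alpha>_# \<Xi> \<beta> has finite outer image:
  a power of \<gamma>2 \<gamma>1 is a translation, and a normalizing affinity with a translation
  among its powers has a power that acts on M as an inner automorphism.\<close>

abbreviation finv :: "('a \<Rightarrow> 'b) \<Rightarrow> 'b \<Rightarrow> 'a" where
  "finv \<equiv> inv_into UNIV"

section \<open>Permutation groups of a space, conjugation of maps, and affine maps through their
  linear parts\<close>

section \<open>Groups of bijections and affine maps\<close>

text \<open>Closure is stated with plain composition and \<open>finv\<close>. The product of
  \<open>BijGroup\<close> is composition only between bijections, so every use of it would carry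
  side conditions.\<close>

definition tgroup :: "('a \<Rightarrow> 'a) set \<Rightarrow> bool" where
  "tgroup G \<longleftrightarrow> (\<forall>g\<in>G. bij g) \<and> id \<in> G \<and> (\<forall>f\<in>G. \<forall>g\<in>G. f \<circ> g \<in> G) \<and> (\<forall>g\<in>G. finv g \<in> G)"

lemma Bij_UNIV: "Bij UNIV = {f. bij f}"
  by (auto simp: Bij_def)

lemma BijGroup_simps [simp]:
  "carrier (BijGroup S) = Bij S"
  "one (BijGroup S) = (\<lambda>x\<in>S. x)"
  by (auto simp: BijGroup_def)

lemma mult_BijGroup:
  assumes "f \<in> Bij S" "g \<in> Bij S"
  shows "f \<otimes>\<^bsub>BijGroup S\<^esub> g = compose S f g"
  using assms by (simp add: BijGroup_def)

lemma compose_UNIV [simp]: "compose UNIV f g = f \<circ> g"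
  by (auto simp: compose_def)

lemma mult_BijGroup_UNIV: "bij f \<Longrightarrow> bij g \<Longrightarrow> f \<otimes>\<^bsub>BijGroup UNIV\<^esub> g = f \<circ> g"
  by (simp add: mult_BijGroup Bij_UNIV)

lemma restrict_UNIV' [simp]: "restrict f UNIV = f"
  by (simp add: restrict_def)

lemma inv_BijGroup_UNIV: "bij f \<Longrightarrow> inv\<^bsub>BijGroup UNIV\<^esub> f = finv f"
  by (simp add: inv_BijGroup Bij_UNIV)

lemma subgroup_BijGroup_UNIV: "subgroup G (BijGroup UNIV) \<longleftrightarrow> tgroup G"
proof
  assume G: "subgroup G (BijGroup UNIV)"
  then have "G \<subseteq> Bij UNIV" using subgroup.subset by fastforce
  then have b: "\<forall>g\<in>G. bij g" by (auto simp: Bij_UNIV)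
  moreover have "id \<in> G" using subgroup.one_closed[OF G] by (simp only: BijGroup_simps restrict_UNIV' id_def)
  moreover have "f \<circ> g \<in> G" if "f \<in> G" "g \<in> G" for f g
    using subgroup.m_closed[OF G that] that b by (simp add: mult_BijGroup_UNIV)
  moreover have "finv g \<in> G" if "g \<in> G" for g
    using subgroup.m_inv_closed[OF G that] that b by (simp add: inv_BijGroup_UNIV)
  ultimately show "tgroup G" by (auto simp: tgroup_def)
next
  assume "tgroup G"
  then show "subgroup G (BijGroup UNIV)"
    by (intro group.subgroupI[OF group_BijGroup])
      (auto simp: tgroup_def Bij_UNIV mult_BijGroup_UNIV inv_BijGroup_UNIV)
qed

lemma tgroupD:
  assumes "tgroup G"
  shows "g \<in> G \<Longrightarrow> bij g" "id \<in> G" "f \<in> G \<Longrightarrow> g \<in> G \<Longrightarrow> f \<circ> g \<in> G" "g \<in> G \<Longrightarrow> finv g \<in> G"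
  using assms by (auto simp: tgroup_def)

lemma tgroup_pow: "tgroup G \<Longrightarrow> g \<in> G \<Longrightarrow> g ^^ k \<in> G"
  by (induction k) (auto simp: tgroup_def)

lemma trans_group_simps [simp]:
  "carrier (trans_group W G) = G"
  "mult (trans_group W G) = mult (BijGroup W)"
  "one (trans_group W G) = one (BijGroup W)"
  by (auto simp: trans_group_def)

lemma group_trans_group: "subgroup G (BijGroup W) \<Longrightarrow> group (trans_group W G)"
  unfolding trans_group_def by (rule subgroup.subgroup_is_group[OF _ group_BijGroup])

lemma inv_trans_group:
  assumes "subgroup G (BijGroup W)" "g \<in> G"
  shows "inv\<^bsub>trans_group W G\<^esub> g = (\<lambda>x\<in>W. inv_into W g x)"
proof -
  have "g \<in> Bij W" using subgroup.subset[OF assms(1)] assms(2) by auto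
  then show ?thesis
    using group.m_inv_consistent[OF group_BijGroup assms] inv_BijGroup
    by (simp add: trans_group_def)
qed

context
  fixes G :: "('a \<Rightarrow> 'a) set"
  assumes G: "tgroup G"
begin

lemma tgroup_group: "group (trans_group UNIV G)"
  using G group_trans_group subgroup_BijGroup_UNIV by blast

lemma tgroup_mult: "f \<in> G \<Longrightarrow> g \<in> G \<Longrightarrow> f \<otimes>\<^bsub>BijGroup UNIV\<^esub> g = f \<circ> g"
  by (simp add: mult_BijGroup_UNIV tgroupD[OF G])

lemma tgroup_inv: "g \<in> G \<Longrightarrow> inv\<^bsub>trans_group UNIV G\<^esub> g = finv g"
  using G by (simp add: inv_trans_group subgroup_BijGroup_UNIV)

lemma tgroup_r_coset:
  assumes "N \<subseteq> G" "g \<in> G"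
  shows "N #>\<^bsub>trans_group UNIV G\<^esub> g = (\<lambda>n. n \<circ> g) ` N"
  using assms by (auto simp: r_coset_def tgroup_mult subset_iff intro!: image_eqI)

lemma subgroup_tgroup: "subgroup N (trans_group UNIV G) \<longleftrightarrow> N \<subseteq> G \<and> tgroup N"
proof
  assume N: "subgroup N (trans_group UNIV G)"
  have s: "N \<subseteq> G" using subgroup.subset[OF N] by simp
  moreover have "subgroup N (BijGroup UNIV)"
    using group.incl_subgroup[OF group_BijGroup _ N[unfolded trans_group_def]] G
    by (simp add: subgroup_BijGroup_UNIV)
  ultimately show "N \<subseteq> G \<and> tgroup N" by (simp add: subgroup_BijGroup_UNIV)
next
  assume "N \<subseteq> G \<and> tgroup N"
  then show "subgroup N (trans_group UNIV G)"
    by (intro group.subgroupI[OF tgroup_group])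
      (auto simp: tgroup_inv tgroup_mult subset_iff tgroup_def)
qed

lemma normal_tgroup:
  "N \<lhd> trans_group UNIV G \<longleftrightarrow> N \<subseteq> G \<and> tgroup N \<and> (\<forall>g\<in>G. \<forall>n\<in>N. g \<circ> n \<circ> finv g \<in> N)"
proof -
  have "N \<subseteq> G \<Longrightarrow> g \<in> G \<Longrightarrow> n \<in> N \<Longrightarrow>
      g \<otimes>\<^bsub>trans_group UNIV G\<^esub> n \<otimes>\<^bsub>trans_group UNIV G\<^esub> inv\<^bsub>trans_group UNIV G\<^esub> g = g \<circ> n \<circ> finv g" for g n
    by (simp add: tgroup_inv tgroup_mult subset_iff tgroupD[OF G])
  then show ?thesis
    unfolding group.normal_inv_iff[OF tgroup_group] subgroup_tgroup by auto
qed

end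

abbreviation conjm :: "('a \<Rightarrow> 'b) \<Rightarrow> ('a \<Rightarrow> 'a) \<Rightarrow> 'b \<Rightarrow> 'b" where
  "conjm \<phi> f \<equiv> \<phi> \<circ> f \<circ> finv \<phi>"

lemma conj_map_UNIV [simp]: "conj_map UNIV UNIV \<phi> f = conjm \<phi> f"
  by (auto simp: conj_map_def)

lemma inv_comp_bij [simp]: "bij \<phi> \<Longrightarrow> finv \<phi> \<circ> \<phi> = id" "bij \<phi> \<Longrightarrow> \<phi> \<circ> finv \<phi> = id"
  by (auto simp: bij_def surj_iff)

lemma inv_app_bij [simp]: "bij \<phi> \<Longrightarrow> finv \<phi> (\<phi> x) = x" "bij \<phi> \<Longrightarrow> \<phi> (finv \<phi> y) = y"
  by (auto simp: bij_def surj_f_inv_f)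

lemma conjm_comp: "bij \<phi> \<Longrightarrow> conjm \<phi> (f \<circ> g) = conjm \<phi> f \<circ> conjm \<phi> g"
  by (auto simp: fun_eq_iff)

lemma conjm_conjm: "bij \<phi> \<Longrightarrow> bij \<psi> \<Longrightarrow> conjm \<phi> (conjm \<psi> f) = conjm (\<phi> \<circ> \<psi>) f"
  by (auto simp: fun_eq_iff o_inv_distrib)

lemma conjm_id [simp]: "conjm id f = f" "bij \<phi> \<Longrightarrow> conjm \<phi> id = id"
  by (auto simp: fun_eq_iff)

lemma conjm_inv: "bij \<phi> \<Longrightarrow> bij f \<Longrightarrow> conjm \<phi> (finv f) = finv (conjm \<phi> f)"
  by (rule sym, rule inv_unique_comp) (auto simp: fun_eq_iff)

lemma bij_conjm: "bij \<phi> \<Longrightarrow> bij f \<Longrightarrow> bij (conjm \<phi> f)"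
  by (simp add: bij_comp bij_imp_bij_inv)

lemma inj_conjm: "bij \<phi> \<Longrightarrow> conjm \<phi> f = conjm \<phi> g \<longleftrightarrow> f = g"
  unfolding fun_eq_iff comp_apply by (metis inv_app_bij)

lemma tgroup_conjm:
  assumes "tgroup G" "bij \<phi>"
  shows "tgroup (conjm \<phi> ` G)"
proof -
  have "id \<in> conjm \<phi> ` G"
    using tgroupD(2)[OF assms(1)] conjm_id(2)[OF assms(2)] by (metis imageI)
  then show ?thesis
    using assms unfolding tgroup_def
    by (auto simp: bij_conjm conjm_comp[symmetric] conjm_inv[symmetric] simp del: comp_apply)
qed

text \<open>Defined for every map, so that affinity of f becomes the proposition
  \<open>linear (lin f)\<close> and no witnesses a and A have to be carried along.\<close>

definition lin :: "('a::real_vector \<Rightarrow> 'b::real_vector) \<Rightarrow> 'a \<Rightarrow> 'b" where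
  "lin f = (\<lambda>x. f x - f 0)"

lemma lin_eq: "linear A \<Longrightarrow> lin (\<lambda>x. a + A x) = A"
  by (auto simp: lin_def linear_0)

lemma affine_decomp: "f x = f 0 + lin f x"
  by (simp add: lin_def)

lemma lin_diff: "linear (lin f) \<Longrightarrow> f x - f y = lin f (x - y)"
  by (simp add: linear_diff) (simp add: lin_def)

lemma lin_add: "linear (lin f) \<Longrightarrow> f (x + y) = f x + lin f y"
  using lin_diff[of f "x + y" x] by (simp add: algebra_simps)

lemma lin_add_left: "linear (lin f) \<Longrightarrow> f (y + x) = f x + lin f y"
  by (simp add: lin_add add.commute)

lemma lin_plus [simp]: "lin ((+) a) = id"
  by (auto simp: lin_def)

lemma lin_id [simp]: "lin id = id"
  by (auto simp: lin_def)

lemma lin_linear: "linear A \<Longrightarrow> lin A = A"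
  by (auto simp: lin_def linear_0)

text \<open>Affinity is asked of the outer map alone, which turns g x - g 0 into a difference of
  values. This gives the rule for inverses in \<open>lin_inv\<close>, where affinity of the inverse
  is the goal.\<close>

lemma lin_comp: "linear (lin f) \<Longrightarrow> lin (f \<circ> g) = lin f \<circ> lin g"
  unfolding fun_eq_iff using lin_diff[of f "g x" "g 0" for x]
  by (simp add: lin_def[of g] lin_def[of "f \<circ> g"] lin_def[of "\<lambda>x. f (g x)"])

lemma lin_eq_id: "lin f = id \<longleftrightarrow> f = (+) (f 0)"
  by (auto simp: lin_def fun_eq_iff algebra_simps)

lemma linear_lin_comp: "linear (lin f) \<Longrightarrow> linear (lin g) \<Longrightarrow> linear (lin (f \<circ> g))"
  by (simp add: lin_comp linear_compose)

lemma bij_lin: "bij f \<Longrightarrow> bij (lin f)"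
proof -
  assume "bij f"
  moreover have "lin f = (\<lambda>x. x + (- f 0)) \<circ> f" by (auto simp: lin_def)
  moreover have "bij (\<lambda>x. x + (- f 0))" by (rule bij_plus_right)
  ultimately show ?thesis by (metis bij_comp)
qed

lemma linear_inv_bij:
  fixes A :: "'a::euclidean_space \<Rightarrow> 'b::euclidean_space"
  assumes "linear A" "bij A" shows "linear (finv A)"
proof (rule linearI)
  fix x y r
  show "finv A (x + y) = finv A x + finv A y"
    using assms by (simp add: inv_into_f_eq[OF bij_is_inj] linear_add)
  show "finv A (r *\<^sub>R x) = r *\<^sub>R finv A x"
    using assms by (simp add: inv_into_f_eq[OF bij_is_inj] linear_scale)
qed

lemma lin_inv:
  fixes f :: "'a::euclidean_space \<Rightarrow> 'b::euclidean_space"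
  assumes "linear (lin f)" "bij f"
  shows "lin (finv f) = finv (lin f)" "linear (lin (finv f))"
proof -
  have "lin f \<circ> lin (finv f) = id"
    using lin_comp[OF assms(1), of "finv f"] assms by simp
  then show *: "lin (finv f) = finv (lin f)"
    using bij_lin[OF assms(2)] by (metis comp_assoc comp_id id_comp inv_comp_bij(1))
  show "linear (lin (finv f))"
    unfolding * using assms bij_lin linear_inv_bij by blast
qed

text \<open>Conjugation acts on translations through the linear part, so a map that normalizes a
  group acts linearly on its lattice of translations.\<close>

lemma conjm_plus:
  assumes "linear (lin f)" "bij f" shows "conjm f ((+) a) = (+) (lin f a)"
  using assms by (auto simp: fun_eq_iff lin_add_left)

lemma comp_plus: "linear (lin f) \<Longrightarrow> f \<circ> (+) a = (+) (lin f a) \<circ> f"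
  by (auto simp: fun_eq_iff lin_add_left)

lemma linear_lin_conjm:
  fixes f :: "'a::euclidean_space \<Rightarrow> 'b::euclidean_space"
  assumes "linear (lin f)" "bij f" "linear (lin g)" 
  shows "lin (conjm f g) = conjm (lin f) (lin g)" "linear (lin (conjm f g))"
proof -
  show "lin (conjm f g) = conjm (lin f) (lin g)"
    unfolding lin_comp[OF linear_lin_comp[OF assms(1,3)]] lin_comp[OF assms(1)] lin_inv(1)[OF assms(1,2)]
    by (rule refl)
  show "linear (lin (conjm f g))"
    using assms by (intro linear_lin_comp lin_inv)
qed

lemma bij_plus_left: "bij ((+) (a::'a::real_vector))"
  by (rule bij_plus)

lemma inv_plus: "finv ((+) (a::'a::real_vector)) = (+) (- a)"
  by (rule inv_unique_comp) auto

lemma plus_comp: "(+) (a::'a::real_vector) \<circ> (+) b = (+) (a + b)"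
  by (auto simp: fun_eq_iff algebra_simps)

lemma plus_inj: "(+) (a::'a::real_vector) = (+) b \<longleftrightarrow> a = b"
  by (metis add.right_neutral)

lemma plus_zero: "(+) (0::'a::real_vector) = id"
  by auto

lemma plus_pow: "(+) (a::'a::real_vector) ^^ k = (+) (real k *\<^sub>R a)"
  by (induction k) (auto simp: fun_eq_iff algebra_simps)

lemma isometry_lin:
  fixes f :: "'a::euclidean_space \<Rightarrow> 'a"
  assumes "f \<in> isometries"
  shows "orthogonal_transformation (lin f)" "linear (lin f)" "bij f"
proof -
  show "orthogonal_transformation (lin f)"
    using assms by (auto simp: orthogonal_transformation_isometry isometries_def lin_def dist_norm)
  then show "linear (lin f)" by (rule orthogonal_transformation_linear)
  show "bij f" using assms by (auto simp: isometries_def Bij_UNIV)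
qed

lemma isometryI:
  fixes f :: "'a::euclidean_space \<Rightarrow> 'a"
  assumes "orthogonal_transformation (lin f)"
  shows "f \<in> isometries"
proof -
  have l: "linear (lin f)" using assms orthogonal_transformation_linear by blast
  have "bij (lin f)" using assms orthogonal_transformation_bij by blast
  moreover have "f = (+) (f 0) \<circ> lin f" by (auto simp: lin_def)
  ultimately have "bij f" by (metis bij_comp bij_plus_left)
  moreover have "dist (f x) (f y) = dist x y" for x y
    using assms l by (simp add: dist_norm lin_diff orthogonal_transformation_norm)
  ultimately show ?thesis by (auto simp: isometries_def Bij_UNIV)
qed

section \<open>Additive subgroups of a Euclidean space, their orthogonal symmetries, and the
  translations of a discrete group\<close>

section \<open>Lattices\<close>

definition transl :: "('a::real_vector \<Rightarrow> 'a) set \<Rightarrow> 'a set" where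
  "transl G = {a. (+) a \<in> G}"

lemma Span_translations: "Span G = span (transl G)"
  by (simp add: Span_def transl_def)

definition additive_subgroup :: "'a::real_vector set \<Rightarrow> bool" where
  "additive_subgroup T \<longleftrightarrow> 0 \<in> T \<and> (\<forall>x\<in>T. \<forall>y\<in>T. x + y \<in> T) \<and> (\<forall>x\<in>T. - x \<in> T)"

lemma additive_subgroup_transl: "tgroup G \<Longrightarrow> additive_subgroup (transl G)"
  unfolding additive_subgroup_def transl_def
  by (simp add: plus_comp[symmetric] inv_plus[symmetric] tgroupD plus_zero)

lemma additive_subgroup_diff: "additive_subgroup T \<Longrightarrow> x \<in> T \<Longrightarrow> y \<in> T \<Longrightarrow> x - y \<in> T"
  unfolding additive_subgroup_def by (metis diff_conv_add_uminus)

lemma additive_subgroup_nat: "additive_subgroup T \<Longrightarrow> x \<in> T \<Longrightarrow> real k *\<^sub>R x \<in> T"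
  by (induction k) (auto simp: additive_subgroup_def algebra_simps)

lemma additive_subgroup_int: 
  assumes T: "additive_subgroup T" "x \<in> T" shows "of_int k *\<^sub>R x \<in> T"
proof (cases k)
  case (nonneg n)
  then show ?thesis using additive_subgroup_nat[OF T, of n] by simp
next
  case (neg n)
  have "- (real (Suc n) *\<^sub>R x) \<in> T"
    using T(1) additive_subgroup_nat[OF T] unfolding additive_subgroup_def by blast
  moreover have "- (real (Suc n) *\<^sub>R x) = of_int k *\<^sub>R x"
    unfolding neg by (simp only: of_int_minus of_int_of_nat_eq scaleR_minus_left)
  ultimately show ?thesis by simp
qed

lemma additive_subgroup_sum: 
  "additive_subgroup T \<Longrightarrow> (\<And>i. i \<in> I \<Longrightarrow> f i \<in> T) \<Longrightarrow> sum f I \<in> T"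
  by (induction I rule: infinite_finite_induct) (auto simp: additive_subgroup_def)

lemma in_span_finite:
  assumes "finite B" "x \<in> span (B::'a::euclidean_space set)"
  shows "\<exists>u. x = (\<Sum>b\<in>B. u b *\<^sub>R b)"
proof -
  have "x \<in> range (\<lambda>u. \<Sum>b\<in>B. u b *\<^sub>R b)" using assms span_finite[OF assms(1)] by blast
  then show ?thesis unfolding image_iff by simp
qed

text \<open>Round down the coefficients with respect to a maximal independent subset of T; the
  remainder has coefficients of absolute value at most 1, whence the bound by the sum of the
  norms.\<close>

lemma additive_subgroup_reduce:
  fixes T :: "'a::euclidean_space set"
  assumes T: "additive_subgroup T"
  shows "\<exists>R. \<forall>x\<in>span T. \<exists>t\<in>T. norm (x - t) \<le> R"
proof -
  obtain B where B: "B \<subseteq> T" "independent B" "T \<subseteq> span B"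
    using maximal_independent_subset by blast
  have fB: "finite B" using B(2) independent_imp_finite by blast
  have sB: "span B = span T" using B by (metis span_mono span_span subset_antisym)
  have "\<exists>t\<in>T. norm (x - t) \<le> (\<Sum>b\<in>B. norm b)" if x: "x \<in> span T" for x
  proof -
    obtain u where u: "x = (\<Sum>b\<in>B. u b *\<^sub>R b)"
      using in_span_finite[OF fB x[folded sB]] by (rule exE)
    let ?t = "\<Sum>b\<in>B. of_int \<lfloor>u b\<rfloor> *\<^sub>R b"
    have "x - ?t = (\<Sum>b\<in>B. (u b - of_int \<lfloor>u b\<rfloor>) *\<^sub>R b)"
      unfolding u by (simp add: sum_subtractf scaleR_left_diff_distrib)
    also have "norm \<dots> \<le> (\<Sum>b\<in>B. norm b)"
    proof (rule sum_norm_le)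
      fix b
      have "\<bar>u b - of_int \<lfloor>u b\<rfloor>\<bar> \<le> 1" by linarith
      then show "norm ((u b - of_int \<lfloor>u b\<rfloor>) *\<^sub>R b) \<le> norm b"
        by (simp add: mult_left_le_one_le)
    qed
    finally have "norm (x - ?t) \<le> (\<Sum>b\<in>B. norm b)" .
    moreover have "?t \<in> T"
      using B(1) by (intro additive_subgroup_sum[OF T] additive_subgroup_int[OF T]) auto
    ultimately show ?thesis by blast
  qed
  then show ?thesis by blast
qed

text \<open>Discreteness in the form that counting arguments use. It is a condition on a set, not on
  a group, and \<open>power_lin_id\<close> applies it to a lattice with two further vectors.\<close>

definition finite_in_balls :: "'a::real_normed_vector set \<Rightarrow> bool" where
  "finite_in_balls T \<longleftrightarrow> (\<forall>R. finite {t \<in> T. norm t \<le> R})"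

text \<open>The multiples \<open>j t\<close> reduced modulo \<open>T0\<close> lie in a finite set, so two of them agree.\<close>

lemma lattice_commensurable:
  fixes T :: "'a::euclidean_space set"
  assumes T: "additive_subgroup T" "finite_in_balls T" and T0: "additive_subgroup T0" "T0 \<subseteq> T"
    and t: "t \<in> T" "t \<in> span T0"
  shows "\<exists>k>0. real k *\<^sub>R t \<in> T0"
proof -
  obtain R where "\<forall>x\<in>span T0. \<exists>t\<in>T0. norm (x - t) \<le> R"
    using additive_subgroup_reduce[OF T0(1)] by blast
  then have "\<forall>j. \<exists>s\<in>T0. norm (real j *\<^sub>R t - s) \<le> R"
    using t(2) span_scale by blast
  then obtain s where s: "\<And>j. s j \<in> T0" "\<And>j. norm (real j *\<^sub>R t - s j) \<le> R"
    by metis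
  let ?f = "\<lambda>j. real j *\<^sub>R t - s j"
  have "range ?f \<subseteq> {t \<in> T. norm t \<le> R}"
    using s T0(2) additive_subgroup_nat[OF T(1) t(1)] by (auto intro!: additive_subgroup_diff[OF T(1)])
  then have "finite (range ?f)"
    using T(2) finite_subset unfolding finite_in_balls_def by blast
  then have "\<not> inj ?f" using finite_imageD infinite_UNIV_nat by blast
  then obtain i j where ij: "i < j" "?f i = ?f j"
    unfolding inj_def by (metis linorder_neqE_nat)
  then have "real (j - i) *\<^sub>R t = s j - s i"
    by (simp add: of_nat_diff algebra_simps)
  then show ?thesis
    using ij(1) additive_subgroup_diff[OF T0(1)] s(1) by (intro exI[of _ "j - i"]) auto
qed

text \<open>A norm-preserving map sends each of finitely many spanning vectors of T into a finite
  set, the part of T in a ball, and it is determined by these images.\<close>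

lemma finite_lattice_stabilizer:
  fixes T :: "'a::euclidean_space set"
  assumes "finite_in_balls T" "span T = UNIV"
  shows "finite {B. orthogonal_transformation B \<and> B ` T \<subseteq> T}" (is "finite ?S")
proof -
  obtain X where X: "X \<subseteq> T" "independent X" "T \<subseteq> span X"
    using maximal_independent_subset by blast
  have fX: "finite X" using X(2) independent_imp_finite by blast
  have sX: "span X = UNIV" using X(3) assms(2) by (metis span_mono span_span top.extremum_unique)
  have "(\<lambda>B. restrict B X) ` ?S \<subseteq> (\<Pi>\<^sub>E x\<in>X. {t \<in> T. norm t \<le> norm x})"
    using X(1) by (auto simp: orthogonal_transformation_norm image_subset_iff subset_iff)
  then have "finite ((\<lambda>B. restrict B X) ` ?S)"
    using fX finite_PiE[of X] assms(1) finite_subset unfolding finite_in_balls_def by meson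
  moreover have "inj_on (\<lambda>B. restrict B X) ?S"
  proof (rule inj_onI)
    fix A B assume AB: "A \<in> ?S" "B \<in> ?S" "restrict A X = restrict B X"
    then have "A x = B x" if "x \<in> X" for x using that by (metis restrict_apply')
    then show "A = B"
      using AB(1,2) linear_eq_on[of A B _ X] sX by (auto intro!: ext orthogonal_transformation_linear)
  qed
  ultimately show ?thesis using finite_imageD by blast
qed

text \<open>Powers of one element repeat, by pigeonhole; the product of the individual exponents
  serves all elements at once.\<close>

lemma finite_monoid_power_id:
  assumes "finite P" and P: "\<And>f g. f \<in> P \<Longrightarrow> g \<in> P \<Longrightarrow> f \<circ> g \<in> P" and "\<And>f. f \<in> P \<Longrightarrow> bij f"
  shows "\<exists>k>0. \<forall>f\<in>P. f ^^ k = id"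
proof -
  have "\<exists>k>0. f ^^ k = id" if "f \<in> P" for f
  proof -
    \<comment> \<open>The exponents start at 1, because P is closed under composition but is not
      assumed to contain the identity.\<close>
    have "f ^^ Suc j \<in> P" for j
    proof (induction j)
      case (Suc j)
      show ?case using P[OF that Suc] by (simp only: funpow.simps)
    qed (use that in simp)
    then have "range (\<lambda>j. f ^^ Suc j) \<subseteq> P" by blast
    then have "finite (range (\<lambda>j. f ^^ Suc j))" using assms(1) finite_subset by blast
    then have "\<not> inj (\<lambda>j. f ^^ Suc j)" using finite_imageD infinite_UNIV_nat by blast
    then obtain i j where ij: "i < j" "f ^^ Suc i = f ^^ Suc j"
      unfolding inj_def by (metis linorder_neqE_nat)
    have "Suc i + (j - i) = Suc j" using ij(1) by simp
    then have "(f ^^ Suc i) ((f ^^ (j - i)) x) = (f ^^ Suc i) x" for x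
      using ij(2) funpow_add[of "Suc i" "j - i" f] by (metis comp_apply)
    then have "(f ^^ (j - i)) x = x" for x
      using assms(3)[OF that] bij_fn bij_is_inj injD by metis
    then have "f ^^ (j - i) = id" by auto
    then show ?thesis using ij(1) by (intro exI[of _ "j - i"]) simp
  qed
  then obtain k where k: "\<And>f. f \<in> P \<Longrightarrow> k f > 0 \<and> f ^^ k f = id" by metis
  have "f ^^ (prod k P) = id" if "f \<in> P" for f
  proof -
    have "k f dvd prod k P" using assms(1) that by (simp add: dvd_prodI)
    then obtain c where "prod k P = k f * c" by blast
    then show ?thesis using k[OF that] by (simp add: funpow_mult[symmetric])
  qed
  moreover have "prod k P > 0" using k by (simp add: prod_pos)
  ultimately show ?thesis by blast
qed

text \<open>Sending a to the translation by a is continuous for pointwise convergence, so a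
  neighbourhood isolating the identity pulls back to a ball without further lattice vectors.
  Differences are lattice vectors too, hence uniform separation.\<close>

lemma discrete_imp_finite_in_balls:
  fixes G :: "('a::euclidean_space \<Rightarrow> 'a) set"
  assumes "tgroup G" "discrete G"
  shows "finite_in_balls (transl G)"
proof -
  have "id \<in> G" using assms(1) tgroupD by blast
  then obtain U where U: "open U" "U \<inter> G = {id}"
    using discreteD[OF assms(2)] isolated_inE by metis
  have "continuous_on UNIV (\<lambda>a::'a. (+) a)"
    by (intro continuous_on_coordinatewise_then_product continuous_intros)
  then have "open ((\<lambda>a. (+) a) -` U)" using U(1) open_vimage by blast
  moreover have "0 \<in> (\<lambda>a. (+) a) -` U" using U(2) by (auto simp: plus_zero)
  ultimately obtain e where e: "e > 0" "\<And>a. dist a 0 < e \<Longrightarrow> (+) a \<in> U"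
    unfolding open_dist by blast
  have z: "a = 0" if "a \<in> transl G" "norm a < e" for a
  proof -
    have "(+) a \<in> U \<inter> G" using that e(2) by (auto simp: transl_def)
    then have "(+) a = (+) 0" unfolding U(2) plus_zero by blast
    then show "a = 0" by (simp only: plus_inj)
  qed
  have ud: "uniform_discrete (transl G)"
    unfolding uniform_discrete_def
  proof (intro exI[of _ e] conjI ballI impI)
    fix x y assume "x \<in> transl G" "y \<in> transl G" "dist x y < e"
    then show "x = y"
      using z[of "x - y"] additive_subgroup_diff[OF additive_subgroup_transl[OF assms(1)]]
      by (simp add: dist_norm)
  qed (rule e(1))
  have "finite {t \<in> transl G. norm t \<le> R}" for R
  proof -
    have "uniform_discrete {t \<in> transl G. norm t \<le> R}"
      by (rule uniform_discrete_subset[OF ud]) auto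
    moreover have "bounded {t \<in> transl G. norm t \<le> R}"
      by (auto simp: bounded_iff)
    ultimately show ?thesis using uniform_discrete_finite_iff[of "{t \<in> transl G. norm t \<le> R}"] by simp
  qed
  then show ?thesis by (simp add: finite_in_balls_def)
qed

section \<open>Affinities normalizing a group, their action on orbits, and Bieberbach
  rigidity\<close>

section \<open>Affinities of flat orbifolds and crystallographic groups\<close>

lemma normalizing_affinities_iff:
  "\<phi> \<in> normalizing_affinities M \<longleftrightarrow> bij \<phi> \<and> linear (lin \<phi>) \<and> conjm \<phi> ` M = M"
proof -
  have "(\<exists>a A. linear A \<and> (\<forall>x. \<phi> x = a + A x)) \<longleftrightarrow> linear (lin \<phi>)"
  proof
    assume "\<exists>a A. linear A \<and> (\<forall>x. \<phi> x = a + A x)"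
    then obtain a A where "linear A" "\<phi> = (\<lambda>x. a + A x)" by auto
    then show "linear (lin \<phi>)" using lin_eq by metis
  next
    assume "linear (lin \<phi>)"
    then show "\<exists>a A. linear A \<and> (\<forall>x. \<phi> x = a + A x)"
      by (intro exI[of _ "\<phi> 0"] exI[of _ "lin \<phi>"]) (simp add: lin_def)
  qed
  then show ?thesis
    unfolding normalizing_affinities_def affinities_def by (auto simp: fun_eq_iff)
qed

lemma normalizing_affinities_D:
  assumes "\<phi> \<in> normalizing_affinities M"
  shows "bij \<phi>" "linear (lin \<phi>)" "\<mu> \<in> M \<Longrightarrow> conjm \<phi> \<mu> \<in> M"
  using assms unfolding normalizing_affinities_iff by auto

lemma normalizing_affinities_comp:
  assumes "\<phi> \<in> normalizing_affinities M" "\<psi> \<in> normalizing_affinities M"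
  shows "\<phi> \<circ> \<psi> \<in> normalizing_affinities M"
proof -
  note iff = normalizing_affinities_iff
  have b: "bij \<phi>" "bij \<psi>" and M: "conjm \<phi> ` M = M" "conjm \<psi> ` M = M"
    using assms unfolding iff by blast+
  have "conjm (\<phi> \<circ> \<psi>) ` M = conjm \<phi> ` conjm \<psi> ` M"
    unfolding image_image conjm_conjm[OF b] ..
  also have "\<dots> = M" unfolding M ..
  finally have "conjm (\<phi> \<circ> \<psi>) ` M = M" .
  then show ?thesis
    using assms by (simp only: normalizing_affinities_iff bij_comp linear_lin_comp)
qed

lemma normalizing_affinities_inv:
  assumes "\<phi> \<in> normalizing_affinities M"
  shows "finv \<phi> \<in> normalizing_affinities M"
proof -
  have b: "bij \<phi>" and M: "conjm \<phi> ` M = M" using assms by (auto simp: normalizing_affinities_iff)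
  have "conjm (finv \<phi>) ` M = conjm (finv \<phi>) ` conjm \<phi> ` M" using M by simp
  also have "\<dots> = conjm (finv \<phi> \<circ> \<phi>) ` M"
    using b by (simp add: image_image conjm_conjm bij_imp_bij_inv)
  also have "\<dots> = M" using b by simp
  finally show ?thesis
    using assms by (simp only: normalizing_affinities_iff bij_imp_bij_inv lin_inv(2))
qed

lemma id_normalizing: "id \<in> normalizing_affinities M"
  by (simp add: normalizing_affinities_iff linear_id)

lemma normalizing_affinities_pow:
  "\<phi> \<in> normalizing_affinities M \<Longrightarrow> \<phi> ^^ k \<in> normalizing_affinities M"
proof (induction k)
  case 0
  show ?case using id_normalizing by (simp add: id_def)
next
  case (Suc k)
  then show ?case unfolding funpow.simps by (intro normalizing_affinities_comp) auto
qed

text \<open>Elements of M are themselves lifts, namely of the identity of the orbifold, and can be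
  composed with other lifts without leaving the normalizer.\<close>

lemma isometries_normalize:
  assumes "tgroup M" "M \<subseteq> isometries" "\<mu> \<in> M"
  shows "\<mu> \<in> normalizing_affinities M"
proof -
  have b: "bij \<mu>" by (rule tgroupD(1)[OF assms(1,3)])
  have "\<nu> \<in> conjm \<mu> ` M" if "\<nu> \<in> M" for \<nu>
  proof (rule image_eqI)
    show "finv \<mu> \<circ> \<nu> \<circ> \<mu> \<in> M"
      by (intro tgroupD(3,4)[OF assms(1)] that assms(3))
    show "\<nu> = conjm \<mu> (finv \<mu> \<circ> \<nu> \<circ> \<mu>)" using b by (auto simp: fun_eq_iff)
  qed
  moreover have "conjm \<mu> \<nu> \<in> M" if "\<nu> \<in> M" for \<nu>
    by (intro tgroupD(3,4)[OF assms(1)] that assms(3))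
  ultimately have "conjm \<mu> ` M = M" by blast
  then show ?thesis
    using assms(2,3) b isometry_lin(2) unfolding normalizing_affinities_iff by blast
qed

lemma orbit_in_orbit_space: "x \<in> W \<Longrightarrow> orbit G x \<in> orbit_space W G"
  by (simp add: orbit_space_def)

lemma orbit_space_E: 
  assumes "X \<in> orbit_space W G" obtains x where "x \<in> W" "X = orbit G x"
  using assms by (auto simp: orbit_space_def)

lemma self_in_orbit: "tgroup G \<Longrightarrow> x \<in> orbit G x"
  unfolding orbit_def using tgroupD(2) by (metis id_apply image_eqI)

lemma orbit_absorb:
  assumes "tgroup G" "g \<in> G" shows "orbit G (g x) = orbit G x"
proof -
  have "h (g x) \<in> orbit G x" if "h \<in> G" for h
    using imageI[OF tgroupD(3)[OF assms(1) that assms(2)], of "\<lambda>k. k x"] by (simp add: orbit_def)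
  moreover have "h x \<in> orbit G (g x)" if "h \<in> G" for h
  proof -
    have "h x = (h \<circ> finv g) (g x)" using tgroupD(1)[OF assms] by simp
    then show ?thesis
      using tgroupD(3)[OF assms(1) that tgroupD(4)[OF assms]] unfolding orbit_def by (rule image_eqI)
  qed
  ultimately show ?thesis by (auto simp: orbit_def)
qed

text \<open>Moving \<phi> past \<mu> replaces \<mu> by its conjugate, and the conjugates again run
  over all of M.\<close>

lemma normalizing_affinities_image_orbit:
  assumes "\<phi> \<in> normalizing_affinities M"
  shows "\<phi> ` orbit M x = orbit M (\<phi> x)"
proof -
  have "orbit M (\<phi> x) = (\<lambda>g. g (\<phi> x)) ` conjm \<phi> ` M"
    using assms by (simp add: orbit_def normalizing_affinities_iff)
  then show ?thesis
    using normalizing_affinities_D[OF assms] by (simp add: orbit_def image_image)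
qed

lemma star_normalizing:
  assumes "\<phi> \<in> normalizing_affinities M"
  shows "star UNIV M \<phi> (orbit M x) = orbit M (\<phi> x)"
  using normalizing_affinities_image_orbit[OF assms] by (simp add: star_def orbit_in_orbit_space)

lemma star_eqI:
  assumes "\<And>X. X \<in> orbit_space W M \<Longrightarrow> \<phi> ` X = \<psi> ` X"
  shows "star W M \<phi> = star W M \<psi>"
  unfolding star_def using assms by (rule restrict_ext)

lemma star_compose:
  assumes "\<psi> \<in> normalizing_affinities M"
  shows "compose (orbit_space UNIV M) (star UNIV M \<phi>) (star UNIV M \<psi>) = star UNIV M (\<phi> \<circ> \<psi>)"
proof
  fix X
  show "compose (orbit_space UNIV M) (star UNIV M \<phi>) (star UNIV M \<psi>) X = star UNIV M (\<phi> \<circ> \<psi>) X"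
  proof (cases "X \<in> orbit_space UNIV M")
    case True
    then obtain x where X: "X = orbit M x" by (auto elim: orbit_space_E)
    have "orbit M (\<psi> x) \<in> orbit_space UNIV M" by (simp add: orbit_in_orbit_space)
    then show ?thesis
      using True normalizing_affinities_image_orbit[OF assms, of x]
      unfolding X by (simp add: compose_def star_def) (metis image_image)
  qed (simp add: compose_def star_def)
qed

lemma star_id: "star UNIV M id = (\<lambda>X\<in>orbit_space UNIV M. X)"
  by (simp add: star_def)

lemma star_Bij:
  assumes "\<phi> \<in> normalizing_affinities M"
  shows "star UNIV M \<phi> \<in> Bij (orbit_space UNIV M)"
proof -
  have "bij_betw (star UNIV M \<phi>) (orbit_space UNIV M) (orbit_space UNIV M)"
  proof (rule bij_betw_byWitness[where f' = "star UNIV M (finv \<phi>)"])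
    have inv: "finv \<phi> \<in> normalizing_affinities M" using normalizing_affinities_inv[OF assms] .
    note b = normalizing_affinities_D(1)[OF assms]
    show "\<forall>X\<in>orbit_space UNIV M. star UNIV M (finv \<phi>) (star UNIV M \<phi> X) = X"
      using star_normalizing[OF assms] star_normalizing[OF inv] b by (auto elim!: orbit_space_E)
    show "\<forall>X\<in>orbit_space UNIV M. star UNIV M \<phi> (star UNIV M (finv \<phi>) X) = X"
      using star_normalizing[OF assms] star_normalizing[OF inv] b by (auto elim!: orbit_space_E)
    show "star UNIV M \<phi> ` orbit_space UNIV M \<subseteq> orbit_space UNIV M"
      using star_normalizing[OF assms] by (auto elim!: orbit_space_E simp: orbit_in_orbit_space)
    show "star UNIV M (finv \<phi>) ` orbit_space UNIV M \<subseteq> orbit_space UNIV M"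
      using star_normalizing[OF inv] by (auto elim!: orbit_space_E simp: orbit_in_orbit_space)
  qed
  then show ?thesis by (simp add: Bij_def star_def)
qed

lemma carrier_Aff: "carrier (Aff M) = star UNIV M ` normalizing_affinities M"
  by (simp add: Aff_def)

text \<open>With \<open>one_Aff\<close>, \<open>inv_Aff\<close> and \<open>Aff_conj_star\<close>
  this moves all calculations in \<open>Aff M\<close> to lifts, where they are compositions of
  maps.\<close>

lemma mult_Aff:
  assumes "\<phi> \<in> normalizing_affinities M" "\<psi> \<in> normalizing_affinities M"
  shows "star UNIV M \<phi> \<otimes>\<^bsub>Aff M\<^esub> star UNIV M \<psi> = star UNIV M (\<phi> \<circ> \<psi>)"
  using assms by (simp add: Aff_def mult_BijGroup star_Bij star_compose)

lemma one_Aff: "\<one>\<^bsub>Aff M\<^esub> = star UNIV M id"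
  by (simp add: Aff_def star_id)

lemma group_Aff: "group (Aff M)"
proof (rule groupI)
  fix x assume "x \<in> carrier (Aff M)"
  then obtain \<phi> where \<phi>: "\<phi> \<in> normalizing_affinities M" "x = star UNIV M \<phi>"
    by (auto simp: carrier_Aff)
  show "\<exists>y\<in>carrier (Aff M). y \<otimes>\<^bsub>Aff M\<^esub> x = \<one>\<^bsub>Aff M\<^esub>"
    using \<phi> normalizing_affinities_inv[OF \<phi>(1)] inv_comp_bij[OF normalizing_affinities_D(1)[OF \<phi>(1)]]
    by (intro bexI[of _ "star UNIV M (finv \<phi>)"]) (simp_all add: carrier_Aff mult_Aff one_Aff)
qed (auto simp: carrier_Aff one_Aff mult_Aff id_normalizing normalizing_affinities_comp comp_assoc)

lemma inv_Aff:
  assumes "\<phi> \<in> normalizing_affinities M"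
  shows "inv\<^bsub>Aff M\<^esub> (star UNIV M \<phi>) = star UNIV M (finv \<phi>)"
  using assms normalizing_affinities_inv[OF assms] normalizing_affinities_D(1)[OF assms]
  by (intro group.inv_equality[OF group_Aff]) (auto simp: carrier_Aff mult_Aff one_Aff)

lemma Aff_conj_star:
  assumes "\<xi> \<in> normalizing_affinities M" "\<phi> \<in> normalizing_affinities M"
  shows "Aff_conj M (star UNIV M \<xi>) (star UNIV M \<phi>) = star UNIV M (conjm \<xi> \<phi>)"
  using assms
  by (simp add: Aff_conj_def inv_Aff mult_Aff normalizing_affinities_comp normalizing_affinities_inv)

text \<open>The spaces are general because the lemma serves twice: for C between whole spaces and
  for \<alpha> from V. That orbits go to orbits is a premise on \<psi>, since restrictions to V are
  not covered by \<open>normalizing_affinities\<close>.\<close>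

lemma sharp_star:
  assumes \<phi>: "bij_betw \<phi> W1 W2" "conj_map W1 W2 \<phi> ` M1 = M2"
    and M1: "\<And>X. X \<in> orbit_space W1 M1 \<Longrightarrow> X \<subseteq> W1"
    and \<psi>: "\<And>X. X \<in> orbit_space W1 M1 \<Longrightarrow> \<psi> ` X \<in> orbit_space W1 M1"
  shows "sharp W1 M1 W2 M2 \<phi> (star W1 M1 \<psi>) = star W2 M2 (conj_map W1 W2 \<phi> \<psi>)"
proof
  have im: "\<phi> ` orbit M1 x = orbit M2 (\<phi> x)" if "x \<in> W1" for x
    using star_orbit[OF \<phi> that] that by (simp add: star_def orbit_in_orbit_space)
  have inj: "inj_on (star W1 M1 \<phi>) (orbit_space W1 M1)"
  proof (rule inj_onI)
    fix X Y assume XY: "X \<in> orbit_space W1 M1" "Y \<in> orbit_space W1 M1" "star W1 M1 \<phi> X = star W1 M1 \<phi> Y"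
    then show "X = Y"
      using inj_on_image_eq_iff[OF bij_betw_imp_inj_on[OF \<phi>(1)] M1 M1] by (simp add: star_def)
  qed
  fix Y
  show "sharp W1 M1 W2 M2 \<phi> (star W1 M1 \<psi>) Y = star W2 M2 (conj_map W1 W2 \<phi> \<psi>) Y"
  proof (cases "Y \<in> orbit_space W2 M2")
    case True
    then obtain y where "y \<in> W2" "Y = orbit M2 y" by (auto elim: orbit_space_E)
    then obtain x where x: "x \<in> W1" "Y = orbit M2 (\<phi> x)" using \<phi>(1) by (auto simp: bij_betw_def)
    define X where "X = orbit M1 x"
    have X: "X \<in> orbit_space W1 M1" "Y = \<phi> ` X" using x im by (auto simp: X_def orbit_in_orbit_space)
    then have Y: "Y = star W1 M1 \<phi> X" by (simp add: star_def)
    have "conj_map W1 W2 \<phi> \<psi> ` Y = \<phi> ` \<psi> ` X"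
    proof -
      have "conj_map W1 W2 \<phi> \<psi> (\<phi> z) = \<phi> (\<psi> z)" if "z \<in> X" for z
      proof -
        have "z \<in> W1" using M1 X(1) that by blast
        then show ?thesis using \<phi>(1) by (auto simp: conj_map_def bij_betw_def)
      qed
      then show ?thesis unfolding X(2) by (simp add: image_image)
    qed
    moreover have "sharp W1 M1 W2 M2 \<phi> (star W1 M1 \<psi>) Y = \<phi> ` \<psi> ` X"
      using True X(1) \<psi>[OF X(1)] inj by (simp add: sharp_def conj_map_def Y) (simp add: star_def)
    ultimately show ?thesis using True by (simp add: star_def)
  qed (simp add: sharp_def conj_map_def star_def)
qed

text \<open>Discreteness and compact quotient are replaced by properties of the translations: a
  lattice, and one that spans. \<open>crystal_of_space_group\<close>, given the span, and
  \<open>space_group\<close> pass between the two forms.\<close>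

locale crystal =
  fixes M :: "('a::euclidean_space \<Rightarrow> 'a) set"
  assumes tgroup: "tgroup M" and isometries: "M \<subseteq> isometries"
    and finite_in_balls: "finite_in_balls (transl M)" and span_transl: "span (transl M) = UNIV"
begin

lemma D:
  assumes "\<mu> \<in> M"
  shows "bij \<mu>" "linear (lin \<mu>)" "orthogonal_transformation (lin \<mu>)" "\<mu> \<in> normalizing_affinities M"
  using assms isometries isometry_lin isometries_normalize[OF tgroup] by blast+

lemmas M = tgroupD(2-4)[OF tgroup]

lemma transl_subgroup: "additive_subgroup (transl M)"
  by (rule additive_subgroup_transl[OF tgroup])

lemma lin_transl: 
  assumes "\<phi> \<in> normalizing_affinities M" "t \<in> transl M" shows "lin \<phi> t \<in> transl M"
  using normalizing_affinities_D(3)[OF assms(1), of "(+) t"] assms(2)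
  by (simp add: transl_def conjm_plus[OF normalizing_affinities_D(2,1)[OF assms(1)]])

lemma finite_point_group: "finite (lin ` M)"
proof (rule finite_subset)
  show "lin ` M \<subseteq> {B. orthogonal_transformation B \<and> B ` transl M \<subseteq> transl M}"
    using D lin_transl by auto
  show "finite {B. orthogonal_transformation B \<and> B ` transl M \<subseteq> transl M}"
    by (rule finite_lattice_stabilizer[OF finite_in_balls span_transl])
qed

lemma linear_eq_on_transl:
  assumes "linear A" "linear B" "\<And>t. t \<in> transl M \<Longrightarrow> A t = B t" shows "A = B"
proof
  fix x show "A x = B x" using linear_eq_on[OF assms(1,2), of x "transl M"] assms(3) span_transl by auto
qed

text \<open>The fibres of \<open>lin\<close> on M are cosets of the translations, so counting
  elements of M reduces to the lattice and the finite point group.\<close>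

lemma same_lin:
  assumes "\<mu> \<in> M" "\<nu> \<in> M" "lin \<mu> = lin \<nu>"
  obtains t where "t \<in> transl M" "\<mu> = (+) t \<circ> \<nu>"
proof
  show eq: "\<mu> = (+) (\<mu> 0 - \<nu> 0) \<circ> \<nu>"
    using assms(3) by (auto simp: fun_eq_iff lin_def algebra_simps)
  have "\<mu> \<circ> finv \<nu> = (+) (\<mu> 0 - \<nu> 0)"
  proof
    fix x
    have "\<mu> (finv \<nu> x) = (\<mu> 0 - \<nu> 0) + \<nu> (finv \<nu> x)"
      using fun_cong[OF eq, of "finv \<nu> x"] by (simp only: comp_apply)
    then show "(\<mu> \<circ> finv \<nu>) x = \<mu> 0 - \<nu> 0 + x" using D(1)[OF assms(2)] by simp
  qed
  then show "\<mu> 0 - \<nu> 0 \<in> transl M"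
    using M(2)[OF assms(1) M(3)[OF assms(2)]] by (simp add: transl_def)
qed

text \<open>Countability is what the Baire argument of \<open>orbitwise_in_M\<close>
  requires.\<close>

lemma countable: "countable M"
proof -
  have "transl M = (\<Union>n. {t \<in> transl M. norm t \<le> real n})"
    using real_arch_simple by auto
  moreover have "countable \<dots>"
    by (intro countable_UN countableI_type)
      (rule countable_finite, use finite_in_balls in \<open>simp add: finite_in_balls_def\<close>)
  ultimately have cT: "countable (transl M)" by simp
  define r where "r p = (SOME \<mu>. \<mu> \<in> M \<and> lin \<mu> = p)" for p
  have r: "r p \<in> M \<and> lin (r p) = p" if "p \<in> lin ` M" for p
  proof -
    have "\<exists>\<mu>. \<mu> \<in> M \<and> lin \<mu> = p" using that by blast
    then show ?thesis unfolding r_def by (rule someI_ex)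
  qed
  have "M \<subseteq> (\<Union>p\<in>lin ` M. (\<lambda>t. (+) t \<circ> r p) ` transl M)"
  proof
    fix \<mu> assume \<mu>: "\<mu> \<in> M"
    then show "\<mu> \<in> (\<Union>p\<in>lin ` M. (\<lambda>t. (+) t \<circ> r p) ` transl M)"
      using same_lin[of \<mu> "r (lin \<mu>)"] r[of "lin \<mu>"] by (smt (verit) UN_I image_eqI)
  qed
  moreover have "countable \<dots>"
    by (rule countable_UN[OF countable_finite[OF finite_point_group]]) (rule countable_image[OF cT])
  ultimately show ?thesis using countable_subset by blast
qed

text \<open>The sets where \<open>\<theta>\<close> agrees with a given \<open>\<mu> \<in> M\<close> are countably many closed affine subspaces
  covering the space, so by Baire one of them is everything.\<close>

lemma orbitwise_in_M:
  assumes \<theta>: "linear (lin \<theta>)" and all: "\<And>x. \<exists>\<mu>\<in>M. \<theta> x = \<mu> x"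
  shows "\<theta> \<in> M"
proof (rule ccontr)
  assume n: "\<theta> \<notin> M"
  define E where "E \<mu> = {x. \<theta> x = \<mu> x}" for \<mu>
  have E: "closed (E \<mu>) \<and> interior (E \<mu>) = {}" if "\<mu> \<in> M" for \<mu>
  proof -
    have c: "continuous_on UNIV f" if "linear (lin f)" for f :: "'a \<Rightarrow> 'a"
    proof -
      have "continuous_on UNIV (\<lambda>x. f 0 + lin f x)"
        using that by (intro continuous_intros linear_continuous_on) (simp add: linear_conv_bounded_linear)
      then show ?thesis by (rule continuous_on_eq) (simp add: lin_def)
    qed
    have "closed (E \<mu>)"
      unfolding E_def using c[OF \<theta>] c[OF D(2)[OF that]] by (intro closed_Collect_eq)
    have "affine (E \<mu>)"
      unfolding affine_def
    proof (intro ballI allI impI)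
      fix x y and u v :: real assume xy: "x \<in> E \<mu>" "y \<in> E \<mu>" "u + v = 1"
      have e: "f (u *\<^sub>R x + v *\<^sub>R y) = u *\<^sub>R f x + v *\<^sub>R f y" if "linear (lin f)" for f :: "'a \<Rightarrow> 'a"
      proof -
        have "u *\<^sub>R f x + v *\<^sub>R f y = (u + v) *\<^sub>R f 0 + (u *\<^sub>R lin f x + v *\<^sub>R lin f y)"
          by (simp add: lin_def algebra_simps)
        also have "\<dots> = f 0 + lin f (u *\<^sub>R x + v *\<^sub>R y)"
          using that xy(3) by (simp add: linear_add linear_scale)
        finally show ?thesis by (simp add: lin_def)
      qed
      show "u *\<^sub>R x + v *\<^sub>R y \<in> E \<mu>"
        using xy e[OF \<theta>] e[OF D(2)[OF that]] by (simp add: E_def)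
    qed
    moreover have "E \<mu> \<noteq> UNIV"
    proof
      assume "E \<mu> = UNIV"
      then have "\<theta> = \<mu>" by (auto simp: E_def fun_eq_iff)
      then show False using n that by simp
    qed
    \<comment> \<open>An affine set with an interior point is the whole space, since it is its own
      affine hull.\<close>
    ultimately have "interior (E \<mu>) = {}"
      using affine_hull_nonempty_interior affine_hull_eq by metis
    with \<open>closed (E \<mu>)\<close> show ?thesis by blast
  qed
  have "(euclidean::'a topology) interior_of (\<Union>(E ` M)) = {}"
    using countable E
    by (intro Baire_category_alt) (auto simp: completely_metrizable_space_euclidean)
  moreover have "\<Union>(E ` M) = UNIV" using all by (auto simp: E_def)
  ultimately show False by simp
qed

text \<open>If the induced maps agree, \<open>\<phi> \<circ> finv \<psi>\<close> sends every point
  into its own orbit, a priori by an element of M that depends on the point;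
  \<open>orbitwise_in_M\<close> yields a single one. The independence of lifts in
  \<open>Omega\<close>, in the fibre product and in later choices rests on this.\<close>

lemma star_eq_iff:
  assumes "\<phi> \<in> normalizing_affinities M" "\<psi> \<in> normalizing_affinities M"
  shows "star UNIV M \<phi> = star UNIV M \<psi> \<longleftrightarrow> (\<exists>\<mu>\<in>M. \<phi> = \<mu> \<circ> \<psi>)"
proof
  assume eq: "star UNIV M \<phi> = star UNIV M \<psi>"
  have "\<phi> \<circ> finv \<psi> \<in> M"
  proof (rule orbitwise_in_M)
    show "linear (lin (\<phi> \<circ> finv \<psi>))"
      using assms normalizing_affinities_comp normalizing_affinities_inv normalizing_affinities_D(2) by blast
    fix x
    have "orbit M (\<phi> (finv \<psi> x)) = orbit M x"
      using fun_cong[OF eq, of "orbit M (finv \<psi> x)"] assms normalizing_affinities_D(1)[OF assms(2)]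
      by (simp add: star_normalizing)
    then have "\<phi> (finv \<psi> x) \<in> orbit M x" using self_in_orbit[OF tgroup] by metis
    then show "\<exists>\<mu>\<in>M. (\<phi> \<circ> finv \<psi>) x = \<mu> x" by (auto simp: orbit_def)
  qed
  moreover have "\<phi> = (\<phi> \<circ> finv \<psi>) \<circ> \<psi>"
    using normalizing_affinities_D(1)[OF assms(2)] by (auto simp: fun_eq_iff)
  ultimately show "\<exists>\<mu>\<in>M. \<phi> = \<mu> \<circ> \<psi>" by blast
next
  assume "\<exists>\<mu>\<in>M. \<phi> = \<mu> \<circ> \<psi>"
  then obtain \<mu> where \<mu>: "\<mu> \<in> M" "\<phi> = \<mu> \<circ> \<psi>" by blast
  show "star UNIV M \<phi> = star UNIV M \<psi>"
  proof (rule star_eqI)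
    fix X assume "X \<in> orbit_space UNIV M"
    then obtain x where "X = orbit M x" by (auto elim: orbit_space_E)
    then show "\<phi> ` X = \<psi> ` X"
      using normalizing_affinities_image_orbit[OF assms(1), of x]
        normalizing_affinities_image_orbit[OF assms(2), of x] orbit_absorb[OF tgroup \<mu>(1), of "\<psi> x"]
        fun_cong[OF \<mu>(2), of x] by (simp only: comp_apply)
  qed
qed

text \<open>This is the space Span(Z(M)): translations by these vectors are those that commute with
  M, and by \<open>fixed_span\<close> the lattice vectors among them span.\<close>

definition fixed :: "'a set" where
  "fixed = {v. \<forall>\<mu>\<in>M. lin \<mu> v = v}"

lemma fixed_commute: "v \<in> fixed \<Longrightarrow> \<mu> \<in> M \<Longrightarrow> (+) v \<circ> \<mu> = \<mu> \<circ> (+) v"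
  by (simp add: comp_plus D fixed_def)

lemma plus_fixed_conjm:
  assumes "v \<in> fixed" "\<mu> \<in> M" shows "conjm ((+) v) \<mu> = \<mu>"
  unfolding fixed_commute[OF assms] by (simp add: comp_assoc bij_plus_left)

lemma plus_fixed_normalizing: "v \<in> fixed \<Longrightarrow> (+) v \<in> normalizing_affinities M"
  using plus_fixed_conjm by (auto simp: normalizing_affinities_iff bij_plus_left linear_id)

lemma fixed_subspace: "subspace fixed"
  unfolding fixed_def subspace_def
  using D(2) by (auto simp: linear_0 linear_add linear_scale)

text \<open>Commuting with the translations forces the linear part to be the identity on a spanning
  set; the other elements of M then restrict the translation vector.\<close>

lemma centralizer:
  assumes "bij \<phi>" "linear (lin \<phi>)" "\<And>\<mu>. \<mu> \<in> M \<Longrightarrow> conjm \<phi> \<mu> = \<mu>"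
  obtains v where "v \<in> fixed" "\<phi> = (+) v"
proof
  have "lin \<phi> t = id t" if "t \<in> transl M" for t
    using that assms(3)[of "(+) t"] conjm_plus[OF assms(2,1)] by (auto simp: transl_def plus_inj)
  then have "lin \<phi> = id" using assms(2) linear_eq_on_transl linear_id by blast
  then show eq: "\<phi> = (+) (\<phi> 0)" by (simp add: lin_eq_id)
  show "\<phi> 0 \<in> fixed"
    unfolding fixed_def
  proof (intro CollectI ballI)
    fix \<mu> assume \<mu>: "\<mu> \<in> M"
    have "\<phi> (\<mu> 0) = \<mu> (\<phi> 0)"
      using fun_cong[OF assms(3)[OF \<mu>], of "\<phi> 0"] assms(1) by simp
    then show "lin \<mu> (\<phi> 0) = \<phi> 0"
      using fun_cong[OF eq, of "\<mu> 0"] by (simp add: lin_def algebra_simps)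
  qed
qed

end

lemma linear_funpow: "linear (A :: 'a::real_vector \<Rightarrow> 'a) \<Longrightarrow> linear (A ^^ k)"
  by (induction k) (simp_all only: funpow.simps linear_compose linear_id)

lemma lin_funpow:
  fixes f :: "'a::real_vector \<Rightarrow> 'a"
  assumes "linear (lin f)" shows "lin (f ^^ k) = lin f ^^ k" "linear (lin (f ^^ k))"
proof -
  show *: "lin (f ^^ k) = lin f ^^ k"
    by (induction k) (simp_all only: funpow.simps lin_id lin_comp[OF assms])
  show "linear (lin (f ^^ k))" unfolding * by (rule linear_funpow[OF assms])
qed

context crystal
begin

lemma lin_power_id: "\<exists>k>0. \<forall>\<mu>\<in>M. lin \<mu> ^^ k = id"
proof -
  have "\<exists>k>0. \<forall>p\<in>lin ` M. p ^^ k = id"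
  proof (rule finite_monoid_power_id[OF finite_point_group])
    fix f g assume "f \<in> lin ` M" "g \<in> lin ` M"
    then obtain \<mu> \<nu> where *: "\<mu> \<in> M" "\<nu> \<in> M" "f = lin \<mu>" "g = lin \<nu>" by blast
    then have "f \<circ> g = lin (\<mu> \<circ> \<nu>)" by (simp only: lin_comp[OF D(2)[OF *(1)]])
    then show "f \<circ> g \<in> lin ` M" using M(2)[OF *(1,2)] by blast
  next
    fix f assume "f \<in> lin ` M"
    then show "bij f" using D(1) bij_lin by blast
  qed
  then show ?thesis by blast
qed

text \<open>An automorphism of \<open>M\<close> preserves the translations, which are exactly the elements that
  commute with all \<open>k\<close>-th powers, where \<open>k\<close> is an exponent of the point group. On them it is given by
  a linear map, because this holds on a sublattice; the remaining discrepancy is a cocycle of the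
  finite point group, hence a coboundary.\<close>

theorem automorphism_affine:
  assumes f: "bij_betw f M M" and hom: "\<And>\<mu> \<nu>. \<mu> \<in> M \<Longrightarrow> \<nu> \<in> M \<Longrightarrow> f (\<mu> \<circ> \<nu>) = f \<mu> \<circ> f \<nu>"
  obtains \<zeta> where "\<zeta> \<in> normalizing_affinities M" "\<And>\<mu>. \<mu> \<in> M \<Longrightarrow> f \<mu> = conjm \<zeta> \<mu>"
proof -
  have fM: "f \<mu> \<in> M" if "\<mu> \<in> M" for \<mu> using f that by (auto simp: bij_betw_def)
  have fid: "f id = id"
  proof -
    have "f id \<circ> f id = f id \<circ> id" using hom[OF M(1) M(1)] by simp
    then have "finv (f id) \<circ> (f id \<circ> f id) = finv (f id) \<circ> (f id \<circ> id)" by simp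
    then show ?thesis using inv_comp_bij(1)[OF D(1)[OF fM[OF M(1)]]] by (simp add: comp_assoc[symmetric])
  qed
  have fpow: "f (\<mu> ^^ k) = f \<mu> ^^ k" if "\<mu> \<in> M" for \<mu> k
  proof (induction k)
    case (Suc k)
    then show ?case using hom[OF that tgroup_pow[OF tgroup that]] by (simp only: funpow.simps)
  qed (simp add: fid[unfolded id_def] id_def)
  obtain k where k: "k > 0" "\<And>\<mu>. \<mu> \<in> M \<Longrightarrow> lin \<mu> ^^ k = id" using lin_power_id by blast
  \<comment> \<open>The condition on the right speaks only of composition and powers, so f and its
    inverse respect it. This is how translations are recognized inside the abstract group.\<close>
  have char: "lin \<mu> = id \<longleftrightarrow> (\<forall>\<nu>\<in>M. \<mu> \<circ> \<nu> ^^ k = \<nu> ^^ k \<circ> \<mu>)" if \<mu>: "\<mu> \<in> M" for \<mu>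
  proof
    assume l: "lin \<mu> = id"
    show "\<forall>\<nu>\<in>M. \<mu> \<circ> \<nu> ^^ k = \<nu> ^^ k \<circ> \<mu>"
    proof
      fix \<nu> assume \<nu>: "\<nu> \<in> M"
      have "lin (\<nu> ^^ k) = id" using k(2)[OF \<nu>] lin_funpow[OF D(2)[OF \<nu>]] by simp
      then obtain a where "\<nu> ^^ k = (+) a" using lin_eq_id by blast
      moreover obtain b where "\<mu> = (+) b" using l lin_eq_id by blast
      ultimately show "\<mu> \<circ> \<nu> ^^ k = \<nu> ^^ k \<circ> \<mu>" by (simp add: plus_comp add.commute)
    qed
  next
    assume c: "\<forall>\<nu>\<in>M. \<mu> \<circ> \<nu> ^^ k = \<nu> ^^ k \<circ> \<mu>"
    have "lin \<mu> t = id t" if t: "t \<in> transl M" for t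
    proof -
      have "\<mu> \<circ> (+) (real k *\<^sub>R t) = (+) (real k *\<^sub>R t) \<circ> \<mu>"
        using c t by (auto simp: transl_def plus_pow[symmetric])
      then have "(+) (lin \<mu> (real k *\<^sub>R t)) \<circ> \<mu> = (+) (real k *\<^sub>R t) \<circ> \<mu>"
        using comp_plus[OF D(2)[OF \<mu>]] by simp
      from fun_cong[OF this, of 0] have "lin \<mu> (real k *\<^sub>R t) = real k *\<^sub>R t" by simp
      then show ?thesis using k(1) linear_scale[OF D(2)[OF \<mu>]] by simp
    qed
    then show "lin \<mu> = id" using D(2)[OF \<mu>] linear_eq_on_transl linear_id by blast
  qed
  have ftrans: "lin (f \<mu>) = id" if "\<mu> \<in> M" "lin \<mu> = id" for \<mu>
    unfolding char[OF fM[OF that(1)]]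
  proof
    fix \<nu> assume "\<nu> \<in> M"
    then obtain \<nu>' where \<nu>': "\<nu>' \<in> M" "\<nu> = f \<nu>'" using f by (auto simp: bij_betw_def)
    have "\<mu> \<circ> \<nu>' ^^ k = \<nu>' ^^ k \<circ> \<mu>" using char that \<nu>'(1) by blast
    then show "f \<mu> \<circ> \<nu> ^^ k = \<nu> ^^ k \<circ> f \<mu>"
      using hom[OF that(1) tgroup_pow[OF tgroup \<nu>'(1)], of k] hom[OF tgroup_pow[OF tgroup \<nu>'(1)] that(1), of k]
      by (simp only: \<nu>'(2) fpow[OF \<nu>'(1)])
  qed
  have ftrans': "lin \<mu> = id" if "\<mu> \<in> M" "lin (f \<mu>) = id" for \<mu>
    unfolding char[OF that(1)]
  proof
    fix \<nu> assume \<nu>: "\<nu> \<in> M"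
    have "f \<mu> \<circ> f \<nu> ^^ k = f \<nu> ^^ k \<circ> f \<mu>" using char[OF fM[OF that(1)]] that fM[OF \<nu>] by blast
    then have "f (\<mu> \<circ> \<nu> ^^ k) = f (\<nu> ^^ k \<circ> \<mu>)"
      using hom[OF that(1) tgroup_pow[OF tgroup \<nu>]] hom[OF tgroup_pow[OF tgroup \<nu>] that(1)] fpow[OF \<nu>] by simp
    then show "\<mu> \<circ> \<nu> ^^ k = \<nu> ^^ k \<circ> \<mu>"
      using f M(2)[OF that(1) tgroup_pow[OF tgroup \<nu>]] M(2)[OF tgroup_pow[OF tgroup \<nu>] that(1)]
      by (auto simp: bij_betw_def dest: inj_onD)
  qed
  define F where "F t = f ((+) t) 0" for t
  have F: "f ((+) t) = (+) (F t)" if "t \<in> transl M" for t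
    using ftrans[of "(+) t"] that unfolding F_def lin_eq_id[symmetric] by (simp add: transl_def)
  have Fmem: "F t \<in> transl M" if "t \<in> transl M" for t
    using fM[of "(+) t"] F[OF that] that by (simp add: transl_def)
  have Fadd: "F (s + t) = F s + F t" if "s \<in> transl M" "t \<in> transl M" for s t
  proof -
    have "s + t \<in> transl M" using that transl_subgroup by (auto simp: additive_subgroup_def)
    have "f ((+) s \<circ> (+) t) = f ((+) s) \<circ> f ((+) t)"
      by (rule hom) (use that in \<open>auto simp: transl_def\<close>)
    then show ?thesis using F that \<open>s + t \<in> transl M\<close> by (simp add: plus_comp plus_inj)
  qed
  have F0: "F 0 = 0" using Fadd[of 0 0] transl_subgroup by (auto simp: additive_subgroup_def)
  have Fminus: "F (- t) = - F t" if "t \<in> transl M" for t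
  proof -
    have "- t \<in> transl M" using that transl_subgroup by (auto simp: additive_subgroup_def)
    then have "F (- t) + F t = 0" using Fadd[of "- t" t] F0 that by simp
    then show ?thesis by (simp add: add_eq_0_iff2)
  qed
  have Fnat: "F (real j *\<^sub>R t) = real j *\<^sub>R F t" if "t \<in> transl M" for j t
  proof (induction j)
    case (Suc j)
    have "F (real (Suc j) *\<^sub>R t) = F (real j *\<^sub>R t + t)" by (simp add: scaleR_left_distrib add.commute)
    also have "\<dots> = real j *\<^sub>R F t + F t"
      using Fadd[OF additive_subgroup_nat[OF transl_subgroup that] that] Suc by simp
    finally show ?case by (simp add: scaleR_left_distrib add.commute)
  qed (simp add: F0)
  obtain B where B: "B \<subseteq> transl M" "independent B" "transl M \<subseteq> span B"
    using maximal_independent_subset by blast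
  obtain L where L: "linear L" "\<And>b. b \<in> B \<Longrightarrow> L b = F b"
    using linear_independent_extend[OF B(2), of F] by blast
  have LF: "L t = F t" if t: "t \<in> transl M" for t
  proof -
    \<comment> \<open>B spans, but it may generate only part of the lattice. T0 is the subgroup
      where L and F agree; it contains B, so each t has a positive multiple in it.\<close>
    define T0 where "T0 = {t \<in> transl M. L t = F t}"
    have "additive_subgroup T0"
      using transl_subgroup Fadd F0 Fminus
      by (auto simp: T0_def additive_subgroup_def linear_0[OF L(1)] linear_add[OF L(1)] linear_neg[OF L(1)])
    moreover have "B \<subseteq> T0" using B(1) L(2) by (auto simp: T0_def)
    then have "t \<in> span T0" using B(3) t span_mono by blast
    ultimately obtain j where j: "j > 0" "real j *\<^sub>R t \<in> T0"
      using lattice_commensurable[OF transl_subgroup finite_in_balls, of T0 t] t by (auto simp: T0_def)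
    then have "real j *\<^sub>R L t = real j *\<^sub>R F t"
      using Fnat[OF t] by (simp add: T0_def linear_scale[OF L(1)])
    then show ?thesis using j(1) by simp
  qed
  have "transl M \<subseteq> range L"
  proof
    fix t assume t: "t \<in> transl M"
    then have "(+) t \<in> f ` M" using f by (simp add: bij_betw_def transl_def)
    then obtain \<mu> where \<mu>: "\<mu> \<in> M" "f \<mu> = (+) t" by auto
    have "lin \<mu> = id" using ftrans'[OF \<mu>(1)] \<mu>(2) by simp
    then have "\<mu> = (+) (\<mu> 0)" by (simp add: lin_eq_id)
    then have "\<mu> 0 \<in> transl M" using \<mu>(1) by (simp add: transl_def)
    moreover have "F (\<mu> 0) = t" using \<open>\<mu> = (+) (\<mu> 0)\<close> \<mu>(2) unfolding F_def by (metis add.right_neutral)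
    ultimately show "t \<in> range L" using LF by (metis rangeI)
  qed
  then have "surj L"
    using span_transl span_minimal[OF _ linear_subspace_image[OF L(1) subspace_UNIV]] by blast
  then have bL: "bij L" using L(1) linear_surjective_imp_injective by (auto simp: bij_def)
  have linf: "lin (f \<mu>) \<circ> L = L \<circ> lin \<mu>" if \<mu>: "\<mu> \<in> M" for \<mu>
  proof (rule linear_eq_on_transl)
    show "linear (lin (f \<mu>) \<circ> L)" "linear (L \<circ> lin \<mu>)"
      using D(2)[OF \<mu>] D(2)[OF fM[OF \<mu>]] L(1) linear_compose by blast+
    fix t assume t: "t \<in> transl M"
    have lt: "lin \<mu> t \<in> transl M" using lin_transl[OF D(4)[OF \<mu>] t] .
    have "f (\<mu> \<circ> (+) t) = f ((+) (lin \<mu> t) \<circ> \<mu>)" by (simp only: comp_plus[OF D(2)[OF \<mu>]])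
    then have "f \<mu> \<circ> (+) (F t) = (+) (F (lin \<mu> t)) \<circ> f \<mu>"
      using hom[OF \<mu>, of "(+) t"] hom[OF _ \<mu>, of "(+) (lin \<mu> t)"] F[OF t] F[OF lt] t lt
      by (simp add: transl_def)
    then have "(+) (lin (f \<mu>) (F t)) \<circ> f \<mu> = (+) (F (lin \<mu> t)) \<circ> f \<mu>"
      by (simp only: comp_plus[OF D(2)[OF fM[OF \<mu>]]])
    from fun_cong[OF this, of 0] show "(lin (f \<mu>) \<circ> L) t = (L \<circ> lin \<mu>) t"
      using LF[OF t] LF[OF lt] by simp
  qed
  have Linv: "linear (finv L)" using L(1) bL linear_inv_bij by blast
  \<comment> \<open>c \<mu> measures by how much conjugation by L alone misses f \<mu>, pulled back
    by L.\<close>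
  define c where "c \<mu> = finv L (f \<mu> 0) - \<mu> 0" for \<mu>
  have fc: "f \<mu> (L x) = L (c \<mu> + \<mu> x)" if \<mu>: "\<mu> \<in> M" for \<mu> x
  proof -
    have "f \<mu> (L x) = f \<mu> 0 + L (lin \<mu> x)"
      using fun_cong[OF linf[OF \<mu>], of x] by (simp add: lin_def algebra_simps)
    also have "f \<mu> 0 = L (c \<mu> + \<mu> 0)" using bL by (simp add: c_def)
    finally show ?thesis by (simp add: linear_add[OF L(1)] linear_diff[OF L(1)] lin_def)
  qed
  have injL: "L x = L y \<longleftrightarrow> x = y" for x y using bL by (simp add: bij_def inj_eq)
  have cadd: "c (\<mu> \<circ> \<nu>) = c \<mu> + lin \<mu> (c \<nu>)" if \<mu>: "\<mu> \<in> M" and \<nu>: "\<nu> \<in> M" for \<mu> \<nu>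
  proof -
    have "L (c (\<mu> \<circ> \<nu>) + \<mu> (\<nu> 0)) = f \<mu> (f \<nu> (L 0))"
      using fc[OF M(2)[OF \<mu> \<nu>], of 0] hom[OF \<mu> \<nu>] by simp
    also have "\<dots> = L (c \<mu> + \<mu> (c \<nu> + \<nu> 0))"
      using fc[OF \<mu>] fc[OF \<nu>] by simp
    finally show ?thesis by (simp add: injL lin_add_left[OF D(2)[OF \<mu>]])
  qed
  have clin: "c \<mu> = c \<nu>" if \<mu>\<nu>: "\<mu> \<in> M" "\<nu> \<in> M" "lin \<mu> = lin \<nu>" for \<mu> \<nu>
  proof -
    obtain t where t: "t \<in> transl M" "\<mu> = (+) t \<circ> \<nu>" using same_lin[OF \<mu>\<nu>] by blast
    have "c ((+) t) = 0" using F[OF t(1)] LF[OF t(1)] bL by (simp add: c_def inv_into_f_eq[OF bij_is_inj])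
    then show ?thesis using cadd[of "(+) t" \<nu>] t \<mu>\<nu> by (simp add: transl_def)
  qed
  \<comment> \<open>c is unchanged by lattice translations, so it is a function on the finite point
    group; by \<open>clin\<close> any representative will do.\<close>
  define c' where "c' p = c (SOME \<mu>. \<mu> \<in> M \<and> lin \<mu> = p)" for p
  have c': "c' (lin \<mu>) = c \<mu>" if "\<mu> \<in> M" for \<mu>
  proof -
    have "\<exists>\<nu>. \<nu> \<in> M \<and> lin \<nu> = lin \<mu>" using that by blast
    from someI_ex[OF this] show ?thesis unfolding c'_def by (intro clin that) auto
  qed
  define S where "S = (\<Sum>p\<in>lin ` M. c' p)"
  let ?n = "real (card (lin ` M))"
  have npos: "?n > 0" using finite_point_group M(1) by (auto simp: card_gt_0_iff)
  \<comment> \<open>Sum the cocycle identity over the point group; left multiplication by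
    \<open>lin \<mu>\<close> only permutes the summands. Dividing by the order gives u with c \<mu>
    = u - lin \<mu> u.\<close>
  have Seq: "S = ?n *\<^sub>R c \<mu> + lin \<mu> S" if \<mu>: "\<mu> \<in> M" for \<mu>
  proof -
    have "bij_betw (\<lambda>p. lin \<mu> \<circ> p) (lin ` M) (lin ` M)"
    proof (rule bij_betw_byWitness[where f' = "\<lambda>p. lin (finv \<mu>) \<circ> p"])
      have e: "lin (finv \<mu>) = finv (lin \<mu>)" by (rule lin_inv[OF D(2,1)[OF \<mu>]])
      have b: "bij (lin \<mu>)" by (rule bij_lin[OF D(1)[OF \<mu>]])
      show "\<forall>p\<in>lin ` M. lin (finv \<mu>) \<circ> (lin \<mu> \<circ> p) = p" "\<forall>p\<in>lin ` M. lin \<mu> \<circ> (lin (finv \<mu>) \<circ> p) = p"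
        unfolding e by (simp_all add: comp_assoc[symmetric] b)
      show "(\<lambda>p. lin \<mu> \<circ> p) ` lin ` M \<subseteq> lin ` M"
        using M(2)[OF \<mu>] by (auto simp: lin_comp[OF D(2)[OF \<mu>], symmetric])
      show "(\<lambda>p. lin (finv \<mu>) \<circ> p) ` lin ` M \<subseteq> lin ` M"
        using M(2)[OF M(3)[OF \<mu>]] by (auto simp: lin_comp[OF D(2)[OF M(3)[OF \<mu>]], symmetric])
    qed
    then have "S = (\<Sum>p\<in>lin ` M. c' (lin \<mu> \<circ> p))"
      unfolding S_def using sum.reindex_bij_betw by metis
    also have "\<dots> = (\<Sum>p\<in>lin ` M. c \<mu> + lin \<mu> (c' p))"
    proof (rule sum.cong[OF refl])
      fix p assume "p \<in> lin ` M"
      then obtain \<nu> where \<nu>: "\<nu> \<in> M" "p = lin \<nu>" by blast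
      have "c' (lin \<mu> \<circ> p) = c (\<mu> \<circ> \<nu>)"
        unfolding \<nu>(2) lin_comp[OF D(2)[OF \<mu>], symmetric] by (rule c'[OF M(2)[OF \<mu> \<nu>(1)]])
      then show "c' (lin \<mu> \<circ> p) = c \<mu> + lin \<mu> (c' p)"
        using cadd[OF \<mu> \<nu>(1)] c'[OF \<nu>(1)] \<nu>(2) by simp
    qed
    also have "\<dots> = ?n *\<^sub>R c \<mu> + lin \<mu> S"
      unfolding S_def by (simp add: sum.distrib linear_sum[OF D(2)[OF \<mu>]] sum_constant_scaleR)
    finally show ?thesis .
  qed
  define u where "u = S /\<^sub>R ?n"
  have cu: "c \<mu> = u - lin \<mu> u" if "\<mu> \<in> M" for \<mu>
  proof -
    have "?n *\<^sub>R c \<mu> = ?n *\<^sub>R (u - lin \<mu> u)"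
      using Seq[OF that] npos unfolding u_def
      by (simp add: linear_scale[OF D(2)[OF that]] scaleR_right_diff_distrib algebra_simps)
    then show ?thesis using npos by (metis less_numeral_extra(3) scaleR_cancel_left)
  qed
  \<comment> \<open>Shifting by u before applying L absorbs the coboundary.\<close>
  define \<zeta> where "\<zeta> = L \<circ> (+) u"
  have b\<zeta>: "bij \<zeta>" unfolding \<zeta>_def by (rule bij_comp[OF bij_plus_left bL])
  have l\<zeta>: "linear (lin \<zeta>)" unfolding \<zeta>_def
    by (rule linear_lin_comp) (simp_all add: lin_linear[OF L(1)] L(1) linear_id)
  have *: "f \<mu> = conjm \<zeta> \<mu>" if \<mu>: "\<mu> \<in> M" for \<mu>
  proof
    fix y
    define x where "x = finv \<zeta> y"
    have y: "y = L (u + x)" using inv_app_bij(2)[OF b\<zeta>, of y] by (simp add: x_def \<zeta>_def)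
    have "f \<mu> y = L (u - lin \<mu> u + \<mu> (u + x))" unfolding y using fc[OF \<mu>] cu[OF \<mu>] by simp
    also have "\<mu> (u + x) = \<mu> x + lin \<mu> u" by (rule lin_add_left[OF D(2)[OF \<mu>]])
    finally show "f \<mu> y = conjm \<zeta> \<mu> y" by (simp add: x_def[symmetric]) (simp add: \<zeta>_def)
  qed
  have "conjm \<zeta> ` M = f ` M" using * by simp
  then have "\<zeta> \<in> normalizing_affinities M"
    using b\<zeta> l\<zeta> f by (simp add: normalizing_affinities_iff bij_betw_def)
  with * show thesis using that by blast
qed

end

section \<open>The outer action of orbifold affinities, and lifts with a power that acts as an inner
  automorphism\<close>

section \<open>The homomorphism \<open>Omega\<close>\<close>

context crystal
begin

abbreviation act :: "('a \<Rightarrow> 'a) \<Rightarrow> ('a \<Rightarrow> 'a) \<Rightarrow> 'a \<Rightarrow> 'a" where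
  "act \<phi> \<equiv> restrict (conjm \<phi>) M"

lemma act_Bij:
  assumes "\<phi> \<in> normalizing_affinities M" shows "act \<phi> \<in> Bij M"
proof -
  have "inj_on (conjm \<phi>) M" using inj_conjm[OF normalizing_affinities_D(1)[OF assms]] by (simp add: inj_on_def)
  moreover have "conjm \<phi> ` M = M" using assms by (simp add: normalizing_affinities_iff)
  ultimately show ?thesis by (simp add: Bij_def bij_betw_def cong: inj_on_cong)
qed

lemma compose_act:
  assumes "\<phi> \<in> normalizing_affinities M" "\<psi> \<in> normalizing_affinities M"
  shows "compose M (act \<phi>) (act \<psi>) = act (\<phi> \<circ> \<psi>)"
proof
  fix \<mu> show "compose M (act \<phi>) (act \<psi>) \<mu> = act (\<phi> \<circ> \<psi>) \<mu>"
  proof (cases "\<mu> \<in> M")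
    case True
    then show ?thesis
      using normalizing_affinities_D(3)[OF assms(2)]
        conjm_conjm[OF normalizing_affinities_D(1)[OF assms(1)] normalizing_affinities_D(1)[OF assms(2)]]
      by (simp only: compose_def restrict_apply if_True)
  qed (simp add: compose_def)
qed

lemma Inn_act: "Inn (trans_group UNIV M) = act ` M"
proof -
  have "(\<lambda>x\<in>M. g \<otimes>\<^bsub>trans_group UNIV M\<^esub> x \<otimes>\<^bsub>trans_group UNIV M\<^esub> inv\<^bsub>trans_group UNIV M\<^esub> g) = act g"
    if "g \<in> M" for g
    using that M by (intro restrict_ext) (simp add: tgroup_mult[OF tgroup] tgroup_inv[OF tgroup])
  then show ?thesis unfolding Inn_def Setcompr_eq_image trans_group_simps(1) by (rule image_cong[OF refl])
qed

text \<open>The coset of Inn(M) through the automorphism induced by \<phi>, written as a set of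
  restricted conjugations so that cosets can be compared elementwise.\<close>

definition Omega_class :: "('a \<Rightarrow> 'a) \<Rightarrow> (('a \<Rightarrow> 'a) \<Rightarrow> 'a \<Rightarrow> 'a) set" where
  "Omega_class \<phi> = (\<lambda>m. act (m \<circ> \<phi>)) ` M"

lemma Omega_class_coset:
  assumes "\<phi> \<in> normalizing_affinities M"
  shows "Inn (trans_group UNIV M) #>\<^bsub>AutoGroup (trans_group UNIV M)\<^esub> act \<phi> = Omega_class \<phi>"
proof -
  have "act m \<otimes>\<^bsub>AutoGroup (trans_group UNIV M)\<^esub> act \<phi> = act (m \<circ> \<phi>)" if "m \<in> M" for m
    using act_Bij[OF assms] act_Bij[OF D(4)[OF that]] compose_act[OF D(4)[OF that] assms]
    by (simp add: AutoGroup_def mult_BijGroup)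
  then show ?thesis unfolding r_coset_def Inn_act Omega_class_def by auto
qed

lemma Omega_class_absorb:
  assumes "\<mu> \<in> M" shows "Omega_class (\<mu> \<circ> \<phi>) = Omega_class \<phi>"
proof -
  have "(\<lambda>m. m \<circ> \<mu>) ` M = M"
  proof
    show "M \<subseteq> (\<lambda>m. m \<circ> \<mu>) ` M"
    proof
      fix m assume "m \<in> M"
      then show "m \<in> (\<lambda>m. m \<circ> \<mu>) ` M"
        using M(2)[OF _ M(3)[OF assms]] D(1)[OF assms] by (intro image_eqI[of _ _ "m \<circ> finv \<mu>"]) (simp_all add: comp_assoc)
    qed
  qed (use M assms in auto)
  then have "Omega_class \<phi> = (\<lambda>m. act (m \<circ> \<phi>)) ` (\<lambda>m. m \<circ> \<mu>) ` M" by (simp only: Omega_class_def)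
  then show ?thesis unfolding Omega_class_def image_image comp_assoc by simp
qed

text \<open>Two lifts differ by an element of M, which only reindexes the coset, so the definite
  description has a unique solution.\<close>

lemma Omega_star:
  assumes "\<phi> \<in> normalizing_affinities M"
  shows "Omega M (star UNIV M \<phi>) = Omega_class \<phi>"
  unfolding Omega_def
proof (rule the_equality)
  show "\<exists>\<psi>\<in>normalizing_affinities M. star UNIV M \<phi> = star UNIV M \<psi> \<and>
    Omega_class \<phi> = Inn (trans_group UNIV M) #>\<^bsub>AutoGroup (trans_group UNIV M)\<^esub> (\<lambda>\<mu>\<in>M. conj_map UNIV UNIV \<psi> \<mu>)"
    using assms Omega_class_coset[OF assms] by (intro bexI[of _ \<phi>]) simp_all
next
  fix c
  assume "\<exists>\<psi>\<in>normalizing_affinities M. star UNIV M \<phi> = star UNIV M \<psi> \<and>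
    c = Inn (trans_group UNIV M) #>\<^bsub>AutoGroup (trans_group UNIV M)\<^esub> (\<lambda>\<mu>\<in>M. conj_map UNIV UNIV \<psi> \<mu>)"
  then obtain \<psi> where \<psi>: "\<psi> \<in> normalizing_affinities M" "star UNIV M \<phi> = star UNIV M \<psi>"
    "c = Inn (trans_group UNIV M) #>\<^bsub>AutoGroup (trans_group UNIV M)\<^esub> (\<lambda>\<mu>\<in>M. conj_map UNIV UNIV \<psi> \<mu>)"
    by blast
  have "c = Omega_class \<psi>" using Omega_class_coset[OF \<psi>(1)] \<psi>(3) by simp
  then show "c = Omega_class \<phi>"
    using star_eq_iff[OF assms \<psi>(1)] \<psi>(2) Omega_class_absorb by metis
qed

lemma Omega_class_eqI:
  assumes "\<phi> \<in> normalizing_affinities M" "\<psi> \<in> normalizing_affinities M"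
    and m: "m \<in> M" "\<And>\<mu>. \<mu> \<in> M \<Longrightarrow> conjm \<phi> \<mu> = conjm m (conjm \<psi> \<mu>)"
  shows "Omega_class \<phi> = Omega_class \<psi>"
proof -
  have "act (n \<circ> \<phi>) = act (n \<circ> (m \<circ> \<psi>))" if n: "n \<in> M" for n
  proof (rule restrict_ext)
    fix \<mu> assume "\<mu> \<in> M"
    then show "conjm (n \<circ> \<phi>) \<mu> = conjm (n \<circ> (m \<circ> \<psi>)) \<mu>"
      using m(2)[of \<mu>] conjm_conjm[OF D(1)[OF n] normalizing_affinities_D(1)[OF assms(1)], of \<mu>]
        conjm_conjm[OF D(1)[OF n], of "m \<circ> \<psi>" \<mu>] conjm_conjm[OF D(1)[OF m(1)] normalizing_affinities_D(1)[OF assms(2)], of \<mu>]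
        bij_comp[OF normalizing_affinities_D(1)[OF assms(2)] D(1)[OF m(1)]]
      by metis
  qed
  then have "Omega_class \<phi> = Omega_class (m \<circ> \<psi>)"
    unfolding Omega_class_def by (rule image_cong[OF refl])
  then show ?thesis using Omega_class_absorb[OF m(1)] by metis
qed

lemma Omega_class_eqD:
  assumes "\<phi> \<in> normalizing_affinities M" "\<psi> \<in> normalizing_affinities M" "Omega_class \<phi> = Omega_class \<psi>"
  obtains m where "m \<in> M" "\<And>\<mu>. \<mu> \<in> M \<Longrightarrow> conjm \<phi> \<mu> = conjm (m \<circ> \<psi>) \<mu>"
proof -
  have "act (id \<circ> \<phi>) \<in> Omega_class \<phi>" unfolding Omega_class_def
    by (rule rev_image_eqI[OF M(1)]) (rule refl)
  then have "act (id \<circ> \<phi>) \<in> Omega_class \<psi>" unfolding assms(3) .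
  then obtain m where m: "m \<in> M" "act \<phi> = act (m \<circ> \<psi>)" by (auto simp: Omega_class_def simp del: comp_apply)
  have "conjm \<phi> \<mu> = conjm (m \<circ> \<psi>) \<mu>" if "\<mu> \<in> M" for \<mu>
    using fun_cong[OF m(2), of \<mu>] that by (simp only: restrict_apply if_True)
  then show thesis using that m(1) by blast
qed

text \<open>If a power of \<open>\<phi>\<close> is the translation by \<open>v\<close>, then \<open>v - p v\<close> is a lattice vector for each \<open>p\<close> in the
  point group; summing over the point group makes a multiple of \<open>v\<close> the sum of a lattice vector and
  a fixed vector.\<close>

lemma power_acts_inner:
  assumes \<phi>: "\<phi> \<in> normalizing_affinities M" and k: "k > 0" "\<phi> ^^ k = (+) v"
  shows "\<exists>K>0. \<exists>m\<in>M. \<forall>\<mu>\<in>M. conjm (\<phi> ^^ K) \<mu> = conjm m \<mu>"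
proof -
  let ?n = "card (lin ` M)"
  have n: "?n > 0" using finite_point_group M(1) by (auto simp: card_gt_0_iff)
  have v: "(+) v \<in> normalizing_affinities M" using normalizing_affinities_pow[OF \<phi>, of k] k(2) by simp
  \<comment> \<open>The translation by v normalizes M, being a power of \<phi>, so its commutator
    with \<mu> lies in M; this commutator is the translation by v - lin \<mu> v.\<close>
  have d: "v - lin \<mu> v \<in> transl M" if \<mu>: "\<mu> \<in> M" for \<mu>
  proof -
    have "conjm ((+) v) \<mu> \<circ> finv \<mu> \<in> M"
      by (rule M(2)[OF normalizing_affinities_D(3)[OF v \<mu>] M(3)[OF \<mu>]])
    moreover have "conjm ((+) v) \<mu> \<circ> finv \<mu> = (+) (v - lin \<mu> v)"
    proof
      fix x
      have "\<mu> (- v + finv \<mu> x) = x - lin \<mu> v"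
        using lin_add_left[OF D(2)[OF \<mu>], of "- v" "finv \<mu> x"] inv_app_bij(2)[OF D(1)[OF \<mu>], of x]
        by (simp add: linear_neg[OF D(2)[OF \<mu>]])
      then show "(conjm ((+) v) \<mu> \<circ> finv \<mu>) x = v - lin \<mu> v + x"
        unfolding inv_plus comp_apply by (simp add: algebra_simps)
    qed
    ultimately show ?thesis by (simp add: transl_def)
  qed
  define f where "f = (\<Sum>p\<in>lin ` M. p v)"
  define t where "t = (\<Sum>p\<in>lin ` M. v - p v)"
  have t: "t \<in> transl M" unfolding t_def
    by (rule additive_subgroup_sum[OF transl_subgroup]) (use d in auto)
  have ft: "real ?n *\<^sub>R v = f + t"
    unfolding f_def t_def by (simp add: sum.distrib[symmetric] sum_constant_scaleR)
  have "f \<in> fixed"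
    unfolding fixed_def
  proof (intro CollectI ballI)
    fix \<mu> assume \<mu>: "\<mu> \<in> M"
    have "inj_on (\<lambda>p. lin \<mu> \<circ> p) (lin ` M)"
    proof (rule inj_onI, rule ext)
      fix p q x assume "lin \<mu> \<circ> p = lin \<mu> \<circ> q"
      from fun_cong[OF this, of x] show "p x = q x"
        using injD[OF bij_is_inj[OF bij_lin[OF D(1)[OF \<mu>]]]] by (simp only: comp_apply)
    qed
    moreover have "(\<lambda>p. lin \<mu> \<circ> p) ` lin ` M \<subseteq> lin ` M"
      using M(2)[OF \<mu>] by (auto simp: lin_comp[OF D(2)[OF \<mu>], symmetric])
    ultimately have im: "(\<lambda>p. lin \<mu> \<circ> p) ` lin ` M = lin ` M"
      using finite_point_group endo_inj_surj by metis
    have "lin \<mu> f = (\<Sum>p\<in>lin ` M. (lin \<mu> \<circ> p) v)"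
      unfolding f_def by (simp add: linear_sum[OF D(2)[OF \<mu>]])
    also have "\<dots> = (\<Sum>p\<in>(\<lambda>p. lin \<mu> \<circ> p) ` lin ` M. p v)"
      using sum.reindex[OF \<open>inj_on (\<lambda>p. lin \<mu> \<circ> p) (lin ` M)\<close>, of "\<lambda>p. p v"] by (simp add: comp_def)
    finally show "lin \<mu> f = f" unfolding im f_def .
  qed
  \<comment> \<open>The fixed summand f commutes with M, so only the lattice translation t is left
    in the action on M.\<close>
  have "\<phi> ^^ (k * ?n) = (+) t \<circ> (+) f"
    using ft by (simp add: funpow_mult[symmetric] k(2) plus_pow plus_comp add.commute)
  moreover have "conjm ((+) t \<circ> (+) f) \<mu> = conjm ((+) t) \<mu>" if "\<mu> \<in> M" for \<mu>
    using plus_fixed_conjm[OF \<open>f \<in> fixed\<close> that] conjm_conjm[OF bij_plus_left bij_plus_left, of t f \<mu>] by metis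
  ultimately have "\<forall>\<mu>\<in>M. conjm (\<phi> ^^ (k * ?n)) \<mu> = conjm ((+) t) \<mu>" by metis
  moreover have "(+) t \<in> M" "k * ?n > 0" using t k(1) n by (simp_all add: transl_def)
  ultimately show ?thesis by blast
qed

end

section \<open>The infinite dihedral group and a finiteness criterion for outer actions\<close>

section \<open>The infinite dihedral group\<close>

lemma bij_delta: "bij delta1" "bij delta2"
  by (auto simp: delta1_def delta2_def intro!: involuntory_imp_bij)

lemma delta_involution: "delta1 \<circ> delta1 = id" "delta2 \<circ> delta2 = id" "finv delta1 = delta1" "finv delta2 = delta2"
proof -
  show *: "delta1 \<circ> delta1 = id" "delta2 \<circ> delta2 = id" by (auto simp: delta1_def delta2_def)
  show "finv delta1 = delta1" "finv delta2 = delta2" using * by (auto intro: inv_unique_comp)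
qed

lemma tgroup_Delta: "tgroup Delta"
  unfolding subgroup_BijGroup_UNIV[symmetric] Delta_def
  by (rule group.generate_is_subgroup[OF group_BijGroup]) (simp add: Bij_UNIV bij_delta)

lemma delta_in_Delta: "delta1 \<in> Delta" "delta2 \<in> Delta"
  unfolding Delta_def by (auto intro: generate.incl)

text \<open>There is no case for inverses: the generators are involutions, so their inverses are
  generators again.\<close>

lemma Delta_induct [consumes 1, case_names id delta1 delta2 comp]:
  assumes "\<delta> \<in> Delta" "P id" "P delta1" "P delta2"
    and "\<And>f g. f \<in> Delta \<Longrightarrow> g \<in> Delta \<Longrightarrow> P f \<Longrightarrow> P g \<Longrightarrow> P (f \<circ> g)"
  shows "P \<delta>"
proof -
  have "\<delta> \<in> generate (BijGroup UNIV) {delta1, delta2}" using assms(1) by (simp add: Delta_def)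
  then have "\<delta> \<in> Delta \<and> P \<delta>"
  proof induction
    case one
    then show ?case using assms(2) tgroupD(2)[OF tgroup_Delta] by (simp add: id_def)
  next
    case (incl h)
    then show ?case using assms(3,4) delta_in_Delta by auto
  next
    case (inv h)
    then show ?case using assms(3,4) delta_in_Delta by (auto simp: inv_BijGroup_UNIV bij_delta delta_involution)
  next
    case (eng f g)
    then have "f \<otimes>\<^bsub>BijGroup UNIV\<^esub> g = f \<circ> g"
      by (intro mult_BijGroup_UNIV tgroupD(1)[OF tgroup_Delta]) blast+
    then show ?case
      using eng assms(5)[of f g] tgroupD(3)[OF tgroup_Delta, of f g] by (simp only:)
  qed
  then show ?thesis by blast
qed

lemma Delta_form:
  assumes "\<delta> \<in> Delta"
  shows "\<exists>k::int. \<delta> = (\<lambda>t. of_int k + t) \<or> \<delta> = (\<lambda>t. of_int k - t)"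
  using assms
proof (induction rule: Delta_induct)
  case id
  show ?case by (intro exI[of _ 0]) auto
next
  case delta1
  show ?case by (intro exI[of _ 0]) (auto simp: delta1_def)
next
  case delta2
  show ?case by (intro exI[of _ 1]) (auto simp: delta2_def)
next
  case (comp f g)
  then obtain k l :: int where "f = (\<lambda>t. of_int k + t) \<or> f = (\<lambda>t. of_int k - t)"
    "g = (\<lambda>t. of_int l + t) \<or> g = (\<lambda>t. of_int l - t)" by blast
  then have "f \<circ> g = (\<lambda>t. of_int (k + l) + t) \<or> f \<circ> g = (\<lambda>t. of_int (k + l) - t)
      \<or> f \<circ> g = (\<lambda>t. of_int (k - l) + t) \<or> f \<circ> g = (\<lambda>t. of_int (k - l) - t)"
    by (elim disjE) (simp_all add: fun_eq_iff)
  then show ?case by blast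
qed

lemma translation_in_Delta: "(\<lambda>t. of_int k + t) \<in> Delta"
proof -
  have 1: "(\<lambda>t. real n + t) \<in> Delta" for n
  proof (induction n)
    case 0
    show ?case using tgroupD(2)[OF tgroup_Delta] by (simp add: id_def)
  next
    case (Suc n)
    \<comment> \<open>The product \<open>delta2 \<circ> delta1\<close> is the translation by
      1.\<close>
    have "(\<lambda>t. real (Suc n) + t) = (delta2 \<circ> delta1) \<circ> (\<lambda>t. real n + t)"
      by (auto simp: delta1_def delta2_def)
    then show ?case using Suc tgroupD(3)[OF tgroup_Delta] delta_in_Delta by metis
  qed
  have 2: "(\<lambda>t. - real n + t) \<in> Delta" for n
  proof -
    have "finv (\<lambda>t. real n + t) = (\<lambda>t. - real n + t)" by (rule inv_plus)
    then show ?thesis using tgroupD(4)[OF tgroup_Delta 1[of n]] by simp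
  qed
  show ?thesis
  proof (cases k)
    case (nonneg n) then show ?thesis using 1 by simp
  next
    case (neg n) then show ?thesis using 2[of "Suc n"] by simp
  qed
qed

lemma tau_pow: "(delta2 \<circ> delta1) ^^ k = (\<lambda>t. real k + t)"
proof (induction k)
  case (Suc k)
  show ?case unfolding funpow.simps(2) Suc by (auto simp: delta1_def delta2_def)
qed (auto simp: id_def)

lemma group_Delta: "group Delta_group"
  by (rule tgroup_group[OF tgroup_Delta])

lemma hom_Delta_comp:
  assumes "\<eta> \<in> hom Delta_group G" "f \<in> Delta" "g \<in> Delta"
  shows "\<eta> (f \<circ> g) = \<eta> f \<otimes>\<^bsub>G\<^esub> \<eta> g"
  using hom_mult[OF assms(1), of f g] assms(2,3) by (simp add: tgroup_mult[OF tgroup_Delta])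

lemma hom_Delta_id:
  assumes "\<eta> \<in> hom Delta_group G" "group G" shows "\<eta> id = \<one>\<^bsub>G\<^esub>"
  using hom_one[OF assms(1) group_Delta assms(2)] by (simp add: id_def)

lemma hom_Delta_eqI:
  assumes "\<eta>1 \<in> hom Delta_group G" "\<eta>2 \<in> hom Delta_group G" "group G"
    "\<eta>1 delta1 = \<eta>2 delta1" "\<eta>1 delta2 = \<eta>2 delta2" "\<delta> \<in> Delta"
  shows "\<eta>1 \<delta> = \<eta>2 \<delta>"
  using assms(6)
  by (induction rule: Delta_induct)
    (simp_all only: assms(4,5) hom_Delta_id[OF assms(1,3)] hom_Delta_id[OF assms(2,3)]
      hom_Delta_comp[OF assms(1)] hom_Delta_comp[OF assms(2)])

lemma lift_exists:
  assumes "\<eta> \<in> hom Delta_group (Aff M)" "\<delta> \<in> Delta"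
  obtains \<phi> where "\<phi> \<in> normalizing_affinities M" "star UNIV M \<phi> = \<eta> \<delta>"
proof -
  have "\<eta> \<delta> \<in> carrier (Aff M)" using assms by (auto simp: hom_def)
  then show thesis using that by (auto simp: carrier_Aff)
qed

text \<open>Some power K of \<phi> acts on M as an inner automorphism, so \<open>Omega\<close> after
  \<eta> is constant on the cosets of the translations by multiples of K, a subgroup of finite index
  in \<Delta>. This is what puts \<alpha>_# \<Xi> \<beta> into \<open>Hom_f M\<close>.\<close>

lemma (in crystal) finite_Omega_criterion:
  assumes \<eta>: "\<eta> \<in> hom Delta_group (Aff M)"
    and \<phi>: "\<phi> \<in> normalizing_affinities M" "\<eta> (delta2 \<circ> delta1) = star UNIV M \<phi>"
    and k: "k > 0" "\<phi> ^^ k = (+) v"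
  shows "finite (Omega M ` \<eta> ` Delta)"
proof -
  obtain K m where K: "K > 0" "m \<in> M" "\<And>\<mu>. \<mu> \<in> M \<Longrightarrow> conjm (\<phi> ^^ K) \<mu> = conjm m \<mu>"
    using power_acts_inner[OF \<phi>(1) k] by blast
  \<comment> \<open>U is the stabilizer of \<open>Omega\<close> after \<eta> under left
    multiplication. It is a group, so one translation in it brings all its integer powers.\<close>
  define U where "U = {\<delta> \<in> Delta. \<forall>\<delta>'\<in>Delta. Omega M (\<eta> (\<delta> \<circ> \<delta>')) = Omega M (\<eta> \<delta>')}"
  note Dc = tgroupD(3)[OF tgroup_Delta] and Di = tgroupD(4)[OF tgroup_Delta]
  have Ucomp: "f \<circ> g \<in> U" if "f \<in> U" "g \<in> U" for f g
    using that Dc unfolding U_def by (auto simp: comp_assoc simp del: comp_apply)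
  have Uinv: "finv f \<in> U" if f: "f \<in> U" for f
  proof -
    have fD: "f \<in> Delta" using f by (simp add: U_def)
    have "Omega M (\<eta> (finv f \<circ> \<delta>')) = Omega M (\<eta> \<delta>')" if "\<delta>' \<in> Delta" for \<delta>'
    proof -
      have "Omega M (\<eta> (f \<circ> (finv f \<circ> \<delta>'))) = Omega M (\<eta> (finv f \<circ> \<delta>'))"
        using f Dc[OF Di[OF fD] that] by (simp only: U_def mem_Collect_eq)
      then show ?thesis using tgroupD(1)[OF tgroup_Delta fD] by (simp add: comp_assoc[symmetric])
    qed
    then show ?thesis using Di[OF fD] by (simp add: U_def)
  qed
  have \<eta>pow: "\<eta> ((delta2 \<circ> delta1) ^^ j) = star UNIV M (\<phi> ^^ j)" for j
  proof (induction j)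
    case 0
    then show ?case using hom_Delta_id[OF \<eta> group_Aff] by (simp add: one_Aff id_def)
  next
    case (Suc j)
    have "(delta2 \<circ> delta1) ^^ j \<in> Delta" by (rule tgroup_pow[OF tgroup_Delta Dc[OF delta_in_Delta(2,1)]])
    then show ?case
      using hom_Delta_comp[OF \<eta> Dc[OF delta_in_Delta(2,1)]] Suc mult_Aff[OF \<phi>(1) normalizing_affinities_pow[OF \<phi>(1)]]
      by (simp only: funpow.simps \<phi>(2))
  qed
  have base: "(\<lambda>t. real K + t) \<in> U"
    unfolding U_def
  proof (intro CollectI conjI ballI)
    show *: "(\<lambda>t. real K + t) \<in> Delta" using translation_in_Delta[of "int K"] by simp
    fix \<delta>' assume \<delta>': "\<delta>' \<in> Delta"
    obtain \<psi> where \<psi>: "\<psi> \<in> normalizing_affinities M" "star UNIV M \<psi> = \<eta> \<delta>'" by (rule lift_exists[OF \<eta> \<delta>'])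
    note pw = normalizing_affinities_pow[OF \<phi>(1), of K]
    have "\<eta> ((\<lambda>t. real K + t) \<circ> \<delta>') = star UNIV M (\<phi> ^^ K \<circ> \<psi>)"
      using hom_Delta_comp[OF \<eta> * \<delta>'] \<eta>pow[of K, unfolded tau_pow] \<psi>(2) mult_Aff[OF pw \<psi>(1)]
      by simp
    moreover have "Omega_class (\<phi> ^^ K \<circ> \<psi>) = Omega_class \<psi>"
    proof (rule Omega_class_eqI[OF normalizing_affinities_comp[OF pw \<psi>(1)] \<psi>(1) K(2)])
      fix \<mu> assume "\<mu> \<in> M"
      then show "conjm (\<phi> ^^ K \<circ> \<psi>) \<mu> = conjm m (conjm \<psi> \<mu>)"
        using K(3)[OF normalizing_affinities_D(3)[OF \<psi>(1)]]
          conjm_conjm[OF normalizing_affinities_D(1)[OF pw] normalizing_affinities_D(1)[OF \<psi>(1)]] by metis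
    qed
    ultimately show "Omega M (\<eta> ((\<lambda>t. real K + t) \<circ> \<delta>')) = Omega M (\<eta> \<delta>')"
      using Omega_star[OF normalizing_affinities_comp[OF pw \<psi>(1)]] Omega_star[OF \<psi>(1)] \<psi>(2) by simp
  qed
  have U: "(\<lambda>t. real_of_int (int K * q) + t) \<in> U" for q :: int
  proof (induction q rule: int_induct[where k = 0])
    case base
    have "(\<lambda>t. real K + t) \<circ> finv (\<lambda>t. real K + t) \<in> U"
      by (intro Ucomp Uinv \<open>(\<lambda>t. real K + t) \<in> U\<close>)
    moreover have "(\<lambda>t. real K + t) \<circ> finv (\<lambda>t. real K + t) = (\<lambda>t. real_of_int (int K * 0) + t)"
      unfolding inv_plus by auto
    ultimately show ?case by simp
  next
    case (step1 i)
    have "(\<lambda>t. real_of_int (int K * (i + 1)) + t) = (\<lambda>t. real K + t) \<circ> (\<lambda>t. real_of_int (int K * i) + t)"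
      by (auto simp: algebra_simps)
    then show ?case using Ucomp[OF base step1(2)] by (simp only:)
  next
    case (step2 i)
    have "(\<lambda>t. real_of_int (int K * (i - 1)) + t) = finv (\<lambda>t. real K + t) \<circ> (\<lambda>t. real_of_int (int K * i) + t)"
      unfolding inv_plus by (auto simp: algebra_simps)
    then show ?case using Ucomp[OF Uinv[OF base] step2(2)] by (simp only:)
  qed
  \<comment> \<open>Representatives modulo the translations by multiples of K: K translations and K
    reflections, with r = l mod K.\<close>
  define S where "S = (\<lambda>r t. real_of_int r + t) ` {0..<int K} \<union> (\<lambda>r t. real_of_int r - t) ` {0..<int K}"
  have "Omega M (\<eta> \<delta>) \<in> Omega M ` \<eta> ` S" if \<delta>: "\<delta> \<in> Delta" for \<delta>
  proof -
    obtain l :: int where l: "\<delta> = (\<lambda>t. of_int l + t) \<or> \<delta> = (\<lambda>t. of_int l - t)"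
      using Delta_form[OF \<delta>] by blast
    define q r where "q = l div int K" and "r = l mod int K"
    have lr: "l = int K * q + r" "0 \<le> r" "r < int K" using K(1) by (simp_all add: q_def r_def)
    define u where "u = (\<lambda>t. real_of_int (int K * q) + t)"
    define s where "s = finv u \<circ> \<delta>"
    have uU: "u \<in> U" unfolding u_def by (rule U)
    have sS: "s \<in> S"
      using l
    proof
      assume "\<delta> = (\<lambda>t. of_int l + t)"
      then have "s = (\<lambda>t. real_of_int r + t)" unfolding s_def u_def inv_plus lr(1) by auto
      then show ?thesis using lr by (auto simp: S_def)
    next
      assume "\<delta> = (\<lambda>t. of_int l - t)"
      then have "s = (\<lambda>t. real_of_int r - t)" unfolding s_def u_def inv_plus lr(1) by auto
      then show ?thesis using lr by (auto simp: S_def)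
    qed
    have "Omega M (\<eta> s) = Omega M (\<eta> \<delta>)"
      using Uinv[OF uU] \<delta> by (simp add: s_def U_def)
    then show ?thesis using sS by (metis imageI)
  qed
  then have "Omega M ` \<eta> ` Delta \<subseteq> Omega M ` \<eta> ` S" by blast
  moreover have "finite S" by (simp add: S_def)
  ultimately show ?thesis by (meson finite_imageI finite_subset)
qed

section \<open>Abstract isomorphism of pairs of transformation groups\<close>

section \<open>Isomorphism of pairs\<close>

text \<open>No discreteness or isometry is built in, because the fibre products to be compared
  consist of affinities that need not be isometries.\<close>

definition group_pair_iso :: "('a \<Rightarrow> 'a) set \<Rightarrow> ('a \<Rightarrow> 'a) set \<Rightarrow> ('b \<Rightarrow> 'b) set \<Rightarrow> ('b \<Rightarrow> 'b) set \<Rightarrow> bool" where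
  "group_pair_iso G H G' H' \<longleftrightarrow>
     (\<exists>f. bij_betw f G G' \<and> (\<forall>g\<in>G. \<forall>h\<in>G. f (g \<circ> h) = f g \<circ> f h) \<and> f ` H = H')"

lemma iso_tgroup_iff:
  assumes "tgroup G" "tgroup G'"
  shows "f \<in> iso (trans_group UNIV G) (trans_group UNIV G') \<longleftrightarrow>
    bij_betw f G G' \<and> (\<forall>g\<in>G. \<forall>h\<in>G. f (g \<circ> h) = f g \<circ> f h)"
proof -
  have "f \<in> hom (trans_group UNIV G) (trans_group UNIV G') \<longleftrightarrow>
    f \<in> G \<rightarrow> G' \<and> (\<forall>g\<in>G. \<forall>h\<in>G. f (g \<circ> h) = f g \<circ> f h)"
    unfolding hom_def by (auto simp: tgroup_mult[OF assms(1)] tgroup_mult[OF assms(2)] Pi_iff simp del: comp_apply)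
  then show ?thesis unfolding iso_def by (auto simp: bij_betw_def simp del: comp_apply)
qed

lemma group_pair_iso_iff:
  assumes "tgroup G" "tgroup G'"
  shows "group_pair_iso G H G' H' \<longleftrightarrow> (\<exists>f\<in>iso (trans_group UNIV G) (trans_group UNIV G'). f ` H = H')"
  unfolding group_pair_iso_def Bex_def iso_tgroup_iff[OF assms] by blast

lemma group_pair_iso_trans:
  assumes "group_pair_iso G H G' H'" "group_pair_iso G' H' G'' H''"
  shows "group_pair_iso G H G'' H''"
proof -
  obtain f where f: "bij_betw f G G'" "\<forall>g\<in>G. \<forall>h\<in>G. f (g \<circ> h) = f g \<circ> f h" "f ` H = H'"
    using assms(1) unfolding group_pair_iso_def by blast
  obtain f' where f': "bij_betw f' G' G''" "\<forall>g\<in>G'. \<forall>h\<in>G'. f' (g \<circ> h) = f' g \<circ> f' h" "f' ` H' = H''"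
    using assms(2) unfolding group_pair_iso_def by blast
  have m: "f g \<in> G'" if "g \<in> G" for g using f(1) that by (auto simp: bij_betw_def)
  show ?thesis
    unfolding group_pair_iso_def
  proof (intro exI[of _ "\<lambda>g. f' (f g)"] conjI ballI)
    show "bij_betw (\<lambda>g. f' (f g)) G G''" using bij_betw_trans[OF f(1) f'(1)] by (simp add: comp_def)
    show "(\<lambda>g. f' (f g)) ` H = H''" using f(3) f'(3) by (metis image_image)
    fix g h assume "g \<in> G" "h \<in> G"
    then show "f' (f (g \<circ> h)) = f' (f g) \<circ> f' (f h)" using f(2) f'(2) m by metis
  qed
qed

lemma group_pair_iso_sym:
  assumes "tgroup G" "H \<subseteq> G" "group_pair_iso G H G' H'"
  shows "group_pair_iso G' H' G H"
proof -
  obtain f where f: "bij_betw f G G'" "\<forall>g\<in>G. \<forall>h\<in>G. f (g \<circ> h) = f g \<circ> f h" "f ` H = H'"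
    using assms(3) unfolding group_pair_iso_def by blast
  let ?f = "inv_into G f"
  have f1: "?f (f g) = g" if "g \<in> G" for g using f(1) that by (simp add: bij_betw_def)
  have f2: "f (?f g) = g" "?f g \<in> G" if "g \<in> G'" for g
    using f(1) that by (auto simp: bij_betw_def f_inv_into_f inv_into_into)
  show ?thesis
    unfolding group_pair_iso_def
  proof (intro exI[of _ ?f] conjI ballI)
    show "bij_betw ?f G' G" using f(1) by (rule bij_betw_inv_into)
    show "?f ` H' = H" unfolding f(3)[symmetric] image_image using f1 assms(2) by (simp add: subset_iff)
    fix g h assume gh: "g \<in> G'" "h \<in> G'"
    have "g \<circ> h = f (?f g \<circ> ?f h)" using f(2) f2 gh by simp
    then show "?f (g \<circ> h) = ?f g \<circ> ?f h"
      using f1[OF tgroupD(3)[OF assms(1) f2(2)[OF gh(1)] f2(2)[OF gh(2)]]] by simp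
  qed
qed

text \<open>Both geometric isomorphisms of fibre products, by C \<times> id and by the shear, are
  conjugations of this kind.\<close>

lemma group_pair_iso_conjm:
  assumes "bij \<phi>" shows "group_pair_iso G H (conjm \<phi> ` G) (conjm \<phi> ` H)"
  unfolding group_pair_iso_def
proof (intro exI[of _ "conjm \<phi>"] conjI ballI)
  show "bij_betw (conjm \<phi>) G (conjm \<phi> ` G)"
    using inj_conjm[OF assms] by (simp add: bij_betw_def inj_on_def)
qed (simp_all only: conjm_comp[OF assms])

section \<open>The fibre product of the normalizer of M and of \<Delta> over
  \<open>Aff M\<close>\<close>

section \<open>The group of compatible pairs\<close>

text \<open>The pair constructed from \<open>\<eta>\<close> by means of \<open>C\<close> is the conjugate by \<open>C \<times> id\<close> of the fibre product
  below, which needs no choice.\<close>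

definition lifted :: "('a::euclidean_space \<Rightarrow> 'a) set \<Rightarrow> ((real \<Rightarrow> real) \<Rightarrow> 'a set \<Rightarrow> 'a set) \<Rightarrow> 'a transf set" where
  "lifted M \<eta> = {map_prod \<phi> \<delta> | \<phi> \<delta>. \<phi> \<in> normalizing_affinities M \<and> \<delta> \<in> Delta \<and> star UNIV M \<phi> = \<eta> \<delta>}"

definition extended :: "('a \<Rightarrow> 'a) set \<Rightarrow> 'a transf set" where
  "extended M = (\<lambda>\<mu>. map_prod \<mu> id) ` M"

lemma map_prod_eq_iff: "map_prod f g = map_prod f' g' \<longleftrightarrow> f = f' \<and> g = g'"
  by (auto simp: fun_eq_iff)

lemma parts_map_prod [simp]: "fst_part (map_prod f g) = f" "snd_part (map_prod f g) = g"
  by (auto simp: fst_part_def snd_part_def)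

lemma bij_map_prod: "bij f \<Longrightarrow> bij g \<Longrightarrow> bij (map_prod f g)"
  by (rule o_bij[where g = "map_prod (finv f) (finv g)"]) (simp_all add: map_prod_compose[symmetric] map_prod.id)

lemma inv_map_prod: "bij f \<Longrightarrow> bij g \<Longrightarrow> finv (map_prod f g) = map_prod (finv f) (finv g)"
  by (rule inv_unique_comp) (simp_all add: map_prod_compose[symmetric] map_prod.id)

lemma map_prod_comp: "map_prod f g \<circ> map_prod f' g' = map_prod (f \<circ> f') (g \<circ> g')"
  by (simp add: map_prod_compose)

lemma conjm_map_prod:
  "bij \<phi> \<Longrightarrow> bij \<psi> \<Longrightarrow> conjm (map_prod \<phi> \<psi>) (map_prod f g) = map_prod (conjm \<phi> f) (conjm \<psi> g)"
  by (simp only: inv_map_prod map_prod_comp)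

lemma extended_comp: "map_prod \<mu> id \<circ> map_prod \<nu> id = map_prod (\<mu> \<circ> \<nu>) id"
  by (simp only: map_prod_comp id_comp)

context crystal
begin

lemma liftedI: "\<phi> \<in> normalizing_affinities M \<Longrightarrow> \<delta> \<in> Delta \<Longrightarrow> star UNIV M \<phi> = \<eta> \<delta> \<Longrightarrow> map_prod \<phi> \<delta> \<in> lifted M \<eta>"
  unfolding lifted_def by blast

lemma star_M: "\<mu> \<in> M \<Longrightarrow> star UNIV M \<mu> = star UNIV M id"
  using star_eq_iff[OF D(4) id_normalizing] by (metis comp_id)

context
  fixes \<eta>
  assumes \<eta>: "\<eta> \<in> hom Delta_group (Aff M)"
begin

lemma \<eta>_id: "\<eta> id = star UNIV M id"
  using hom_Delta_id[OF \<eta> group_Aff] by (simp add: one_Aff)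

lemma tgroup_lifted: "tgroup (lifted M \<eta>)"
  unfolding tgroup_def
proof (intro conjI ballI)
  fix g assume "g \<in> lifted M \<eta>"
  then obtain \<phi> \<delta> where *: "g = map_prod \<phi> \<delta>" "\<phi> \<in> normalizing_affinities M" "\<delta> \<in> Delta" "star UNIV M \<phi> = \<eta> \<delta>"
    by (auto simp: lifted_def)
  note b = normalizing_affinities_D(1)[OF *(2)] tgroupD(1)[OF tgroup_Delta *(3)]
  show "bij g" unfolding *(1) by (rule bij_map_prod[OF b])
  have i: "finv \<delta> \<in> Delta" by (rule tgroupD(4)[OF tgroup_Delta *(3)])
  have "star UNIV M (finv \<phi>) = \<eta> (finv \<delta>)"
  proof -
    have "\<eta> (finv \<delta>) \<otimes>\<^bsub>Aff M\<^esub> \<eta> \<delta> = \<one>\<^bsub>Aff M\<^esub>"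
      using hom_Delta_comp[OF \<eta> i *(3)] b(2) by (simp add: \<eta>_id one_Aff)
    moreover have "\<eta> \<delta> \<in> carrier (Aff M)" "\<eta> (finv \<delta>) \<in> carrier (Aff M)" using \<eta> *(3) i by (auto simp: hom_def)
    ultimately have "inv\<^bsub>Aff M\<^esub> (\<eta> \<delta>) = \<eta> (finv \<delta>)" by (intro group.inv_equality[OF group_Aff]) auto
    then show ?thesis using inv_Aff[OF *(2)] *(4) by simp
  qed
  then show "finv g \<in> lifted M \<eta>"
    unfolding *(1) inv_map_prod[OF b] by (intro liftedI normalizing_affinities_inv[OF *(2)] i)
next
  show "id \<in> lifted M \<eta>"
    unfolding map_prod.id[symmetric] by (intro liftedI id_normalizing tgroupD(2)[OF tgroup_Delta]) (simp add: \<eta>_id)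
next
  fix f g assume "f \<in> lifted M \<eta>" "g \<in> lifted M \<eta>"
  then obtain \<phi> \<delta> \<phi>' \<delta>' where *: "f = map_prod \<phi> \<delta>" "\<phi> \<in> normalizing_affinities M" "\<delta> \<in> Delta" "star UNIV M \<phi> = \<eta> \<delta>"
    "g = map_prod \<phi>' \<delta>'" "\<phi>' \<in> normalizing_affinities M" "\<delta>' \<in> Delta" "star UNIV M \<phi>' = \<eta> \<delta>'"
    by (auto simp: lifted_def)
  show "f \<circ> g \<in> lifted M \<eta>"
    unfolding *(1,5) map_prod_comp
    by (intro liftedI normalizing_affinities_comp tgroupD(3)[OF tgroup_Delta] *)
      (simp only: hom_Delta_comp[OF \<eta> *(3,7)] *(4,8)[symmetric] mult_Aff[OF *(2,6)])
qed

lemma extended_subset: "extended M \<subseteq> lifted M \<eta>"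
  unfolding extended_def
  using star_M D(4) tgroupD(2)[OF tgroup_Delta] by (auto intro!: liftedI simp: \<eta>_id)

text \<open>Over the identity of \<Delta> the first factor is a lift of the identity of the
  orbifold, that is, an element of M by \<open>star_eq_iff\<close>.\<close>

lemma extended_kernel: "extended M = {g \<in> lifted M \<eta>. snd_part g = id}"
proof
  show "extended M \<subseteq> {g \<in> lifted M \<eta>. snd_part g = id}" using extended_subset by (auto simp: extended_def)
  show "{g \<in> lifted M \<eta>. snd_part g = id} \<subseteq> extended M"
  proof
    fix g assume "g \<in> {g \<in> lifted M \<eta>. snd_part g = id}"
    then obtain \<phi> where *: "g = map_prod \<phi> id" "\<phi> \<in> normalizing_affinities M" "star UNIV M \<phi> = \<eta> id"
      by (auto simp: lifted_def)
    then have "\<phi> \<in> M" using star_eq_iff[OF *(2) id_normalizing] by (auto simp: \<eta>_id)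
    then show "g \<in> extended M" unfolding *(1) extended_def by blast
  qed
qed

lemma normal_extended: "extended M \<lhd> trans_group UNIV (lifted M \<eta>)"
  unfolding normal_tgroup[OF tgroup_lifted]
proof (intro conjI ballI)
  show "extended M \<subseteq> lifted M \<eta>" by (rule extended_subset)
  show "tgroup (extended M)"
    unfolding tgroup_def extended_def
  proof (safe)
    fix \<mu> \<nu> assume \<mu>: "\<mu> \<in> M" and \<nu>: "\<nu> \<in> M"
    show "bij (map_prod \<mu> (id :: real \<Rightarrow> real))" by (rule bij_map_prod[OF D(1)[OF \<mu>] bij_id])
    show "map_prod \<mu> id \<circ> map_prod \<nu> (id :: real \<Rightarrow> real) \<in> (\<lambda>\<mu>. map_prod \<mu> id) ` M"
      unfolding extended_comp by (rule imageI[OF M(2)[OF \<mu> \<nu>]])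
    show "finv (map_prod \<mu> (id :: real \<Rightarrow> real)) \<in> (\<lambda>\<mu>. map_prod \<mu> id) ` M"
      unfolding inv_map_prod[OF D(1)[OF \<mu>] bij_id] inv_id by (rule imageI[OF M(3)[OF \<mu>]])
  next
    show "id \<in> (\<lambda>\<mu>. map_prod \<mu> id) ` M" using M(1) map_prod.id by (metis imageI)
  qed
  fix g n assume "g \<in> lifted M \<eta>" "n \<in> extended M"
  then obtain \<phi> \<delta> \<mu> where *: "g = map_prod \<phi> \<delta>" "\<phi> \<in> normalizing_affinities M" "\<delta> \<in> Delta" "n = map_prod \<mu> id" "\<mu> \<in> M"
    by (auto simp: lifted_def extended_def)
  note b = normalizing_affinities_D(1)[OF *(2)] tgroupD(1)[OF tgroup_Delta *(3)]
  have "conjm g n = map_prod (conjm \<phi> \<mu>) id"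
    unfolding *(1,4) conjm_map_prod[OF b] by (simp add: b)
  then show "conjm g n \<in> extended M"
    using normalizing_affinities_D(3)[OF *(2,5)] by (auto simp: extended_def)
qed

end

end

section \<open>Space groups from local finiteness, and the realization of a homomorphism by
  isometries\<close>

section \<open>Existence of the construction\<close>

text \<open>Evaluation at 0 leaves finitely many competitors near g, and each of them is excluded at
  one point where it differs from g; both are open conditions for pointwise convergence.\<close>

lemma locally_finite_imp_discrete:
  fixes G :: "('a::euclidean_space \<Rightarrow> 'a) set"
  assumes fin: "\<And>R. finite {g \<in> G. norm (g 0) \<le> R}"
  shows "discrete G"
proof (rule discreteI)
  fix g assume g: "g \<in> G"
  define F where "F = {h \<in> G. norm (h 0) \<le> norm (g 0) + 1} - {g}"
  have "finite F" unfolding F_def using fin by blast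
  have "\<exists>x. h x \<noteq> g x" if "h \<in> F" for h using that by (auto simp: F_def fun_eq_iff)
  then obtain x where x: "\<And>h. h \<in> F \<Longrightarrow> h (x h) \<noteq> g (x h)" by metis
  define U where "U = {f. norm (f 0) < norm (g 0) + 1} \<inter> (\<Inter>h\<in>F. {f. f (x h) \<noteq> h (x h)})"
  have "open {f :: 'a \<Rightarrow> 'a. norm (f 0) < norm (g 0) + 1}"
    by (intro open_Collect_less continuous_intros continuous_on_product_coordinates)
  moreover have "open {f :: 'a \<Rightarrow> 'a. f (x h) \<noteq> h (x h)}" for h
    by (intro open_Collect_neq continuous_intros continuous_on_product_coordinates)
  ultimately have "open U" unfolding U_def using \<open>finite F\<close> by (intro open_Int open_INT) auto
  moreover have "U \<inter> G = {g}"
  proof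
    show "{g} \<subseteq> U \<inter> G" using g x by (auto simp: U_def) metis
    show "U \<inter> G \<subseteq> {g}" by (force simp: U_def F_def)
  qed
  ultimately show "g isolated_in G" by (rule isolated_inI[OF g])
qed

text \<open>A compact set that meets every orbit is mapped onto the orbit space by the quotient
  map.\<close>

lemma space_groupI:
  assumes "tgroup G" "G \<subseteq> isometries" "\<And>R. finite {g \<in> G. norm (g 0) \<le> R}"
    and K: "compact K" "\<And>x. \<exists>g\<in>G. g x \<in> K"
  shows "space_group G"
proof -
  have "orbit_space UNIV G \<subseteq> orbit G ` K"
  proof
    fix X assume "X \<in> orbit_space UNIV G"
    then obtain x where X: "X = orbit G x" by (auto elim: orbit_space_E)
    obtain g where "g \<in> G" "g x \<in> K" using K(2) by blast
    then show "X \<in> orbit G ` K" using orbit_absorb[OF assms(1)] X by blast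
  qed
  then have "orbit G ` K = topspace (orbit_topology G)"
    unfolding topspace_orbit_topology by (auto simp: orbit_space_def)
  moreover have "compactin (orbit_topology G) (orbit G ` K)"
    using K(1) by (intro image_compactin[OF _ quotient_imp_continuous_map[OF quotient_map_orbit]]) simp
  ultimately have "compact_space (orbit_topology G)" by (simp add: compact_space_def)
  then show ?thesis
    unfolding space_group_def subgroup_BijGroup_UNIV
    using assms(1,2) locally_finite_imp_discrete[OF assms(3)] by blast
qed

lemma space_group_D:
  assumes "space_group G"
  shows "tgroup G" "G \<subseteq> isometries" "discrete G"
  using assms by (auto simp: space_group_def subgroup_BijGroup_UNIV)

lemma crystal_of_space_group:
  assumes "space_group M" "span (transl M) = UNIV" shows "crystal M"
  using space_group_D[OF assms(1)] assms(2) discrete_imp_finite_in_balls by unfold_locales auto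

context crystal
begin

lemma locally_finite: "finite {\<mu> \<in> M. norm (\<mu> 0) \<le> R}"
proof -
  have "finite {\<mu> \<in> M. lin \<mu> = p \<and> norm (\<mu> 0) \<le> R}" for p
  proof (cases "\<exists>\<nu>\<in>M. lin \<nu> = p")
    case True
    then obtain \<nu> where \<nu>: "\<nu> \<in> M" "lin \<nu> = p" by blast
    have "{\<mu> \<in> M. lin \<mu> = p \<and> norm (\<mu> 0) \<le> R} \<subseteq> (\<lambda>t. (+) t \<circ> \<nu>) ` {t \<in> transl M. norm t \<le> R + norm (\<nu> 0)}"
    proof
      fix \<mu> assume \<mu>: "\<mu> \<in> {\<mu> \<in> M. lin \<mu> = p \<and> norm (\<mu> 0) \<le> R}"
      then obtain t where t: "t \<in> transl M" "\<mu> = (+) t \<circ> \<nu>" using same_lin[of \<mu> \<nu>] \<nu> by auto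
      then have "t = \<mu> 0 - \<nu> 0" by simp
      then have "norm t \<le> R + norm (\<nu> 0)" using \<mu> norm_triangle_ineq4[of "\<mu> 0" "\<nu> 0"] by auto
      then show "\<mu> \<in> (\<lambda>t. (+) t \<circ> \<nu>) ` {t \<in> transl M. norm t \<le> R + norm (\<nu> 0)}" using t by blast
    qed
    then show ?thesis
      using finite_in_balls unfolding finite_in_balls_def by (meson finite_imageI finite_subset)
  next
    case False
    then have "{\<mu> \<in> M. lin \<mu> = p \<and> norm (\<mu> 0) \<le> R} = {}" by blast
    then show ?thesis by (simp only: finite.emptyI)
  qed
  then have "finite (\<Union>p\<in>lin ` M. {\<mu> \<in> M. lin \<mu> = p \<and> norm (\<mu> 0) \<le> R})"
    using finite_point_group by blast
  then show ?thesis by (rule finite_subset[rotated]) blast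
qed

lemma cocompact: "\<exists>R. \<forall>x. \<exists>\<mu>\<in>M. norm (\<mu> x) \<le> R"
proof -
  obtain R where R: "\<And>x. \<exists>t\<in>transl M. norm (x - t) \<le> R"
    using additive_subgroup_reduce[OF transl_subgroup] span_transl by auto
  have "\<exists>\<mu>\<in>M. norm (\<mu> x) \<le> R" for x
  proof -
    obtain t where t: "t \<in> transl M" "norm (x - t) \<le> R" using R by blast
    then have "- t \<in> transl M" using transl_subgroup by (simp add: additive_subgroup_def)
    then show ?thesis using t(2) by (intro bexI[of _ "(+) (- t)"]) (simp_all add: transl_def)
  qed
  then show ?thesis by blast
qed

lemma space_group: "space_group M"
proof -
  obtain R where "\<And>x. \<exists>\<mu>\<in>M. norm (\<mu> x) \<le> R" using cocompact by blast
  then show ?thesis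
    by (intro space_groupI[OF tgroup isometries locally_finite, of "cball 0 R"]) auto
qed

lemma transl_conjm:
  assumes "bij C" "linear C" shows "transl (conjm C ` M) = C ` transl M"
proof -
  have l: "linear (lin C)" using assms(2) by (simp add: lin_linear)
  have c: "conjm C ((+) t) = (+) (C t)" for t using conjm_plus[OF l assms(1)] lin_linear[OF assms(2)] by simp
  have "a \<in> C ` transl M" if a: "(+) a \<in> conjm C ` M" for a
  proof -
    obtain \<mu> where \<mu>: "\<mu> \<in> M" "(+) a = conjm C \<mu>" using a by blast
    have "conjm C ((+) (finv C a)) = conjm C \<mu>" unfolding c using \<mu>(2) assms(1) by simp
    then have "(+) (finv C a) = \<mu>" using inj_conjm[OF assms(1)] by blast
    then show ?thesis using \<mu>(1) assms(1) by (intro image_eqI[of _ _ "finv C a"]) (auto simp: transl_def)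
  qed
  moreover have "(+) (C t) \<in> conjm C ` M" if "(+) t \<in> M" for t unfolding c[symmetric] using that by blast
  ultimately show ?thesis by (auto simp: transl_def)
qed

text \<open>A linear change of coordinates carries the lattice along; whether the conjugate still
  consists of isometries depends on C and is therefore a premise.\<close>

lemma crystal_conjm:
  assumes C: "bij C" "linear C" and iso: "conjm C ` M \<subseteq> isometries"
  shows "crystal (conjm C ` M)"
proof
  show "tgroup (conjm C ` M)" by (rule tgroup_conjm[OF tgroup C(1)])
  show "conjm C ` M \<subseteq> isometries" by (rule iso)
  show "span (transl (conjm C ` M)) = UNIV"
    unfolding transl_conjm[OF C] span_linear_image[OF C(2)] span_transl using C(1) by (simp add: bij_def)
  show "finite_in_balls (transl (conjm C ` M))"
    unfolding finite_in_balls_def transl_conjm[OF C]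
  proof
    fix R
    \<comment> \<open>The inverse of C is bounded, so a ball contains only images of lattice vectors
      that lie in some other ball.\<close>
    have "bounded_linear (finv C)" using linear_inv_bij[OF C(2,1)] linear_conv_bounded_linear by blast
    then obtain B where B: "\<And>x. norm (finv C x) \<le> norm x * B" using bounded_linear.bounded by blast
    have "{t \<in> C ` transl M. norm t \<le> R} \<subseteq> C ` {t \<in> transl M. norm t \<le> R * \<bar>B\<bar>}"
    proof
      fix s assume "s \<in> {t \<in> C ` transl M. norm t \<le> R}"
      then obtain t where t: "t \<in> transl M" "s = C t" "norm s \<le> R" by blast
      have "norm t \<le> norm s * B" using B[of s] t(2) C(1) by simp
      also have "\<dots> \<le> norm s * \<bar>B\<bar>" by (simp add: mult_left_mono)
      also have "\<dots> \<le> R * \<bar>B\<bar>" using t(3) by (simp add: mult_right_mono)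
      finally show "s \<in> C ` {t \<in> transl M. norm t \<le> R * \<bar>B\<bar>}" using t by blast
    qed
    then show "finite {t \<in> C ` transl M. norm t \<le> R}"
      using finite_in_balls unfolding finite_in_balls_def by (meson finite_imageI finite_subset)
  qed
qed

end

lemma normalizing_conjm:
  assumes "\<phi> \<in> normalizing_affinities M" "bij C" "linear (lin C)"
  shows "conjm C \<phi> \<in> normalizing_affinities (conjm C ` M)"
  unfolding normalizing_affinities_iff
proof (intro conjI)
  note d = normalizing_affinities_D(1,2)[OF assms(1)]
  show "bij (conjm C \<phi>)" by (rule bij_conjm[OF assms(2) d(1)])
  show "linear (lin (conjm C \<phi>))" by (rule linear_lin_conjm(2)[OF assms(3,2) d(2)])
  have "conjm (conjm C \<phi>) (conjm C \<mu>) = conjm C (conjm \<phi> \<mu>)" for \<mu>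
    using assms(2) d(1) by (simp add: fun_eq_iff conjm_inv[symmetric])
  then have "conjm (conjm C \<phi>) ` conjm C ` M = conjm C ` conjm \<phi> ` M"
    unfolding image_image by (rule image_cong[OF refl])
  then show "conjm (conjm C \<phi>) ` conjm C ` M = conjm C ` M"
    using assms(1) by (simp only: normalizing_affinities_iff)
qed

lemma sharp_UNIV_star:
  assumes "bij C" "\<phi> \<in> normalizing_affinities M"
  shows "sharp UNIV M UNIV (conjm C ` M) C (star UNIV M \<phi>) = star UNIV (conjm C ` M) (conjm C \<phi>)"
proof -
  have "sharp UNIV M UNIV (conjm C ` M) C (star UNIV M \<phi>) = star UNIV (conjm C ` M) (conj_map UNIV UNIV C \<phi>)"
  proof (rule sharp_star)
    fix X assume "X \<in> orbit_space UNIV M"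
    then show "\<phi> ` X \<in> orbit_space UNIV M"
      using normalizing_affinities_image_orbit[OF assms(2)] by (auto elim!: orbit_space_E simp: orbit_in_orbit_space)
  qed (use assms(1) in auto)
  then show ?thesis by simp
qed

text \<open>Once C is chosen, the construction leaves no freedom: the first factor over d lifts C_#
  \<eta>(d), two lifts differ by an element of M' = C M C^-1, and the extension of M' is contained
  in \<Gamma>.\<close>

lemma constructed_from_conj:
  fixes M :: "('a::euclidean_space \<Rightarrow> 'a) set"
  assumes M: "crystal M" and \<eta>: "\<eta> \<in> hom Delta_group (Aff M)" and c: "constructed_from M \<eta> C \<Gamma> N"
  shows "bij (map_prod C (id :: real \<Rightarrow> real))"
    "\<Gamma> = conjm (map_prod C id) ` lifted M \<eta>" "N = conjm (map_prod C id) ` extended M"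
proof -
  interpret crystal M by (rule M)
  define M' where "M' = conjm C ` M"
  have C: "linear C" "bij C" and sM': "space_group M'" and N: "N = (\<lambda>\<mu>. map_prod \<mu> id) ` M'"
    and s\<Gamma>: "space_group \<Gamma>" and nN: "N \<lhd> trans_group UNIV \<Gamma>"
    and diag: "\<And>\<gamma>. \<gamma> \<in> \<Gamma> \<Longrightarrow> \<gamma> = map_prod (fst_part \<gamma>) (snd_part \<gamma>)"
    and sn: "snd_part ` \<Gamma> = Delta"
    and st: "\<And>\<gamma>. \<gamma> \<in> \<Gamma> \<Longrightarrow> star UNIV M' (fst_part \<gamma>) = sharp UNIV M UNIV M' C (\<eta> (snd_part \<gamma>))"
    using c unfolding constructed_from_def Let_def M'_def conj_map_UNIV[abs_def] by auto
  have lC: "linear (lin C)" using C(1) by (simp add: lin_linear)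
  interpret M': crystal M'
    unfolding M'_def by (rule crystal_conjm[OF C(2,1)]) (use space_group_D(2)[OF sM'] in \<open>simp only: M'_def\<close>)
  note t\<Gamma> = space_group_D(1)[OF s\<Gamma>]
  have NG: "N \<subseteq> \<Gamma>" "\<And>g n. g \<in> \<Gamma> \<Longrightarrow> n \<in> N \<Longrightarrow> conjm g n \<in> N" using nN unfolding normal_tgroup[OF t\<Gamma>] by blast+
  have bC: "bij (map_prod C (id :: real \<Rightarrow> real))" by (rule bij_map_prod[OF C(2) bij_id])
  then show "bij (map_prod C (id :: real \<Rightarrow> real))" .
  have cj: "conjm (map_prod C id) (map_prod \<phi> \<delta>) = map_prod (conjm C \<phi>) (\<delta> :: real \<Rightarrow> real)" for \<phi> \<delta>
    unfolding conjm_map_prod[OF C(2) bij_id] by simp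
  show "N = conjm (map_prod C id) ` extended M"
    unfolding N M'_def extended_def image_image cj ..
  \<comment> \<open>\<open>star_eq_iff\<close> for M' asks for normalizing affinities: the first
    factor is an isometry because \<Gamma> is diagonal and isometric, and it normalizes M' because
    \<Gamma> normalizes N.\<close>
  have f: "f \<in> normalizing_affinities M' \<and> d \<in> Delta" if g: "map_prod f d \<in> \<Gamma>" for f d
  proof -
    have d: "d \<in> Delta" using sn g by (metis imageI parts_map_prod(2))
    have db: "bij d" by (rule tgroupD(1)[OF tgroup_Delta d])
    have bfd: "bij (map_prod f d)" by (rule tgroupD(1)[OF t\<Gamma> g])
    have bf: "bij f"
    proof (rule bijI)
      show "inj f"
      proof (rule injI)
        fix x y assume "f x = f y"
        then have "map_prod f d (x, 0) = map_prod f d (y, 0)" by simp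
        from injD[OF bij_is_inj[OF bfd] this] show "x = y" by simp
      qed
      show "surj f"
      proof (rule surjI)
        fix y
        show "f (fst (finv (map_prod f d) (y, 0))) = y"
          using inv_app_bij(2)[OF bfd, of "(y, 0)"] by (metis fst_conv fst_map_prod)
      qed
    qed
    have "dist (f x) (f y) = dist x y" for x y
    proof -
      have "dist (map_prod f d (x, 0)) (map_prod f d (y, 0)) = dist (x, 0::real) (y, 0)"
        using space_group_D(2)[OF s\<Gamma>] g by (auto simp: isometries_def)
      then show ?thesis by (simp add: dist_Pair_Pair)
    qed
    then have "f \<in> isometries" using bf by (simp add: isometries_def Bij_UNIV)
    then have lf: "linear (lin f)" by (rule isometry_lin(2))
    \<comment> \<open>Stated for all f and d, to be applied to the inverse as well.\<close>
    have 1: "conjm f \<mu> \<in> M'" if "\<mu> \<in> M'" and "map_prod f d \<in> \<Gamma>" "bij f" "bij d" for f d \<mu>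
    proof -
      have "conjm (map_prod f d) (map_prod \<mu> id) \<in> N" using NG(2)[OF that(2)] that(1) N by blast
      then have "map_prod (conjm f \<mu>) (id :: real \<Rightarrow> real) \<in> N"
        unfolding conjm_map_prod[OF that(3,4)] using that(4) by simp
      then show ?thesis unfolding N by (auto simp: map_prod_eq_iff)
    qed
    have gi: "map_prod (finv f) (finv d) \<in> \<Gamma>"
      using tgroupD(4)[OF t\<Gamma> g] inv_map_prod[OF bf db] by simp
    have "conjm f ` M' = M'"
    proof
      show "conjm f ` M' \<subseteq> M'" using 1[OF _ g bf db] by blast
      show "M' \<subseteq> conjm f ` M'"
      proof
        fix \<mu> assume "\<mu> \<in> M'"
        then have "conjm (finv f) \<mu> \<in> M'"
          by (rule 1[OF _ gi bij_imp_bij_inv[OF bf] bij_imp_bij_inv[OF db]])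
        moreover have "\<mu> = conjm f (conjm (finv f) \<mu>)"
          unfolding conjm_conjm[OF bf bij_imp_bij_inv[OF bf]] inv_comp_bij(2)[OF bf]
          by (rule conjm_id(1)[symmetric])
        ultimately show "\<mu> \<in> conjm f ` M'" by (metis imageI)
      qed
    qed
    then show ?thesis using bf lf d by (simp add: normalizing_affinities_iff)
  qed
  have key: "\<exists>\<mu>\<in>M. f = conjm C (\<mu> \<circ> \<phi>)"
    if g: "map_prod f d \<in> \<Gamma>" and \<phi>: "\<phi> \<in> normalizing_affinities M" "star UNIV M \<phi> = \<eta> d" for f d \<phi>
  proof -
    have "star UNIV M' f = star UNIV M' (conjm C \<phi>)"
      using st[OF g] sharp_UNIV_star[OF C(2) \<phi>(1)] \<phi>(2) by (simp add: M'_def)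
    then obtain \<mu>' where "\<mu>' \<in> M'" "f = \<mu>' \<circ> conjm C \<phi>"
      using M'.star_eq_iff[of f "conjm C \<phi>"] f[OF g] normalizing_conjm[OF \<phi>(1) C(2) lC] unfolding M'_def by blast
    then show ?thesis using conjm_comp[OF C(2)] unfolding M'_def by auto
  qed
  show "\<Gamma> = conjm (map_prod C id) ` lifted M \<eta>"
  proof
    show "\<Gamma> \<subseteq> conjm (map_prod C id) ` lifted M \<eta>"
    proof
      fix \<gamma> assume \<gamma>: "\<gamma> \<in> \<Gamma>"
      define f d where "f = fst_part \<gamma>" and "d = snd_part \<gamma>"
      have g: "\<gamma> = map_prod f d" using diag[OF \<gamma>] by (simp add: f_def d_def)
      have d: "d \<in> Delta" using f \<gamma> g by blast
      obtain \<phi> where \<phi>: "\<phi> \<in> normalizing_affinities M" "star UNIV M \<phi> = \<eta> d" by (rule lift_exists[OF \<eta> d])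
      obtain \<mu> where \<mu>: "\<mu> \<in> M" "f = conjm C (\<mu> \<circ> \<phi>)" using key[OF _ \<phi>] \<gamma> g by blast
      have nm: "\<mu> \<circ> \<phi> \<in> normalizing_affinities M" by (rule normalizing_affinities_comp[OF D(4)[OF \<mu>(1)] \<phi>(1)])
      have "map_prod (\<mu> \<circ> \<phi>) d \<in> lifted M \<eta>"
      proof (rule liftedI[OF nm d])
        have "star UNIV M (\<mu> \<circ> \<phi>) = star UNIV M \<phi>" using star_eq_iff[OF nm \<phi>(1)] \<mu>(1) by blast
        then show "star UNIV M (\<mu> \<circ> \<phi>) = \<eta> d" using \<phi>(2) by (rule trans)
      qed
      then show "\<gamma> \<in> conjm (map_prod C id) ` lifted M \<eta>"
        unfolding g \<mu>(2) cj[symmetric] by (rule imageI)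
    qed
    show "conjm (map_prod C id) ` lifted M \<eta> \<subseteq> \<Gamma>"
    proof (rule image_subsetI)
      fix g assume "g \<in> lifted M \<eta>"
      then obtain \<phi> d where g: "g = map_prod \<phi> d" and \<phi>: "\<phi> \<in> normalizing_affinities M" "star UNIV M \<phi> = \<eta> d" and d: "d \<in> Delta"
        by (auto simp: lifted_def)
      have "d \<in> snd_part ` \<Gamma>" using d by (simp only: sn)
      then obtain \<gamma> where \<gamma>: "snd_part \<gamma> = d" "\<gamma> \<in> \<Gamma>" by (rule imageE) simp
      define f where "f = fst_part \<gamma>"
      have \<gamma>': "\<gamma> = map_prod f d" using diag[OF \<gamma>(2)] \<gamma>(1) by (simp add: f_def)
      obtain \<mu> where \<mu>: "\<mu> \<in> M" "f = conjm C (\<mu> \<circ> \<phi>)" using key[OF \<gamma>(2)[unfolded \<gamma>'] \<phi>] by blast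
      have "finv \<mu> \<in> M" by (rule M(3)[OF \<mu>(1)])
      then have n: "map_prod (conjm C (finv \<mu>)) id \<in> \<Gamma>" using NG(1) N unfolding M'_def by blast
      \<comment> \<open>The element of \<Gamma> over d may carry a lift other than
        \<open>conjm C \<phi>\<close>; an element of N corrects it.\<close>
      have "conjm C (finv \<mu>) \<circ> f = conjm C \<phi>"
        unfolding \<mu>(2) conjm_comp[OF C(2), symmetric] using D(1)[OF \<mu>(1)] by (simp add: comp_assoc[symmetric])
      then have "conjm (map_prod C id) g = map_prod (conjm C (finv \<mu>)) id \<circ> \<gamma>"
        unfolding g cj unfolding \<gamma>' map_prod_comp id_comp by (simp only:)
      then show "conjm (map_prod C id) g \<in> \<Gamma>" using tgroupD(3)[OF t\<Gamma> n \<gamma>(2)] by simp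
    qed
  qed
qed

text \<open>\<open>C\<close> is found one summand at a time: \<open>x \<mapsto> (C x, A x)\<close> is followed by a linear isometry of its
  range with \<open>E\<^sup>n\<^sup>-\<^sup>1\<close>.\<close>

lemma sum_norm_squares_linear:
  fixes L :: "('a::euclidean_space \<Rightarrow> 'a) set"
  assumes "finite L" "\<And>A. A \<in> L \<Longrightarrow> linear A"
  shows "\<exists>C :: 'a \<Rightarrow> 'a. linear C \<and> (\<forall>x. (norm (C x))\<^sup>2 = (norm x)\<^sup>2 + (\<Sum>A\<in>L. (norm (A x))\<^sup>2))"
  using assms
proof (induction rule: finite_induct)
  case empty
  show ?case by (intro exI[of _ id] conjI linear_id) simp
next
  case (insert A L)
  then obtain C :: "'a \<Rightarrow> 'a" where C: "linear C" "\<And>x. (norm (C x))\<^sup>2 = (norm x)\<^sup>2 + (\<Sum>A\<in>L. (norm (A x))\<^sup>2)"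
    by auto
  define D where "D x = (C x, A x)" for x
  have lA: "linear A" using insert.prems by blast
  have D: "linear D"
    unfolding D_def by (rule linearI) (simp_all add: linear_add[OF C(1)] linear_add[OF lA] linear_scale[OF C(1)] linear_scale[OF lA])
  have nD: "(norm (D x))\<^sup>2 = (norm (C x))\<^sup>2 + (norm (A x))\<^sup>2" for x
    by (simp add: D_def norm_Pair)
  \<comment> \<open>The squared norm of x, present from the start of the induction, makes C and
    hence D injective, so the range of D has the dimension of the original space.\<close>
  have "inj D"
    unfolding linear_injective_0[OF D]
  proof (intro allI impI)
    fix x assume "D x = 0"
    then have "(norm (C x))\<^sup>2 = 0" by (simp add: D_def zero_prod_def)
    moreover have "(\<Sum>A\<in>L. (norm (A x))\<^sup>2) \<ge> 0" by (simp add: sum_nonneg)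
    ultimately have "(norm x)\<^sup>2 \<le> 0" using C(2)[of x] by linarith
    then show "x = 0" by simp
  qed
  then have "dim (range D) = dim (UNIV :: 'a set)" using dim_image_eq[OF D] by simp
  then obtain f :: "'a \<times> 'a \<Rightarrow> 'a" where f: "linear f" "f ` range D = UNIV" "\<And>y. y \<in> range D \<Longrightarrow> norm (f y) = norm y"
    by (rule isometry_subspaces[OF linear_subspace_image[OF D subspace_UNIV] subspace_UNIV])
      (rule that, assumption, assumption, blast)
  show ?case
  proof (intro exI[of _ "f \<circ> D"] conjI allI)
    show "linear (f \<circ> D)" by (rule linear_compose[OF D f(1)])
    fix x show "(norm ((f \<circ> D) x))\<^sup>2 = (norm x)\<^sup>2 + (\<Sum>A\<in>insert A L. (norm (A x))\<^sup>2)"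
      using f(3)[of "D x"] nD[of x] C(2)[of x] insert.hyps by simp
  qed
qed

text \<open>The sum of the squared norms of A x over the group is an invariant quadratic form; C
  carries it to the standard one.\<close>

lemma finite_linear_group_orthogonal:
  fixes L :: "('a::euclidean_space \<Rightarrow> 'a) set"
  assumes fin: "finite L" and L: "tgroup L" "\<And>A. A \<in> L \<Longrightarrow> linear A"
  obtains C :: "'a \<Rightarrow> 'a" where "linear C" "bij C" "\<And>A. A \<in> L \<Longrightarrow> orthogonal_transformation (conjm C A)"
proof -
  \<comment> \<open>The identity is removed from L because its summand is the squared norm of x that
    is already there.\<close>
  obtain C :: "'a \<Rightarrow> 'a" where C: "linear C"
    "\<And>x. (norm (C x))\<^sup>2 = (norm x)\<^sup>2 + (\<Sum>A\<in>L - {id}. (norm (A x))\<^sup>2)"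
    using sum_norm_squares_linear[of "L - {id}"] fin L(2) by auto
  have C': "(norm (C x))\<^sup>2 = (\<Sum>A\<in>L. (norm (A x))\<^sup>2)" for x
    using sum.remove[OF fin tgroupD(2)[OF L(1)], of "\<lambda>A. (norm (A x))\<^sup>2"] C(2)[of x] by simp
  have "inj C"
    unfolding linear_injective_0[OF C(1)]
  proof (intro allI impI)
    fix x assume "C x = 0"
    then have "(norm (C x))\<^sup>2 = 0" by simp
    moreover have "(\<Sum>A\<in>L - {id}. (norm (A x))\<^sup>2) \<ge> 0" by (simp add: sum_nonneg)
    ultimately have "(norm x)\<^sup>2 \<le> 0" using C(2)[of x] by linarith
    then show "x = 0" by simp
  qed
  then have bC: "bij C" using linear_injective_imp_surjective[OF C(1)] by (simp add: bij_def)
  have inv: "norm (C (A x)) = norm (C x)" if A: "A \<in> L" for A x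
  proof -
    have b: "bij A" by (rule tgroupD(1)[OF L(1) A])
    have "bij_betw (\<lambda>B. B \<circ> A) L L"
    proof (rule bij_betw_byWitness[where f' = "\<lambda>B. B \<circ> finv A"])
      show "(\<lambda>B. B \<circ> A) ` L \<subseteq> L" "(\<lambda>B. B \<circ> finv A) ` L \<subseteq> L"
        using tgroupD(3)[OF L(1) _ A] tgroupD(3)[OF L(1) _ tgroupD(4)[OF L(1) A]] by blast+
    qed (simp_all add: comp_assoc b)
    then have "(\<Sum>B\<in>L. (norm (B x))\<^sup>2) = (\<Sum>B\<in>L. (norm ((B \<circ> A) x))\<^sup>2)"
      using sum.reindex_bij_betw[of "\<lambda>B. B \<circ> A" L L "\<lambda>B. (norm (B x))\<^sup>2"] by simp
    then have "(norm (C (A x)))\<^sup>2 = (norm (C x))\<^sup>2" unfolding C' by simp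
    then show ?thesis by simp
  qed
  have "orthogonal_transformation (conjm C A)" if A: "A \<in> L" for A
    unfolding orthogonal_transformation
  proof (intro conjI allI)
    show "linear (conjm C A)"
      by (intro linear_compose linear_inv_bij[OF C(1) bC] L(2)[OF A] C(1))
    fix x show "norm (conjm C A x) = norm x" using inv[OF A, of "finv C x"] bC by simp
  qed
  then show thesis using that C(1) bC by blast
qed

text \<open>Existence makes the definite description in \<open>psi\<close> meaningful.
  \<open>Hom_f\<close> enters through L, the group of linear parts of all lifts: it is finite
  because the point group and the set of outer classes are finite, and C makes it
  orthogonal.\<close>

theorem (in crystal) construction_exists:
  assumes \<eta>: "\<eta> \<in> Hom_f M"
  shows "\<exists>C \<Gamma> N. constructed_from M \<eta> C \<Gamma> N"
proof -
  have \<eta>h: "\<eta> \<in> hom Delta_group (Aff M)" and fin: "finite (Omega M ` \<eta> ` Delta)"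
    using \<eta> by (auto simp: Hom_f_def)
  define L where "L = lin ` fst_part ` lifted M \<eta>"
  have L_iff: "A \<in> L \<longleftrightarrow> (\<exists>\<phi> \<delta>. A = lin \<phi> \<and> \<phi> \<in> normalizing_affinities M \<and> \<delta> \<in> Delta \<and> star UNIV M \<phi> = \<eta> \<delta>)" for A
    unfolding L_def lifted_def by (auto simp: image_iff) (metis parts_map_prod(1))+
  have finL: "finite L"
  proof -
    define r where "r c = (SOME \<phi>. \<phi> \<in> normalizing_affinities M \<and> Omega_class \<phi> = c)" for c
    have "L \<subseteq> (\<lambda>(p, c). p \<circ> lin (r c)) ` (lin ` M \<times> (Omega M ` \<eta> ` Delta))"
    proof
      fix A assume "A \<in> L"
      then obtain \<phi> \<delta> where *: "A = lin \<phi>" "\<phi> \<in> normalizing_affinities M" "\<delta> \<in> Delta" "star UNIV M \<phi> = \<eta> \<delta>"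
        unfolding L_iff by blast
      define c where "c = Omega_class \<phi>"
      have c: "c \<in> Omega M ` \<eta> ` Delta" using Omega_star[OF *(2)] *(3,4) unfolding c_def by (metis imageI)
      have "\<exists>\<psi>. \<psi> \<in> normalizing_affinities M \<and> Omega_class \<psi> = c" using *(2) c_def by blast
      then have r: "r c \<in> normalizing_affinities M" "Omega_class (r c) = c"
        unfolding r_def by (metis (mono_tags, lifting) someI_ex)+
      \<comment> \<open>Lifts of the same outer class act on M alike up to an element m of M, and
        the action on the spanning lattice determines the linear part.\<close>
      have "Omega_class \<phi> = Omega_class (r c)" using r(2) by (simp only: c_def[symmetric])
      from Omega_class_eqD[OF *(2) r(1) this]
      obtain m where m: "m \<in> M" "\<And>\<mu>. \<mu> \<in> M \<Longrightarrow> conjm \<phi> \<mu> = conjm (m \<circ> r c) \<mu>" by metis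
      have mr: "m \<circ> r c \<in> normalizing_affinities M" by (rule normalizing_affinities_comp[OF D(4)[OF m(1)] r(1)])
      have "lin \<phi> = lin (m \<circ> r c)"
      proof (rule linear_eq_on_transl)
        show "linear (lin \<phi>)" "linear (lin (m \<circ> r c))" using *(2) mr normalizing_affinities_D(2) by blast+
        fix t assume t: "t \<in> transl M"
        have "conjm \<phi> ((+) t) = conjm (m \<circ> r c) ((+) t)" by (rule m(2)) (use t in \<open>simp add: transl_def\<close>)
        then show "lin \<phi> t = lin (m \<circ> r c) t"
          unfolding conjm_plus[OF normalizing_affinities_D(2,1)[OF *(2)]]
            conjm_plus[OF normalizing_affinities_D(2,1)[OF mr]] plus_inj .
      qed
      then have "A = (\<lambda>(p, c). p \<circ> lin (r c)) (lin m, c)" unfolding *(1) by (simp add: lin_comp[OF D(2)[OF m(1)]])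
      then show "A \<in> (\<lambda>(p, c). p \<circ> lin (r c)) ` (lin ` M \<times> (Omega M ` \<eta> ` Delta))"
        using m(1) c by (intro image_eqI[where x = "(lin m, c)"]) auto
    qed
    then show ?thesis
      by (rule finite_subset) (intro finite_imageI[OF finite_cartesian_product] finite_point_group fin)
  qed
  have Lg: "tgroup L"
    unfolding tgroup_def
  proof (intro conjI ballI)
    show "id \<in> L" unfolding L_iff using id_normalizing tgroupD(2)[OF tgroup_Delta] \<eta>_id[OF \<eta>h] lin_id by metis
  next
    fix A assume "A \<in> L"
    then obtain \<phi> \<delta> where *: "A = lin \<phi>" "map_prod \<phi> \<delta> \<in> lifted M \<eta>" "\<phi> \<in> normalizing_affinities M" "\<delta> \<in> Delta"
      unfolding L_iff lifted_def by blast
    note d = normalizing_affinities_D(1,2)[OF *(3)] tgroupD(1)[OF tgroup_Delta *(4)]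
    show "bij A" unfolding *(1) by (rule bij_lin[OF d(1)])
    have "map_prod (finv \<phi>) (finv \<delta>) \<in> lifted M \<eta>"
      using tgroupD(4)[OF tgroup_lifted[OF \<eta>h] *(2)] inv_map_prod[OF d(1,3)] by simp
    then have "lin (finv \<phi>) \<in> L" unfolding L_def by (metis imageI parts_map_prod(1))
    then show "finv A \<in> L" unfolding *(1) lin_inv(1)[OF d(2,1)] .
  next
    fix A B assume "A \<in> L" "B \<in> L"
    then obtain \<phi> \<delta> \<phi>' \<delta>' where *: "A = lin \<phi>" "map_prod \<phi> \<delta> \<in> lifted M \<eta>" "\<phi> \<in> normalizing_affinities M"
      "B = lin \<phi>'" "map_prod \<phi>' \<delta>' \<in> lifted M \<eta>"
      unfolding L_iff lifted_def by blast
    have "map_prod (\<phi> \<circ> \<phi>') (\<delta> \<circ> \<delta>') \<in> lifted M \<eta>"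
      using tgroupD(3)[OF tgroup_lifted[OF \<eta>h] *(2,5)] by (simp only: map_prod_comp)
    then have "lin (\<phi> \<circ> \<phi>') \<in> L" unfolding L_def by (metis imageI parts_map_prod(1))
    then show "A \<circ> B \<in> L" unfolding *(1,4) lin_comp[OF normalizing_affinities_D(2)[OF *(3)]] .
  qed
  have linL: "linear A" if "A \<in> L" for A using that normalizing_affinities_D(2) unfolding L_iff by blast
  obtain C :: "'a \<Rightarrow> 'a" where C: "linear C" "bij C" "\<And>A. A \<in> L \<Longrightarrow> orthogonal_transformation (conjm C A)"
    by (rule finite_linear_group_orthogonal[OF finL Lg linL]) (assumption, rule that, assumption, assumption, blast)
  have lC: "linear (lin C)" using C(1) by (simp add: lin_linear)
  have isoC: "conjm C \<phi> \<in> isometries" if \<phi>: "\<phi> \<in> normalizing_affinities M" "\<delta> \<in> Delta" "star UNIV M \<phi> = \<eta> \<delta>" for \<phi> \<delta>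
  proof -
    have "lin \<phi> \<in> L" unfolding L_iff using \<phi> by blast
    then have "orthogonal_transformation (conjm C (lin \<phi>))" by (rule C(3))
    moreover have "lin (conjm C \<phi>) = conjm C (lin \<phi>)"
      using linear_lin_conjm(1)[OF lC C(2) normalizing_affinities_D(2)[OF \<phi>(1)]] lin_linear[OF C(1)] by simp
    ultimately show ?thesis by (intro isometryI) simp
  qed
  define M' where "M' = conjm C ` M"
  have M'iso: "M' \<subseteq> isometries"
    unfolding M'_def using isoC[OF D(4) tgroupD(2)[OF tgroup_Delta]] star_M \<eta>_id[OF \<eta>h] by auto
  interpret M': crystal M' unfolding M'_def by (rule crystal_conjm[OF C(2,1) M'iso[unfolded M'_def]])
  let ?K = "map_prod C (id :: real \<Rightarrow> real)"
  have bK: "bij ?K" by (rule bij_map_prod[OF C(2) bij_id])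
  have cj: "conjm ?K (map_prod \<phi> \<delta>) = map_prod (conjm C \<phi>) \<delta>" for \<phi> and \<delta> :: "real \<Rightarrow> real"
    unfolding conjm_map_prod[OF C(2) bij_id] by simp
  define \<Gamma> where "\<Gamma> = conjm ?K ` lifted M \<eta>"
  define N where "N = conjm ?K ` extended M"
  have \<Gamma>E: "\<exists>\<phi> \<delta>. \<gamma> = map_prod (conjm C \<phi>) \<delta> \<and> \<phi> \<in> normalizing_affinities M \<and> \<delta> \<in> Delta \<and> star UNIV M \<phi> = \<eta> \<delta>"
    if "\<gamma> \<in> \<Gamma>" for \<gamma>
  proof -
    from that obtain g where "g \<in> lifted M \<eta>" "\<gamma> = conjm ?K g" unfolding \<Gamma>_def by blast
    then show ?thesis unfolding lifted_def using cj by blast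
  qed
  have \<Gamma>E': "\<exists>\<phi>. \<gamma> = map_prod (conjm C \<phi>) (snd_part \<gamma>) \<and> \<phi> \<in> normalizing_affinities M
      \<and> snd_part \<gamma> \<in> Delta \<and> star UNIV M \<phi> = \<eta> (snd_part \<gamma>)" if "\<gamma> \<in> \<Gamma>" for \<gamma>
    using \<Gamma>E[OF that] parts_map_prod(2) by metis
  have \<Gamma>I: "map_prod (conjm C \<phi>) \<delta> \<in> \<Gamma>"
    if "\<phi> \<in> normalizing_affinities M" "\<delta> \<in> Delta" "star UNIV M \<phi> = \<eta> \<delta>" for \<phi> \<delta>
    unfolding \<Gamma>_def cj[symmetric] by (rule imageI) (rule liftedI[of \<phi> \<delta> \<eta>, OF that])
  have N_eq: "N = (\<lambda>\<mu>. map_prod \<mu> id) ` M'"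
    unfolding N_def extended_def M'_def image_image cj ..
  have t\<Gamma>: "tgroup \<Gamma>" unfolding \<Gamma>_def by (rule tgroup_conjm[OF tgroup_lifted[OF \<eta>h] bK])
  have nor: "N \<lhd> trans_group UNIV \<Gamma>"
    unfolding normal_tgroup[OF t\<Gamma>]
  proof (intro conjI ballI)
    note n = normal_extended[OF \<eta>h, unfolded normal_tgroup[OF tgroup_lifted[OF \<eta>h]]]
    show "N \<subseteq> \<Gamma>" unfolding N_def \<Gamma>_def using n by blast
    show "tgroup N" unfolding N_def using n tgroup_conjm[OF _ bK] by blast
    fix g h assume "g \<in> \<Gamma>" "h \<in> N"
    then obtain g' h' where *: "g' \<in> lifted M \<eta>" "h' \<in> extended M" "g = conjm ?K g'" "h = conjm ?K h'"
      unfolding N_def \<Gamma>_def by blast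
    have bg: "bij g'" by (rule tgroupD(1)[OF tgroup_lifted[OF \<eta>h] *(1)])
    have "conjm g h = conjm ?K (conjm g' h')"
      unfolding *(3,4) using conjm_inv[OF bK bg, symmetric] by (simp only: conjm_comp[OF bK])
    then show "conjm g h \<in> N" unfolding N_def using n *(1,2) by blast
  qed
  have iso\<Gamma>: "\<Gamma> \<subseteq> isometries"
  proof
    fix \<gamma> assume \<gamma>: "\<gamma> \<in> \<Gamma>"
    then obtain \<phi> \<delta> where *: "\<gamma> = map_prod (conjm C \<phi>) \<delta>" "\<phi> \<in> normalizing_affinities M" "\<delta> \<in> Delta" "star UNIV M \<phi> = \<eta> \<delta>"
      using \<Gamma>E by blast
    have "dist (conjm C \<phi> x) (conjm C \<phi> y) = dist x y" for x y
      using isoC[OF *(2-4)] unfolding isometries_def by blast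
    moreover have "dist (\<delta> s) (\<delta> t) = dist s t" for s t
      using Delta_form[OF *(3)] by (auto simp: dist_real_def)
    ultimately have "dist (\<gamma> x) (\<gamma> y) = dist x y" for x y
      unfolding *(1) dist_prod_def fst_map_prod snd_map_prod by (simp only:)
    then show "\<gamma> \<in> isometries" using tgroupD(1)[OF t\<Gamma> \<gamma>] by (auto simp: isometries_def Bij_UNIV)
  qed
  have fin\<Gamma>: "finite {\<gamma> \<in> \<Gamma>. norm (\<gamma> 0) \<le> R}" for R
  proof -
    define K where "K = {k :: int. \<bar>real_of_int k\<bar> \<le> R}"
    have "finite K"
    proof (rule finite_subset)
      show "K \<subseteq> {- \<lceil>R\<rceil>..\<lceil>R\<rceil>}" unfolding K_def by (auto simp: ceiling_le_iff le_ceiling_iff) linarith+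
    qed simp
    \<comment> \<open>The second coordinate of \<gamma> 0 is the integer k in the normal form of the
      \<Delta>-part, so bounding it leaves finitely many \<delta>; over each of them \<gamma> is
      determined by an element of M'.\<close>
    define DR where "DR = (\<lambda>k t. real_of_int k + t) ` K \<union> (\<lambda>k t. real_of_int k - t) ` K"
    have fDR: "finite DR" using \<open>finite K\<close> by (simp add: DR_def)
    have fib: "finite {\<gamma> \<in> \<Gamma>. norm (\<gamma> 0) \<le> R \<and> snd_part \<gamma> = \<delta>}" for \<delta>
    proof (cases "\<exists>\<gamma>\<in>\<Gamma>. snd_part \<gamma> = \<delta>")
      case False
      then have "{\<gamma> \<in> \<Gamma>. norm (\<gamma> 0) \<le> R \<and> snd_part \<gamma> = \<delta>} = {}" by blast
      then show ?thesis by (simp only: finite.emptyI)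
    next
      case True
      then obtain \<gamma>0 where \<gamma>0: "\<gamma>0 \<in> \<Gamma>" "snd_part \<gamma>0 = \<delta>" by blast
      from \<Gamma>E'[OF \<gamma>0(1)] obtain \<phi>0
        where \<phi>0: "\<gamma>0 = map_prod (conjm C \<phi>0) \<delta>" "\<phi>0 \<in> normalizing_affinities M" "star UNIV M \<phi>0 = \<eta> \<delta>"
        unfolding \<gamma>0(2) by blast
      define f where "f = conjm C \<phi>0"
      have "{\<gamma> \<in> \<Gamma>. norm (\<gamma> 0) \<le> R \<and> snd_part \<gamma> = \<delta>} \<subseteq>
        (\<lambda>\<mu>. map_prod (\<mu> \<circ> f) \<delta>) ` {\<mu> \<in> M'. norm (\<mu> 0) \<le> R + norm (f 0)}"
      proof
        fix \<gamma> assume \<gamma>: "\<gamma> \<in> {\<gamma> \<in> \<Gamma>. norm (\<gamma> 0) \<le> R \<and> snd_part \<gamma> = \<delta>}"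
        then have g: "\<gamma> \<in> \<Gamma>" "snd_part \<gamma> = \<delta>" by simp_all
        from \<Gamma>E'[OF g(1)] obtain \<phi>
          where \<phi>: "\<gamma> = map_prod (conjm C \<phi>) \<delta>" "\<phi> \<in> normalizing_affinities M" "star UNIV M \<phi> = \<eta> \<delta>"
          unfolding g(2) by blast
        then have "star UNIV M \<phi> = star UNIV M \<phi>0" using \<phi>0(3) by simp
        then obtain \<mu> where \<mu>: "\<mu> \<in> M" "\<phi> = \<mu> \<circ> \<phi>0" using star_eq_iff[OF \<phi>(2) \<phi>0(2)] by blast
        define \<mu>' where "\<mu>' = conjm C \<mu>"
        have \<mu>': "\<mu>' \<in> M'" "\<gamma> = map_prod (\<mu>' \<circ> f) \<delta>"
          unfolding \<phi>(1) \<mu>(2) f_def \<mu>'_def M'_def using \<mu>(1) conjm_comp[OF C(2)] by auto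
        have "norm (\<mu>' (f 0)) \<le> norm (\<gamma> 0)"
          unfolding \<mu>'(2) by (simp add: zero_prod_def norm_Pair)
        then have "norm (\<mu>' (f 0)) \<le> R" using \<gamma> by simp
        moreover have "dist (\<mu>' (f 0)) (\<mu>' 0) = dist (f 0) 0" using M'iso \<mu>'(1) unfolding isometries_def by blast
        ultimately have "norm (\<mu>' 0) \<le> R + norm (f 0)"
          using norm_triangle_ineq2[of "\<mu>' 0" "\<mu>' (f 0)"] by (simp add: dist_norm norm_minus_commute)
        then show "\<gamma> \<in> (\<lambda>\<mu>. map_prod (\<mu> \<circ> f) \<delta>) ` {\<mu> \<in> M'. norm (\<mu> 0) \<le> R + norm (f 0)}"
          using \<mu>' by blast
      qed
      then show ?thesis using M'.locally_finite by (meson finite_imageI finite_subset)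
    qed
    have "{\<gamma> \<in> \<Gamma>. norm (\<gamma> 0) \<le> R} \<subseteq> (\<Union>\<delta>\<in>DR. {\<gamma> \<in> \<Gamma>. norm (\<gamma> 0) \<le> R \<and> snd_part \<gamma> = \<delta>})"
    proof
      fix \<gamma> assume \<gamma>: "\<gamma> \<in> {\<gamma> \<in> \<Gamma>. norm (\<gamma> 0) \<le> R}"
      then obtain \<phi> \<delta> where *: "\<gamma> = map_prod (conjm C \<phi>) \<delta>" "\<delta> \<in> Delta"
        using \<Gamma>E by blast
      have "norm (snd (\<gamma> 0)) \<le> norm (\<gamma> 0)" using norm_snd_le[of "snd (\<gamma> 0)" "fst (\<gamma> 0)"] by simp
      then have "\<bar>\<delta> 0\<bar> \<le> R" using \<gamma> unfolding *(1) by (auto simp: zero_prod_def)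
      then have "\<delta> \<in> DR" using Delta_form[OF *(2)] unfolding DR_def K_def by auto
      then show "\<gamma> \<in> (\<Union>\<delta>\<in>DR. {\<gamma> \<in> \<Gamma>. norm (\<gamma> 0) \<le> R \<and> snd_part \<gamma> = \<delta>})"
        using \<gamma> *(1) by (intro UN_I[of \<delta>]) auto
    qed
    then show ?thesis using fDR fib by (meson finite_UN_I finite_subset)
  qed
  have sp\<Gamma>: "space_group \<Gamma>"
  proof -
    obtain R where R: "\<And>x. \<exists>\<mu>\<in>M'. norm (\<mu> x) \<le> R" using M'.cocompact by blast
    show ?thesis
    proof (rule space_groupI[OF t\<Gamma> iso\<Gamma> fin\<Gamma>])
      show "compact (cball (0::'a) R \<times> cball (0::real) 1)" by (intro compact_Times compact_cball)
      fix z :: "'a \<times> real"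
      obtain x t where z: "z = (x, t)" by (cases z)
      \<comment> \<open>This translation brings t into the unit interval; an element of N then moves
        the first coordinate into the ball and leaves the second alone.\<close>
      define d where "d = (\<lambda>s. real_of_int (- \<lfloor>t\<rfloor>) + s)"
      have d: "d \<in> Delta" unfolding d_def by (rule translation_in_Delta)
      obtain \<phi> where \<phi>: "\<phi> \<in> normalizing_affinities M" "star UNIV M \<phi> = \<eta> d" by (rule lift_exists[OF \<eta>h d])
      obtain \<mu> where \<mu>: "\<mu> \<in> M'" "norm (\<mu> (conjm C \<phi> x)) \<le> R" using R by blast
      have 1: "map_prod \<mu> id \<in> \<Gamma>" using \<mu>(1) nor unfolding normal_tgroup[OF t\<Gamma>] N_eq by blast
      have "\<bar>d t\<bar> \<le> 1" unfolding d_def by simp linarith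
      then have "(map_prod \<mu> id \<circ> map_prod (conjm C \<phi>) d) z \<in> cball 0 R \<times> cball 0 1"
        using \<mu>(2) by (simp add: z)
      then show "\<exists>g\<in>\<Gamma>. g z \<in> cball 0 R \<times> cball 0 1"
        by (rule bexI[of "\<lambda>g. g z \<in> cball 0 R \<times> cball 0 1"]) (rule tgroupD(3)[OF t\<Gamma> 1 \<Gamma>I[OF \<phi>(1) d \<phi>(2)]])
    qed
  qed
  have "constructed_from M \<eta> C \<Gamma> N"
    unfolding constructed_from_def Let_def conj_map_UNIV[abs_def] M'_def[symmetric]
  proof (intro conjI ballI)
    show "linear C" "bij C" "space_group M'" "space_group \<Gamma>" "N \<lhd> trans_group UNIV \<Gamma>" "N = (\<lambda>\<mu>. map_prod \<mu> id) ` M'"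
      by (rule C(1) C(2) M'.space_group sp\<Gamma> nor N_eq)+
    show "sharp UNIV M UNIV M' C ` \<eta> ` Delta \<subseteq> orbifold_isometries M'"
    proof safe
      fix \<delta> assume \<delta>: "\<delta> \<in> Delta"
      obtain \<phi> where \<phi>: "\<phi> \<in> normalizing_affinities M" "star UNIV M \<phi> = \<eta> \<delta>" by (rule lift_exists[OF \<eta>h \<delta>])
      define f where "f = conjm C \<phi>"
      have fn: "f \<in> normalizing_affinities M'" unfolding f_def M'_def by (rule normalizing_conjm[OF \<phi>(1) C(2) lC])
      have fi: "dist (f x) (f y) = dist x y" for x y using isoC[OF \<phi>(1) \<delta> \<phi>(2)] unfolding isometries_def f_def by blast
      have eq: "sharp UNIV M UNIV M' C (\<eta> \<delta>) = star UNIV M' f"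
        unfolding \<phi>(2)[symmetric] M'_def f_def by (rule sharp_UNIV_star[OF C(2) \<phi>(1)])
      have "setdist (f ` X) (f ` Y) = setdist X Y" for X Y
      proof -
        have "{dist x y |x y. x \<in> f ` X \<and> y \<in> f ` Y} = {dist (f x) (f y) |x y. x \<in> X \<and> y \<in> Y}"
          by blast
        then have "{dist x y |x y. x \<in> f ` X \<and> y \<in> f ` Y} = {dist x y |x y. x \<in> X \<and> y \<in> Y}"
          by (simp only: fi)
        then show ?thesis by (simp add: setdist_def)
      qed
      then show "sharp UNIV M UNIV M' C (\<eta> \<delta>) \<in> orbifold_isometries M'"
        unfolding eq orbifold_isometries_def using star_Bij[OF fn] by (simp add: star_def)
    qed
    show "N = {\<gamma> \<in> \<Gamma>. snd_part \<gamma> = id}"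
    proof
      show "N \<subseteq> {\<gamma> \<in> \<Gamma>. snd_part \<gamma> = id}"
        using nor unfolding normal_tgroup[OF t\<Gamma>] N_eq by auto
      show "{\<gamma> \<in> \<Gamma>. snd_part \<gamma> = id} \<subseteq> N"
      proof
        fix \<gamma> assume "\<gamma> \<in> {\<gamma> \<in> \<Gamma>. snd_part \<gamma> = id}"
        then obtain g where g: "g \<in> lifted M \<eta>" "\<gamma> = conjm ?K g" "snd_part \<gamma> = id" unfolding \<Gamma>_def by blast
        then obtain \<phi> \<delta> where *: "g = map_prod \<phi> \<delta>" unfolding lifted_def by blast
        have "snd_part \<gamma> = snd_part g" unfolding g(2) * cj parts_map_prod ..
        then have "g \<in> extended M" using g unfolding extended_kernel[OF \<eta>h] by simp
        then show "\<gamma> \<in> N" unfolding N_def g(2) by (rule imageI)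
      qed
    qed
    show "snd_part ` \<Gamma> = Delta"
    proof
      show "snd_part ` \<Gamma> \<subseteq> Delta" using \<Gamma>E' by blast
      show "Delta \<subseteq> snd_part ` \<Gamma>"
      proof
        fix \<delta> assume \<delta>: "\<delta> \<in> Delta"
        obtain \<phi> where \<phi>: "\<phi> \<in> normalizing_affinities M" "star UNIV M \<phi> = \<eta> \<delta>" by (rule lift_exists[OF \<eta>h \<delta>])
        from imageI[OF \<Gamma>I[OF \<phi>(1) \<delta> \<phi>(2)], of snd_part] show "\<delta> \<in> snd_part ` \<Gamma>"
          unfolding parts_map_prod .
      qed
    qed
    fix \<gamma> assume "\<gamma> \<in> \<Gamma>"
    then obtain \<phi> \<delta> where *: "\<gamma> = map_prod (conjm C \<phi>) \<delta>" "\<phi> \<in> normalizing_affinities M" "\<delta> \<in> Delta" "star UNIV M \<phi> = \<eta> \<delta>"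
      using \<Gamma>E by blast
    show "\<gamma> = map_prod (fst_part \<gamma>) (snd_part \<gamma>)" unfolding *(1) parts_map_prod ..
    show "star UNIV M' (fst_part \<gamma>) = sharp UNIV M UNIV M' C (\<eta> (snd_part \<gamma>))"
      unfolding *(1) parts_map_prod *(4)[symmetric] M'_def by (rule sharp_UNIV_star[OF C(2) *(2), symmetric])
  qed
  then show ?thesis by blast
qed

section \<open>Isomorphism classes of pairs, and fibre products under twisting of the
  homomorphism\<close>

section \<open>The map \<open>psi\<close>\<close>

lemma equiv_pair_iso: "equiv (space_pairs M) (pair_iso M)"
proof -
  have tg: "tgroup \<Gamma> \<and> N \<subseteq> \<Gamma>" if "(\<Gamma>, N) \<in> space_pairs M" for \<Gamma> N
  proof -
    have t: "tgroup \<Gamma>" using that space_group_D(1) unfolding space_pairs_def by blast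
    then show ?thesis using that normal_tgroup[OF t] unfolding space_pairs_def by blast
  qed
  have iff: "((\<Gamma>1, N1), (\<Gamma>2, N2)) \<in> pair_iso M \<longleftrightarrow>
    (\<Gamma>1, N1) \<in> space_pairs M \<and> (\<Gamma>2, N2) \<in> space_pairs M \<and> group_pair_iso \<Gamma>1 N1 \<Gamma>2 N2" for \<Gamma>1 N1 \<Gamma>2 N2
  proof (cases "(\<Gamma>1, N1) \<in> space_pairs M \<and> (\<Gamma>2, N2) \<in> space_pairs M")
    case True
    then have "tgroup \<Gamma>1" "tgroup \<Gamma>2" using tg by blast+
    from group_pair_iso_iff[OF this] show ?thesis using True by (simp add: pair_iso_def)
  qed (auto simp: pair_iso_def)
  show ?thesis
  proof (rule equivI)
    show "pair_iso M \<subseteq> space_pairs M \<times> space_pairs M" unfolding pair_iso_def by blast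
    show "refl_on (space_pairs M) (pair_iso M)"
    proof (rule refl_onI)
      fix x assume x: "x \<in> space_pairs M"
      obtain \<Gamma> N where e: "x = (\<Gamma>, N)" by (cases x)
      have "group_pair_iso \<Gamma> N \<Gamma> N" using group_pair_iso_conjm[OF bij_id, of \<Gamma> N] by (simp add: conjm_id(1)[unfolded id_def])
      then show "(x, x) \<in> pair_iso M" using x unfolding e iff by blast
    qed
    show "sym (pair_iso M)"
    proof (rule symI)
      fix x y assume xy: "(x, y) \<in> pair_iso M"
      obtain \<Gamma>1 N1 \<Gamma>2 N2 where e: "x = (\<Gamma>1, N1)" "y = (\<Gamma>2, N2)" by (cases x; cases y)
      have *: "(\<Gamma>1, N1) \<in> space_pairs M" "(\<Gamma>2, N2) \<in> space_pairs M" "group_pair_iso \<Gamma>1 N1 \<Gamma>2 N2"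
        using xy unfolding e iff by blast+
      show "(y, x) \<in> pair_iso M"
        unfolding e iff using *(1,2) group_pair_iso_sym[OF _ _ *(3)] tg[OF *(1)] by blast
    qed
    show "trans (pair_iso M)"
    proof (rule transI)
      fix x y z assume xyz: "(x, y) \<in> pair_iso M" "(y, z) \<in> pair_iso M"
      obtain \<Gamma>1 N1 \<Gamma>2 N2 \<Gamma>3 N3 where e: "x = (\<Gamma>1, N1)" "y = (\<Gamma>2, N2)" "z = (\<Gamma>3, N3)"
        by (cases x; cases y; cases z)
      have *: "(\<Gamma>1, N1) \<in> space_pairs M" "(\<Gamma>3, N3) \<in> space_pairs M"
        "group_pair_iso \<Gamma>1 N1 \<Gamma>2 N2" "group_pair_iso \<Gamma>2 N2 \<Gamma>3 N3"
        using xyz unfolding e iff by blast+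
      show "(x, z) \<in> pair_iso M"
        unfolding e iff using *(1,2) group_pair_iso_trans[OF *(3,4)] by blast
    qed
  qed
qed

lemma space_pairs_D:
  assumes "(\<Gamma>, N) \<in> space_pairs M"
  shows "space_group \<Gamma>" "tgroup \<Gamma>" "N \<subseteq> \<Gamma>" "tgroup N" "g \<in> \<Gamma> \<Longrightarrow> n \<in> N \<Longrightarrow> conjm g n \<in> N"
proof -
  show "space_group \<Gamma>" using assms by (simp add: space_pairs_def)
  then show t: "tgroup \<Gamma>" by (rule space_group_D(1))
  have "N \<subseteq> \<Gamma> \<and> tgroup N \<and> (\<forall>g\<in>\<Gamma>. \<forall>n\<in>N. conjm g n \<in> N)"
    using assms normal_tgroup[OF t] by (simp add: space_pairs_def)
  then show "N \<subseteq> \<Gamma>" "tgroup N" "g \<in> \<Gamma> \<Longrightarrow> n \<in> N \<Longrightarrow> conjm g n \<in> N" by blast+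
qed

lemma Iso_class_eq_iff:
  assumes "(\<Gamma>1, N1) \<in> space_pairs M" "(\<Gamma>2, N2) \<in> space_pairs M"
  shows "Iso_class M \<Gamma>1 N1 = Iso_class M \<Gamma>2 N2 \<longleftrightarrow> group_pair_iso \<Gamma>1 N1 \<Gamma>2 N2"
proof -
  have "Iso_class M \<Gamma>1 N1 = Iso_class M \<Gamma>2 N2 \<longleftrightarrow> ((\<Gamma>1, N1), (\<Gamma>2, N2)) \<in> pair_iso M"
    unfolding Iso_class_def using eq_equiv_class_iff[OF equiv_pair_iso assms] .
  then show ?thesis
    using assms group_pair_iso_iff[OF space_pairs_D(2)[OF assms(1)] space_pairs_D(2)[OF assms(2)]]
    unfolding pair_iso_def by blast
qed

context crystal
begin

text \<open>\<open>snd_part\<close> is a homomorphism onto \<Delta> with kernel N, which identifies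
  the quotient.\<close>

lemma constructed_in_space_pairs:
  assumes \<eta>: "\<eta> \<in> hom Delta_group (Aff M)" and c: "constructed_from M \<eta> C \<Gamma> N"
  shows "(\<Gamma>, N) \<in> space_pairs M"
proof -
  define M' where "M' = conjm C ` M"
  have C: "linear C" "bij C" and N: "N = (\<lambda>\<mu>. map_prod \<mu> id) ` M'"
    and s\<Gamma>: "space_group \<Gamma>" and nN: "N \<lhd> trans_group UNIV \<Gamma>"
    and diag: "\<And>\<gamma>. \<gamma> \<in> \<Gamma> \<Longrightarrow> \<gamma> = map_prod (fst_part \<gamma>) (snd_part \<gamma>)"
    and ker: "N = {\<gamma> \<in> \<Gamma>. snd_part \<gamma> = id}" and sn: "snd_part ` \<Gamma> = Delta"
    using c unfolding constructed_from_def Let_def M'_def conj_map_UNIV[abs_def] by auto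
  note t\<Gamma> = space_group_D(1)[OF s\<Gamma>]
  have tN: "tgroup N" using nN unfolding normal_tgroup[OF t\<Gamma>] by blast
  have "(\<lambda>\<mu>. map_prod (conjm C \<mu>) id) \<in> iso (trans_group UNIV M) (trans_group UNIV N)"
    unfolding iso_tgroup_iff[OF tgroup tN]
  proof (intro conjI ballI)
    show "bij_betw (\<lambda>\<mu>. map_prod (conjm C \<mu>) id) M N"
      unfolding bij_betw_def N M'_def image_image
      using inj_conjm[OF C(2)] by (auto simp: inj_on_def map_prod_eq_iff simp del: comp_apply)
    fix \<mu> \<nu>
    show "map_prod (conjm C (\<mu> \<circ> \<nu>)) id = map_prod (conjm C \<mu>) id \<circ> (map_prod (conjm C \<nu>) id :: 'a transf)"
      unfolding map_prod_comp conjm_comp[OF C(2)] id_comp ..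
  qed
  then have 1: "trans_group UNIV N \<cong> trans_group UNIV M"
    using group.iso_sym[OF tgroup_group[OF tgroup]] unfolding is_iso_def by blast
  have sm: "snd_part (g \<circ> h) = snd_part g \<circ> snd_part h" if "g \<in> \<Gamma>" "h \<in> \<Gamma>" for g h
    using diag[OF that(1)] diag[OF that(2)] map_prod_comp parts_map_prod(2) by metis
  have hom: "snd_part \<in> hom (trans_group UNIV \<Gamma>) Delta_group"
  proof (rule homI)
    have sd: "snd_part g \<in> Delta" if "g \<in> \<Gamma>" for g unfolding sn[symmetric] by (rule imageI[OF that])
    fix g h assume gh: "g \<in> carrier (trans_group UNIV \<Gamma>)"
    then show "snd_part g \<in> carrier Delta_group" using sd by simp
    assume "h \<in> carrier (trans_group UNIV \<Gamma>)"
    then show "snd_part (g \<otimes>\<^bsub>trans_group UNIV \<Gamma>\<^esub> h) = snd_part g \<otimes>\<^bsub>Delta_group\<^esub> snd_part h"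
      using gh sd sm by (simp add: tgroup_mult[OF t\<Gamma>] tgroup_mult[OF tgroup_Delta])
  qed
  interpret h: group_hom "trans_group UNIV \<Gamma>" Delta_group snd_part
    by (intro group_hom.intro group_hom_axioms.intro tgroup_group[OF t\<Gamma>] group_Delta hom)
  have "kernel (trans_group UNIV \<Gamma>) Delta_group snd_part = N"
    unfolding kernel_def ker by (simp add: id_def)
  then have 2: "trans_group UNIV \<Gamma> Mod N \<cong> Delta_group"
    using h.FactGroup_iso sn by simp
  show ?thesis unfolding space_pairs_def using s\<Gamma> nN 1 2 by blast
qed

text \<open>The isomorphism sends (\<phi>, \<delta>) to (\<xi>^-1 \<phi> \<xi>, \<sigma> \<delta>).
  It is the reason why the class of the fibre product depends only on [\<eta>].\<close>

lemma lifted_twist_iso: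
  assumes \<eta>: "\<eta>1 \<in> hom Delta_group (Aff M)" "\<eta>2 \<in> hom Delta_group (Aff M)"
    and \<xi>: "\<xi> \<in> normalizing_affinities M"
    and \<sigma>: "bij_betw \<sigma> Delta Delta" "\<And>f g. f \<in> Delta \<Longrightarrow> g \<in> Delta \<Longrightarrow> \<sigma> (f \<circ> g) = \<sigma> f \<circ> \<sigma> g"
    and eq: "\<And>\<delta>. \<delta> \<in> Delta \<Longrightarrow> \<eta>2 \<delta> = Aff_conj M (star UNIV M \<xi>) (\<eta>1 (\<sigma> \<delta>))"
  shows "group_pair_iso (lifted M \<eta>2) (extended M) (lifted M \<eta>1) (extended M)"
proof -
  define \<zeta> where "\<zeta> = finv \<xi>"
  have \<zeta>: "\<zeta> \<in> normalizing_affinities M" unfolding \<zeta>_def by (rule normalizing_affinities_inv[OF \<xi>])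
  note b = normalizing_affinities_D(1)[OF \<xi>] normalizing_affinities_D(1)[OF \<zeta>]
  have inv1: "conjm \<zeta> (conjm \<xi> f) = f" "conjm \<xi> (conjm \<zeta> f) = f" for f
    unfolding conjm_conjm[OF b(2,1)] conjm_conjm[OF b] unfolding \<zeta>_def inv_comp_bij[OF b(1)] by (rule conjm_id(1))+
  have \<sigma>D: "\<sigma> \<delta> \<in> Delta" if "\<delta> \<in> Delta" for \<delta> using \<sigma>(1) that by (auto simp: bij_betw_def)
  have c\<zeta>: "conjm \<zeta> \<phi> \<in> normalizing_affinities M" if "\<phi> \<in> normalizing_affinities M" for \<phi>
    by (intro normalizing_affinities_comp normalizing_affinities_inv that \<zeta>)
  have c\<xi>: "conjm \<xi> \<phi> \<in> normalizing_affinities M" if "\<phi> \<in> normalizing_affinities M" for \<phi>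
    by (intro normalizing_affinities_comp normalizing_affinities_inv that \<xi>)
  have st: "star UNIV M (conjm \<zeta> \<phi>) = \<eta>1 (\<sigma> \<delta>)"
    if \<phi>: "\<phi> \<in> normalizing_affinities M" "\<delta> \<in> Delta" "star UNIV M \<phi> = \<eta>2 \<delta>" for \<phi> \<delta>
  proof -
    obtain \<psi> where \<psi>: "\<psi> \<in> normalizing_affinities M" "star UNIV M \<psi> = \<eta>1 (\<sigma> \<delta>)"
      by (rule lift_exists[OF \<eta>(1) \<sigma>D[OF \<phi>(2)]])
    have "star UNIV M \<phi> = star UNIV M (conjm \<xi> \<psi>)"
      unfolding \<phi>(3) eq[OF \<phi>(2)] \<psi>(2)[symmetric] by (rule Aff_conj_star[OF \<xi> \<psi>(1)])
    then have "Aff_conj M (star UNIV M \<zeta>) (star UNIV M \<phi>) = Aff_conj M (star UNIV M \<zeta>) (star UNIV M (conjm \<xi> \<psi>))"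
      by simp
    then show ?thesis
      unfolding Aff_conj_star[OF \<zeta> \<phi>(1)] Aff_conj_star[OF \<zeta> c\<xi>[OF \<psi>(1)]] inv1 \<psi>(2) .
  qed
  define F where "F g = map_prod (conjm \<zeta> (fst_part g)) (\<sigma> (snd_part g))" for g :: "'a transf"
  have F: "F (map_prod \<phi> \<delta>) = map_prod (conjm \<zeta> \<phi>) (\<sigma> \<delta>)" for \<phi> \<delta> unfolding F_def parts_map_prod ..
  have \<sigma>id: "\<sigma> id = id"
  proof -
    have i: "id \<in> Delta" by (rule tgroupD(2)[OF tgroup_Delta])
    have bi: "bij (\<sigma> id)" by (rule tgroupD(1)[OF tgroup_Delta \<sigma>D[OF i]])
    have "\<sigma> id \<circ> \<sigma> id = \<sigma> id" using \<sigma>(2)[OF i i] by simp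
    then have "finv (\<sigma> id) \<circ> (\<sigma> id \<circ> \<sigma> id) = finv (\<sigma> id) \<circ> \<sigma> id" by simp
    then show ?thesis unfolding comp_assoc[symmetric] inv_comp_bij[OF bi] id_comp .
  qed
  show ?thesis
    unfolding group_pair_iso_def
  proof (intro exI[of _ F] conjI ballI)
    show "bij_betw F (lifted M \<eta>2) (lifted M \<eta>1)"
      unfolding bij_betw_def
    proof
      show "inj_on F (lifted M \<eta>2)"
      proof (rule inj_onI)
        fix g h assume "g \<in> lifted M \<eta>2" "h \<in> lifted M \<eta>2" and FF: "F g = F h"
        then obtain \<phi> \<delta> \<phi>' \<delta>' where *: "g = map_prod \<phi> \<delta>" "\<delta> \<in> Delta" "h = map_prod \<phi>' \<delta>'" "\<delta>' \<in> Delta"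
          unfolding lifted_def by blast
        have "\<phi> = \<phi>'" "\<sigma> \<delta> = \<sigma> \<delta>'"
          using FF unfolding *(1,3) F map_prod_eq_iff inj_conjm[OF b(2)] by blast+
        moreover have "\<delta> = \<delta>'"
          by (rule inj_onD[OF bij_betw_imp_inj_on[OF \<sigma>(1)] \<open>\<sigma> \<delta> = \<sigma> \<delta>'\<close> *(2,4)])
        ultimately show "g = h" unfolding *(1,3) by simp
      qed
      show "F ` lifted M \<eta>2 = lifted M \<eta>1"
      proof
        show "F ` lifted M \<eta>2 \<subseteq> lifted M \<eta>1"
        proof (rule image_subsetI)
          fix g assume "g \<in> lifted M \<eta>2"
          then obtain \<phi> \<delta> where *: "g = map_prod \<phi> \<delta>" "\<phi> \<in> normalizing_affinities M" "\<delta> \<in> Delta" "star UNIV M \<phi> = \<eta>2 \<delta>"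
            unfolding lifted_def by blast
          show "F g \<in> lifted M \<eta>1" unfolding *(1) F by (rule liftedI[where \<eta> = \<eta>1, OF c\<zeta>[OF *(2)] \<sigma>D[OF *(3)] st[OF *(2-4)]])
        qed
        show "lifted M \<eta>1 \<subseteq> F ` lifted M \<eta>2"
        proof
          fix g assume "g \<in> lifted M \<eta>1"
          then obtain \<phi> \<delta> where *: "g = map_prod \<phi> \<delta>" "\<phi> \<in> normalizing_affinities M" "\<delta> \<in> Delta" "star UNIV M \<phi> = \<eta>1 \<delta>"
            unfolding lifted_def by blast
          have "\<delta> \<in> \<sigma> ` Delta" using *(3) \<sigma>(1) by (simp add: bij_betw_def)
          then obtain \<delta>' where \<delta>': "\<delta>' \<in> Delta" "\<sigma> \<delta>' = \<delta>" by blast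
          have "star UNIV M (conjm \<xi> \<phi>) = \<eta>2 \<delta>'"
            unfolding eq[OF \<delta>'(1)] \<delta>'(2) *(4)[symmetric] by (rule Aff_conj_star[OF \<xi> *(2), symmetric])
          then have "map_prod (conjm \<xi> \<phi>) \<delta>' \<in> lifted M \<eta>2" by (rule liftedI[where \<eta> = \<eta>2, OF c\<xi>[OF *(2)] \<delta>'(1)])
          moreover have "F (map_prod (conjm \<xi> \<phi>) \<delta>') = g" unfolding F inv1 \<delta>'(2) *(1) ..
          ultimately show "g \<in> F ` lifted M \<eta>2" by (metis imageI)
        qed
      qed
    qed
    fix g h assume "g \<in> lifted M \<eta>2" "h \<in> lifted M \<eta>2"
    then obtain \<phi> \<delta> \<phi>' \<delta>' where *: "g = map_prod \<phi> \<delta>" "\<delta> \<in> Delta" "h = map_prod \<phi>' \<delta>'" "\<delta>' \<in> Delta"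
      unfolding lifted_def by blast
    show "F (g \<circ> h) = F g \<circ> F h"
      unfolding *(1,3) F map_prod_comp conjm_comp[OF b(2), symmetric] \<sigma>(2)[OF *(2,4), symmetric] ..
  next
    have "F ` extended M = (\<lambda>\<mu>. map_prod \<mu> id) ` conjm \<zeta> ` M"
      unfolding extended_def image_image F \<sigma>id ..
    then show "F ` extended M = extended M"
      using \<zeta> unfolding extended_def normalizing_affinities_iff by simp
  qed
qed

end

section \<open>Classes of homomorphisms under conjugation and automorphisms of \<Delta>, and the
  evaluation of \<open>psi\<close>\<close>

section \<open>Classes in \<open>Aff(\<Delta>, M)\<close>\<close>

lemma auto_Delta_iff:
  "\<sigma> \<in> auto Delta_group \<longleftrightarrow> \<sigma> \<in> extensional Delta \<and> bij_betw \<sigma> Delta Delta \<and>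
    (\<forall>f\<in>Delta. \<forall>g\<in>Delta. \<sigma> (f \<circ> g) = \<sigma> f \<circ> \<sigma> g)"
proof -
  have "\<sigma> \<in> hom Delta_group Delta_group \<longleftrightarrow> \<sigma> \<in> Delta \<rightarrow> Delta \<and> (\<forall>f\<in>Delta. \<forall>g\<in>Delta. \<sigma> (f \<circ> g) = \<sigma> f \<circ> \<sigma> g)"
    unfolding hom_def by (auto simp: tgroup_mult[OF tgroup_Delta] Pi_iff simp del: comp_apply)
  then show ?thesis unfolding auto_def Bij_def by (auto simp: bij_betw_def simp del: comp_apply)
qed

definition conj_Delta :: "(real \<Rightarrow> real) \<Rightarrow> (real \<Rightarrow> real) \<Rightarrow> real \<Rightarrow> real" where
  "conj_Delta d = (\<lambda>x\<in>Delta. conjm d x)"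

lemma Inn_Delta: "Inn Delta_group = conj_Delta ` Delta"
proof -
  have "(\<lambda>x\<in>carrier Delta_group. g \<otimes>\<^bsub>Delta_group\<^esub> x \<otimes>\<^bsub>Delta_group\<^esub> inv\<^bsub>Delta_group\<^esub> g) = conj_Delta g"
    if "g \<in> Delta" for g
    using that tgroupD[OF tgroup_Delta] unfolding conj_Delta_def trans_group_simps(1)
    by (intro restrict_ext) (simp_all add: tgroup_mult[OF tgroup_Delta] tgroup_inv[OF tgroup_Delta])
  then show ?thesis unfolding Inn_def Setcompr_eq_image trans_group_simps(1) by (intro image_cong) auto
qed

lemma conjm_Delta: "d \<in> Delta \<Longrightarrow> x \<in> Delta \<Longrightarrow> conjm d x \<in> Delta"
  by (intro tgroupD(3,4)[OF tgroup_Delta])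

lemma conj_Delta_auto: "d \<in> Delta \<Longrightarrow> conj_Delta d \<in> auto Delta_group"
  unfolding auto_Delta_iff
proof (intro conjI ballI)
  assume d: "d \<in> Delta"
  note b = tgroupD(1)[OF tgroup_Delta d]
  show "conj_Delta d \<in> extensional Delta" by (simp add: conj_Delta_def)
  show "bij_betw (conj_Delta d) Delta Delta"
  proof (rule bij_betw_byWitness[where f' = "conj_Delta (finv d)"])
    have i: "finv d \<in> Delta" by (rule tgroupD(4)[OF tgroup_Delta d])
    have e: "conjm (finv d) (conjm d x) = x" "conjm d (conjm (finv d) x) = x" for x
      using b by (simp_all add: fun_eq_iff inv_inv_eq)
    show "\<forall>x\<in>Delta. conj_Delta (finv d) (conj_Delta d x) = x" "\<forall>x\<in>Delta. conj_Delta d (conj_Delta (finv d) x) = x"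
      unfolding conj_Delta_def using conjm_Delta[OF d] conjm_Delta[OF i] e by simp_all
    show "conj_Delta d ` Delta \<subseteq> Delta" "conj_Delta (finv d) ` Delta \<subseteq> Delta"
      unfolding conj_Delta_def using conjm_Delta[OF d] conjm_Delta[OF i] by auto
  qed
  fix f g assume "f \<in> Delta" "g \<in> Delta"
  then show "conj_Delta d (f \<circ> g) = conj_Delta d f \<circ> conj_Delta d g"
    unfolding conj_Delta_def using tgroupD(3)[OF tgroup_Delta] conjm_comp[OF b] by simp
qed

lemma auto_Delta_D:
  assumes "\<sigma> \<in> auto Delta_group"
  shows "\<sigma> \<in> Bij Delta" "\<delta> \<in> Delta \<Longrightarrow> \<sigma> \<delta> \<in> Delta" "bij_betw \<sigma> Delta Delta"
    "f \<in> Delta \<Longrightarrow> g \<in> Delta \<Longrightarrow> \<sigma> (f \<circ> g) = \<sigma> f \<circ> \<sigma> g"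
  using assms by (auto simp: auto_Delta_iff Bij_def bij_betw_def simp del: comp_apply)

lemma compose_auto:
  assumes "\<sigma> \<in> auto Delta_group" "\<tau> \<in> auto Delta_group"
  shows "compose Delta \<sigma> \<tau> \<in> auto Delta_group"
proof -
  have "compose Delta \<sigma> \<tau> = \<sigma> \<otimes>\<^bsub>AutoGroup Delta_group\<^esub> \<tau>"
    using auto_Delta_D(1)[OF assms(1)] auto_Delta_D(1)[OF assms(2)] by (simp add: AutoGroup_def mult_BijGroup)
  moreover have "carrier (AutoGroup Delta_group) = auto Delta_group" by (simp add: AutoGroup_def)
  ultimately show ?thesis
    using monoid.m_closed[OF group.is_monoid[OF group.AutoGroup[OF group_Delta]], of \<sigma> \<tau>] assms by simp
qed

text \<open>An element of Out(\<Delta>), a coset of Inn(\<Delta>), with the product of automorphisms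
  written as \<open>compose\<close>.\<close>

definition Inn_coset :: "((real \<Rightarrow> real) \<Rightarrow> real \<Rightarrow> real) \<Rightarrow> ((real \<Rightarrow> real) \<Rightarrow> real \<Rightarrow> real) set" where
  "Inn_coset \<sigma> = (\<lambda>d. compose Delta (conj_Delta d) \<sigma>) ` Delta"

lemma carrier_Out: "carrier (Out Delta_group) = Inn_coset ` auto Delta_group"
proof -
  have "Inn Delta_group #>\<^bsub>AutoGroup Delta_group\<^esub> \<sigma> = Inn_coset \<sigma>" if \<sigma>: "\<sigma> \<in> auto Delta_group" for \<sigma>
  proof -
    have "conj_Delta d \<otimes>\<^bsub>AutoGroup Delta_group\<^esub> \<sigma> = compose Delta (conj_Delta d) \<sigma>" if "d \<in> Delta" for d
      using auto_Delta_D(1)[OF \<sigma>] auto_Delta_D(1)[OF conj_Delta_auto[OF that]] by (simp add: AutoGroup_def mult_BijGroup)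
    then show ?thesis unfolding r_coset_def Inn_Delta Inn_coset_def by auto
  qed
  then show ?thesis unfolding Out_def FactGroup_def RCOSETS_def by (auto simp: AutoGroup_def)
qed

text \<open>Normality of Inn(\<Delta>): \<sigma> after conjugation by d is conjugation by \<sigma> d
  after \<sigma>.\<close>

lemma compose_Inn_coset:
  assumes \<sigma>: "\<sigma> \<in> auto Delta_group" and \<tau>: "\<tau> \<in> auto Delta_group"
  shows "compose Delta \<sigma> ` Inn_coset \<tau> = Inn_coset (compose Delta \<sigma> \<tau>)"
proof -
  have "compose Delta \<sigma> (compose Delta (conj_Delta d) \<tau>) = compose Delta (conj_Delta (\<sigma> d)) (compose Delta \<sigma> \<tau>)"
    if d: "d \<in> Delta" for d
  proof
    fix x
    show "compose Delta \<sigma> (compose Delta (conj_Delta d) \<tau>) x = compose Delta (conj_Delta (\<sigma> d)) (compose Delta \<sigma> \<tau>) x"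
    proof (cases "x \<in> Delta")
      case True
      define y where "y = \<tau> x"
      have y: "y \<in> Delta" unfolding y_def by (rule auto_Delta_D(2)[OF \<tau> True])
      have i: "finv d \<in> Delta" by (rule tgroupD(4)[OF tgroup_Delta d])
      have "\<sigma> (finv d) = finv (\<sigma> d)"
      proof (rule inv_unique_comp[symmetric])
        have id: "\<sigma> id = id"
        proof -
          have ii: "id \<in> Delta" by (rule tgroupD(2)[OF tgroup_Delta])
          have bi: "bij (\<sigma> id)" by (rule tgroupD(1)[OF tgroup_Delta auto_Delta_D(2)[OF \<sigma> ii]])
          have "\<sigma> id \<circ> \<sigma> id = \<sigma> id" using auto_Delta_D(4)[OF \<sigma> ii ii] by simp
          then have "finv (\<sigma> id) \<circ> (\<sigma> id \<circ> \<sigma> id) = finv (\<sigma> id) \<circ> \<sigma> id" by simp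
          then show ?thesis unfolding comp_assoc[symmetric] inv_comp_bij[OF bi] id_comp .
        qed
        show "\<sigma> d \<circ> \<sigma> (finv d) = id" "\<sigma> (finv d) \<circ> \<sigma> d = id"
          using auto_Delta_D(4)[OF \<sigma> d i] auto_Delta_D(4)[OF \<sigma> i d] tgroupD(1)[OF tgroup_Delta d] id by simp_all
      qed
      then have "\<sigma> (conjm d y) = conjm (\<sigma> d) (\<sigma> y)"
        using auto_Delta_D(4)[OF \<sigma> tgroupD(3)[OF tgroup_Delta d y] i] auto_Delta_D(4)[OF \<sigma> d y] by simp
      then show ?thesis
        using True y auto_Delta_D(2)[OF \<sigma> y] by (simp add: compose_def conj_Delta_def y_def[symmetric])
    qed (simp add: compose_def)
  qed
  then have "compose Delta \<sigma> ` Inn_coset \<tau> = (\<lambda>d. compose Delta (conj_Delta d) (compose Delta \<sigma> \<tau>)) ` \<sigma> ` Delta"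
    unfolding Inn_coset_def image_image by (rule image_cong[OF refl])
  then show ?thesis using auto_Delta_D(3)[OF \<sigma>] unfolding Inn_coset_def bij_betw_def by simp
qed

lemma compose_compose_Delta:
  assumes "\<tau> \<in> auto Delta_group"
  shows "compose Delta (compose Delta f \<sigma>) \<tau> = compose Delta f (compose Delta \<sigma> \<tau>)"
  using auto_Delta_D(2)[OF assms] by (auto simp: compose_def)

lemma Inn_coset_auto: "\<tau> \<in> auto Delta_group \<Longrightarrow> s \<in> Inn_coset \<tau> \<Longrightarrow> s \<in> auto Delta_group"
  unfolding Inn_coset_def using compose_auto conj_Delta_auto by blast

lemma compose_auto_surj:
  assumes \<sigma>: "\<sigma> \<in> auto Delta_group"
  shows "compose Delta \<sigma> ` auto Delta_group = auto Delta_group"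
proof -
  have "compose Delta \<sigma> \<tau> = \<sigma> \<otimes>\<^bsub>AutoGroup Delta_group\<^esub> \<tau>" if "\<tau> \<in> auto Delta_group" for \<tau>
    using auto_Delta_D(1)[OF \<sigma>] auto_Delta_D(1)[OF that] by (simp add: AutoGroup_def mult_BijGroup)
  then have "compose Delta \<sigma> ` auto Delta_group = (\<lambda>\<tau>. \<sigma> \<otimes>\<^bsub>AutoGroup Delta_group\<^esub> \<tau>) ` auto Delta_group"
    by (rule image_cong[OF refl])
  moreover have "carrier (AutoGroup Delta_group) = auto Delta_group" by (simp add: AutoGroup_def)
  ultimately show ?thesis
    using group.surj_const_mult[OF group.AutoGroup[OF group_Delta], of \<sigma>] \<sigma> by simp
qed

context crystal
begin

text \<open>Conjugating further by \<zeta> amounts to conjugating by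
  \<open>\<zeta> \<circ> \<xi>\<close>, which again runs over the whole normalizer.\<close>

lemma Aff_orbit_twist:
  assumes \<eta>1: "\<eta>1 \<in> hom Delta_group (Aff M)" and \<xi>: "\<xi> \<in> normalizing_affinities M"
    and \<sigma>: "\<sigma> \<in> auto Delta_group"
    and eq: "\<And>\<delta>. \<delta> \<in> Delta \<Longrightarrow> \<eta>2 \<delta> = Aff_conj M (star UNIV M \<xi>) (\<eta>1 (\<sigma> \<delta>))"
  shows "Aff_orbit M \<eta>2 = (\<lambda>\<eta>. compose Delta \<eta> \<sigma>) ` Aff_orbit M \<eta>1"
proof -
  let ?S = "star UNIV M ` normalizing_affinities M"
  define tw where "tw \<eta> \<zeta> = (\<lambda>\<delta>\<in>Delta. Aff_conj M (star UNIV M \<zeta>) (\<eta> \<delta>))" for \<eta> :: "(real \<Rightarrow> real) \<Rightarrow> 'a set \<Rightarrow> 'a set" and \<zeta>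
  have orb: "Aff_orbit M \<eta> = tw \<eta> ` normalizing_affinities M" for \<eta>
    unfolding Aff_orbit_def carrier_Aff image_image tw_def ..
  have 1: "tw \<eta>2 \<zeta> = compose Delta (tw \<eta>1 (\<zeta> \<circ> \<xi>)) \<sigma>" if \<zeta>: "\<zeta> \<in> normalizing_affinities M" for \<zeta>
  proof
    fix \<delta>
    show "tw \<eta>2 \<zeta> \<delta> = compose Delta (tw \<eta>1 (\<zeta> \<circ> \<xi>)) \<sigma> \<delta>"
    proof (cases "\<delta> \<in> Delta")
      case True
      note s = auto_Delta_D(2)[OF \<sigma> True]
      obtain \<psi> where \<psi>: "\<psi> \<in> normalizing_affinities M" "star UNIV M \<psi> = \<eta>1 (\<sigma> \<delta>)"
        by (rule lift_exists[OF \<eta>1 s])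
      have c: "conjm \<xi> \<psi> \<in> normalizing_affinities M"
        by (intro normalizing_affinities_comp normalizing_affinities_inv \<psi> \<xi>)
      show ?thesis
        using True s unfolding tw_def compose_def
        by (simp only: restrict_apply if_True eq[OF True] Aff_conj_star[OF \<xi> \<psi>(1)] Aff_conj_star[OF \<zeta> c]
          Aff_conj_star[OF normalizing_affinities_comp[OF \<zeta> \<xi>] \<psi>(1)]
          conjm_conjm[OF normalizing_affinities_D(1)[OF \<zeta>] normalizing_affinities_D(1)[OF \<xi>]] \<psi>(2)[symmetric])
    qed (simp add: tw_def compose_def)
  qed
  have "(\<lambda>\<zeta>. \<zeta> \<circ> \<xi>) ` normalizing_affinities M = normalizing_affinities M"
  proof
    show "(\<lambda>\<zeta>. \<zeta> \<circ> \<xi>) ` normalizing_affinities M \<subseteq> normalizing_affinities M"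
      using normalizing_affinities_comp[OF _ \<xi>] by blast
    show "normalizing_affinities M \<subseteq> (\<lambda>\<zeta>. \<zeta> \<circ> \<xi>) ` normalizing_affinities M"
    proof
      fix \<zeta> assume "\<zeta> \<in> normalizing_affinities M"
      then have "\<zeta> \<circ> finv \<xi> \<in> normalizing_affinities M"
        by (intro normalizing_affinities_comp normalizing_affinities_inv \<xi>)
      moreover have "\<zeta> = (\<zeta> \<circ> finv \<xi>) \<circ> \<xi>" unfolding comp_assoc using normalizing_affinities_D(1)[OF \<xi>] by simp
      ultimately show "\<zeta> \<in> (\<lambda>\<zeta>. \<zeta> \<circ> \<xi>) ` normalizing_affinities M" by (metis imageI)
    qed
  qed
  then have "(\<lambda>\<eta>. compose Delta \<eta> \<sigma>) ` Aff_orbit M \<eta>1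
    = (\<lambda>\<eta>. compose Delta \<eta> \<sigma>) ` tw \<eta>1 ` (\<lambda>\<zeta>. \<zeta> \<circ> \<xi>) ` normalizing_affinities M"
    unfolding orb by simp
  also have "\<dots> = tw \<eta>2 ` normalizing_affinities M"
    unfolding image_image using 1 by (intro image_cong) auto
  finally show ?thesis unfolding orb by simp
qed

text \<open>A class is a set of sets of homomorphisms indexed by cosets of automorphisms \<tau>.
  Twisting by \<sigma> replaces \<tau> by \<sigma> \<tau>, a permutation of the
  automorphisms.\<close>

lemma Aff_class_twist:
  assumes \<eta>1: "\<eta>1 \<in> hom Delta_group (Aff M)" and \<xi>: "\<xi> \<in> normalizing_affinities M"
    and \<sigma>: "\<sigma> \<in> auto Delta_group"
    and eq: "\<And>\<delta>. \<delta> \<in> Delta \<Longrightarrow> \<eta>2 \<delta> = Aff_conj M (star UNIV M \<xi>) (\<eta>1 (\<sigma> \<delta>))"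
  shows "Aff_class M \<eta>2 = Aff_class M \<eta>1"
proof -
  have "Out_act (Aff_orbit M \<eta>2) (Inn_coset \<tau>) = Out_act (Aff_orbit M \<eta>1) (Inn_coset (compose Delta \<sigma> \<tau>))"
    if \<tau>: "\<tau> \<in> auto Delta_group" for \<tau>
  proof -
    have U: "Out_act X g = (\<Union>\<eta>\<in>X. compose Delta \<eta> ` g)" for X :: "((real \<Rightarrow> real) \<Rightarrow> 'a set \<Rightarrow> 'a set) set" and g
      unfolding Out_act_def by blast
    have orb: "Aff_orbit M \<eta>2 = (\<lambda>\<eta>. compose Delta \<eta> \<sigma>) ` Aff_orbit M \<eta>1"
      by (rule Aff_orbit_twist[OF assms])
    have "Out_act (Aff_orbit M \<eta>2) (Inn_coset \<tau>) = (\<Union>\<eta>\<in>Aff_orbit M \<eta>1. compose Delta (compose Delta \<eta> \<sigma>) ` Inn_coset \<tau>)"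
      unfolding U orb by (rule UN_extend_simps(10)[symmetric])
    also have "\<dots> = (\<Union>\<eta>\<in>Aff_orbit M \<eta>1. compose Delta \<eta> ` compose Delta \<sigma> ` Inn_coset \<tau>)"
      unfolding image_image
      by (intro SUP_cong image_cong refl compose_compose_Delta Inn_coset_auto[OF \<tau>])
    also have "\<dots> = Out_act (Aff_orbit M \<eta>1) (compose Delta \<sigma> ` Inn_coset \<tau>)"
      unfolding U ..
    finally show ?thesis unfolding compose_Inn_coset[OF \<sigma> \<tau>] .
  qed
  then have "Aff_class M \<eta>2 = (\<lambda>\<tau>. Out_act (Aff_orbit M \<eta>1) (Inn_coset \<tau>)) ` compose Delta \<sigma> ` auto Delta_group"
    unfolding Aff_class_def carrier_Out image_image by (rule image_cong[OF refl])
  then show ?thesis unfolding compose_auto_surj[OF \<sigma>] unfolding Aff_class_def carrier_Out image_image .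
qed

text \<open>\<eta>2 occurs in the union of its own class, through the identity conjugation and the
  identity automorphism; its occurrence in the equal class of \<eta>1 exhibits \<xi> and
  \<sigma>.\<close>

lemma Aff_class_eqD:
  assumes \<eta>2: "\<eta>2 \<in> hom Delta_group (Aff M)" "\<eta>2 \<in> extensional Delta"
    and eq: "Aff_class M \<eta>2 = Aff_class M \<eta>1"
  obtains \<xi> \<sigma> where "\<xi> \<in> normalizing_affinities M" "\<sigma> \<in> auto Delta_group"
    "\<And>\<delta>. \<delta> \<in> Delta \<Longrightarrow> \<eta>2 \<delta> = Aff_conj M (star UNIV M \<xi>) (\<eta>1 (\<sigma> \<delta>))"
proof -
  define I where "I = conj_Delta id"
  have idD: "id \<in> Delta" by (rule tgroupD(2)[OF tgroup_Delta])
  have I: "I \<in> auto Delta_group" unfolding I_def by (rule conj_Delta_auto[OF idD])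
  have Ix: "I x = x" if "x \<in> Delta" for x using that by (simp add: I_def conj_Delta_def)
  have "\<eta>2 \<in> Aff_orbit M \<eta>2"
  proof -
    have "\<eta>2 = (\<lambda>\<delta>\<in>Delta. Aff_conj M (star UNIV M id) (\<eta>2 \<delta>))"
    proof
      fix \<delta>
      show "\<eta>2 \<delta> = (\<lambda>\<delta>\<in>Delta. Aff_conj M (star UNIV M id) (\<eta>2 \<delta>)) \<delta>"
      proof (cases "\<delta> \<in> Delta")
        case True
        obtain \<psi> where \<psi>: "\<psi> \<in> normalizing_affinities M" "star UNIV M \<psi> = \<eta>2 \<delta>" by (rule lift_exists[OF \<eta>2(1) True])
        show ?thesis using True unfolding \<psi>(2)[symmetric]
          by (simp only: restrict_apply if_True \<psi>(2)[symmetric] Aff_conj_star[OF id_normalizing \<psi>(1)] conjm_id(1))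
      qed (use \<eta>2(2) in \<open>simp add: extensional_def\<close>)
    qed
    then show ?thesis unfolding Aff_orbit_def carrier_Aff using id_normalizing by blast
  qed
  moreover have "I \<in> Inn_coset I"
  proof -
    have "compose Delta (conj_Delta id) I = I"
      using auto_Delta_D(2)[OF I] Ix I by (auto simp: compose_def I_def[symmetric] auto_Delta_iff extensional_def)
    then show ?thesis unfolding Inn_coset_def using idD by (metis imageI)
  qed
  moreover have "compose Delta \<eta>2 I = \<eta>2" using Ix \<eta>2(2) by (auto simp: compose_def extensional_def)
  ultimately have "\<eta>2 \<in> Out_act (Aff_orbit M \<eta>2) (Inn_coset I)" unfolding Out_act_def by (metis (mono_tags, lifting) mem_Collect_eq)
  then have "\<eta>2 \<in> \<Union>(Aff_class M \<eta>2)" unfolding Aff_class_def carrier_Out using I by blast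
  then obtain \<tau> where \<tau>: "\<tau> \<in> auto Delta_group" "\<eta>2 \<in> Out_act (Aff_orbit M \<eta>1) (Inn_coset \<tau>)"
    unfolding eq unfolding Aff_class_def carrier_Out by blast
  then obtain \<eta> \<sigma> where *: "\<eta> \<in> Aff_orbit M \<eta>1" "\<sigma> \<in> Inn_coset \<tau>" "\<eta>2 = compose Delta \<eta> \<sigma>"
    unfolding Out_act_def by blast
  have \<sigma>: "\<sigma> \<in> auto Delta_group" by (rule Inn_coset_auto[OF \<tau>(1) *(2)])
  obtain \<xi> where \<xi>: "\<xi> \<in> normalizing_affinities M" "\<eta> = (\<lambda>\<delta>\<in>Delta. Aff_conj M (star UNIV M \<xi>) (\<eta>1 \<delta>))"
    using *(1) unfolding Aff_orbit_def carrier_Aff by blast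
  have "\<eta>2 \<delta> = Aff_conj M (star UNIV M \<xi>) (\<eta>1 (\<sigma> \<delta>))" if "\<delta> \<in> Delta" for \<delta>
    using that auto_Delta_D(2)[OF \<sigma> that] by (simp add: *(3) compose_def \<xi>(2))
  then show thesis using that \<xi>(1) \<sigma> by blast
qed

text \<open>All later reasoning about \<open>psi\<close> goes through this equivalence. The
  description is unique because representatives of one class are twists of each other, so their
  fibre products are isomorphic, and each construction is isomorphic to its fibre product.\<close>

theorem psi_eq_iff:
  assumes \<eta>: "\<eta> \<in> Hom_f M" and pair: "(\<Gamma>, N) \<in> space_pairs M"
  shows "psi M (Aff_class M \<eta>) = Iso_class M \<Gamma> N \<longleftrightarrow> group_pair_iso (lifted M \<eta>) (extended M) \<Gamma> N"
proof -
  have hom: "\<eta>' \<in> hom Delta_group (Aff M)" "\<eta>' \<in> extensional Delta" if "\<eta>' \<in> Hom_f M" for \<eta>'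
    using that by (auto simp: Hom_f_def)
  note h = hom[OF \<eta>]
  have lift: "group_pair_iso (lifted M \<eta>') (extended M) \<Gamma>' N'" "(\<Gamma>', N') \<in> space_pairs M"
    if "\<eta>' \<in> Hom_f M" "constructed_from M \<eta>' C \<Gamma>' N'" for \<eta>' C \<Gamma>' N'
  proof -
    note c = constructed_from_conj[OF crystal_axioms hom(1)[OF that(1)] that(2)]
    show "group_pair_iso (lifted M \<eta>') (extended M) \<Gamma>' N'"
      unfolding c(2,3) by (rule group_pair_iso_conjm[OF c(1)])
    show "(\<Gamma>', N') \<in> space_pairs M" by (rule constructed_in_space_pairs[OF hom(1)[OF that(1)] that(2)])
  qed
  obtain C \<Gamma>0 N0 where c0: "constructed_from M \<eta> C \<Gamma>0 N0" using construction_exists[OF \<eta>] by blast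
  note l0 = lift[OF \<eta> c0]
  have "psi M (Aff_class M \<eta>) = Iso_class M \<Gamma>0 N0"
    unfolding psi_def
  proof (rule the_equality)
    have "Iso_class M \<Gamma>0 N0 \<in> Iso_Delta M" unfolding Iso_class_def Iso_Delta_def using l0(2) by (rule quotientI)
    then show "Iso_class M \<Gamma>0 N0 \<in> Iso_Delta M \<and> (\<exists>\<eta>'\<in>Hom_f M. Aff_class M \<eta> = Aff_class M \<eta>' \<and>
      (\<exists>C \<Gamma> N. constructed_from M \<eta>' C \<Gamma> N \<and> Iso_class M \<Gamma>0 N0 = Iso_class M \<Gamma> N))"
      using \<eta> c0 by blast
    fix d assume "d \<in> Iso_Delta M \<and> (\<exists>\<eta>'\<in>Hom_f M. Aff_class M \<eta> = Aff_class M \<eta>' \<and>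
      (\<exists>C \<Gamma> N. constructed_from M \<eta>' C \<Gamma> N \<and> d = Iso_class M \<Gamma> N))"
    then obtain \<eta>' C' \<Gamma>' N' where *: "\<eta>' \<in> Hom_f M" "Aff_class M \<eta> = Aff_class M \<eta>'"
      "constructed_from M \<eta>' C' \<Gamma>' N'" "d = Iso_class M \<Gamma>' N'" by blast
    note l' = lift[OF *(1,3)]
    obtain \<xi> \<sigma> where \<xi>\<sigma>: "\<xi> \<in> normalizing_affinities M" "\<sigma> \<in> auto Delta_group"
      "\<And>\<delta>. \<delta> \<in> Delta \<Longrightarrow> \<eta> \<delta> = Aff_conj M (star UNIV M \<xi>) (\<eta>' (\<sigma> \<delta>))"
      using Aff_class_eqD[OF h *(2)] by metis
    have "group_pair_iso (lifted M \<eta>) (extended M) (lifted M \<eta>') (extended M)"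
      by (rule lifted_twist_iso[OF hom(1)[OF *(1)] h(1) \<xi>\<sigma>(1) auto_Delta_D(3)[OF \<xi>\<sigma>(2)] auto_Delta_D(4)[OF \<xi>\<sigma>(2)] \<xi>\<sigma>(3)])
    then have "group_pair_iso (lifted M \<eta>) (extended M) \<Gamma>' N'"
      using l'(1) by (rule group_pair_iso_trans)
    then have "group_pair_iso \<Gamma>' N' \<Gamma>0 N0"
      using group_pair_iso_trans[OF group_pair_iso_sym[OF tgroup_lifted[OF h(1)] extended_subset[OF h(1)]] l0(1)] by blast
    then show "d = Iso_class M \<Gamma>0 N0" unfolding *(4) Iso_class_eq_iff[OF l'(2) l0(2)] .
  qed
  moreover have "group_pair_iso \<Gamma>0 N0 \<Gamma> N \<longleftrightarrow> group_pair_iso (lifted M \<eta>) (extended M) \<Gamma> N"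
    using group_pair_iso_trans[OF l0(1)]
      group_pair_iso_trans[OF group_pair_iso_sym[OF tgroup_lifted[OF h(1)] extended_subset[OF h(1)] l0(1)]] by blast
  ultimately show ?thesis using Iso_class_eq_iff[OF l0(2) pair] by simp
qed

lemma hom_twist:
  assumes \<eta>: "\<eta> \<in> hom Delta_group (Aff M)" and \<xi>: "\<xi> \<in> normalizing_affinities M"
    and \<sigma>: "\<sigma> \<in> auto Delta_group"
  shows "(\<lambda>\<delta>. Aff_conj M (star UNIV M \<xi>) (\<eta> (\<sigma> \<delta>))) \<in> hom Delta_group (Aff M)"
proof (rule homI)
  fix x assume "x \<in> carrier Delta_group"
  then obtain \<psi> where \<psi>: "\<psi> \<in> normalizing_affinities M" "star UNIV M \<psi> = \<eta> (\<sigma> x)"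
    using lift_exists[OF \<eta> auto_Delta_D(2)[OF \<sigma>]] by auto
  show "Aff_conj M (star UNIV M \<xi>) (\<eta> (\<sigma> x)) \<in> carrier (Aff M)"
    unfolding \<psi>(2)[symmetric] Aff_conj_star[OF \<xi> \<psi>(1)] carrier_Aff
    by (intro imageI normalizing_affinities_comp normalizing_affinities_inv \<xi> \<psi>(1))
next
  fix x y assume "x \<in> carrier Delta_group" "y \<in> carrier Delta_group"
  then have xy: "x \<in> Delta" "y \<in> Delta" by simp_all
  obtain \<psi> where \<psi>: "\<psi> \<in> normalizing_affinities M" "star UNIV M \<psi> = \<eta> (\<sigma> x)"
    using lift_exists[OF \<eta> auto_Delta_D(2)[OF \<sigma> xy(1)]] by blast
  obtain \<psi>' where \<psi>': "\<psi>' \<in> normalizing_affinities M" "star UNIV M \<psi>' = \<eta> (\<sigma> y)"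
    using lift_exists[OF \<eta> auto_Delta_D(2)[OF \<sigma> xy(2)]] by blast
  have c: "conjm \<xi> \<phi> \<in> normalizing_affinities M" if "\<phi> \<in> normalizing_affinities M" for \<phi>
    by (intro normalizing_affinities_comp normalizing_affinities_inv \<xi> that)
  have "\<eta> (\<sigma> (x \<circ> y)) = star UNIV M (\<psi> \<circ> \<psi>')"
    unfolding auto_Delta_D(4)[OF \<sigma> xy] hom_Delta_comp[OF \<eta> auto_Delta_D(2)[OF \<sigma> xy(1)] auto_Delta_D(2)[OF \<sigma> xy(2)]]
      \<psi>(2)[symmetric] \<psi>'(2)[symmetric] by (rule mult_Aff[OF \<psi>(1) \<psi>'(1)])
  then have "Aff_conj M (star UNIV M \<xi>) (\<eta> (\<sigma> (x \<circ> y))) = Aff_conj M (star UNIV M \<xi>) (\<eta> (\<sigma> x)) \<otimes>\<^bsub>Aff M\<^esub> Aff_conj M (star UNIV M \<xi>) (\<eta> (\<sigma> y))"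
    unfolding \<psi>(2)[symmetric] \<psi>'(2)[symmetric]
    by (simp only: Aff_conj_star[OF \<xi> \<psi>(1)] Aff_conj_star[OF \<xi> \<psi>'(1)]
      Aff_conj_star[OF \<xi> normalizing_affinities_comp[OF \<psi>(1) \<psi>'(1)]] mult_Aff[OF c[OF \<psi>(1)] c[OF \<psi>'(1)]]
      conjm_comp[OF normalizing_affinities_D(1)[OF \<xi>]])
  then show "Aff_conj M (star UNIV M \<xi>) (\<eta> (\<sigma> (x \<otimes>\<^bsub>Delta_group\<^esub> y))) = Aff_conj M (star UNIV M \<xi>) (\<eta> (\<sigma> x)) \<otimes>\<^bsub>Aff M\<^esub> Aff_conj M (star UNIV M \<xi>) (\<eta> (\<sigma> y))"
    using tgroup_mult[OF tgroup_Delta xy] by simp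
qed

text \<open>An element of \<open>Aff(\<Delta>, M)\<close> is determined by the corresponding class of pairs; exchanging the
  two elements amounts to composing with the automorphism of \<open>\<Delta>\<close> induced by \<open>t \<mapsto> 1/2 - t\<close>.\<close>

lemma Aff_class_eqI:
  assumes \<eta>1: "\<eta>1 \<in> hom Delta_group (Aff M)" and \<eta>2: "\<eta>2 \<in> hom Delta_group (Aff M)"
    and eq: "pair_conj_class M {\<eta>2 delta1, \<eta>2 delta2} = pair_conj_class M {\<eta>1 delta1, \<eta>1 delta2}"
  shows "Aff_class M \<eta>2 = Aff_class M \<eta>1"
proof -
  have lft: "\<exists>\<psi>. \<psi> \<in> normalizing_affinities M \<and> star UNIV M \<psi> = \<eta> \<delta>"
    if "\<eta> \<in> hom Delta_group (Aff M)" "\<delta> \<in> Delta" for \<eta> \<delta>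
    using lift_exists[OF that] by blast
  have "{\<eta>2 delta1, \<eta>2 delta2} \<in> pair_conj_class M {\<eta>2 delta1, \<eta>2 delta2}"
  proof -
    have e: "Aff_conj M (star UNIV M id) (\<eta>2 \<delta>) = \<eta>2 \<delta>" if \<delta>: "\<delta> \<in> Delta" for \<delta>
    proof -
      obtain \<psi> where \<psi>: "\<psi> \<in> normalizing_affinities M" "star UNIV M \<psi> = \<eta>2 \<delta>" using lft[OF \<eta>2 \<delta>] by blast
      show ?thesis unfolding \<psi>(2)[symmetric] Aff_conj_star[OF id_normalizing \<psi>(1)] conjm_id(1) ..
    qed
    have e': "Aff_conj M (star UNIV M id) ` {\<eta>2 delta1, \<eta>2 delta2} = {\<eta>2 delta1, \<eta>2 delta2}"
      using e[OF delta_in_Delta(1)] e[OF delta_in_Delta(2)] by simp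
    have "Aff_conj M (star UNIV M id) ` {\<eta>2 delta1, \<eta>2 delta2} \<in> pair_conj_class M {\<eta>2 delta1, \<eta>2 delta2}"
      unfolding pair_conj_class_def carrier_Aff by (intro imageI id_normalizing)
    then show ?thesis unfolding e' .
  qed
  then have "{\<eta>2 delta1, \<eta>2 delta2} \<in>
      (\<lambda>\<xi>. Aff_conj M (star UNIV M \<xi>) ` {\<eta>1 delta1, \<eta>1 delta2}) ` normalizing_affinities M"
    unfolding eq unfolding pair_conj_class_def carrier_Aff image_image[of _ "star UNIV M"] .
  then obtain \<xi> where \<xi>: "\<xi> \<in> normalizing_affinities M"
    "{\<eta>2 delta1, \<eta>2 delta2} = Aff_conj M (star UNIV M \<xi>) ` {\<eta>1 delta1, \<eta>1 delta2}"
    by (rule imageE) simp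
  let ?c = "Aff_conj M (star UNIV M \<xi>)"
  \<comment> \<open>The reflection in 1/4, which exchanges the fixed points 0 and 1/2 of the two
    generators.\<close>
  define s where "s = (\<lambda>t::real. 1/2 - t)"
  have s: "bij s" "finv s = s"
    unfolding s_def by (auto intro!: involuntory_imp_bij inv_unique_comp)
  have s1: "conjm s delta1 = delta2" "conjm s delta2 = delta1"
    unfolding s(2) by (auto simp: s_def delta1_def delta2_def)
  have sD: "conjm s \<delta> \<in> Delta" if "\<delta> \<in> Delta" for \<delta>
    using that
  proof (induction rule: Delta_induct)
    case id
    show ?case unfolding conjm_id(2)[OF s(1)] by (rule tgroupD(2)[OF tgroup_Delta])
  next
    case (comp f g)
    show ?case unfolding conjm_comp[OF s(1)] by (rule tgroupD(3)[OF tgroup_Delta comp(3,4)])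
  qed (simp_all only: s1 delta_in_Delta)
  define swap where "swap = restrict (conjm s) Delta"
  have swap: "swap \<in> auto Delta_group"
    unfolding auto_Delta_iff
  proof (intro conjI ballI)
    show "swap \<in> extensional Delta" by (simp add: swap_def)
    have ss: "conjm s (conjm s x) = x" for x unfolding s(2) by (auto simp: s_def)
    show "bij_betw swap Delta Delta"
      by (rule bij_betw_byWitness[where f' = swap]) (auto simp: swap_def sD ss simp del: comp_apply)
    fix f g assume "f \<in> Delta" "g \<in> Delta"
    then show "swap (f \<circ> g) = swap f \<circ> swap g"
      unfolding swap_def using tgroupD(3)[OF tgroup_Delta] conjm_comp[OF s(1)] by simp
  qed
  have I: "conj_Delta id \<in> auto Delta_group" by (rule conj_Delta_auto[OF tgroupD(2)[OF tgroup_Delta]])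
  \<comment> \<open>The pair is unordered, so the conjugation may match the generators directly or
    crosswise; the second case is absorbed by \<open>swap\<close>.\<close>
  have "\<exists>\<sigma>\<in>auto Delta_group. \<eta>2 delta1 = ?c (\<eta>1 (\<sigma> delta1)) \<and> \<eta>2 delta2 = ?c (\<eta>1 (\<sigma> delta2))"
  proof -
    have "\<eta>2 delta1 = ?c (\<eta>1 delta1) \<and> \<eta>2 delta2 = ?c (\<eta>1 delta2) \<or>
      \<eta>2 delta1 = ?c (\<eta>1 delta2) \<and> \<eta>2 delta2 = ?c (\<eta>1 delta1)"
      using \<xi>(2) by (simp add: doubleton_eq_iff)
    then show ?thesis
    proof
      assume "\<eta>2 delta1 = ?c (\<eta>1 delta1) \<and> \<eta>2 delta2 = ?c (\<eta>1 delta2)"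
      then show ?thesis by (intro bexI[OF _ I]) (simp add: conj_Delta_def delta_in_Delta)
    next
      assume "\<eta>2 delta1 = ?c (\<eta>1 delta2) \<and> \<eta>2 delta2 = ?c (\<eta>1 delta1)"
      then show ?thesis by (intro bexI[OF _ swap]) (simp only: swap_def restrict_apply delta_in_Delta if_True s1)
    qed
  qed
  then obtain \<sigma> where \<sigma>: "\<sigma> \<in> auto Delta_group" "\<eta>2 delta1 = ?c (\<eta>1 (\<sigma> delta1))" "\<eta>2 delta2 = ?c (\<eta>1 (\<sigma> delta2))"
    by blast
  have "(\<lambda>\<delta>. ?c (\<eta>1 (\<sigma> \<delta>))) \<in> hom Delta_group (Aff M)"
    by (rule hom_twist[OF \<eta>1 \<xi>(1) \<sigma>(1)])
  then have "\<eta>2 \<delta> = ?c (\<eta>1 (\<sigma> \<delta>))" if "\<delta> \<in> Delta" for \<delta>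
    by (rule hom_Delta_eqI[OF \<eta>2 _ group_Aff \<sigma>(2,3) that])
  then show ?thesis by (rule Aff_class_twist[OF \<eta>1 \<xi>(1) \<sigma>(1)])
qed

end

section \<open>Deformations of a homomorphism by fixed vectors, and isomorphisms as
  deformations\<close>

section \<open>Deformation by fixed vectors\<close>

lemma linear_lin_Delta: "\<delta> \<in> Delta \<Longrightarrow> linear (lin \<delta>)"
proof -
  assume "\<delta> \<in> Delta"
  then obtain k :: int where "\<delta> = (\<lambda>t. of_int k + t) \<or> \<delta> = (\<lambda>t. of_int k - t)" using Delta_form by blast
  then have "lin \<delta> = (\<lambda>t. t) \<or> lin \<delta> = (\<lambda>t. - t)" by (auto simp: lin_def)
  then show ?thesis by (auto intro: linearI)
qed

text \<open>\<open>lin \<delta> 1\<close> is the sign of \<delta>, 1 for translations and -1 for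
  reflections; the shear calculation separates it from the value at 0.\<close>

lemma Delta_affine: "\<delta> \<in> Delta \<Longrightarrow> \<delta> t = \<delta> 0 + lin \<delta> 1 * t"
  using linear_scale[OF linear_lin_Delta, of \<delta> t 1] affine_decomp[of \<delta> t] by (simp add: mult.commute)

lemma lin_Delta_comp: "f \<in> Delta \<Longrightarrow> g \<in> Delta \<Longrightarrow> lin (f \<circ> g) 1 = lin f 1 * lin g 1"
  using Delta_affine[of f "g 1"] Delta_affine[of f "g 0"] by (simp add: lin_def algebra_simps)

context crystal
begin

text \<open>Fixed translations commute with M, so deforming lifts by them changes no outer class,
  and the deformed homomorphism stays in \<open>Hom_f\<close>.\<close>

lemma Omega_class_plus_fixed:
  assumes "v \<in> fixed" "\<phi> \<in> normalizing_affinities M"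
  shows "Omega_class ((+) v \<circ> \<phi>) = Omega_class \<phi>"
proof (rule Omega_class_eqI[OF normalizing_affinities_comp[OF plus_fixed_normalizing[OF assms(1)] assms(2)] assms(2) M(1)])
  fix \<mu> assume "\<mu> \<in> M"
  then have "conjm ((+) v) (conjm \<phi> \<mu>) = conjm \<phi> \<mu>"
    by (intro plus_fixed_conjm[OF assms(1)] normalizing_affinities_D(3)[OF assms(2)])
  then show "conjm ((+) v \<circ> \<phi>) \<mu> = conjm id (conjm \<phi> \<mu>)"
    unfolding conjm_conjm[OF bij_plus_left normalizing_affinities_D(1)[OF assms(2)]] conjm_id(1) .
qed

text \<open>Summing over the point group maps the lattice to fixed lattice vectors, and it
  multiplies a fixed vector by the order of the group. This is what relates \<open>fixed\<close> to
  the centre.\<close>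

lemma fixed_span: "fixed \<subseteq> span (transl M \<inter> fixed)"
proof
  fix v assume v: "v \<in> fixed"
  define Q where "Q x = (\<Sum>p\<in>lin ` M. p x)" for x
  have lp: "linear p" if "p \<in> lin ` M" for p using that D(2) by blast
  have Q: "linear Q"
    unfolding Q_def by (rule linear_compose_sum) (use lp in blast)
  have Qt: "Q t \<in> transl M" if t: "t \<in> transl M" for t
    unfolding Q_def by (rule additive_subgroup_sum[OF transl_subgroup]) (use lin_transl[OF D(4) t] in blast)
  have Qf: "Q x \<in> fixed" for x
    unfolding fixed_def
  proof (intro CollectI ballI)
    fix \<mu> assume \<mu>: "\<mu> \<in> M"
    have inj: "inj_on (\<lambda>p. lin \<mu> \<circ> p) (lin ` M)"
    proof (rule inj_onI, rule ext)
      fix p q x assume "lin \<mu> \<circ> p = lin \<mu> \<circ> q"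
      from fun_cong[OF this, of x] show "p x = q x"
        using injD[OF bij_is_inj[OF bij_lin[OF D(1)[OF \<mu>]]]] by (simp only: comp_apply)
    qed
    moreover have "(\<lambda>p. lin \<mu> \<circ> p) ` lin ` M \<subseteq> lin ` M"
      using M(2)[OF \<mu>] by (auto simp: lin_comp[OF D(2)[OF \<mu>], symmetric])
    ultimately have im: "(\<lambda>p. lin \<mu> \<circ> p) ` lin ` M = lin ` M"
      using finite_point_group endo_inj_surj by metis
    have "lin \<mu> (Q x) = (\<Sum>p\<in>lin ` M. (lin \<mu> \<circ> p) x)"
      unfolding Q_def by (simp add: linear_sum[OF D(2)[OF \<mu>]])
    also have "\<dots> = (\<Sum>p\<in>(\<lambda>p. lin \<mu> \<circ> p) ` lin ` M. p x)"
      using sum.reindex[OF inj, of "\<lambda>p. p x"] by (simp add: comp_def)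
    finally show "lin \<mu> (Q x) = Q x" unfolding im Q_def .
  qed
  have "v \<in> span (transl M)" using span_transl by simp
  then have "Q v \<in> span (Q ` transl M)" unfolding span_linear_image[OF Q] by (rule imageI)
  then have "Q v \<in> span (transl M \<inter> fixed)"
    by (rule subsetD[OF span_mono, rotated]) (use Qt Qf in blast)
  moreover have "Q v = real (card (lin ` M)) *\<^sub>R v"
  proof -
    have "Q v = (\<Sum>p\<in>lin ` M. v)" unfolding Q_def by (rule sum.cong) (use v in \<open>auto simp: fixed_def\<close>)
    then show ?thesis by (simp add: sum_constant_scaleR)
  qed
  ultimately have "real (card (lin ` M)) *\<^sub>R v \<in> span (transl M \<inter> fixed)" by simp
  from span_scale[OF this, of "1 / real (card (lin ` M))"]
  show "v \<in> span (transl M \<inter> fixed)" using finite_point_group M(1) by (simp add: card_gt_0_iff) (metis M(1) card_0_eq empty_iff finite_imageI image_is_empty scaleR_one nonzero_divide_eq_eq of_nat_eq_0_iff)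
qed

text \<open>The new homomorphism is obtained by conjugating with the shear \<open>(x, t) \<mapsto> (x + t w, t)\<close>.\<close>

theorem shear_deformation:
  assumes \<eta>: "\<eta> \<in> Hom_f M" and w: "w \<in> fixed"
    and \<phi>1: "\<phi>1 \<in> normalizing_affinities M" "star UNIV M \<phi>1 = \<eta> delta1" "lin \<phi>1 w = - w"
    and \<phi>2: "\<phi>2 \<in> normalizing_affinities M" "star UNIV M \<phi>2 = \<eta> delta2" "lin \<phi>2 w = - w"
  obtains \<eta>' where "\<eta>' \<in> Hom_f M" "\<eta>' delta1 = star UNIV M \<phi>1" "\<eta>' delta2 = star UNIV M ((+) w \<circ> \<phi>2)"
    "group_pair_iso (lifted M \<eta>) (extended M) (lifted M \<eta>') (extended M)"
proof -
  have \<eta>h: "\<eta> \<in> hom Delta_group (Aff M)" and fin: "finite (Omega M ` \<eta> ` Delta)"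
    using \<eta> by (auto simp: Hom_f_def)
  have fx: "lin \<mu> w = w" if "\<mu> \<in> M" for \<mu> using w that by (simp add: fixed_def)
  \<comment> \<open>Two lifts act alike on w as soon as one of them sends w to a multiple of itself,
    because the point group fixes w.\<close>
  have absorb: "lin \<phi> w = lin \<psi> w"
    if a: "\<phi> \<in> normalizing_affinities M" "\<psi> \<in> normalizing_affinities M" "star UNIV M \<phi> = star UNIV M \<psi>"
      "lin \<psi> w = c *\<^sub>R w" for \<phi> \<psi> c
  proof -
    obtain \<mu> where \<mu>: "\<mu> \<in> M" "\<phi> = \<mu> \<circ> \<psi>" using star_eq_iff[OF a(1,2)] a(3) by blast
    show ?thesis
      unfolding \<mu>(2) lin_comp[OF D(2)[OF \<mu>(1)]] using a(4) linear_scale[OF D(2)[OF \<mu>(1)]] fx[OF \<mu>(1)] by simp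
  qed
  \<comment> \<open>The hypothesis on the two generators spreads to all of \<Delta>: lifts of \<eta>
    \<delta> act on w by the sign of \<delta>.\<close>
  have lw: "\<forall>\<phi>\<in>normalizing_affinities M. star UNIV M \<phi> = \<eta> \<delta> \<longrightarrow> lin \<phi> w = lin \<delta> 1 *\<^sub>R w"
    if "\<delta> \<in> Delta" for \<delta>
    using that
  proof (induction rule: Delta_induct)
    case id
    show ?case
      unfolding \<eta>_id[OF \<eta>h] lin_id using absorb[OF _ id_normalizing, where c = 1] by simp
  next
    case delta1
    have "lin delta1 1 = -1" by (simp add: lin_def delta1_def)
    then show ?case using absorb[OF _ \<phi>1(1), where c = "-1"] \<phi>1(2,3) by simp
  next
    case delta2
    have "lin delta2 1 = -1" by (simp add: lin_def delta2_def)
    then show ?case using absorb[OF _ \<phi>2(1), where c = "-1"] \<phi>2(2,3) by simp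
  next
    case (comp f g)
    obtain \<psi>f where f: "\<psi>f \<in> normalizing_affinities M" "star UNIV M \<psi>f = \<eta> f" by (rule lift_exists[OF \<eta>h comp(1)])
    obtain \<psi>g where g: "\<psi>g \<in> normalizing_affinities M" "star UNIV M \<psi>g = \<eta> g" by (rule lift_exists[OF \<eta>h comp(2)])
    have fg: "\<psi>f \<circ> \<psi>g \<in> normalizing_affinities M" by (rule normalizing_affinities_comp[OF f(1) g(1)])
    have st: "star UNIV M (\<psi>f \<circ> \<psi>g) = \<eta> (f \<circ> g)"
      unfolding hom_Delta_comp[OF \<eta>h comp(1,2)] f(2)[symmetric] g(2)[symmetric] mult_Aff[OF f(1) g(1)] ..
    have "lin (\<psi>f \<circ> \<psi>g) w = lin (f \<circ> g) 1 *\<^sub>R w"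
      using comp(3,4) f g unfolding lin_comp[OF normalizing_affinities_D(2)[OF f(1)]] lin_Delta_comp[OF comp(1,2)]
      by (simp add: linear_scale[OF normalizing_affinities_D(2)[OF f(1)]] mult.commute)
    then show ?case using absorb[OF _ fg] st by metis
  qed
  define lf where "lf \<delta> = (SOME \<phi>. \<phi> \<in> normalizing_affinities M \<and> star UNIV M \<phi> = \<eta> \<delta>)" for \<delta>
  have lf: "lf \<delta> \<in> normalizing_affinities M" "star UNIV M (lf \<delta>) = \<eta> \<delta>" if \<delta>: "\<delta> \<in> Delta" for \<delta>
  proof -
    have "\<exists>\<phi>. \<phi> \<in> normalizing_affinities M \<and> star UNIV M \<phi> = \<eta> \<delta>" using lift_exists[OF \<eta>h \<delta>] by blast
    from someI_ex[OF this] show "lf \<delta> \<in> normalizing_affinities M" "star UNIV M (lf \<delta>) = \<eta> \<delta>"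
      unfolding lf_def by blast+
  qed
  \<comment> \<open>The shear conjugates \<phi> \<times> \<delta> to a map with first factor \<phi>
    x + c w, where c is \<delta> t minus t times the sign of \<delta>, that is, \<delta> 0. This is
    0 for \<open>delta1\<close> and 1 for \<open>delta2\<close>, so the first generator keeps its
    value.\<close>
  define \<eta>' where "\<eta>' = (\<lambda>\<delta>\<in>Delta. star UNIV M ((+) (\<delta> 0 *\<^sub>R w) \<circ> lf \<delta>))"
  have sw: "c *\<^sub>R w \<in> fixed" for c using w fixed_subspace subspace_scale by blast
  have pn: "(+) (c *\<^sub>R w) \<circ> \<phi> \<in> normalizing_affinities M" if "\<phi> \<in> normalizing_affinities M" for c \<phi>
    by (rule normalizing_affinities_comp[OF plus_fixed_normalizing[OF sw] that])
  have \<eta>': "\<eta>' \<delta> = star UNIV M ((+) (\<delta> 0 *\<^sub>R w) \<circ> \<phi>)"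
    if d\<phi>: "\<delta> \<in> Delta" "\<phi> \<in> normalizing_affinities M" "star UNIV M \<phi> = \<eta> \<delta>" for \<delta> \<phi>
  proof -
    obtain \<mu> where \<mu>: "\<mu> \<in> M" "\<phi> = \<mu> \<circ> lf \<delta>"
      using star_eq_iff[OF d\<phi>(2) lf(1)[OF d\<phi>(1)]] d\<phi>(3) lf(2)[OF d\<phi>(1)] by auto
    have "(+) (\<delta> 0 *\<^sub>R w) \<circ> \<phi> = \<mu> \<circ> ((+) (\<delta> 0 *\<^sub>R w) \<circ> lf \<delta>)"
      unfolding \<mu>(2) comp_assoc[symmetric] fixed_commute[OF sw \<mu>(1)] ..
    then have "star UNIV M ((+) (\<delta> 0 *\<^sub>R w) \<circ> \<phi>) = star UNIV M ((+) (\<delta> 0 *\<^sub>R w) \<circ> lf \<delta>)"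
      using star_eq_iff[OF pn[OF d\<phi>(2)] pn[OF lf(1)[OF d\<phi>(1)]]] \<mu>(1) by blast
    then show ?thesis using d\<phi>(1) by (simp add: \<eta>'_def)
  qed
  have \<eta>'h: "\<eta>' \<in> hom Delta_group (Aff M)"
  proof (rule homI)
    fix \<delta> assume "\<delta> \<in> carrier Delta_group"
    then have d: "\<delta> \<in> Delta" by simp
    show "\<eta>' \<delta> \<in> carrier (Aff M)" unfolding \<eta>'[OF d lf[OF d]] carrier_Aff by (rule imageI[OF pn[OF lf(1)[OF d]]])
  next
    fix f g assume "f \<in> carrier Delta_group" "g \<in> carrier Delta_group"
    then have fg: "f \<in> Delta" "g \<in> Delta" by simp_all
    define \<psi>f \<psi>g where "\<psi>f = lf f" and "\<psi>g = lf g"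
    have f: "\<psi>f \<in> normalizing_affinities M" "star UNIV M \<psi>f = \<eta> f" unfolding \<psi>f_def by (rule lf[OF fg(1)])+
    have g: "\<psi>g \<in> normalizing_affinities M" "star UNIV M \<psi>g = \<eta> g" unfolding \<psi>g_def by (rule lf[OF fg(2)])+
    note n = normalizing_affinities_comp[OF f(1) g(1)]
    have st: "star UNIV M (\<psi>f \<circ> \<psi>g) = \<eta> (f \<circ> g)"
      unfolding hom_Delta_comp[OF \<eta>h fg] f(2)[symmetric] g(2)[symmetric] mult_Aff[OF f(1) g(1)] ..
    \<comment> \<open>The coefficients obey the cocycle rule that the value of f g at 0 is f 0 plus
      the sign of f times g 0, which matches the action of the lifts on w.\<close>
    have "((+) (f 0 *\<^sub>R w) \<circ> \<psi>f) \<circ> ((+) (g 0 *\<^sub>R w) \<circ> \<psi>g) = (+) ((f \<circ> g) 0 *\<^sub>R w) \<circ> (\<psi>f \<circ> \<psi>g)"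
    proof
      fix x
      have "lin \<psi>f (g 0 *\<^sub>R w) = (lin f 1 * g 0) *\<^sub>R w"
        using lw[OF fg(1)] f linear_scale[OF normalizing_affinities_D(2)[OF f(1)]] by (simp add: mult.commute)
      then show "(((+) (f 0 *\<^sub>R w) \<circ> \<psi>f) \<circ> ((+) (g 0 *\<^sub>R w) \<circ> \<psi>g)) x = ((+) ((f \<circ> g) 0 *\<^sub>R w) \<circ> (\<psi>f \<circ> \<psi>g)) x"
        using Delta_affine[OF fg(1), of "g 0"] lin_add_left[OF normalizing_affinities_D(2)[OF f(1)], of "g 0 *\<^sub>R w" "\<psi>g x"]
        by (simp add: algebra_simps)
    qed
    then have "\<eta>' (f \<circ> g) = \<eta>' f \<otimes>\<^bsub>Aff M\<^esub> \<eta>' g"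
      using \<eta>'[OF tgroupD(3)[OF tgroup_Delta fg] n st] \<eta>'[OF fg(1) f] \<eta>'[OF fg(2) g] mult_Aff[OF pn[OF f(1)] pn[OF g(1)], of "f 0" "g 0"]
      by simp
    then show "\<eta>' (f \<otimes>\<^bsub>Delta_group\<^esub> g) = \<eta>' f \<otimes>\<^bsub>Aff M\<^esub> \<eta>' g"
      using tgroup_mult[OF tgroup_Delta fg] by simp
  qed
  have "Omega M (\<eta>' \<delta>) = Omega M (\<eta> \<delta>)" if d: "\<delta> \<in> Delta" for \<delta>
    using Omega_star[OF pn[OF lf(1)[OF d]]] Omega_star[OF lf(1)[OF d]] Omega_class_plus_fixed[OF sw lf(1)[OF d]]
    by (simp add: \<eta>'[OF d lf[OF d]] lf(2)[OF d])
  then have "Omega M ` \<eta>' ` Delta = Omega M ` \<eta> ` Delta" unfolding image_image by (rule image_cong[OF refl])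
  then have 1: "\<eta>' \<in> Hom_f M" using \<eta>'h fin by (simp add: Hom_f_def \<eta>'_def)
  have 2: "\<eta>' delta1 = star UNIV M \<phi>1"
    using \<eta>'[OF delta_in_Delta(1) \<phi>1(1,2)] by (simp add: delta1_def plus_zero)
  have 3: "\<eta>' delta2 = star UNIV M ((+) w \<circ> \<phi>2)"
    using \<eta>'[OF delta_in_Delta(2) \<phi>2(1,2)] by (simp add: delta2_def)
  define K :: "'a transf" where "K = (\<lambda>(x, t). (x + t *\<^sub>R w, t))"
  define K' :: "'a transf" where "K' = (\<lambda>(x, t). (x - t *\<^sub>R w, t))"
  have KK: "K \<circ> K' = id" "K' \<circ> K = id" unfolding K_def K'_def by (auto simp: fun_eq_iff)
  have bK: "bij K" by (rule o_bij[OF KK(2,1)])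
  have iK: "finv K = K'" by (rule inv_unique_comp[OF KK])
  have cK: "conjm K (map_prod \<phi> \<delta>) = map_prod ((+) (\<delta> 0 *\<^sub>R w) \<circ> \<phi>) \<delta>"
    if "\<delta> \<in> Delta" "\<phi> \<in> normalizing_affinities M" "lin \<phi> w = lin \<delta> 1 *\<^sub>R w" for \<phi> \<delta>
  proof
    fix z :: "'a \<times> real"
    obtain x t where z: "z = (x, t)" by (cases z)
    note l = normalizing_affinities_D(2)[OF that(2)]
    have "\<phi> (x - t *\<^sub>R w) = \<phi> x - (t * lin \<delta> 1) *\<^sub>R w"
      using lin_add[OF l, of x "- (t *\<^sub>R w)"] by (simp add: linear_neg[OF l] linear_scale[OF l] that(3))
    then show "conjm K (map_prod \<phi> \<delta>) z = map_prod ((+) (\<delta> 0 *\<^sub>R w) \<circ> \<phi>) \<delta> z"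
      unfolding comp_apply iK unfolding z K_def K'_def using Delta_affine[OF that(1), of t] by (simp add: algebra_simps)
  qed
  have "conjm K ` lifted M \<eta> = lifted M \<eta>'"
  proof
    show "conjm K ` lifted M \<eta> \<subseteq> lifted M \<eta>'"
    proof (rule image_subsetI)
      fix g assume "g \<in> lifted M \<eta>"
      then obtain \<phi> \<delta> where *: "g = map_prod \<phi> \<delta>" "\<phi> \<in> normalizing_affinities M" "\<delta> \<in> Delta" "star UNIV M \<phi> = \<eta> \<delta>"
        unfolding lifted_def by blast
      have l: "lin \<phi> w = lin \<delta> 1 *\<^sub>R w" using lw[OF *(3)] *(2,4) by blast
      show "conjm K g \<in> lifted M \<eta>'"
        unfolding *(1) cK[OF *(3,2) l] by (rule liftedI[where \<eta> = \<eta>', OF pn[OF *(2)] *(3) \<eta>'[OF *(3,2,4), symmetric]])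
    qed
    show "lifted M \<eta>' \<subseteq> conjm K ` lifted M \<eta>"
    proof
      fix g assume "g \<in> lifted M \<eta>'"
      then obtain \<phi>' \<delta> where *: "g = map_prod \<phi>' \<delta>" "\<phi>' \<in> normalizing_affinities M" "\<delta> \<in> Delta" "star UNIV M \<phi>' = \<eta>' \<delta>"
        unfolding lifted_def by blast
      note L = lf[OF *(3)]
      obtain \<mu> where \<mu>: "\<mu> \<in> M" "\<phi>' = \<mu> \<circ> ((+) (\<delta> 0 *\<^sub>R w) \<circ> lf \<delta>)"
        using star_eq_iff[OF *(2) pn[OF L(1)]] *(4) \<eta>'[OF *(3) L] by auto
      define \<phi> where "\<phi> = \<mu> \<circ> lf \<delta>"
      have \<phi>: "\<phi> \<in> normalizing_affinities M" unfolding \<phi>_def by (rule normalizing_affinities_comp[OF D(4)[OF \<mu>(1)] L(1)])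
      have st: "star UNIV M \<phi> = \<eta> \<delta>" using star_eq_iff[OF \<phi> L(1)] \<mu>(1) L(2) unfolding \<phi>_def by auto
      have l: "lin \<phi> w = lin \<delta> 1 *\<^sub>R w" using lw[OF *(3)] \<phi> st by blast
      have "\<phi>' = (+) (\<delta> 0 *\<^sub>R w) \<circ> \<phi>"
        unfolding \<mu>(2) \<phi>_def comp_assoc[symmetric] fixed_commute[OF sw \<mu>(1)] ..
      then have "g = conjm K (map_prod \<phi> \<delta>)" unfolding *(1) cK[OF *(3) \<phi> l] by simp
      moreover have "map_prod \<phi> \<delta> \<in> lifted M \<eta>" by (rule liftedI[where \<eta> = \<eta>, OF \<phi> *(3) st])
      ultimately show "g \<in> conjm K ` lifted M \<eta>" by (metis imageI)
    qed
  qed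
  moreover have "conjm K ` extended M = extended M"
  proof -
    have "conjm K (map_prod \<mu> id) = map_prod \<mu> id" if "\<mu> \<in> M" for \<mu>
      using cK[OF tgroupD(2)[OF tgroup_Delta] D(4)[OF that]] fx[OF that] by (simp add: plus_zero)
    then show ?thesis unfolding extended_def image_image by (rule image_cong[OF refl])
  qed
  ultimately have "group_pair_iso (lifted M \<eta>) (extended M) (lifted M \<eta>') (extended M)"
    using group_pair_iso_conjm[OF bK, of "lifted M \<eta>" "extended M"] by simp
  with 1 2 3 that show thesis by blast
qed

text \<open>By \<open>automorphism_affine\<close> the isomorphism may be assumed to be the identity on \<open>M\<close>; then it changes
  the lifts by elements of the centralizer of \<open>M\<close>, that is, by fixed translations.\<close>

theorem isomorphism_deformation:
  assumes \<eta>: "\<eta> \<in> Hom_f M" and \<eta>': "\<eta>' \<in> Hom_f M"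
    and iso: "group_pair_iso (lifted M \<eta>) (extended M) (lifted M \<eta>') (extended M)"
    and \<phi>1: "\<phi>1 \<in> normalizing_affinities M" "star UNIV M \<phi>1 = \<eta> delta1"
    and \<phi>2: "\<phi>2 \<in> normalizing_affinities M" "star UNIV M \<phi>2 = \<eta> delta2"
  obtains \<eta>'' v1 v2 where "\<eta>'' \<in> Hom_f M" "Aff_class M \<eta>'' = Aff_class M \<eta>'"
    "v1 \<in> fixed" "lin \<phi>1 v1 = - v1" "\<eta>'' delta1 = star UNIV M ((+) v1 \<circ> \<phi>1)"
    "v2 \<in> fixed" "lin \<phi>2 v2 = - v2" "\<eta>'' delta2 = star UNIV M ((+) v2 \<circ> \<phi>2)"
proof -
  have \<eta>h: "\<eta> \<in> hom Delta_group (Aff M)" and fin: "finite (Omega M ` \<eta> ` Delta)"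
    and \<eta>'h: "\<eta>' \<in> hom Delta_group (Aff M)" using \<eta> \<eta>' by (auto simp: Hom_f_def)
  obtain f where f: "bij_betw f (lifted M \<eta>) (lifted M \<eta>')"
      "\<And>g h. g \<in> lifted M \<eta> \<Longrightarrow> h \<in> lifted M \<eta> \<Longrightarrow> f (g \<circ> h) = f g \<circ> f h" "f ` extended M = extended M"
    using iso unfolding group_pair_iso_def by blast
  have fE: "\<exists>\<phi>' \<delta>'. f g = map_prod \<phi>' \<delta>' \<and> \<phi>' \<in> normalizing_affinities M \<and> \<delta>' \<in> Delta \<and> star UNIV M \<phi>' = \<eta>' \<delta>'"
    if "g \<in> lifted M \<eta>" for g
    using bij_betwE[OF f(1)] that unfolding lifted_def by blast
  have fin1: "inj_on f (lifted M \<eta>)" using f(1) by (rule bij_betw_imp_inj_on)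
  define ex where "ex \<mu> = (map_prod \<mu> id :: 'a transf)" for \<mu>
  have exM: "ex \<mu> \<in> lifted M \<eta>" if "\<mu> \<in> M" for \<mu>
    using extended_subset[OF \<eta>h] that unfolding extended_def ex_def by blast
  \<comment> \<open>f preserves the copy of M in the fibre product, so it restricts to an
    automorphism g of M.\<close>
  define g where "g \<mu> = fst_part (f (ex \<mu>))" for \<mu>
  have g: "f (ex \<mu>) = ex (g \<mu>)" "g \<mu> \<in> M" if \<mu>: "\<mu> \<in> M" for \<mu>
  proof -
    have "f (ex \<mu>) \<in> extended M" using f(3) \<mu> unfolding extended_def ex_def by blast
    then obtain \<nu> where \<nu>: "\<nu> \<in> M" "f (ex \<mu>) = ex \<nu>" unfolding extended_def ex_def by blast
    then have "g \<mu> = \<nu>" by (simp add: g_def ex_def)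
    with \<nu> show "f (ex \<mu>) = ex (g \<mu>)" "g \<mu> \<in> M" by simp_all
  qed
  have exc: "ex (\<mu> \<circ> \<nu>) = ex \<mu> \<circ> ex \<nu>" for \<mu> \<nu> unfolding ex_def extended_comp ..
  have exi: "ex \<mu> = ex \<nu> \<longleftrightarrow> \<mu> = \<nu>" for \<mu> \<nu> unfolding ex_def map_prod_eq_iff by simp
  have gb: "bij_betw g M M"
    unfolding bij_betw_def
  proof
    show "inj_on g M"
    proof (rule inj_onI)
      fix \<mu> \<nu> assume *: "\<mu> \<in> M" "\<nu> \<in> M" "g \<mu> = g \<nu>"
      then have "f (ex \<mu>) = f (ex \<nu>)" using g(1) by simp
      then have "ex \<mu> = ex \<nu>" by (rule inj_onD[OF fin1 _ exM[OF *(1)] exM[OF *(2)]])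
      then show "\<mu> = \<nu>" unfolding exi .
    qed
    show "g ` M = M"
    proof
      show "g ` M \<subseteq> M" using g(2) by blast
      show "M \<subseteq> g ` M"
      proof
        fix \<nu> assume "\<nu> \<in> M"
        then have "ex \<nu> \<in> f ` extended M" unfolding f(3) unfolding extended_def ex_def by (rule imageI)
        then obtain \<mu> where "\<mu> \<in> M" "ex \<nu> = f (ex \<mu>)" unfolding extended_def ex_def by blast
        then show "\<nu> \<in> g ` M" using g(1) exi by (metis imageI)
      qed
    qed
  qed
  have gh: "g (\<mu> \<circ> \<nu>) = g \<mu> \<circ> g \<nu>" if "\<mu> \<in> M" "\<nu> \<in> M" for \<mu> \<nu>
  proof -
    have "ex (g (\<mu> \<circ> \<nu>)) = ex (g \<mu> \<circ> g \<nu>)"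
      unfolding exc g(1)[OF that(1), symmetric] g(1)[OF that(2), symmetric] g(1)[OF M(2)[OF that], symmetric]
      by (rule f(2)[OF exM[OF that(1)] exM[OF that(2)]])
    then show ?thesis unfolding exi .
  qed
  obtain \<zeta> where \<zeta>: "\<zeta> \<in> normalizing_affinities M" "\<And>\<mu>. \<mu> \<in> M \<Longrightarrow> g \<mu> = conjm \<zeta> \<mu>"
    using automorphism_affine[OF gb gh] by metis
  \<comment> \<open>Conjugation by the inverse of \<zeta> turns the restriction g into the
    identity.\<close>
  define \<kappa> where "\<kappa> = finv \<zeta>"
  have \<kappa>: "\<kappa> \<in> normalizing_affinities M" unfolding \<kappa>_def by (rule normalizing_affinities_inv[OF \<zeta>(1)])
  note b\<zeta> = normalizing_affinities_D(1)[OF \<zeta>(1)] and b\<kappa> = normalizing_affinities_D(1)[OF \<kappa>]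
  have \<kappa>\<zeta>: "conjm \<kappa> (conjm \<zeta> h) = h" for h
    unfolding conjm_conjm[OF b\<kappa> b\<zeta>] unfolding \<kappa>_def inv_comp_bij[OF b\<zeta>] by (rule conjm_id(1))
  define lf where "lf \<delta> = (SOME \<phi>. \<phi> \<in> normalizing_affinities M \<and> star UNIV M \<phi> = \<eta> \<delta>)" for \<delta>
  have lf: "lf \<delta> \<in> normalizing_affinities M" "star UNIV M (lf \<delta>) = \<eta> \<delta>" if \<delta>: "\<delta> \<in> Delta" for \<delta>
  proof -
    have "\<exists>\<phi>. \<phi> \<in> normalizing_affinities M \<and> star UNIV M \<phi> = \<eta> \<delta>" using lift_exists[OF \<eta>h \<delta>] by blast
    from someI_ex[OF this] show "lf \<delta> \<in> normalizing_affinities M" "star UNIV M (lf \<delta>) = \<eta> \<delta>"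
      unfolding lf_def by blast+
  qed
  \<comment> \<open>f induces an automorphism of the quotient \<Delta>. The lift used to define it
    does not matter, since lifts over \<delta> differ by elements of M and f preserves M.\<close>
  define \<sigma> where "\<sigma> = (\<lambda>\<delta>\<in>Delta. snd_part (f (map_prod (lf \<delta>) \<delta>)))"
  have f\<sigma>: "\<exists>\<phi>'. f (map_prod \<phi> \<delta>) = map_prod \<phi>' (\<sigma> \<delta>) \<and> \<phi>' \<in> normalizing_affinities M \<and> \<sigma> \<delta> \<in> Delta \<and> star UNIV M \<phi>' = \<eta>' (\<sigma> \<delta>)"
    if d\<phi>: "\<delta> \<in> Delta" "\<phi> \<in> normalizing_affinities M" "star UNIV M \<phi> = \<eta> \<delta>" for \<phi> \<delta>
  proof -
    note L = lf[OF d\<phi>(1)]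
    have m: "map_prod \<phi> \<delta> \<in> lifted M \<eta>" "map_prod (lf \<delta>) \<delta> \<in> lifted M \<eta>"
      by (rule liftedI[where \<eta> = \<eta>, OF d\<phi>(2,1,3)], rule liftedI[where \<eta> = \<eta>, OF L(1) d\<phi>(1) L(2)])
    obtain \<mu> where \<mu>: "\<mu> \<in> M" "\<phi> = \<mu> \<circ> lf \<delta>" using star_eq_iff[OF d\<phi>(2) L(1)] d\<phi>(3) L(2) by auto
    obtain \<phi>' \<delta>' where *: "f (map_prod (lf \<delta>) \<delta>) = map_prod \<phi>' \<delta>'" "\<phi>' \<in> normalizing_affinities M" "\<delta>' \<in> Delta" "star UNIV M \<phi>' = \<eta>' \<delta>'"
      using fE[OF m(2)] by blast
    have s: "\<sigma> \<delta> = \<delta>'" using d\<phi>(1) by (simp add: \<sigma>_def *(1))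
    have "map_prod \<phi> \<delta> = ex \<mu> \<circ> map_prod (lf \<delta>) \<delta>" unfolding \<mu>(2) ex_def map_prod_comp id_comp ..
    then have "f (map_prod \<phi> \<delta>) = ex (g \<mu>) \<circ> map_prod \<phi>' \<delta>'" using f(2)[OF exM[OF \<mu>(1)] m(2)] g(1)[OF \<mu>(1)] *(1) by simp
    also have "\<dots> = map_prod (g \<mu> \<circ> \<phi>') \<delta>'" unfolding ex_def map_prod_comp id_comp ..
    finally have e: "f (map_prod \<phi> \<delta>) = map_prod (g \<mu> \<circ> \<phi>') (\<sigma> \<delta>)" unfolding s .
    have n: "g \<mu> \<circ> \<phi>' \<in> normalizing_affinities M" by (rule normalizing_affinities_comp[OF D(4)[OF g(2)[OF \<mu>(1)]] *(2)])
    have "star UNIV M (g \<mu> \<circ> \<phi>') = star UNIV M \<phi>'" using star_eq_iff[OF n *(2)] g(2)[OF \<mu>(1)] by blast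
    then show ?thesis using e n *(3,4) s by auto
  qed
  have \<sigma>D: "\<sigma> \<delta> \<in> Delta" if "\<delta> \<in> Delta" for \<delta> using f\<sigma>[OF that lf[OF that]] by blast
  have \<sigma>h: "\<sigma> (a \<circ> b) = \<sigma> a \<circ> \<sigma> b" if ab: "a \<in> Delta" "b \<in> Delta" for a b
  proof -
    note A = lf[OF ab(1)] and B = lf[OF ab(2)]
    have m: "map_prod (lf a) a \<in> lifted M \<eta>" "map_prod (lf b) b \<in> lifted M \<eta>"
      by (rule liftedI[where \<eta> = \<eta>, OF A(1) ab(1) A(2)], rule liftedI[where \<eta> = \<eta>, OF B(1) ab(2) B(2)])
    have st: "star UNIV M (lf a \<circ> lf b) = \<eta> (a \<circ> b)"
      unfolding hom_Delta_comp[OF \<eta>h ab] A(2)[symmetric] B(2)[symmetric] mult_Aff[OF A(1) B(1)] ..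
    obtain \<phi>' where 1: "f (map_prod (lf a \<circ> lf b) (a \<circ> b)) = map_prod \<phi>' (\<sigma> (a \<circ> b))"
      using f\<sigma>[OF tgroupD(3)[OF tgroup_Delta ab] normalizing_affinities_comp[OF A(1) B(1)] st] by blast
    obtain \<phi>a where 2: "f (map_prod (lf a) a) = map_prod \<phi>a (\<sigma> a)" using f\<sigma>[OF ab(1) A] by blast
    obtain \<phi>b where 3: "f (map_prod (lf b) b) = map_prod \<phi>b (\<sigma> b)" using f\<sigma>[OF ab(2) B] by blast
    have "map_prod \<phi>' (\<sigma> (a \<circ> b)) = map_prod \<phi>a (\<sigma> a) \<circ> map_prod \<phi>b (\<sigma> b)"
      using f(2)[OF m] unfolding map_prod_comp 1 2 3 .
    then show ?thesis unfolding map_prod_comp map_prod_eq_iff by blast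
  qed
  have \<sigma>b: "bij_betw \<sigma> Delta Delta"
    unfolding bij_betw_def
  proof
    show "inj_on \<sigma> Delta"
    proof (rule inj_onI)
      fix a b assume ab: "a \<in> Delta" "b \<in> Delta" "\<sigma> a = \<sigma> b"
      note A = lf[OF ab(1)] and B = lf[OF ab(2)]
      have m: "map_prod (lf a) a \<in> lifted M \<eta>" "map_prod (lf b) b \<in> lifted M \<eta>"
        by (rule liftedI[where \<eta> = \<eta>, OF A(1) ab(1) A(2)], rule liftedI[where \<eta> = \<eta>, OF B(1) ab(2) B(2)])
      obtain \<phi>a where 2: "f (map_prod (lf a) a) = map_prod \<phi>a (\<sigma> a)" "\<phi>a \<in> normalizing_affinities M" "star UNIV M \<phi>a = \<eta>' (\<sigma> a)"
        using f\<sigma>[OF ab(1) A] by blast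
      obtain \<phi>b where 3: "f (map_prod (lf b) b) = map_prod \<phi>b (\<sigma> b)" "\<phi>b \<in> normalizing_affinities M" "star UNIV M \<phi>b = \<eta>' (\<sigma> b)"
        using f\<sigma>[OF ab(2) B] by blast
      have "star UNIV M \<phi>a = star UNIV M \<phi>b" using 2(3) 3(3) ab(3) by simp
      then obtain \<nu> where \<nu>: "\<nu> \<in> M" "\<phi>a = \<nu> \<circ> \<phi>b" using star_eq_iff[OF 2(2) 3(2)] by blast
      have "\<nu> \<in> g ` M" using gb \<nu>(1) by (simp add: bij_betw_def)
      then obtain \<mu> where \<mu>: "\<mu> \<in> M" "g \<mu> = \<nu>" by blast
      have "f (map_prod (lf a) a) = ex \<nu> \<circ> map_prod \<phi>b (\<sigma> b)"
        unfolding 2(1) \<nu>(2) ab(3) ex_def map_prod_comp id_comp ..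
      also have "\<dots> = f (ex \<mu> \<circ> map_prod (lf b) b)"
        unfolding f(2)[OF exM[OF \<mu>(1)] m(2)] g(1)[OF \<mu>(1)] \<mu>(2) 3(1) ..
      finally have "map_prod (lf a) a = ex \<mu> \<circ> map_prod (lf b) b"
        by (rule inj_onD[OF fin1 _ m(1) tgroupD(3)[OF tgroup_lifted[OF \<eta>h] exM[OF \<mu>(1)] m(2)]])
      then show "a = b" unfolding ex_def map_prod_comp id_comp map_prod_eq_iff by blast
    qed
    show "\<sigma> ` Delta = Delta"
    proof
      show "\<sigma> ` Delta \<subseteq> Delta" using \<sigma>D by blast
      show "Delta \<subseteq> \<sigma> ` Delta"
      proof
        fix d assume d: "d \<in> Delta"
        obtain \<phi>' where \<phi>': "\<phi>' \<in> normalizing_affinities M" "star UNIV M \<phi>' = \<eta>' d" by (rule lift_exists[OF \<eta>'h d])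
        have "map_prod \<phi>' d \<in> f ` lifted M \<eta>"
          using liftedI[where \<eta> = \<eta>', OF \<phi>'(1) d \<phi>'(2)] f(1) by (simp add: bij_betw_def)
        then obtain \<phi> \<delta> where *: "map_prod \<phi>' d = f (map_prod \<phi> \<delta>)" "\<phi> \<in> normalizing_affinities M" "\<delta> \<in> Delta" "star UNIV M \<phi> = \<eta> \<delta>"
          unfolding lifted_def by blast
        have "d = \<sigma> \<delta>" using f\<sigma>[OF *(3,2,4)] unfolding *(1)[symmetric] map_prod_eq_iff by blast
        then show "d \<in> \<sigma> ` Delta" using *(3) by blast
      qed
    qed
  qed
  have \<sigma>: "\<sigma> \<in> auto Delta_group" unfolding auto_Delta_iff using \<sigma>b \<sigma>h by (simp add: \<sigma>_def)
  \<comment> \<open>This twist of \<eta>' lies in the same class and is matched with \<eta> over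
    every \<delta>.\<close>
  define \<eta>'' where "\<eta>'' = (\<lambda>\<delta>\<in>Delta. Aff_conj M (star UNIV M \<kappa>) (\<eta>' (\<sigma> \<delta>)))"
  have \<eta>''eq: "\<eta>'' \<delta> = Aff_conj M (star UNIV M \<kappa>) (\<eta>' (\<sigma> \<delta>))" if "\<delta> \<in> Delta" for \<delta>
    using that by (simp add: \<eta>''_def)
  have cls: "Aff_class M \<eta>'' = Aff_class M \<eta>'" by (rule Aff_class_twist[OF \<eta>'h \<kappa> \<sigma> \<eta>''eq])
  have \<eta>''h: "\<eta>'' \<in> hom Delta_group (Aff M)"
  proof -
    have "\<eta>'' \<in> hom Delta_group (Aff M) \<longleftrightarrow> (\<lambda>\<delta>. Aff_conj M (star UNIV M \<kappa>) (\<eta>' (\<sigma> \<delta>))) \<in> hom Delta_group (Aff M)"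
      unfolding hom_def using \<eta>''eq tgroupD(3)[OF tgroup_Delta]
      by (auto simp: Pi_iff tgroup_mult[OF tgroup_Delta] simp del: comp_apply)
    then show ?thesis using hom_twist[OF \<eta>'h \<kappa> \<sigma>] by simp
  qed
  have key: "\<exists>v\<in>fixed. \<eta>'' \<delta> = star UNIV M ((+) v \<circ> \<phi>) \<and> f (map_prod \<phi> \<delta>) = map_prod (conjm \<zeta> ((+) v \<circ> \<phi>)) (\<sigma> \<delta>)"
    if \<delta>: "\<delta> \<in> Delta" and \<phi>: "\<phi> \<in> normalizing_affinities M" "star UNIV M \<phi> = \<eta> \<delta>" for \<phi> \<delta>
  proof -
    obtain \<phi>' where \<phi>': "f (map_prod \<phi> \<delta>) = map_prod \<phi>' (\<sigma> \<delta>)" "\<phi>' \<in> normalizing_affinities M" "star UNIV M \<phi>' = \<eta>' (\<sigma> \<delta>)"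
      using f\<sigma>[OF \<delta> \<phi>] by blast
    \<comment> \<open>\<rho> is the image of the lift \<phi> after the correction by \<kappa>. It
      conjugates M in the same way as \<phi>, so \<open>\<rho> \<circ> finv \<phi>\<close>
      centralizes M and is a fixed translation.\<close>
    define \<rho> where "\<rho> = conjm \<kappa> \<phi>'"
    have \<rho>: "\<rho> \<in> normalizing_affinities M" unfolding \<rho>_def
      by (intro normalizing_affinities_comp normalizing_affinities_inv \<kappa> \<phi>'(2))
    have m: "map_prod \<phi> \<delta> \<in> lifted M \<eta>" by (rule liftedI[where \<eta> = \<eta>, OF \<phi>(1) \<delta> \<phi>(2)])
    note b = normalizing_affinities_D(1)[OF \<phi>(1)] normalizing_affinities_D(1)[OF \<phi>'(2)] normalizing_affinities_D(1)[OF \<rho>]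
    have c1: "conjm \<phi>' (g \<mu>) = g (conjm \<phi> \<mu>)" if \<mu>: "\<mu> \<in> M" for \<mu>
    proof -
      have c: "conjm \<phi> \<mu> \<in> M" by (rule normalizing_affinities_D(3)[OF \<phi>(1) \<mu>])
      have "map_prod \<phi> \<delta> \<circ> ex \<mu> = ex (conjm \<phi> \<mu>) \<circ> map_prod \<phi> \<delta>"
        unfolding ex_def map_prod_comp comp_id id_comp using b(1) by (simp add: comp_assoc)
      then have "f (map_prod \<phi> \<delta>) \<circ> f (ex \<mu>) = f (ex (conjm \<phi> \<mu>)) \<circ> f (map_prod \<phi> \<delta>)"
        using f(2)[OF m exM[OF \<mu>]] f(2)[OF exM[OF c] m] by simp
      then have "map_prod (\<phi>' \<circ> g \<mu>) (\<sigma> \<delta>) = map_prod (g (conjm \<phi> \<mu>) \<circ> \<phi>') (\<sigma> \<delta>)"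
        unfolding \<phi>'(1) g(1)[OF \<mu>] g(1)[OF c] unfolding ex_def map_prod_comp comp_id id_comp .
      then have "\<phi>' \<circ> g \<mu> = g (conjm \<phi> \<mu>) \<circ> \<phi>'" unfolding map_prod_eq_iff by blast
      then show ?thesis using b(2) by (simp add: comp_assoc)
    qed
    have c2: "conjm \<rho> \<mu> = conjm \<phi> \<mu>" if \<mu>: "\<mu> \<in> M" for \<mu>
    proof -
      have "conjm \<kappa> (conjm \<phi>' (conjm \<zeta> \<mu>)) = conjm \<kappa> (conjm \<zeta> (conjm \<phi> \<mu>))"
        using c1[OF \<mu>] \<zeta>(2)[OF \<mu>] \<zeta>(2)[OF normalizing_affinities_D(3)[OF \<phi>(1) \<mu>]] by simp
      then have e: "conjm \<kappa> (conjm \<phi>' (conjm \<zeta> \<mu>)) = conjm \<phi> \<mu>" unfolding \<kappa>\<zeta> .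
      have i\<kappa>: "finv \<kappa> = \<zeta>" unfolding \<kappa>_def by (rule inv_inv_eq[OF b\<zeta>])
      have i\<zeta>: "finv \<zeta> = \<kappa>" by (simp add: \<kappa>_def)
      have i\<rho>: "finv \<rho> = conjm \<kappa> (finv \<phi>')" unfolding \<rho>_def by (rule conjm_inv[OF b\<kappa> b(2), symmetric])
      have "conjm \<rho> \<mu> = conjm \<kappa> (conjm \<phi>' (conjm \<zeta> \<mu>))"
        unfolding i\<rho> unfolding \<rho>_def i\<kappa> i\<zeta> comp_assoc ..
      then show ?thesis using e by simp
    qed
    have "conjm (\<rho> \<circ> finv \<phi>) \<nu> = \<nu>" if "\<nu> \<in> M" for \<nu>
    proof -
      obtain \<mu> where \<mu>: "\<mu> \<in> M" "\<nu> = conjm \<phi> \<mu>" using \<phi>(1) \<open>\<nu> \<in> M\<close> unfolding normalizing_affinities_iff by blast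
      have "conjm (\<rho> \<circ> finv \<phi>) \<nu> = conjm \<rho> (conjm (finv \<phi>) (conjm \<phi> \<mu>))"
        unfolding \<mu>(2) conjm_conjm[OF b(3) bij_imp_bij_inv[OF b(1)]] ..
      also have "conjm (finv \<phi>) (conjm \<phi> \<mu>) = \<mu>"
        unfolding conjm_conjm[OF bij_imp_bij_inv[OF b(1)] b(1)] inv_comp_bij[OF b(1)] by (rule conjm_id(1))
      finally show ?thesis unfolding c2[OF \<mu>(1)] \<mu>(2) .
    qed
    moreover have "\<rho> \<circ> finv \<phi> \<in> normalizing_affinities M"
      by (intro normalizing_affinities_comp normalizing_affinities_inv \<phi>(1) \<rho>)
    ultimately obtain v where v: "v \<in> fixed" "\<rho> \<circ> finv \<phi> = (+) v"
      using centralizer[of "\<rho> \<circ> finv \<phi>"] normalizing_affinities_D(1,2) by blast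
    have \<rho>v: "\<rho> = (+) v \<circ> \<phi>" unfolding v(2)[symmetric] comp_assoc inv_comp_bij(1)[OF b(1)] by simp
    have "\<eta>'' \<delta> = star UNIV M \<rho>"
      unfolding \<eta>''eq[OF \<delta>] \<phi>'(3)[symmetric] \<rho>_def by (rule Aff_conj_star[OF \<kappa> \<phi>'(2)])
    moreover have "\<phi>' = conjm \<zeta> \<rho>"
      unfolding \<rho>_def conjm_conjm[OF b\<zeta> b\<kappa>] unfolding \<kappa>_def inv_comp_bij(2)[OF b\<zeta>] by (rule conjm_id(1)[symmetric])
    ultimately show ?thesis using v(1) \<phi>'(1) unfolding \<rho>v by blast
  qed
  have "Omega M (\<eta>'' \<delta>) = Omega M (\<eta> \<delta>)" if d: "\<delta> \<in> Delta" for \<delta>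
  proof -
    obtain v where v: "v \<in> fixed" "\<eta>'' \<delta> = star UNIV M ((+) v \<circ> lf \<delta>)" using key[OF d lf[OF d]] by blast
    show ?thesis
      using Omega_star[OF normalizing_affinities_comp[OF plus_fixed_normalizing[OF v(1)] lf(1)[OF d]]] Omega_star[OF lf(1)[OF d]]
        Omega_class_plus_fixed[OF v(1) lf(1)[OF d]] v(2) lf(2)[OF d] by simp
  qed
  then have "Omega M ` \<eta>'' ` Delta = Omega M ` \<eta> ` Delta" unfolding image_image by (rule image_cong[OF refl])
  then have hf: "\<eta>'' \<in> Hom_f M" using \<eta>''h fin by (simp add: Hom_f_def \<eta>''_def)
  \<comment> \<open>The square of a lift of an involution lies in M, where f acts as conjugation by
    \<zeta>. Hence the deformed lift has the same square as \<phi>, and comparing values at 0 gives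
    lin \<phi> v = - v.\<close>
  have inv: "\<exists>v\<in>fixed. lin \<phi> v = - v \<and> \<eta>'' \<delta> = star UNIV M ((+) v \<circ> \<phi>)"
    if \<delta>: "\<delta> \<in> Delta" "\<delta> \<circ> \<delta> = id" and \<phi>: "\<phi> \<in> normalizing_affinities M" "star UNIV M \<phi> = \<eta> \<delta>" for \<phi> \<delta>
  proof -
    obtain v where v: "v \<in> fixed" "\<eta>'' \<delta> = star UNIV M ((+) v \<circ> \<phi>)"
      "f (map_prod \<phi> \<delta>) = map_prod (conjm \<zeta> ((+) v \<circ> \<phi>)) (\<sigma> \<delta>)"
      using key[OF \<delta>(1) \<phi>] by blast
    have m: "map_prod \<phi> \<delta> \<in> lifted M \<eta>" by (rule liftedI[where \<eta> = \<eta>, OF \<phi>(1) \<delta>(1) \<phi>(2)])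
    have "map_prod \<phi> \<delta> \<circ> map_prod \<phi> \<delta> \<in> lifted M \<eta>" by (rule tgroupD(3)[OF tgroup_lifted[OF \<eta>h] m m])
    then have "map_prod (\<phi> \<circ> \<phi>) id \<in> {g \<in> lifted M \<eta>. snd_part g = id}" unfolding map_prod_comp \<delta>(2) by simp
    then have \<phi>\<phi>: "\<phi> \<circ> \<phi> \<in> M" unfolding extended_kernel[OF \<eta>h, symmetric] extended_def by (auto simp: map_prod_eq_iff simp del: comp_apply)
    have "f (map_prod \<phi> \<delta> \<circ> map_prod \<phi> \<delta>) = ex (g (\<phi> \<circ> \<phi>))"
      unfolding map_prod_comp \<delta>(2) using g(1)[OF \<phi>\<phi>] unfolding ex_def .
    then have "f (map_prod \<phi> \<delta>) \<circ> f (map_prod \<phi> \<delta>) = ex (conjm \<zeta> (\<phi> \<circ> \<phi>))"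
      using f(2)[OF m m] \<zeta>(2)[OF \<phi>\<phi>] by simp
    then have "conjm \<zeta> ((+) v \<circ> \<phi>) \<circ> conjm \<zeta> ((+) v \<circ> \<phi>) = conjm \<zeta> (\<phi> \<circ> \<phi>)"
      unfolding v(3) map_prod_comp ex_def map_prod_eq_iff by blast
    then have e: "((+) v \<circ> \<phi>) \<circ> ((+) v \<circ> \<phi>) = \<phi> \<circ> \<phi>"
      unfolding conjm_comp[OF b\<zeta>, symmetric] inj_conjm[OF b\<zeta>] .
    have "v + \<phi> (v + \<phi> 0) = \<phi> (\<phi> 0)" using fun_cong[OF e, of 0] by simp
    then have "lin \<phi> v = - v"
      using lin_add_left[OF normalizing_affinities_D(2)[OF \<phi>(1)], of v "\<phi> 0"]
      by (simp add: eq_neg_iff_add_eq_0 add.commute add.left_commute)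
    then show ?thesis using v(1,2) by blast
  qed
  obtain v1 where "v1 \<in> fixed" "lin \<phi>1 v1 = - v1" "\<eta>'' delta1 = star UNIV M ((+) v1 \<circ> \<phi>1)"
    using inv[OF delta_in_Delta(1) delta_involution(1) \<phi>1] by blast
  moreover obtain v2 where "v2 \<in> fixed" "lin \<phi>2 v2 = - v2" "\<eta>'' delta2 = star UNIV M ((+) v2 \<circ> \<phi>2)"
    using inv[OF delta_in_Delta(2) delta_involution(2) \<phi>2] by blast
  ultimately show thesis using that[OF hf cls] by blast
qed

lemma pair_conj_class_conj:
  assumes \<xi>: "\<xi> \<in> normalizing_affinities M" and P: "P \<subseteq> carrier (Aff M)"
  shows "pair_conj_class M (Aff_conj M (star UNIV M \<xi>) ` P) = pair_conj_class M P"
proof -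
  have "Aff_conj M (star UNIV M \<zeta>) ` Aff_conj M (star UNIV M \<xi>) ` P = Aff_conj M (star UNIV M (\<zeta> \<circ> \<xi>)) ` P"
    if \<zeta>: "\<zeta> \<in> normalizing_affinities M" for \<zeta>
    unfolding image_image
  proof (rule image_cong[OF refl])
    fix a assume "a \<in> P"
    then obtain \<psi> where \<psi>: "\<psi> \<in> normalizing_affinities M" "a = star UNIV M \<psi>" using P unfolding carrier_Aff by blast
    have c: "conjm \<xi> \<psi> \<in> normalizing_affinities M"
      by (intro normalizing_affinities_comp normalizing_affinities_inv \<psi> \<xi>)
    show "Aff_conj M (star UNIV M \<zeta>) (Aff_conj M (star UNIV M \<xi>) a) = Aff_conj M (star UNIV M (\<zeta> \<circ> \<xi>)) a"
      unfolding \<psi>(2) Aff_conj_star[OF \<xi> \<psi>(1)] Aff_conj_star[OF \<zeta> c] Aff_conj_star[OF normalizing_affinities_comp[OF \<zeta> \<xi>] \<psi>(1)]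
        conjm_conjm[OF normalizing_affinities_D(1)[OF \<zeta>] normalizing_affinities_D(1)[OF \<xi>]] ..
  qed
  then have "pair_conj_class M (Aff_conj M (star UNIV M \<xi>) ` P)
    = (\<lambda>\<zeta>. Aff_conj M (star UNIV M \<zeta>) ` P) ` (\<lambda>\<zeta>. \<zeta> \<circ> \<xi>) ` normalizing_affinities M"
    unfolding pair_conj_class_def carrier_Aff image_image[of _ "star UNIV M"] image_image[of _ "\<lambda>\<zeta>. \<zeta> \<circ> \<xi>"]
    by (rule image_cong[OF refl])
  also have "(\<lambda>\<zeta>. \<zeta> \<circ> \<xi>) ` normalizing_affinities M = normalizing_affinities M"
  proof
    show "(\<lambda>\<zeta>. \<zeta> \<circ> \<xi>) ` normalizing_affinities M \<subseteq> normalizing_affinities M"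
      using normalizing_affinities_comp[OF _ \<xi>] by blast
    show "normalizing_affinities M \<subseteq> (\<lambda>\<zeta>. \<zeta> \<circ> \<xi>) ` normalizing_affinities M"
    proof
      fix \<zeta> assume "\<zeta> \<in> normalizing_affinities M"
      then have "\<zeta> \<circ> finv \<xi> \<in> normalizing_affinities M"
        by (intro normalizing_affinities_comp normalizing_affinities_inv \<xi>)
      moreover have "\<zeta> = (\<zeta> \<circ> finv \<xi>) \<circ> \<xi>" unfolding comp_assoc using normalizing_affinities_D(1)[OF \<xi>] by simp
      ultimately show "\<zeta> \<in> (\<lambda>\<zeta>. \<zeta> \<circ> \<xi>) ` normalizing_affinities M" by (metis imageI)
    qed
  qed
  finally show ?thesis unfolding pair_conj_class_def carrier_Aff image_image[of _ "star UNIV M"] .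
qed

end

section \<open>Splitting of \<Gamma> along V and its normal line, and the triviality of N on the
  line\<close>

section \<open>Pairs of codimension one\<close>

lemma codim_one_normal:
  fixes V :: "'b::euclidean_space set"
  assumes "subspace V" "dim V + 1 = DIM('b)"
  obtains e where "norm e = 1" "V = {x. x \<bullet> e = 0}"
proof -
  obtain a where a: "a \<noteq> 0" "span V \<subseteq> {x. a \<bullet> x = 0}"
    using lowdim_subset_hyperplane[of V] assms(2) by auto
  have "V = {x. a \<bullet> x = 0}"
  proof (rule subspace_dim_equal)
    show "subspace V" "subspace {x. a \<bullet> x = 0}" using assms(1) by (auto intro: subspace_hyperplane)
    show "V \<subseteq> {x. a \<bullet> x = 0}" using a(2) span_superset by blast
    show "dim {x. a \<bullet> x = 0} \<le> dim V" using dim_hyperplane[OF a(1)] assms(2) by simp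
  qed
  then have "V = {x. x \<bullet> (a /\<^sub>R norm a) = 0}" using a(1) by (auto simp: inner_commute)
  moreover have "norm (a /\<^sub>R norm a) = 1" using a(1) by simp
  ultimately show thesis using that by blast
qed

text \<open>On \<open>S\<close> the maps \<open>B1\<close>, \<open>B2\<close> are self-adjoint involutions, and the image of
  \<open>u \<mapsto> u - B2 u\<close> on the fixed space of \<open>B1\<close> is a complement of \<open>E1 \<inter> E2\<close> in \<open>E2\<close>.\<close>

lemma eigenspace_adjustment:
  fixes B1 B2 :: "'b::euclidean_space \<Rightarrow> 'b"
  assumes S: "subspace S" and B: "orthogonal_transformation B1" "orthogonal_transformation B2"
    and BS: "\<And>x. x \<in> S \<Longrightarrow> B1 x \<in> S" "\<And>x. x \<in> S \<Longrightarrow> B2 x \<in> S"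
    and inv: "\<And>x. x \<in> S \<Longrightarrow> B1 (B1 x) = x" "\<And>x. x \<in> S \<Longrightarrow> B2 (B2 x) = x"
    and w1: "w1 \<in> S" "B1 w1 = - w1" and w2: "w2 \<in> S" "B2 w2 = - w2"
  obtains u w where "u \<in> S" "w1 + u - B1 u = 0" "w2 + u - B2 u = w" "w \<in> S" "B1 w = - w" "B2 w = - w"
proof -
  note l = orthogonal_transformation_linear[OF B(1)] orthogonal_transformation_linear[OF B(2)]
  have ip: "B1 x \<bullet> B1 y = x \<bullet> y" "B2 x \<bullet> B2 y = x \<bullet> y" for x y
    using B by (auto simp: orthogonal_transformation_def)
  \<comment> \<open>As B1 w1 = - w1, this choice gives u0 - B1 u0 = - w1.\<close>
  define u0 where "u0 = - (w1 /\<^sub>R 2)"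
  have u0: "u0 \<in> S" unfolding u0_def using w1(1) S by (simp add: subspace_neg subspace_scale)
  have u01: "w1 + u0 - B1 u0 = 0"
    unfolding u0_def by (simp add: linear_neg[OF l(1)] linear_scale[OF l(1)] w1(2) flip: scaleR_left_distrib) (simp add: algebra_simps flip: scaleR_left_distrib)
  define w2' where "w2' = w2 + u0 - B2 u0"
  have w2': "w2' \<in> S" "B2 w2' = - w2'"
    unfolding w2'_def using w2 u0 BS(2) inv(2)[OF u0] S
    by (auto simp: subspace_add subspace_diff linear_add[OF l(2)] linear_diff[OF l(2)])
  \<comment> \<open>The remaining freedom: adding a vector of F to u0 keeps the first equation and
    changes w2' by an element of I.\<close>
  define F where "F = {u \<in> S. B1 u = u}"
  have F: "subspace F" unfolding F_def using S
    by (auto simp: subspace_def linear_0[OF l(1)] linear_add[OF l(1)] linear_scale[OF l(1)])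
  define I where "I = (\<lambda>u. u - B2 u) ` F"
  have lI: "linear (\<lambda>u. u - B2 u)" by (intro linear_compose_sub linear_ident l(2))
  have I: "subspace I" unfolding I_def by (rule linear_subspace_image[OF lI F])
  obtain i j where ij: "i \<in> span I" "\<And>z. z \<in> span I \<Longrightarrow> orthogonal j z" "w2' = i + j"
    using orthogonal_subspace_decomp_exists[of I w2'] by blast
  have "i \<in> I" using ij(1) span_minimal[OF order_refl I] by blast
  then obtain u1 where u1: "u1 \<in> F" "i = u1 - B2 u1" unfolding I_def by blast
  have u1S: "u1 \<in> S" "B1 u1 = u1" using u1(1) by (auto simp: F_def)
  have iS: "i \<in> S" "B2 i = - i"
    unfolding u1(2) using u1S BS(2) inv(2) S by (auto simp: subspace_diff linear_diff[OF l(2)])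
  have j: "j = w2' - i" using ij(3) by simp
  have jS: "j \<in> S" "B2 j = - j"
    unfolding j using iS w2' S by (auto simp: subspace_diff linear_diff[OF l(2)])
  \<comment> \<open>j is orthogonal to y - B2 y, while B2 j = - j makes the products of j with y and
    with B2 y opposite; so both vanish.\<close>
  have ortho: "j \<bullet> y = 0" if y: "y \<in> F" for y
  proof -
    have yS: "y \<in> S" using y by (simp add: F_def)
    have "y - B2 y \<in> span I" using y unfolding I_def by (intro span_base imageI)
    from ij(2)[OF this] have "j \<bullet> y - j \<bullet> B2 y = 0" by (simp add: orthogonal_def inner_diff_right)
    moreover have "j \<bullet> B2 y = - (j \<bullet> y)"
      using ip(2)[of j "B2 y"] inv(2)[OF yS] jS(2) by simp
    ultimately show ?thesis by simp
  qed
  \<comment> \<open>j + B1 j is fixed by B1, hence orthogonal to j and, as B1 is an isometry, to B1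
    j; so it is orthogonal to itself.\<close>
  have "j + B1 j \<in> F" unfolding F_def using jS(1) BS(1) inv(1) S by (simp add: subspace_add linear_add[OF l(1)] add.commute)
  then have "j \<bullet> (j + B1 j) = 0" by (rule ortho)
  moreover have "B1 j \<bullet> (j + B1 j) = j \<bullet> (j + B1 j)"
    using ip(1)[of j j] by (simp add: inner_add_right inner_commute)
  ultimately have "(j + B1 j) \<bullet> (j + B1 j) = 0" by (simp add: inner_add_left)
  then have B1j: "B1 j = - j" by (simp add: eq_neg_iff_add_eq_0 add.commute)
  have "u0 - u1 \<in> S" using u0 u1S S by (simp add: subspace_diff)
  moreover have "w1 + (u0 - u1) - B1 (u0 - u1) = 0"
    using u01 u1S(2) by (simp add: linear_diff[OF l(1)] algebra_simps)
  moreover have "w2 + (u0 - u1) - B2 (u0 - u1) = j"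
    unfolding j w2'_def u1(2) by (simp add: linear_diff[OF l(2)] algebra_simps)
  ultimately show thesis using that jS B1j by blast
qed

text \<open>The assumption \<open>inf\<close> records what is used of the infinite quotient at this
  stage: an element of infinite order modulo N. The vector e is a unit normal of V.\<close>

locale codim_one_pair =
  fixes M :: "('a::euclidean_space \<Rightarrow> 'a) set" and \<Gamma> N :: "'a transf set"
    and \<alpha> :: "'a \<times> real \<Rightarrow> 'a" and a :: 'a and A :: "'a \<times> real \<Rightarrow> 'a" and e :: "'a \<times> real"
  assumes sM: "space_group M" and pair: "(\<Gamma>, N) \<in> space_pairs M"
    and lA: "linear A" and \<alpha>_eq: "\<And>x. x \<in> Span N \<Longrightarrow> \<alpha> x = a + A x"
    and \<alpha>_bij: "bij_betw \<alpha> (Span N) UNIV" and \<alpha>_conj: "conj_map (Span N) UNIV \<alpha> ` bar_group N = M"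
    and e: "norm e = 1" "Span N = {x. x \<bullet> e = 0}"
    and inf: "\<exists>\<gamma>\<in>\<Gamma>. \<forall>j>0. \<gamma> ^^ j \<notin> N"
begin

abbreviation "V \<equiv> Span N"

lemmas N = space_pairs_D(3-5)[OF pair]
lemmas tg = space_pairs_D(2)[OF pair]

lemma V_iff: "x \<in> V \<longleftrightarrow> x \<bullet> e = 0" unfolding e(2) by simp

lemma subspace_V: "subspace V" unfolding Span_def by (rule subspace_span)

lemma ee: "e \<bullet> e = 1" using e(1) by (simp add: norm_eq_1)

definition p :: "'a \<times> real \<Rightarrow> 'a \<times> real" where "p x = x - (x \<bullet> e) *\<^sub>R e"

lemma p_V: "p x \<in> V" unfolding V_iff p_def by (simp add: inner_diff_left ee)

lemma p_id: "x \<in> V \<Longrightarrow> p x = x" unfolding V_iff p_def by simp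

lemma p_decomp: "x = p x + (x \<bullet> e) *\<^sub>R e" unfolding p_def by simp

lemma linear_p: "linear p"
  unfolding p_def by (rule linearI) (simp_all add: inner_add_left algebra_simps)

lemma V_perp: "x \<in> V\<^sup>\<bottom> \<longleftrightarrow> x = (x \<bullet> e) *\<^sub>R e"
proof
  assume x: "x \<in> V\<^sup>\<bottom>"
  have "p x \<bullet> x = 0" using x p_V[of x] unfolding orthogonal_comp_def orthogonal_def by blast
  then have "p x \<bullet> p x = 0"
    using p_V[of x] unfolding p_def[of x] V_iff by (simp add: inner_diff_right inner_diff_left inner_commute ee)
  then show "x = (x \<bullet> e) *\<^sub>R e" using p_decomp[of x] by simp
next
  assume x: "x = (x \<bullet> e) *\<^sub>R e"
  show "x \<in> V\<^sup>\<bottom>"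
    unfolding orthogonal_comp_def orthogonal_def by (subst x) (simp add: V_iff)
qed

text \<open>Orthogonal projection solves the definite description in \<open>bar\<close>; by
  \<open>V_perp\<close> the solution is unique.\<close>

lemma bar_eq: "v \<in> V \<Longrightarrow> bar V \<gamma> v = p (\<gamma> v)"
  unfolding bar_def restrict_apply if_P
proof (rule the_equality)
  show "p (\<gamma> v) \<in> V \<and> \<gamma> v - p (\<gamma> v) \<in> V\<^sup>\<bottom>" using p_V unfolding V_perp by (simp add: p_def inner_diff_left ee)
  fix u assume u: "u \<in> V \<and> \<gamma> v - u \<in> V\<^sup>\<bottom>"
  then have "\<gamma> v - u = (\<gamma> v \<bullet> e) *\<^sub>R e" unfolding V_perp V_iff by (simp add: inner_diff_left)
  then show "u = p (\<gamma> v)" by (simp add: p_def algebra_simps)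
qed

lemma bar_V: "v \<in> V \<Longrightarrow> bar V \<gamma> v \<in> V" by (simp add: bar_eq p_V)

lemma G:
  assumes "\<gamma> \<in> \<Gamma>"
  shows "orthogonal_transformation (lin \<gamma>)" "linear (lin \<gamma>)" "bij \<gamma>"
  using assms space_group_D(2)[OF space_pairs_D(1)[OF pair]] isometry_lin by blast+

lemma transl_V: "t \<in> transl N \<Longrightarrow> t \<in> V" unfolding Span_translations by (rule span_base)

lemma lin_transl_N:
  assumes "\<gamma> \<in> \<Gamma>" "t \<in> transl N" shows "lin \<gamma> t \<in> transl N"
proof -
  have "conjm \<gamma> ((+) t) \<in> N" by (rule N(3)[OF assms(1)]) (use assms(2) in \<open>simp add: transl_def\<close>)
  then show ?thesis unfolding conjm_plus[OF G(2,3)[OF assms(1)]] transl_def by simp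
qed

text \<open>The linear parts carry translations of N to translations of N, and these span V.\<close>

lemma lin_V:
  assumes \<gamma>: "\<gamma> \<in> \<Gamma>" shows "lin \<gamma> ` V = V"
proof (rule subspace_dim_equal)
  show "subspace (lin \<gamma> ` V)" by (rule linear_subspace_image[OF G(2)[OF \<gamma>] subspace_V])
  show "subspace V" by (rule subspace_V)
  have "lin \<gamma> ` V = span (lin \<gamma> ` transl N)" unfolding Span_translations span_linear_image[OF G(2)[OF \<gamma>]] ..
  also have "\<dots> \<subseteq> V" unfolding Span_translations by (rule span_mono) (use lin_transl_N[OF \<gamma>] in blast)
  finally show "lin \<gamma> ` V \<subseteq> V" .
  have "inj (lin \<gamma>)" using G(1)[OF \<gamma>] orthogonal_transformation_inj by blast
  then show "dim V \<le> dim (lin \<gamma> ` V)" using dim_image_eq[OF G(2)[OF \<gamma>], of V] inj_on_subset by (metis order_refl subset_UNIV)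
qed

text \<open>The sign by which \<gamma> acts on the normal line of V.\<close>

definition sg :: "'a transf \<Rightarrow> real" where "sg \<gamma> = lin \<gamma> e \<bullet> e"

lemma lin_e:
  assumes \<gamma>: "\<gamma> \<in> \<Gamma>" shows "lin \<gamma> e = sg \<gamma> *\<^sub>R e" "sg \<gamma> = 1 \<or> sg \<gamma> = -1"
proof -
  have "lin \<gamma> e \<in> V\<^sup>\<bottom>"
    unfolding orthogonal_comp_def orthogonal_def
  proof (intro CollectI ballI)
    fix y assume "y \<in> V"
    then obtain v where v: "v \<in> V" "y = lin \<gamma> v" using lin_V[OF \<gamma>] by blast
    show "y \<bullet> lin \<gamma> e = 0"
      using G(1)[OF \<gamma>] v(1) unfolding v(2) orthogonal_transformation_def V_iff by metis
  qed
  then show 1: "lin \<gamma> e = sg \<gamma> *\<^sub>R e" unfolding V_perp sg_def .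
  have "norm (lin \<gamma> e) = 1" using orthogonal_transformation_norm[OF G(1)[OF \<gamma>]] e(1) by simp
  then show "sg \<gamma> = 1 \<or> sg \<gamma> = -1" unfolding 1 using e(1) by auto
qed

lemma lin_V_mem: "\<gamma> \<in> \<Gamma> \<Longrightarrow> v \<in> V \<Longrightarrow> lin \<gamma> v \<in> V" using lin_V by blast

text \<open>The restricted action \<gamma>' on the normal line, in the coordinate x \<bullet> e; its
  slope is the sign.\<close>

definition h :: "'a transf \<Rightarrow> real \<Rightarrow> real" where "h \<gamma> t = \<gamma> 0 \<bullet> e + sg \<gamma> * t"

lemma inner_h:
  assumes \<gamma>: "\<gamma> \<in> \<Gamma>" shows "\<gamma> x \<bullet> e = h \<gamma> (x \<bullet> e)"
proof -
  have "lin \<gamma> x = lin \<gamma> (p x) + (x \<bullet> e) *\<^sub>R lin \<gamma> e"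
    using linear_add[OF G(2)[OF \<gamma>], of "p x" "(x \<bullet> e) *\<^sub>R e"] linear_scale[OF G(2)[OF \<gamma>]] p_decomp[of x] by simp
  moreover have "lin \<gamma> (p x) \<bullet> e = 0" using lin_V_mem[OF \<gamma> p_V] unfolding V_iff .
  ultimately have "lin \<gamma> x \<bullet> e = (x \<bullet> e) * sg \<gamma>" unfolding lin_e(1)[OF \<gamma>] by (simp add: inner_add_left ee)
  then show ?thesis using affine_decomp[of \<gamma> x] by (simp add: h_def inner_add_left mult.commute)
qed

text \<open>Moving x along e moves \<gamma> x along e only, because e is an eigenvector of the
  linear part.\<close>

lemma p_comp:
  assumes \<gamma>: "\<gamma> \<in> \<Gamma>" shows "p (\<gamma> x) = bar V \<gamma> (p x)"
proof -
  have "\<gamma> x = \<gamma> (p x) + (x \<bullet> e) *\<^sub>R (sg \<gamma> *\<^sub>R e)"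
    using lin_add[OF G(2)[OF \<gamma>], of "p x" "(x \<bullet> e) *\<^sub>R e"] linear_scale[OF G(2)[OF \<gamma>]] p_decomp[of x] lin_e(1)[OF \<gamma>] by simp
  then have "p (\<gamma> x) = p (\<gamma> (p x)) + ((x \<bullet> e) * sg \<gamma>) *\<^sub>R p e"
    using linear_add[OF linear_p] linear_scale[OF linear_p] by simp
  moreover have "p e = 0" by (simp add: p_def ee)
  ultimately show ?thesis by (simp add: bar_eq[OF p_V])
qed

lemma bar_comp:
  assumes "\<gamma> \<in> \<Gamma>" "v \<in> V" shows "bar V (\<gamma> \<circ> \<delta>) v = bar V \<gamma> (bar V \<delta> v)"
  using p_comp[OF assms(1), of "\<delta> v"] by (simp add: bar_eq[OF assms(2)])

lemma h_comp:
  assumes "\<gamma> \<in> \<Gamma>" "\<delta> \<in> \<Gamma>" shows "h (\<gamma> \<circ> \<delta>) = h \<gamma> \<circ> h \<delta>"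
proof
  fix t
  have "((\<gamma> \<circ> \<delta>) (t *\<^sub>R e)) \<bullet> e = h \<gamma> (h \<delta> ((t *\<^sub>R e) \<bullet> e))" using inner_h[OF assms(1)] inner_h[OF assms(2)] by simp
  then show "h (\<gamma> \<circ> \<delta>) t = (h \<gamma> \<circ> h \<delta>) t" using inner_h[OF tgroupD(3)[OF tg assms], of "t *\<^sub>R e"] by (simp add: ee)
qed

lemma h_id: "h id = id" by (auto simp: h_def sg_def ee fun_eq_iff)

lemma h_plus: "h ((+) b) = (+) (b \<bullet> e)" by (auto simp: h_def sg_def ee fun_eq_iff)

lemma decompose:
  assumes "\<gamma> \<in> \<Gamma>" shows "\<gamma> x = bar V \<gamma> (p x) + h \<gamma> (x \<bullet> e) *\<^sub>R e"
  using p_decomp[of "\<gamma> x"] p_comp[OF assms] inner_h[OF assms] by simp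

lemma transl_h: "t \<in> transl N \<Longrightarrow> h ((+) t) = id"
  unfolding h_plus using transl_V[of t] unfolding V_iff by (simp add: plus_zero)

text \<open>The conjugate of the restricted action by \<alpha>; it becomes the first factor of the
  isomorphism onto the fibre product.\<close>

definition \<Phi> :: "'a transf \<Rightarrow> 'a \<Rightarrow> 'a" where "\<Phi> \<gamma> = conj_map V UNIV \<alpha> (bar V \<gamma>)"

lemma \<Phi>_\<alpha>: "v \<in> V \<Longrightarrow> \<Phi> \<gamma> (\<alpha> v) = \<alpha> (bar V \<gamma> v)"
  using \<alpha>_bij by (simp add: \<Phi>_def conj_map_def bij_betw_def inv_into_f_f)

lemma \<alpha>_surj: obtains v where "v \<in> V" "\<alpha> v = y"
  using \<alpha>_bij unfolding bij_betw_def by (metis UNIV_I imageE)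

lemma \<alpha>_inj: "v \<in> V \<Longrightarrow> w \<in> V \<Longrightarrow> \<alpha> v = \<alpha> w \<longleftrightarrow> v = w"
  using \<alpha>_bij unfolding bij_betw_def by (meson inj_onD)

lemma A_inj: "v \<in> V \<Longrightarrow> w \<in> V \<Longrightarrow> A v = A w \<longleftrightarrow> v = w"
  using \<alpha>_inj \<alpha>_eq by (metis add_left_cancel)

lemma A_surj: obtains v where "v \<in> V" "A v = y"
proof -
  obtain v where "v \<in> V" "\<alpha> v = a + y" by (rule \<alpha>_surj)
  then show thesis using that \<alpha>_eq[of v] by simp
qed

lemma \<Phi>_comp: "\<gamma> \<in> \<Gamma> \<Longrightarrow> \<Phi> (\<gamma> \<circ> \<delta>) = \<Phi> \<gamma> \<circ> \<Phi> \<delta>"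
proof
  fix y assume "\<gamma> \<in> \<Gamma>"
  obtain v where v: "v \<in> V" "\<alpha> v = y" by (rule \<alpha>_surj)
  show "\<Phi> (\<gamma> \<circ> \<delta>) y = (\<Phi> \<gamma> \<circ> \<Phi> \<delta>) y"
    using \<Phi>_\<alpha>[OF v(1)] \<Phi>_\<alpha>[OF bar_V[OF v(1)]] bar_comp[OF \<open>\<gamma> \<in> \<Gamma>\<close> v(1)] unfolding v(2)[symmetric] by simp
qed

lemma \<Phi>_plus: "t \<in> V \<Longrightarrow> \<Phi> ((+) t) = (+) (A t)"
proof
  fix y assume t: "t \<in> V"
  obtain v where v: "v \<in> V" "\<alpha> v = y" by (rule \<alpha>_surj)
  have tv: "t + v \<in> V" by (rule subspace_add[OF subspace_V t v(1)])
  show "\<Phi> ((+) t) y = A t + y"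
    using \<Phi>_\<alpha>[OF v(1), of "(+) t"] bar_eq[OF v(1), of "(+) t"] p_id[OF tv] \<alpha>_eq[OF tv] \<alpha>_eq[OF v(1)] linear_add[OF lA]
    unfolding v(2)[symmetric] by simp
qed

lemma \<Phi>_id: "\<Phi> id = id"
  using \<Phi>_plus[of 0] subspace_0[OF subspace_V] linear_0[OF lA] by (simp add: plus_zero[unfolded id_def] id_def)

lemma \<Phi>_bij: "\<gamma> \<in> \<Gamma> \<Longrightarrow> bij (\<Phi> \<gamma>)"
proof (rule o_bij)
  assume \<gamma>: "\<gamma> \<in> \<Gamma>"
  have i: "finv \<gamma> \<in> \<Gamma>" by (rule tgroupD(4)[OF tg \<gamma>])
  show "\<Phi> (finv \<gamma>) \<circ> \<Phi> \<gamma> = id" "\<Phi> \<gamma> \<circ> \<Phi> (finv \<gamma>) = id"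
    unfolding \<Phi>_comp[OF \<gamma>, symmetric] \<Phi>_comp[OF i, symmetric] inv_comp_bij[OF G(3)[OF \<gamma>]] by (rule \<Phi>_id)+
qed

lemma \<Phi>_N: "\<Phi> ` N = M"
  using \<alpha>_conj unfolding bar_group_def image_image \<Phi>_def .

lemma \<Phi>_A:
  assumes \<gamma>: "\<gamma> \<in> \<Gamma>" and w: "w \<in> V" shows "\<Phi> \<gamma> (A w + y) = \<Phi> \<gamma> y + A (lin \<gamma> w)"
proof -
  have "\<gamma> \<circ> (+) w = (+) (lin \<gamma> w) \<circ> \<gamma>" by (rule comp_plus[OF G(2)[OF \<gamma>]])
  then have "\<Phi> (\<gamma> \<circ> (+) w) = \<Phi> ((+) (lin \<gamma> w) \<circ> \<gamma>)" by simp
  moreover have "\<Phi> ((+) (lin \<gamma> w) \<circ> \<gamma>) = (+) (A (lin \<gamma> w)) \<circ> \<Phi> \<gamma>"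
  proof
    fix y
    obtain v where v: "v \<in> V" "\<alpha> v = y" by (rule \<alpha>_surj)
    have lw: "lin \<gamma> w \<in> V" by (rule lin_V_mem[OF \<gamma> w])
    have "bar V ((+) (lin \<gamma> w) \<circ> \<gamma>) v = lin \<gamma> w + bar V \<gamma> v"
      unfolding bar_eq[OF v(1)] using linear_add[OF linear_p, of "lin \<gamma> w" "\<gamma> v"] p_id[OF lw] by simp
    moreover have "lin \<gamma> w + bar V \<gamma> v \<in> V" by (rule subspace_add[OF subspace_V lw bar_V[OF v(1)]])
    ultimately show "\<Phi> ((+) (lin \<gamma> w) \<circ> \<gamma>) y = ((+) (A (lin \<gamma> w)) \<circ> \<Phi> \<gamma>) y"
      unfolding v(2)[symmetric] using \<alpha>_eq bar_V[OF v(1)] by (simp add: \<Phi>_\<alpha>[OF v(1)] linear_add[OF lA])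
  qed
  ultimately have "\<Phi> \<gamma> \<circ> (+) (A w) = (+) (A (lin \<gamma> w)) \<circ> \<Phi> \<gamma>"
    unfolding \<Phi>_comp[OF \<gamma>] \<Phi>_plus[OF w] by simp
  from fun_cong[OF this, of y] show ?thesis by (simp add: add.commute)
qed

text \<open>A intertwines the linear parts, so eigenvectors of the generators in V correspond to
  eigenvectors of their images under \<Phi>.\<close>

lemma lin_\<Phi>:
  assumes \<gamma>: "\<gamma> \<in> \<Gamma>" shows "w \<in> V \<Longrightarrow> lin (\<Phi> \<gamma>) (A w) = A (lin \<gamma> w)" "linear (lin (\<Phi> \<gamma>))"
proof -
  show 1: "lin (\<Phi> \<gamma>) (A w) = A (lin \<gamma> w)" if "w \<in> V" for w
    using \<Phi>_A[OF \<gamma> that, of 0] by (simp add: lin_def)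
  note l = G(2)[OF \<gamma>]
  show "linear (lin (\<Phi> \<gamma>))"
  proof (rule linearI)
    fix x y :: 'a and r :: real
    obtain v where v: "v \<in> V" "A v = x" by (rule A_surj)
    obtain w where w: "w \<in> V" "A w = y" by (rule A_surj)
    have vw: "v + w \<in> V" "r *\<^sub>R v \<in> V" using v(1) w(1) subspace_V by (simp_all add: subspace_add subspace_scale)
    show "lin (\<Phi> \<gamma>) (x + y) = lin (\<Phi> \<gamma>) x + lin (\<Phi> \<gamma>) y"
      using 1[OF vw(1)] 1[OF v(1)] 1[OF w(1)] by (simp add: linear_add[OF lA] linear_add[OF l] v(2) w(2))
    show "lin (\<Phi> \<gamma>) (r *\<^sub>R x) = r *\<^sub>R lin (\<Phi> \<gamma>) x"
      using 1[OF vw(2)] 1[OF v(1)] by (simp add: linear_scale[OF lA] linear_scale[OF l] v(2))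
  qed
qed

lemma crystal_M: "crystal M"
proof (rule crystal_of_space_group[OF sM])
  have "A ` transl N \<subseteq> transl M"
  proof (rule image_subsetI)
    fix t assume t: "t \<in> transl N"
    then have "\<Phi> ((+) t) \<in> M" using \<Phi>_N unfolding transl_def by blast
    then show "A t \<in> transl M" unfolding \<Phi>_plus[OF transl_V[OF t]] by (simp add: transl_def)
  qed
  then have "span (A ` transl N) \<subseteq> span (transl M)" by (rule span_mono)
  moreover have "span (A ` transl N) = UNIV"
    unfolding span_linear_image[OF lA] Span_translations[symmetric] using A_surj by (metis UNIV_eq_I imageI)
  ultimately show "span (transl M) = UNIV" by blast
qed

lemma \<Phi>_normalizing:
  assumes \<gamma>: "\<gamma> \<in> \<Gamma>" shows "\<Phi> \<gamma> \<in> normalizing_affinities M"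
  unfolding normalizing_affinities_iff
proof (intro conjI)
  show "bij (\<Phi> \<gamma>)" "linear (lin (\<Phi> \<gamma>))" by (rule \<Phi>_bij[OF \<gamma>], rule lin_\<Phi>(2)[OF \<gamma>])
  have c: "conjm (\<Phi> \<gamma>) (\<Phi> \<nu>) = \<Phi> (conjm \<gamma> \<nu>)" if "\<gamma> \<in> \<Gamma>" "\<nu> \<in> N" for \<gamma> \<nu>
  proof -
    have "\<Phi> \<gamma> \<circ> \<Phi> \<nu> = \<Phi> (conjm \<gamma> \<nu> \<circ> \<gamma>)"
      unfolding \<Phi>_comp[OF that(1), symmetric] comp_assoc inv_comp_bij[OF G(3)[OF that(1)]] by simp
    also have "\<dots> = \<Phi> (conjm \<gamma> \<nu>) \<circ> \<Phi> \<gamma>" by (rule \<Phi>_comp) (use N(1) N(3)[OF that] in blast)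
    finally show ?thesis using \<Phi>_bij[OF that(1)] by (simp add: comp_assoc)
  qed
  show "conjm (\<Phi> \<gamma>) ` M = M"
  proof
    show "conjm (\<Phi> \<gamma>) ` M \<subseteq> M"
      unfolding \<Phi>_N[symmetric] image_image
    proof (rule image_subsetI)
      fix \<nu> assume \<nu>: "\<nu> \<in> N"
      show "conjm (\<Phi> \<gamma>) (\<Phi> \<nu>) \<in> \<Phi> ` N" unfolding c[OF \<gamma> \<nu>] by (rule imageI[OF N(3)[OF \<gamma> \<nu>]])
    qed
    show "M \<subseteq> conjm (\<Phi> \<gamma>) ` M"
    proof
      fix \<mu> assume "\<mu> \<in> M"
      then obtain \<nu> where \<nu>: "\<nu> \<in> N" "\<mu> = \<Phi> \<nu>" unfolding \<Phi>_N[symmetric] by blast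
      have i: "finv \<gamma> \<in> \<Gamma>" by (rule tgroupD(4)[OF tg \<gamma>])
      have n: "conjm (finv \<gamma>) \<nu> \<in> N" by (rule N(3)[OF i \<nu>(1)])
      have "conjm \<gamma> (conjm (finv \<gamma>) \<nu>) = \<nu>"
        unfolding conjm_conjm[OF G(3)[OF \<gamma>] G(3)[OF i]] inv_comp_bij[OF G(3)[OF \<gamma>]] by (rule conjm_id(1))
      then have "\<mu> = conjm (\<Phi> \<gamma>) (\<Phi> (conjm (finv \<gamma>) \<nu>))" unfolding c[OF \<gamma> n] \<nu>(2) by simp
      moreover have "\<Phi> (conjm (finv \<gamma>) \<nu>) \<in> M" unfolding \<Phi>_N[symmetric] by (rule imageI[OF n])
      ultimately show "\<mu> \<in> conjm (\<Phi> \<gamma>) ` M" by (rule image_eqI[where f = "conjm (\<Phi> \<gamma>)"])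
    qed
  qed
qed

lemma \<Phi>_h_inject:
  assumes "\<gamma> \<in> \<Gamma>" "\<delta> \<in> \<Gamma>" "\<Phi> \<gamma> = \<Phi> \<delta>" "h \<gamma> = h \<delta>" shows "\<gamma> = \<delta>"
proof
  fix x
  have "\<alpha> (bar V \<gamma> (p x)) = \<alpha> (bar V \<delta> (p x))"
    using \<Phi>_\<alpha>[OF p_V, of \<gamma> x] \<Phi>_\<alpha>[OF p_V, of \<delta> x] assms(3) by simp
  then have "bar V \<gamma> (p x) = bar V \<delta> (p x)" using \<alpha>_inj[OF bar_V[OF p_V] bar_V[OF p_V]] by blast
  then show "\<gamma> x = \<delta> x" using decompose[OF assms(1)] decompose[OF assms(2)] assms(4) by simp
qed

text \<open>The lattice of N spans only V. Adding e and - e, which linear parts permute, gives a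
  spanning set that is finite in balls and preserved, so the linear parts lie in a finite
  stabilizer.\<close>

lemma power_lin_id: "\<exists>r>0. \<forall>\<gamma>\<in>\<Gamma>. lin \<gamma> ^^ r = id"
proof -
  define T where "T = transl N \<union> {e, - e}"
  have sub: "transl N \<subseteq> transl \<Gamma>" using N(1) by (auto simp: transl_def)
  have "finite_in_balls (transl \<Gamma>)"
    by (rule discrete_imp_finite_in_balls[OF tg space_group_D(3)[OF space_pairs_D(1)[OF pair]]])
  then have "finite_in_balls T"
    unfolding finite_in_balls_def
  proof (intro allI)
    fix R assume "\<forall>R. finite {t \<in> transl \<Gamma>. norm t \<le> R}"
    then have "finite ({t \<in> transl \<Gamma>. norm t \<le> R} \<union> {e, - e})" by simp
    then show "finite {t \<in> T. norm t \<le> R}" by (rule finite_subset[rotated]) (use sub in \<open>auto simp: T_def\<close>)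
  qed
  moreover have "span T = UNIV"
  proof -
    have "x \<in> span T" for x
    proof -
      have "p x \<in> span T" using p_V[of x] span_mono[of "transl N" T] unfolding Span_translations T_def by blast
      moreover have "e \<in> span T" by (rule span_base) (simp add: T_def)
      ultimately have "p x + (x \<bullet> e) *\<^sub>R e \<in> span T" by (intro span_add span_scale)
      then show ?thesis using p_decomp[of x] by simp
    qed
    then show ?thesis by blast
  qed
  ultimately have "finite {B. orthogonal_transformation B \<and> B ` T \<subseteq> T}" (is "finite ?S")
    by (rule finite_lattice_stabilizer)
  then have "\<exists>k>0. \<forall>f\<in>?S. f ^^ k = id"
  proof (rule finite_monoid_power_id)
    fix f g assume "f \<in> ?S" "g \<in> ?S"
    then show "f \<circ> g \<in> ?S" by (auto intro: orthogonal_transformation_compose simp del: comp_apply) (auto simp: image_subset_iff)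
  next
    fix f assume "f \<in> ?S" then show "bij f" using orthogonal_transformation_bij by blast
  qed
  then obtain k where k: "k > 0" "\<forall>f\<in>?S. f ^^ k = id" by (elim exE conjE)
  have S: "lin \<gamma> \<in> ?S" if \<gamma>: "\<gamma> \<in> \<Gamma>" for \<gamma>
  proof -
    have "lin \<gamma> e = e \<or> lin \<gamma> e = - e" using lin_e(2)[OF \<gamma>] unfolding lin_e(1)[OF \<gamma>] by auto
    moreover have "lin \<gamma> (- e) = - lin \<gamma> e" by (rule linear_neg[OF G(2)[OF \<gamma>]])
    ultimately have "lin \<gamma> e \<in> T" "lin \<gamma> (- e) \<in> T" by (auto simp: T_def)
    then have "lin \<gamma> ` T \<subseteq> T" using lin_transl_N[OF \<gamma>] by (auto simp: T_def image_subset_iff)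
    then show ?thesis using G(1)[OF \<gamma>] by blast
  qed
  show ?thesis by (intro exI[of _ k] conjI ballI k(1) bspec[OF k(2) S])
qed

lemma h_pow: "\<gamma> \<in> \<Gamma> \<Longrightarrow> h (\<gamma> ^^ k) = h \<gamma> ^^ k"
proof (induction k)
  case 0
  then show ?case using h_id by (simp add: id_def)
next
  case (Suc k)
  then show ?case using h_comp[OF Suc(2) tgroup_pow[OF tg Suc(2)]] by (simp only: funpow.simps)
qed

lemma \<Phi>_pow: "\<gamma> \<in> \<Gamma> \<Longrightarrow> \<Phi> (\<gamma> ^^ k) = \<Phi> \<gamma> ^^ k"
proof (induction k)
  case 0
  then show ?case using \<Phi>_id by (simp add: id_def)
next
  case (Suc k)
  then show ?case using \<Phi>_comp[OF Suc(2)] by (simp only: funpow.simps)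
qed

lemma power_translation:
  assumes "\<gamma> \<in> \<Gamma>" obtains r b where "r > 0" "\<gamma> ^^ r = (+) b"
proof -
  obtain r where r: "r > 0" "lin \<gamma> ^^ r = id" using power_lin_id assms by blast
  then have "lin (\<gamma> ^^ r) = id" using lin_funpow(1)[OF G(2)[OF assms]] by simp
  then show thesis using that r(1) lin_eq_id by blast
qed

text \<open>Some power of \<gamma> is a translation. As it is trivial on the normal line, its vector
  lies in V, the span of the lattice of N, so a further power is in N.\<close>

lemma kernel_torsion:
  assumes \<gamma>: "\<gamma> \<in> \<Gamma>" and h: "h \<gamma> = id" shows "\<exists>k>0. \<gamma> ^^ k \<in> N"
proof -
  obtain r b where r: "r > 0" "\<gamma> ^^ r = (+) b" by (rule power_translation[OF \<gamma>])
  have "h ((+) b) = id" using h_pow[OF \<gamma>, of r] unfolding r(2) h by simp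
  then have "b \<in> V" unfolding h_plus V_iff by (metis add.right_neutral id_apply)
  moreover have "b \<in> transl \<Gamma>" using tgroup_pow[OF tg \<gamma>, of r] unfolding r(2) transl_def by simp
  moreover have "finite_in_balls (transl \<Gamma>)"
    by (rule discrete_imp_finite_in_balls[OF tg space_group_D(3)[OF space_pairs_D(1)[OF pair]]])
  moreover have "transl N \<subseteq> transl \<Gamma>" using N(1) by (auto simp: transl_def)
  ultimately obtain j where j: "j > 0" "real j *\<^sub>R b \<in> transl N"
    using lattice_commensurable[OF additive_subgroup_transl[OF tg] _ additive_subgroup_transl[OF N(2)], of b]
    unfolding Span_translations by blast
  have "\<gamma> ^^ (r * j) = (+) (real j *\<^sub>R b)" unfolding funpow_mult[symmetric] r(2) plus_pow ..
  then show ?thesis using j r(1) by (intro exI[of _ "r * j"]) (simp add: transl_def)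
qed

lemma sg_comp: "\<gamma> \<in> \<Gamma> \<Longrightarrow> \<delta> \<in> \<Gamma> \<Longrightarrow> sg (\<gamma> \<circ> \<delta>) = sg \<gamma> * sg \<delta>"
proof -
  assume *: "\<gamma> \<in> \<Gamma>" "\<delta> \<in> \<Gamma>"
  have "lin (\<gamma> \<circ> \<delta>) e = sg \<delta> *\<^sub>R lin \<gamma> e"
    unfolding lin_comp[OF G(2)[OF *(1)]] comp_apply lin_e(1)[OF *(2)] by (rule linear_scale[OF G(2)[OF *(1)]])
  then have "sg (\<gamma> \<circ> \<delta>) = (sg \<delta> *\<^sub>R lin \<gamma> e) \<bullet> e" by (simp only: sg_def)
  then show ?thesis by (simp add: sg_def[of \<gamma>])
qed

text \<open>With positive sign \<nu> shifts the line. A power of \<nu> is a translation of N, whose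
  vector lies in V, so a multiple of the shift is zero.\<close>

lemma h_pos_N:
  assumes \<nu>: "\<nu> \<in> N" and sg: "sg \<nu> = 1" shows "h \<nu> = id"
proof -
  have \<nu>\<Gamma>: "\<nu> \<in> \<Gamma>" using N(1) \<nu> by blast
  obtain r b where r: "r > 0" "\<nu> ^^ r = (+) b" by (rule power_translation[OF \<nu>\<Gamma>])
  have "b \<in> transl N" using tgroup_pow[OF N(2) \<nu>, of r] unfolding r(2) transl_def by simp
  then have "h (\<nu> ^^ r) = id" unfolding r(2) by (rule transl_h)
  moreover have "h \<nu> = (+) (\<nu> 0 \<bullet> e)" by (auto simp: h_def sg)
  ultimately have "(+) (real r *\<^sub>R (\<nu> 0 \<bullet> e)) = (id :: real \<Rightarrow> real)" unfolding h_pow[OF \<nu>\<Gamma>] using plus_pow by metis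
  then have "real r * (\<nu> 0 \<bullet> e) = 0" by (metis add.right_neutral id_apply real_scaleR_def)
  then show ?thesis using \<open>h \<nu> = (+) (\<nu> 0 \<bullet> e)\<close> r(1) by (simp add: plus_zero)
qed

text \<open>A reflection in the image of \<open>N\<close> would be the only one, so its center would be fixed by the image
  of \<open>\<Gamma>\<close>, and \<open>\<Gamma> / N\<close> would be a torsion group.\<close>

lemma h_N:
  assumes \<nu>: "\<nu> \<in> N" shows "h \<nu> = id"
proof (rule ccontr)
  assume n: "h \<nu> \<noteq> id"
  have \<nu>\<Gamma>: "\<nu> \<in> \<Gamma>" using N(1) \<nu> by blast
  have s: "sg \<nu> = -1" using h_pos_N[OF \<nu>] n lin_e(2)[OF \<nu>\<Gamma>] by blast
  obtain \<gamma> where \<gamma>: "\<gamma> \<in> \<Gamma>" "\<And>j. j > 0 \<Longrightarrow> \<gamma> ^^ j \<notin> N" using inf by blast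
  have c: "conjm \<gamma> \<nu> \<in> N" by (rule N(3)[OF \<gamma>(1) \<nu>])
  have c\<Gamma>: "conjm \<gamma> \<nu> \<in> \<Gamma>" using N(1) c by blast
  have "conjm \<gamma> \<nu> \<circ> \<gamma> = \<gamma> \<circ> \<nu>" using G(3)[OF \<gamma>(1)] by (simp add: comp_assoc)
  then have hc: "h (conjm \<gamma> \<nu>) \<circ> h \<gamma> = h \<gamma> \<circ> h \<nu>" and sc: "sg (conjm \<gamma> \<nu>) * sg \<gamma> = sg \<gamma> * sg \<nu>"
    using h_comp[OF c\<Gamma> \<gamma>(1)] h_comp[OF \<gamma>(1) \<nu>\<Gamma>] sg_comp[OF c\<Gamma> \<gamma>(1)] sg_comp[OF \<gamma>(1) \<nu>\<Gamma>] by metis+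
  have scn: "sg (conjm \<gamma> \<nu>) = -1" using sc s lin_e(2)[OF \<gamma>(1)] by auto
  \<comment> \<open>The product of two reflections coming from N has positive sign, so it is trivial
    and the two reflections coincide.\<close>
  have "h (conjm \<gamma> \<nu> \<circ> \<nu>) = id"
    by (rule h_pos_N[OF tgroupD(3)[OF N(2) c \<nu>]]) (simp add: sg_comp[OF c\<Gamma> \<nu>\<Gamma>] scn s)
  then have e: "h (conjm \<gamma> \<nu>) \<circ> h \<nu> = id" unfolding h_comp[OF c\<Gamma> \<nu>\<Gamma>] .
  have 0: "conjm \<gamma> \<nu> 0 \<bullet> e = \<nu> 0 \<bullet> e" using fun_cong[OF e, of 0] by (simp add: h_def scn)
  have "h (conjm \<gamma> \<nu>) = h \<nu>" unfolding h_def[abs_def] 0 scn s ..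
  then have hh: "h \<nu> (h \<gamma> t) = h \<gamma> (h \<nu> t)" for t using fun_cong[OF hc, of t] by simp
  \<comment> \<open>h \<gamma> commutes with the reflection and therefore fixes its centre; an
    isometry of the line with a fixed point is the identity or a reflection.\<close>
  have "h \<gamma> (h \<gamma> t) = t \<or> h \<gamma> = id" for t
    using hh[of 0] lin_e(2)[OF \<gamma>(1)] by (auto simp: h_def s fun_eq_iff)
  then have "h \<gamma> (h \<gamma> t) = t" for t by (cases "h \<gamma> = id") auto
  then have "h \<gamma> ^^ 2 = id" by (auto simp: numeral_2_eq_2)
  then have "h (\<gamma> ^^ 2) = id" unfolding h_pow[OF \<gamma>(1)] .
  then obtain k where "k > 0" "(\<gamma> ^^ 2) ^^ k \<in> N" using kernel_torsion[OF tgroup_pow[OF tg \<gamma>(1)]] by blast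
  then show False using \<gamma>(2)[of "2 * k"] unfolding funpow_mult by simp
qed

text \<open>The subspace Span(Z(N)), as \<open>Span_centre\<close> shows; A carries it onto the
  fixed vectors of M.\<close>

definition FixN :: "('a \<times> real) set" where
  "FixN = {w \<in> V. \<forall>\<nu>\<in>N. lin \<nu> w = w}"

lemma FixN_fixed: "w \<in> V \<Longrightarrow> w \<in> FixN \<longleftrightarrow> A w \<in> crystal.fixed M"
proof -
  assume w: "w \<in> V"
  have "lin \<nu> w = w \<longleftrightarrow> lin (\<Phi> \<nu>) (A w) = A w" if "\<nu> \<in> N" for \<nu>
  proof -
    have \<nu>: "\<nu> \<in> \<Gamma>" using that N(1) by blast
    show ?thesis unfolding lin_\<Phi>(1)[OF \<nu> w] using A_inj[OF lin_V_mem[OF \<nu> w] w] by simp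
  qed
  moreover have "A w \<in> crystal.fixed M \<longleftrightarrow> (\<forall>\<mu>\<in>\<Phi> ` N. lin \<mu> (A w) = A w)"
    unfolding \<Phi>_N crystal.fixed_def[OF crystal_M] by simp
  ultimately show ?thesis unfolding FixN_def using w by simp
qed

lemma FixN_subspace: "subspace FixN"
  unfolding FixN_def subspace_def
proof (intro conjI ballI allI CollectI)
  have l: "linear (lin \<nu>)" if "\<nu> \<in> N" for \<nu> using that N(1) G(2) by blast
  show "0 \<in> V" by (rule subspace_0[OF subspace_V])
  show "lin \<nu> 0 = 0" if "\<nu> \<in> N" for \<nu> by (rule linear_0[OF l[OF that]])
  fix x assume x: "x \<in> {w \<in> V. \<forall>\<nu>\<in>N. lin \<nu> w = w}"
  show "r *\<^sub>R x \<in> V" for r using x subspace_scale[OF subspace_V] by blast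
  show "lin \<nu> (r *\<^sub>R x) = r *\<^sub>R x" if "\<nu> \<in> N" for \<nu> r using x that linear_scale[OF l[OF that]] by simp
  fix y assume y: "y \<in> {w \<in> V. \<forall>\<nu>\<in>N. lin \<nu> w = w}"
  show "x + y \<in> V" using x y subspace_add[OF subspace_V] by blast
  show "lin \<nu> (x + y) = x + y" if "\<nu> \<in> N" for \<nu> using x y that linear_add[OF l[OF that]] by simp
qed

lemma centre_N: "centre (trans_group UNIV N) = {z \<in> N. \<forall>\<nu>\<in>N. z \<circ> \<nu> = \<nu> \<circ> z}"
  unfolding centre_def by (auto simp: tgroup_mult[OF N(2)] simp del: comp_apply)

text \<open>Central translations of N are those with vector in \<open>FixN\<close>. That they span
  is transferred from M through A; pulling a translation of M back to one of N uses that N acts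
  trivially on the normal line.\<close>

lemma Span_centre: "Span (centre (trans_group UNIV N)) = FixN"
proof -
  have lN: "linear (lin \<nu>)" if "\<nu> \<in> N" for \<nu> using that N(1) G(2) by blast
  have c: "(+) t \<in> centre (trans_group UNIV N) \<longleftrightarrow> t \<in> transl N \<inter> FixN" for t
  proof -
    have "(+) t \<circ> \<nu> = \<nu> \<circ> (+) t \<longleftrightarrow> lin \<nu> t = t" if "\<nu> \<in> N" for \<nu>
      unfolding comp_plus[OF lN[OF that]] by (auto simp: fun_eq_iff)
    then show ?thesis unfolding centre_N FixN_def using transl_V[of t] by (simp add: transl_def conj_commute cong: conj_cong)
  qed
  interpret M: crystal M by (rule crystal_M)
  have "FixN \<subseteq> span (transl N \<inter> FixN)"
  proof
    fix w assume w: "w \<in> FixN"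
    then have wV: "w \<in> V" by (simp add: FixN_def)
    have "transl M \<inter> M.fixed \<subseteq> A ` (transl N \<inter> FixN)"
    proof
      fix s assume s: "s \<in> transl M \<inter> M.fixed"
      obtain t where t: "t \<in> V" "A t = s" by (rule A_surj)
      have "(+) s \<in> \<Phi> ` N" using s unfolding \<Phi>_N by (simp add: transl_def)
      then obtain \<nu> where \<nu>: "\<nu> \<in> N" "\<Phi> \<nu> = (+) s" by auto
      have \<nu>\<Gamma>: "\<nu> \<in> \<Gamma>" using \<nu>(1) N(1) by blast
      \<comment> \<open>\<Phi> \<nu> determines only the component of \<nu> in V; \<open>h_N\<close>
        supplies the component along e.\<close>
      have "\<nu> x = t + x" for x
      proof -
        have tv: "t + p x \<in> V" by (rule subspace_add[OF subspace_V t(1) p_V])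
        have "\<alpha> (bar V \<nu> (p x)) = \<alpha> (t + p x)"
          using \<Phi>_\<alpha>[OF p_V, of \<nu> x] \<alpha>_eq[OF tv] \<alpha>_eq[OF p_V[of x]] by (simp add: \<nu>(2) t(2)[symmetric] linear_add[OF lA] algebra_simps)
        then have "bar V \<nu> (p x) = t + p x" using \<alpha>_inj[OF bar_V[OF p_V] tv] by blast
        then show ?thesis using decompose[OF \<nu>\<Gamma>, of x] h_N[OF \<nu>(1)] p_decomp[of x] by (simp add: add.assoc)
      qed
      then have "\<nu> = (+) t" by blast
      then have "t \<in> transl N" using \<nu>(1) by (simp add: transl_def)
      moreover have "t \<in> FixN" using FixN_fixed[OF t(1)] t(2) s by simp
      ultimately show "s \<in> A ` (transl N \<inter> FixN)" using t(2) by blast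
    qed
    then have "A w \<in> span (A ` (transl N \<inter> FixN))"
      using M.fixed_span FixN_fixed[OF wV] w span_mono by blast
    then obtain w' where w': "w' \<in> span (transl N \<inter> FixN)" "A w = A w'"
      unfolding span_linear_image[OF lA] by blast
    have w'V: "w' \<in> V" using w'(1) span_mono[of "transl N \<inter> FixN" "transl N"] unfolding Span_translations by blast
    have "w = w'" using A_inj[OF wV w'V] w'(2) by blast
    then show "w \<in> span (transl N \<inter> FixN)" using w'(1) by simp
  qed
  moreover have "span (transl N \<inter> FixN) \<subseteq> FixN" by (rule span_minimal[OF _ FixN_subspace]) blast
  moreover have "t \<in> transl (centre (trans_group UNIV N)) \<longleftrightarrow> t \<in> transl N \<inter> FixN" for t
    unfolding c[symmetric] by (simp add: transl_def)
  then have "transl (centre (trans_group UNIV N)) = transl N \<inter> FixN" by blast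
  ultimately show ?thesis unfolding Span_translations[of "centre (trans_group UNIV N)"]
    by (simp only: subset_antisym)
qed

end

section \<open>The dihedral quotient, the fibre product of \<alpha>_# \<Xi> \<beta>, and the fibre
  of \<open>psi\<close>\<close>

section \<open>The fibre of \<open>psi\<close>\<close>

text \<open>The algebra of the quotient, kept apart from \<alpha>: it provides the element of
  infinite order modulo N that \<open>codim_one_pair\<close> takes as \<open>inf\<close>.\<close>

locale dihedral_quotient =
  fixes M :: "('a::euclidean_space \<Rightarrow> 'a) set" and \<Gamma> N :: "'a transf set"
    and \<gamma>1 \<gamma>2 :: "'a transf" and \<beta> :: "(real \<Rightarrow> real) \<Rightarrow> 'a transf set"
  assumes pair: "(\<Gamma>, N) \<in> space_pairs M" and \<gamma>: "\<gamma>1 \<in> \<Gamma>" "\<gamma>2 \<in> \<Gamma>"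
    and \<beta>: "\<beta> \<in> iso Delta_group (trans_group UNIV \<Gamma> Mod N)"
      "\<beta> delta1 = N #>\<^bsub>trans_group UNIV \<Gamma>\<^esub> \<gamma>1" "\<beta> delta2 = N #>\<^bsub>trans_group UNIV \<Gamma>\<^esub> \<gamma>2"
begin

lemmas Npair = space_pairs_D(3-5)[OF pair]
lemmas \<Gamma>tg = space_pairs_D(2)[OF pair]

abbreviation coset :: "'a transf \<Rightarrow> 'a transf set" where
  "coset g \<equiv> N #>\<^bsub>trans_group UNIV \<Gamma>\<^esub> g"

lemma cos_eq: "g \<in> \<Gamma> \<Longrightarrow> coset g = (\<lambda>n. n \<circ> g) ` N"
  by (rule tgroup_r_coset[OF \<Gamma>tg Npair(1)])

lemma cos_self: "g \<in> \<Gamma> \<Longrightarrow> g \<in> coset g"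
  unfolding cos_eq using tgroupD(2)[OF Npair(2)] by (metis id_comp imageI)

lemma cos_subset: "g \<in> \<Gamma> \<Longrightarrow> coset g \<subseteq> \<Gamma>"
  unfolding cos_eq using Npair(1) tgroupD(3)[OF \<Gamma>tg] by blast

lemma cos_absorb:
  assumes g: "g \<in> \<Gamma>" and x: "x \<in> coset g" shows "coset x = coset g"
proof -
  obtain n where n: "n \<in> N" "x = n \<circ> g" using x unfolding cos_eq[OF g] by blast
  have x\<Gamma>: "x \<in> \<Gamma>" using x cos_subset[OF g] by blast
  have "(\<lambda>m. m \<circ> n) ` N = N"
  proof
    show "(\<lambda>m. m \<circ> n) ` N \<subseteq> N" using tgroupD(3)[OF Npair(2) _ n(1)] by blast
    show "N \<subseteq> (\<lambda>m. m \<circ> n) ` N"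
    proof
      fix m assume "m \<in> N"
      then have "m \<circ> finv n \<in> N" by (rule tgroupD(3)[OF Npair(2) _ tgroupD(4)[OF Npair(2) n(1)]])
      moreover have "m = (m \<circ> finv n) \<circ> n"
        unfolding comp_assoc inv_comp_bij[OF tgroupD(1)[OF Npair(2) n(1)]] by simp
      ultimately show "m \<in> (\<lambda>m. m \<circ> n) ` N" by (rule image_eqI[where f = "\<lambda>m. m \<circ> n", rotated])
    qed
  qed
  then have "(\<lambda>m. m \<circ> g) ` (\<lambda>m. m \<circ> n) ` N = (\<lambda>m. m \<circ> g) ` N" by simp
  then show ?thesis unfolding cos_eq[OF x\<Gamma>] cos_eq[OF g] unfolding n(2) image_image comp_assoc .
qed

lemma carrier_Mod: "carrier (trans_group UNIV \<Gamma> Mod N) = coset ` \<Gamma>"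
  unfolding FactGroup_def RCOSETS_def by auto

lemma \<beta>_cos:
  assumes "\<delta> \<in> Delta" obtains g where "g \<in> \<Gamma>" "\<beta> \<delta> = coset g"
proof -
  have "\<beta> \<delta> \<in> coset ` \<Gamma>"
    using \<beta>(1) assms unfolding iso_def hom_def carrier_Mod[symmetric] by auto
  then show thesis using that by blast
qed

lemma \<beta>_mem_cos: "\<delta> \<in> Delta \<Longrightarrow> x \<in> \<beta> \<delta> \<Longrightarrow> x \<in> \<Gamma> \<and> \<beta> \<delta> = coset x"
proof -
  assume *: "\<delta> \<in> Delta" "x \<in> \<beta> \<delta>"
  obtain g where g: "g \<in> \<Gamma>" "\<beta> \<delta> = coset g" by (rule \<beta>_cos[OF *(1)])
  have x: "x \<in> coset g" using *(2) g(2) by simp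
  show ?thesis using subsetD[OF cos_subset[OF g(1)] x] cos_absorb[OF g(1) x] g(2) by simp
qed

lemma \<beta>_comp:
  assumes "f \<in> Delta" "g \<in> Delta"
  shows "z \<in> \<beta> (f \<circ> g) \<longleftrightarrow> (\<exists>x\<in>\<beta> f. \<exists>y\<in>\<beta> g. z = x \<circ> y)"
proof -
  have "\<beta> (f \<circ> g) = \<beta> f <#>\<^bsub>trans_group UNIV \<Gamma>\<^esub> \<beta> g"
    using \<beta>(1) hom_Delta_comp[OF _ assms, of \<beta> "trans_group UNIV \<Gamma> Mod N"] unfolding iso_def FactGroup_def by simp
  moreover have "x \<otimes>\<^bsub>trans_group UNIV \<Gamma>\<^esub> y = x \<circ> y" if "x \<in> \<beta> f" "y \<in> \<beta> g" for x y
    using \<beta>_mem_cos[OF assms(1) that(1)] \<beta>_mem_cos[OF assms(2) that(2)] tgroup_mult[OF \<Gamma>tg] by simp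
  ultimately show ?thesis unfolding set_mult_def by auto
qed

lemma \<beta>_gen: "\<gamma>1 \<in> \<beta> delta1" "\<gamma>2 \<in> \<beta> delta2"
  unfolding \<beta>(2,3) by (rule cos_self[OF \<gamma>(1)], rule cos_self[OF \<gamma>(2)])

lemma \<beta>_id: "\<beta> id = N"
proof -
  have n: "N \<lhd> trans_group UNIV \<Gamma>" using pair by (simp add: space_pairs_def)
  have "\<beta> \<in> hom Delta_group (trans_group UNIV \<Gamma> Mod N)" using \<beta>(1) by (simp add: iso_def)
  then have "\<beta> id = \<one>\<^bsub>trans_group UNIV \<Gamma> Mod N\<^esub>"
    by (rule hom_Delta_id[OF _ normal.factorgroup_is_group[OF n]])
  then show ?thesis by (simp add: FactGroup_def)
qed

lemma \<beta>_inj: "f \<in> Delta \<Longrightarrow> g \<in> Delta \<Longrightarrow> \<beta> f = \<beta> g \<Longrightarrow> f = g"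
  using \<beta>(1) unfolding iso_def bij_betw_def by (auto dest: inj_onD)

lemma \<beta>_surj: "g \<in> \<Gamma> \<Longrightarrow> \<exists>\<delta>\<in>Delta. g \<in> \<beta> \<delta>"
proof -
  assume g: "g \<in> \<Gamma>"
  have "\<beta> ` Delta = coset ` \<Gamma>" using \<beta>(1) unfolding iso_def bij_betw_def carrier_Mod by simp
  then have "coset g \<in> \<beta> ` Delta" using g by blast
  then obtain \<delta> where "\<delta> \<in> Delta" "\<beta> \<delta> = coset g" by auto
  then show ?thesis using cos_self[OF g] by blast
qed

lemma tau_Delta: "delta2 \<circ> delta1 \<in> Delta"
  by (rule tgroupD(3)[OF tgroup_Delta delta_in_Delta(2,1)])

lemma tau_power_mem: "(\<gamma>2 \<circ> \<gamma>1) ^^ j \<in> \<beta> ((delta2 \<circ> delta1) ^^ j)"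
proof (induction j)
  case 0
  then show ?case using \<beta>_id tgroupD(2)[OF Npair(2)] by (simp add: id_def)
next
  case (Suc j)
  have "\<gamma>2 \<circ> \<gamma>1 \<in> \<beta> (delta2 \<circ> delta1)"
    unfolding \<beta>_comp[OF delta_in_Delta(2,1)] using \<beta>_gen by blast
  then show ?case
    unfolding funpow.simps \<beta>_comp[OF tau_Delta tgroup_pow[OF tgroup_Delta tau_Delta]] using Suc by blast
qed

text \<open>\<beta> sends the translation by 1, which has infinite order in \<Delta>, to the coset
  of \<gamma>2 \<gamma>1.\<close>

lemma tau_power_N: "j > 0 \<Longrightarrow> (\<gamma>2 \<circ> \<gamma>1) ^^ j \<notin> N"
proof
  assume j: "j > 0" and n: "(\<gamma>2 \<circ> \<gamma>1) ^^ j \<in> N"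
  let ?d = "(delta2 \<circ> delta1) ^^ j"
  have d: "?d \<in> Delta" by (rule tgroup_pow[OF tgroup_Delta tau_Delta])
  have i: "id \<in> Delta" by (rule tgroupD(2)[OF tgroup_Delta])
  have "\<beta> ?d = \<beta> id"
    using \<beta>_mem_cos[OF d tau_power_mem] \<beta>_mem_cos[OF i, of "(\<gamma>2 \<circ> \<gamma>1) ^^ j"] n \<beta>_id by simp
  then have "?d = id" by (rule \<beta>_inj[OF d i])
  from fun_cong[OF this, of 0] show False using j unfolding tau_pow by simp
qed

end

locale dihedral_pair = codim_one_pair M \<Gamma> N \<alpha> a A e + dihedral_quotient M \<Gamma> N \<gamma>1 \<gamma>2 \<beta>
  for M :: "('a::euclidean_space \<Rightarrow> 'a) set" and \<Gamma> N :: "'a transf set"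
    and \<alpha> :: "'a \<times> real \<Rightarrow> 'a" and a :: 'a and A :: "'a \<times> real \<Rightarrow> 'a" and e :: "'a \<times> real"
    and \<gamma>1 \<gamma>2 :: "'a transf" and \<beta> :: "(real \<Rightarrow> real) \<Rightarrow> 'a transf set"
begin

interpretation crystal M by (rule crystal_M)

lemma gen_square: "\<gamma>1 \<circ> \<gamma>1 \<in> N" "\<gamma>2 \<circ> \<gamma>2 \<in> N"
proof -
  have "\<gamma>1 \<circ> \<gamma>1 \<in> \<beta> (delta1 \<circ> delta1)" "\<gamma>2 \<circ> \<gamma>2 \<in> \<beta> (delta2 \<circ> delta2)"
    unfolding \<beta>_comp[OF delta_in_Delta(1,1)] \<beta>_comp[OF delta_in_Delta(2,2)] using \<beta>_gen by blast+
  then show "\<gamma>1 \<circ> \<gamma>1 \<in> N" "\<gamma>2 \<circ> \<gamma>2 \<in> N" unfolding delta_involution \<beta>_id .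
qed

lemma h_involution: "h \<gamma>1 (h \<gamma>1 t) = t" "h \<gamma>2 (h \<gamma>2 t) = t"
  using fun_cong[OF h_N[OF gen_square(1)], of t] fun_cong[OF h_N[OF gen_square(2)], of t]
  unfolding h_comp[OF \<gamma>(1,1)] h_comp[OF \<gamma>(2,2)] by simp_all

lemma tau_\<Gamma>: "\<gamma>2 \<circ> \<gamma>1 \<in> \<Gamma>" by (rule tgroupD(3)[OF tg \<gamma>(2,1)])

text \<open>Elements acting trivially on the line are torsion modulo N by
  \<open>kernel_torsion\<close>, and no positive power of \<gamma>2 \<gamma>1 is.\<close>

lemma tau_h: "j > 0 \<Longrightarrow> h (\<gamma>2 \<circ> \<gamma>1) ^^ j \<noteq> id"
proof
  assume j: "j > 0" and i: "h (\<gamma>2 \<circ> \<gamma>1) ^^ j = id"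
  have "h ((\<gamma>2 \<circ> \<gamma>1) ^^ j) = id" unfolding h_pow[OF tau_\<Gamma>] by (rule i)
  then obtain k where "k > 0" "((\<gamma>2 \<circ> \<gamma>1) ^^ j) ^^ k \<in> N"
    using kernel_torsion[OF tgroup_pow[OF tg tau_\<Gamma>]] by blast
  then show False using tau_power_N[of "j * k"] j unfolding funpow_mult by simp
qed

text \<open>The generators act on the line as involutions, so each is a reflection or trivial there;
  if one were trivial, the square of \<gamma>2 \<gamma>1 would act trivially too.\<close>

lemma sg_gen: "sg \<gamma>1 = -1" "sg \<gamma>2 = -1"
proof -
  have i: "h \<gamma> = id" if "\<gamma> \<in> \<Gamma>" "\<And>t. h \<gamma> (h \<gamma> t) = t" "sg \<gamma> \<noteq> -1" for \<gamma>
  proof -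
    have "sg \<gamma> = 1" using lin_e(2)[OF that(1)] that(3) by blast
    then show ?thesis using that(2)[of 0] by (auto simp: h_def)
  qed
  have 2: "h (\<gamma>2 \<circ> \<gamma>1) (h (\<gamma>2 \<circ> \<gamma>1) t) \<noteq> t" if "h \<gamma>1 = id \<or> h \<gamma>2 = id" for t
  proof -
    have "h (\<gamma>2 \<circ> \<gamma>1) (h (\<gamma>2 \<circ> \<gamma>1) t) = t" for t
      unfolding h_comp[OF \<gamma>(2,1)] using that h_involution by auto
    then have "h (\<gamma>2 \<circ> \<gamma>1) ^^ 2 = id" by (auto simp: numeral_2_eq_2)
    then show ?thesis using tau_h[of 2] by simp
  qed
  have 3: "h (\<gamma>2 \<circ> \<gamma>1) (h (\<gamma>2 \<circ> \<gamma>1) t) = t" if "h \<gamma>1 = id \<or> h \<gamma>2 = id" for t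
    unfolding h_comp[OF \<gamma>(2,1)] using that h_involution by auto
  show "sg \<gamma>1 = -1" using i[OF \<gamma>(1) h_involution(1)] 2 3 by blast
  show "sg \<gamma>2 = -1" using i[OF \<gamma>(2) h_involution(2)] 2 3 by blast
qed

definition s1 :: real where "s1 = \<gamma>1 0 \<bullet> e"
definition s2 :: real where "s2 = \<gamma>2 0 \<bullet> e"

lemma h_gen: "h \<gamma>1 t = s1 - t" "h \<gamma>2 t = s2 - t"
  by (simp_all add: h_def sg_gen s1_def s2_def)

lemma s_neq: "s1 \<noteq> s2"
proof
  assume "s1 = s2"
  then have "h (\<gamma>2 \<circ> \<gamma>1) = id" unfolding h_comp[OF \<gamma>(2,1)] by (auto simp: h_gen)
  then show False using tau_h[of 1] by simp
qed

text \<open>The affine coordinate on the line in which the generators act as \<open>delta1\<close> and \<open>delta2\<close>.\<close>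

definition \<tau> :: "real \<Rightarrow> real" where "\<tau> t = (t - s1 / 2) / (s2 - s1)"

text \<open>\<tau> sends the centres s1/2 and s2/2 of the two reflections to 0 and 1/2, those of
  \<open>delta1\<close> and \<open>delta2\<close>; s1 \<noteq> s2 makes it a bijection.\<close>

lemma \<tau>: "bij \<tau>" "finv \<tau> = (\<lambda>t. (s2 - s1) * t + s1 / 2)"
proof -
  have "\<tau> \<circ> (\<lambda>t. (s2 - s1) * t + s1 / 2) = id" "(\<lambda>t. (s2 - s1) * t + s1 / 2) \<circ> \<tau> = id"
    using s_neq by (auto simp: \<tau>_def fun_eq_iff)
  then show "bij \<tau>" "finv \<tau> = (\<lambda>t. (s2 - s1) * t + s1 / 2)" using o_bij inv_unique_comp by blast+
qed

definition ht :: "'a transf \<Rightarrow> real \<Rightarrow> real" where "ht \<gamma> = conjm \<tau> (h \<gamma>)"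

lemma ht_gen: "ht \<gamma>1 = delta1" "ht \<gamma>2 = delta2"
  using s_neq by (auto simp: ht_def \<tau>(2) h_gen delta1_def delta2_def \<tau>_def fun_eq_iff field_simps)

lemma ht_comp: "\<gamma> \<in> \<Gamma> \<Longrightarrow> \<delta> \<in> \<Gamma> \<Longrightarrow> ht (\<gamma> \<circ> \<delta>) = ht \<gamma> \<circ> ht \<delta>"
  unfolding ht_def h_comp by (rule conjm_comp[OF \<tau>(1)])

lemma ht_N: "\<nu> \<in> N \<Longrightarrow> ht \<nu> = id"
  unfolding ht_def by (simp only: h_N conjm_id(2)[OF \<tau>(1)])

text \<open>\<open>ht\<close> inverts \<beta>: it is constant on cosets because N acts trivially on
  the line, and it has the right values on the generators.\<close>

lemma ht_\<beta>: "\<delta> \<in> Delta \<Longrightarrow> \<forall>\<gamma>\<in>\<beta> \<delta>. ht \<gamma> = \<delta>"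
proof (induction rule: Delta_induct)
  case id
  show ?case unfolding \<beta>_id using ht_N by blast
next
  case delta1
  show ?case
  proof
    fix x assume "x \<in> \<beta> delta1"
    then obtain n where n: "n \<in> N" "x = n \<circ> \<gamma>1" unfolding \<beta>(2) cos_eq[OF \<gamma>(1)] by blast
    then show "ht x = delta1" using ht_comp[OF subsetD[OF N(1) n(1)] \<gamma>(1)] ht_N[OF n(1)] ht_gen by simp
  qed
next
  case delta2
  show ?case
  proof
    fix x assume "x \<in> \<beta> delta2"
    then obtain n where n: "n \<in> N" "x = n \<circ> \<gamma>2" unfolding \<beta>(3) cos_eq[OF \<gamma>(2)] by blast
    then show "ht x = delta2" using ht_comp[OF subsetD[OF N(1) n(1)] \<gamma>(2)] ht_N[OF n(1)] ht_gen by simp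
  qed
next
  case (comp f g)
  show ?case
  proof
    fix z assume "z \<in> \<beta> (f \<circ> g)"
    then obtain x y where xy: "x \<in> \<beta> f" "y \<in> \<beta> g" "z = x \<circ> y" unfolding \<beta>_comp[OF comp(1,2)] by blast
    have "x \<in> \<Gamma>" "y \<in> \<Gamma>" using \<beta>_mem_cos[OF comp(1) xy(1)] \<beta>_mem_cos[OF comp(2) xy(2)] by blast+
    from ht_comp[OF this] show "ht z = f \<circ> g" using comp(3,4) xy by simp
  qed
qed

lemma ht_mem:
  assumes "\<gamma> \<in> \<Gamma>" shows "ht \<gamma> \<in> Delta" "\<gamma> \<in> \<beta> (ht \<gamma>)"
proof -
  obtain \<delta> where "\<delta> \<in> Delta" "\<gamma> \<in> \<beta> \<delta>" using \<beta>_surj[OF assms] by blast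
  with ht_\<beta> show "ht \<gamma> \<in> Delta" "\<gamma> \<in> \<beta> (ht \<gamma>)" by metis+
qed

lemma orbit_bar: "orbit (bar_group N) v = (\<lambda>\<nu>. bar V \<nu> v) ` N"
  by (simp add: orbit_def bar_group_def image_image)

text \<open>The counterpart of \<open>normalizing_affinities_image_orbit\<close> for maps that live
  on V; the content is the normality of N.\<close>

lemma bar_image_orbit:
  assumes \<gamma>: "\<gamma> \<in> \<Gamma>" and v: "v \<in> V"
  shows "bar V \<gamma> ` orbit (bar_group N) v = orbit (bar_group N) (bar V \<gamma> v)"
proof
  have c: "bar V \<gamma> (bar V \<nu> v) = bar V (conjm \<gamma> \<nu>) (bar V \<gamma> v)" if \<nu>: "\<nu> \<in> N" for \<nu>
  proof -
    have c\<Gamma>: "conjm \<gamma> \<nu> \<in> \<Gamma>" using N(1) N(3)[OF \<gamma> \<nu>] by blast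
    have "\<gamma> \<circ> \<nu> = conjm \<gamma> \<nu> \<circ> \<gamma>" using G(3)[OF \<gamma>] by (simp add: comp_assoc)
    then show ?thesis unfolding bar_comp[OF \<gamma> v, symmetric] bar_comp[OF c\<Gamma> v, symmetric] by simp
  qed
  show "bar V \<gamma> ` orbit (bar_group N) v \<subseteq> orbit (bar_group N) (bar V \<gamma> v)"
    unfolding orbit_bar image_image
  proof (rule image_subsetI)
    fix \<nu> assume \<nu>: "\<nu> \<in> N"
    show "bar V \<gamma> (bar V \<nu> v) \<in> (\<lambda>\<nu>. bar V \<nu> (bar V \<gamma> v)) ` N" unfolding c[OF \<nu>] by (rule imageI[OF N(3)[OF \<gamma> \<nu>]])
  qed
  show "orbit (bar_group N) (bar V \<gamma> v) \<subseteq> bar V \<gamma> ` orbit (bar_group N) v"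
    unfolding orbit_bar image_image
  proof (rule image_subsetI)
    fix \<nu> assume \<nu>: "\<nu> \<in> N"
    have i: "finv \<gamma> \<in> \<Gamma>" by (rule tgroupD(4)[OF tg \<gamma>])
    have n: "conjm (finv \<gamma>) \<nu> \<in> N" by (rule N(3)[OF i \<nu>])
    have "conjm \<gamma> (conjm (finv \<gamma>) \<nu>) = \<nu>"
      unfolding conjm_conjm[OF G(3)[OF \<gamma>] G(3)[OF i]] inv_comp_bij[OF G(3)[OF \<gamma>]] by (rule conjm_id(1))
    then have "bar V \<nu> (bar V \<gamma> v) = bar V \<gamma> (bar V (conjm (finv \<gamma>) \<nu>) v)" unfolding c[OF n] by simp
    then show "bar V \<nu> (bar V \<gamma> v) \<in> (\<lambda>\<nu>. bar V \<gamma> (bar V \<nu> v)) ` N" using n by (rule image_eqI)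
  qed
qed

lemma orbit_bar_absorb:
  assumes \<nu>: "\<nu> \<in> N" and v: "v \<in> V"
  shows "orbit (bar_group N) (bar V \<nu> v) = orbit (bar_group N) v"
proof
  have sub: "orbit (bar_group N) (bar V \<nu> v) \<subseteq> orbit (bar_group N) v" if "\<nu> \<in> N" "v \<in> V" for \<nu> v
    unfolding orbit_bar
  proof (rule image_subsetI)
    fix \<mu> assume \<mu>: "\<mu> \<in> N"
    show "bar V \<mu> (bar V \<nu> v) \<in> (\<lambda>\<nu>. bar V \<nu> v) ` N"
      unfolding bar_comp[OF subsetD[OF N(1) \<mu>] that(2), symmetric] by (rule imageI[OF tgroupD(3)[OF N(2) \<mu> that(1)]])
  qed
  show "orbit (bar_group N) (bar V \<nu> v) \<subseteq> orbit (bar_group N) v" by (rule sub[OF \<nu> v])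
  have i: "finv \<nu> \<in> N" by (rule tgroupD(4)[OF N(2) \<nu>])
  have "bar V (finv \<nu>) (bar V \<nu> v) = v"
    unfolding bar_comp[OF subsetD[OF N(1) i] v, symmetric] inv_comp_bij[OF tgroupD(1)[OF N(2) \<nu>]]
    by (simp add: bar_eq[OF v] p_id[OF v])
  then show "orbit (bar_group N) v \<subseteq> orbit (bar_group N) (bar V \<nu> v)"
    using sub[OF i bar_V[OF v], of \<nu>] by simp
qed

text \<open>Another representative of the coset changes the map by an element of N, which the orbits
  absorb, so the definite description is unique.\<close>

lemma Xi_eq:
  assumes \<gamma>: "\<gamma> \<in> \<Gamma>"
  shows "Xi \<Gamma> N (coset \<gamma>) = star V (bar_group N) (bar V \<gamma>)"
  unfolding Xi_def
proof (rule the_equality)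
  show "\<exists>\<gamma>'\<in>\<Gamma>. coset \<gamma> = coset \<gamma>' \<and> star V (bar_group N) (bar V \<gamma>) = star V (bar_group N) (bar V \<gamma>')"
    using \<gamma> by blast
  fix \<xi> assume "\<exists>\<gamma>'\<in>\<Gamma>. coset \<gamma> = coset \<gamma>' \<and> \<xi> = star V (bar_group N) (bar V \<gamma>')"
  then obtain \<gamma>' where \<gamma>': "\<gamma>' \<in> \<Gamma>" "coset \<gamma> = coset \<gamma>'" "\<xi> = star V (bar_group N) (bar V \<gamma>')" by blast
  have "\<gamma>' \<in> coset \<gamma>" using cos_self[OF \<gamma>'(1)] \<gamma>'(2) by simp
  then obtain \<nu> where \<nu>: "\<nu> \<in> N" "\<gamma>' = \<nu> \<circ> \<gamma>" unfolding cos_eq[OF \<gamma>] by blast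
  show "\<xi> = star V (bar_group N) (bar V \<gamma>)"
    unfolding \<gamma>'(3)
  proof (rule star_eqI)
    fix X assume "X \<in> orbit_space V (bar_group N)"
    then obtain v where v: "v \<in> V" "X = orbit (bar_group N) v" by (auto elim: orbit_space_E)
    show "bar V \<gamma>' ` X = bar V \<gamma> ` X"
      unfolding v(2) bar_image_orbit[OF \<gamma>'(1) v(1)] bar_image_orbit[OF \<gamma> v(1)]
      using orbit_bar_absorb[OF \<nu>(1) bar_V[OF v(1)], of \<gamma>] bar_comp[OF subsetD[OF N(1) \<nu>(1)] v(1), of \<gamma>]
      unfolding \<nu>(2) by simp
  qed
qed

lemma sharp_bar:
  assumes \<gamma>: "\<gamma> \<in> \<Gamma>"
  shows "sharp V (bar_group N) UNIV M \<alpha> (star V (bar_group N) (bar V \<gamma>)) = star UNIV M (\<Phi> \<gamma>)"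
  unfolding \<Phi>_def
proof (rule sharp_star[OF \<alpha>_bij \<alpha>_conj])
  fix X assume "X \<in> orbit_space V (bar_group N)"
  then obtain v where v: "v \<in> V" "X = orbit (bar_group N) v" by (auto elim: orbit_space_E)
  show "X \<subseteq> V" unfolding v(2) orbit_bar using bar_V[OF v(1)] by blast
  show "bar V \<gamma> ` X \<in> orbit_space V (bar_group N)"
    unfolding v(2) bar_image_orbit[OF \<gamma> v(1)] by (rule orbit_in_orbit_space[OF bar_V[OF v(1)]])
qed

text \<open>The homomorphism \<alpha>_# \<Xi> \<beta> of the theorem; the restriction to \<Delta> is
  the extensionality that \<open>Hom_f\<close> demands.\<close>

definition \<eta> :: "(real \<Rightarrow> real) \<Rightarrow> 'a set \<Rightarrow> 'a set" where
  "\<eta> = (\<lambda>\<delta>\<in>Delta. sharp V (bar_group N) UNIV M \<alpha> (Xi \<Gamma> N (\<beta> \<delta>)))"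

lemma \<eta>_eq:
  assumes "\<delta> \<in> Delta" "\<gamma> \<in> \<beta> \<delta>" shows "\<eta> \<delta> = star UNIV M (\<Phi> \<gamma>)"
proof -
  have "\<gamma> \<in> \<Gamma>" "\<beta> \<delta> = coset \<gamma>" using \<beta>_mem_cos[OF assms] by blast+
  then show ?thesis using assms(1) by (simp add: \<eta>_def Xi_eq sharp_bar)
qed

lemma \<eta>_ht: "\<gamma> \<in> \<Gamma> \<Longrightarrow> \<eta> (ht \<gamma>) = star UNIV M (\<Phi> \<gamma>)"
  using \<eta>_eq ht_mem by blast

lemma \<eta>_gen: "\<eta> delta1 = star UNIV M (\<Phi> \<gamma>1)" "\<eta> delta2 = star UNIV M (\<Phi> \<gamma>2)"
  by (rule \<eta>_eq[OF delta_in_Delta(1) \<beta>_gen(1)], rule \<eta>_eq[OF delta_in_Delta(2) \<beta>_gen(2)])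

lemma \<beta>_nonempty: "\<delta> \<in> Delta \<Longrightarrow> \<exists>\<gamma>. \<gamma> \<in> \<beta> \<delta>"
  using \<beta>_cos cos_self by metis

lemma \<eta>_hom: "\<eta> \<in> hom Delta_group (Aff M)"
proof (rule homI)
  fix \<delta> assume "\<delta> \<in> carrier Delta_group"
  then have d: "\<delta> \<in> Delta" by simp
  then obtain \<gamma> where g: "\<gamma> \<in> \<beta> \<delta>" using \<beta>_nonempty by blast
  have "\<gamma> \<in> \<Gamma>" using \<beta>_mem_cos[OF d g] by blast
  then show "\<eta> \<delta> \<in> carrier (Aff M)"
    unfolding \<eta>_eq[OF d g] carrier_Aff by (intro imageI \<Phi>_normalizing)
next
  fix f g assume "f \<in> carrier Delta_group" "g \<in> carrier Delta_group"
  then have fg: "f \<in> Delta" "g \<in> Delta" by simp_all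
  obtain x where x: "x \<in> \<beta> f" using \<beta>_nonempty[OF fg(1)] by blast
  obtain y where y: "y \<in> \<beta> g" using \<beta>_nonempty[OF fg(2)] by blast
  have xy: "x \<in> \<Gamma>" "y \<in> \<Gamma>" using \<beta>_mem_cos[OF fg(1) x] \<beta>_mem_cos[OF fg(2) y] by blast+
  have "x \<circ> y \<in> \<beta> (f \<circ> g)" unfolding \<beta>_comp[OF fg] using x y by blast
  then have "\<eta> (f \<circ> g) = star UNIV M (\<Phi> x \<circ> \<Phi> y)"
    using \<eta>_eq[OF tgroupD(3)[OF tgroup_Delta fg]] \<Phi>_comp[OF xy(1)] by simp
  also have "\<dots> = \<eta> f \<otimes>\<^bsub>Aff M\<^esub> \<eta> g"
    unfolding \<eta>_eq[OF fg(1) x] \<eta>_eq[OF fg(2) y]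
    by (rule mult_Aff[OF \<Phi>_normalizing[OF xy(1)] \<Phi>_normalizing[OF xy(2)], symmetric])
  finally show "\<eta> (f \<otimes>\<^bsub>Delta_group\<^esub> g) = \<eta> f \<otimes>\<^bsub>Aff M\<^esub> \<eta> g"
    using tgroup_mult[OF tgroup_Delta fg] by simp
qed

text \<open>A power of \<gamma>2 \<gamma>1 is the translation by some b, which may leave V. Its
  image under \<Phi> is the translation by A applied to the V-component of b, and the finiteness
  criterion applies.\<close>

lemma \<eta>_Hom_f: "\<eta> \<in> Hom_f M"
proof -
  obtain r b where r: "r > 0" "(\<gamma>2 \<circ> \<gamma>1) ^^ r = (+) b" by (rule power_translation[OF tau_\<Gamma>])
  have "\<Phi> ((+) b) = (+) (A (p b))"
  proof
    fix y
    obtain v where v: "v \<in> V" "\<alpha> v = y" by (rule \<alpha>_surj)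
    have "bar V ((+) b) v = p b + v" using linear_add[OF linear_p, of b v] p_id[OF v(1)] by (simp add: bar_eq[OF v(1)])
    then show "\<Phi> ((+) b) y = A (p b) + y"
      unfolding v(2)[symmetric] \<Phi>_\<alpha>[OF v(1)]
      using \<alpha>_eq[OF v(1)] \<alpha>_eq[OF subspace_add[OF subspace_V p_V v(1)], of b] by (simp add: linear_add[OF lA])
  qed
  then have "\<Phi> (\<gamma>2 \<circ> \<gamma>1) ^^ r = (+) (A (p b))" unfolding \<Phi>_pow[OF tau_\<Gamma>, symmetric] r(2) .
  moreover have "\<eta> (delta2 \<circ> delta1) = star UNIV M (\<Phi> (\<gamma>2 \<circ> \<gamma>1))"
    using \<eta>_ht[OF tau_\<Gamma>] ht_comp[OF \<gamma>(2,1)] ht_gen by simp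
  ultimately have "finite (Omega M ` \<eta> ` Delta)"
    using finite_Omega_criterion[OF \<eta>_hom \<Phi>_normalizing[OF tau_\<Gamma>] _ r(1)] by blast
  then show ?thesis using \<eta>_hom by (simp add: Hom_f_def \<eta>_def)
qed

text \<open>This is conjugation of \<Gamma> by \<alpha> on V and by \<tau> on the normal line. It is
  injective because the two components determine \<gamma>, and surjective because lifts of the same
  \<eta> \<delta> differ by elements of M, the image of N.\<close>

lemma \<Gamma>_lifted: "group_pair_iso \<Gamma> N (lifted M \<eta>) (extended M)"
  unfolding group_pair_iso_def
proof (intro exI[of _ "\<lambda>\<gamma>. map_prod (\<Phi> \<gamma>) (ht \<gamma>)"] conjI ballI)
  let ?f = "\<lambda>\<gamma>. map_prod (\<Phi> \<gamma>) (ht \<gamma>)"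
  show "bij_betw ?f \<Gamma> (lifted M \<eta>)"
    unfolding bij_betw_def
  proof
    show "inj_on ?f \<Gamma>"
    proof (rule inj_onI)
      fix x y assume xy: "x \<in> \<Gamma>" "y \<in> \<Gamma>" "?f x = ?f y"
      then have "\<Phi> x = \<Phi> y" "ht x = ht y" unfolding map_prod_eq_iff by blast+
      then show "x = y" using \<Phi>_h_inject[OF xy(1,2)] inj_conjm[OF \<tau>(1)] unfolding ht_def by blast
    qed
    show "?f ` \<Gamma> = lifted M \<eta>"
    proof
      show "?f ` \<Gamma> \<subseteq> lifted M \<eta>"
      proof (rule image_subsetI)
        fix x assume x: "x \<in> \<Gamma>"
        show "?f x \<in> lifted M \<eta>"
          by (rule liftedI[where \<eta> = \<eta>, OF \<Phi>_normalizing[OF x] ht_mem(1)[OF x] \<eta>_ht[OF x, symmetric]])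
      qed
      show "lifted M \<eta> \<subseteq> ?f ` \<Gamma>"
      proof
        fix z assume "z \<in> lifted M \<eta>"
        then obtain \<phi> \<delta> where z: "z = map_prod \<phi> \<delta>" "\<phi> \<in> normalizing_affinities M" "\<delta> \<in> Delta" "star UNIV M \<phi> = \<eta> \<delta>"
          unfolding lifted_def by blast
        obtain x where x: "x \<in> \<beta> \<delta>" using \<beta>_nonempty[OF z(3)] by blast
        have x\<Gamma>: "x \<in> \<Gamma>" using \<beta>_mem_cos[OF z(3) x] by blast
        have "star UNIV M \<phi> = star UNIV M (\<Phi> x)" using z(4) \<eta>_eq[OF z(3) x] by simp
        then obtain \<mu> where \<mu>: "\<mu> \<in> M" "\<phi> = \<mu> \<circ> \<Phi> x"
          using star_eq_iff[OF z(2) \<Phi>_normalizing[OF x\<Gamma>]] by blast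
        obtain \<nu> where \<nu>: "\<nu> \<in> N" "\<mu> = \<Phi> \<nu>" using \<mu>(1) unfolding \<Phi>_N[symmetric] by blast
        have \<nu>\<Gamma>: "\<nu> \<in> \<Gamma>" by (rule subsetD[OF N(1) \<nu>(1)])
        have "\<phi> = \<Phi> (\<nu> \<circ> x)" unfolding \<mu>(2) \<nu>(2) \<Phi>_comp[OF \<nu>\<Gamma>] ..
        moreover have "\<delta> = ht (\<nu> \<circ> x)" unfolding ht_comp[OF \<nu>\<Gamma> x\<Gamma>] ht_N[OF \<nu>(1)] using ht_\<beta>[OF z(3)] x by simp
        ultimately have "z = ?f (\<nu> \<circ> x)" unfolding z(1) by simp
        then show "z \<in> ?f ` \<Gamma>" using tgroupD(3)[OF tg \<nu>\<Gamma> x\<Gamma>] by (rule image_eqI)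
      qed
    qed
  qed
  show "?f ` N = extended M"
  proof -
    have "?f ` N = (\<lambda>\<nu>. map_prod (\<Phi> \<nu>) id) ` N" by (rule image_cong[OF refl]) (simp only: ht_N)
    then show ?thesis unfolding extended_def \<Phi>_N[symmetric] image_image .
  qed
  fix x y assume "x \<in> \<Gamma>" "y \<in> \<Gamma>"
  then show "?f (x \<circ> y) = ?f x \<circ> ?f y" unfolding map_prod_comp by (simp only: \<Phi>_comp ht_comp)
qed

lemma lifted_\<Gamma>: "group_pair_iso (lifted M \<eta>) (extended M) \<Gamma> N"
  by (rule group_pair_iso_sym[OF tg N(1) \<Gamma>_lifted])

lemma psi_iff:
  assumes "\<eta>' \<in> Hom_f M"
  shows "psi M (Aff_class M \<eta>') = Iso_class M \<Gamma> N \<longleftrightarrow>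
    group_pair_iso (lifted M \<eta>) (extended M) (lifted M \<eta>') (extended M)"
proof -
  have h: "\<eta>' \<in> hom Delta_group (Aff M)" using assms by (simp add: Hom_f_def)
  have "group_pair_iso (lifted M \<eta>') (extended M) \<Gamma> N \<longleftrightarrow>
    group_pair_iso (lifted M \<eta>) (extended M) (lifted M \<eta>') (extended M)"
  proof
    assume 1: "group_pair_iso (lifted M \<eta>') (extended M) \<Gamma> N"
    show "group_pair_iso (lifted M \<eta>) (extended M) (lifted M \<eta>') (extended M)"
      by (rule group_pair_iso_trans[OF lifted_\<Gamma> group_pair_iso_sym[OF tgroup_lifted[OF h] extended_subset[OF h] 1]])
  next
    assume 1: "group_pair_iso (lifted M \<eta>) (extended M) (lifted M \<eta>') (extended M)"
    show "group_pair_iso (lifted M \<eta>') (extended M) \<Gamma> N"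
      by (rule group_pair_iso_trans[OF group_pair_iso_sym[OF tgroup_lifted[OF \<eta>_hom] extended_subset[OF \<eta>_hom] 1] lifted_\<Gamma>])
  qed
  then show ?thesis unfolding psi_eq_iff[OF assms pair] .
qed

text \<open>The intersection of E_1 and E_2, with \<open>FixN\<close> for Span(Z(N)) and linear
  parts for B_1 and B_2.\<close>

definition E :: "('a \<times> real) set" where
  "E = {w \<in> FixN. lin \<gamma>1 w = - w \<and> lin \<gamma>2 w = - w}"

text \<open>Conjugation by \<alpha> turns the translation by w in V into the translation by A
  w.\<close>

definition pair_at :: "'a \<times> real \<Rightarrow> ('a set \<Rightarrow> 'a set) set" where
  "pair_at w = {star UNIV M (\<Phi> \<gamma>1), star UNIV M ((+) (A w) \<circ> \<Phi> \<gamma>2)}"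

lemma FixN_V: "w \<in> FixN \<Longrightarrow> w \<in> V" by (simp add: FixN_def)

lemma FixN_A: "w \<in> FixN \<Longrightarrow> A w \<in> fixed"
  using FixN_fixed[OF FixN_V] by blast

text \<open>One inclusion of (b): the shear along A w deforms \<eta> without changing the
  isomorphism type of the fibre product.\<close>

lemma pair_at_realized:
  assumes "w \<in> E"
  obtains \<eta>' where "\<eta>' \<in> Hom_f M" "{\<eta>' delta1, \<eta>' delta2} = pair_at w"
    "psi M (Aff_class M \<eta>') = Iso_class M \<Gamma> N"
proof -
  have w: "w \<in> FixN" "lin \<gamma>1 w = - w" "lin \<gamma>2 w = - w" using assms by (auto simp: E_def)
  have neg: "lin (\<Phi> \<gamma>1) (A w) = - A w" "lin (\<Phi> \<gamma>2) (A w) = - A w"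
    unfolding lin_\<Phi>(1)[OF \<gamma>(1) FixN_V[OF w(1)]] lin_\<Phi>(1)[OF \<gamma>(2) FixN_V[OF w(1)]] w(2,3)
    by (simp_all add: linear_neg[OF lA])
  obtain \<eta>' where \<eta>': "\<eta>' \<in> Hom_f M" "\<eta>' delta1 = star UNIV M (\<Phi> \<gamma>1)" "\<eta>' delta2 = star UNIV M ((+) (A w) \<circ> \<Phi> \<gamma>2)"
    "group_pair_iso (lifted M \<eta>) (extended M) (lifted M \<eta>') (extended M)"
    using shear_deformation[OF \<eta>_Hom_f FixN_A[OF w(1)] \<Phi>_normalizing[OF \<gamma>(1)] \<eta>_gen(1)[symmetric] neg(1)
      \<Phi>_normalizing[OF \<gamma>(2)] \<eta>_gen(2)[symmetric] neg(2)] by metis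
  have "psi M (Aff_class M \<eta>') = Iso_class M \<Gamma> N" unfolding psi_iff[OF \<eta>'(1)] by (rule \<eta>'(4))
  moreover have "{\<eta>' delta1, \<eta>' delta2} = pair_at w" unfolding pair_at_def \<eta>'(2,3) ..
  ultimately show thesis using that[OF \<eta>'(1)] by blast
qed

text \<open>g permutes N by conjugation, so its linear part preserves the common fixed vectors;
  \<open>eigenspace_adjustment\<close> needs this invariance.\<close>

lemma lin_FixN:
  assumes g: "g \<in> \<Gamma>" and w: "w \<in> FixN" shows "lin g w \<in> FixN"
  unfolding FixN_def
proof (intro CollectI conjI ballI)
  show "lin g w \<in> V" by (rule lin_V_mem[OF g FixN_V[OF w]])
  fix \<nu> assume \<nu>: "\<nu> \<in> N"
  have i: "finv g \<in> \<Gamma>" by (rule tgroupD(4)[OF tg g])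
  have n: "conjm (finv g) \<nu> \<in> N" by (rule N(3)[OF i \<nu>])
  have n\<Gamma>: "conjm (finv g) \<nu> \<in> \<Gamma>" by (rule subsetD[OF N(1) n])
  have \<nu>\<Gamma>: "\<nu> \<in> \<Gamma>" by (rule subsetD[OF N(1) \<nu>])
  have "\<nu> \<circ> g = g \<circ> conjm (finv g) \<nu>"
    using G(3)[OF g] by (simp add: inv_inv_eq comp_assoc[symmetric])
  then have "lin \<nu> \<circ> lin g = lin g \<circ> lin (conjm (finv g) \<nu>)"
    unfolding lin_comp[OF G(2)[OF \<nu>\<Gamma>], symmetric] lin_comp[OF G(2)[OF g], symmetric] by simp
  from fun_cong[OF this, of w] show "lin \<nu> (lin g w) = lin g w" using w n by (simp add: FixN_def)
qed

lemma lin_involution: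
  assumes "g \<in> \<Gamma>" "g \<circ> g \<in> N" "w \<in> FixN" shows "lin g (lin g w) = w"
proof -
  have "lin (g \<circ> g) w = w" using assms(2,3) by (simp add: FixN_def)
  then show ?thesis unfolding lin_comp[OF G(2)[OF assms(1)]] by simp
qed

text \<open>The other inclusion of (b): the two deformation vectors of an isomorphism are normalized
  by conjugating with a translation, which does not affect the class of the pair.\<close>

lemma fibre_realized:
  assumes \<eta>': "\<eta>' \<in> Hom_f M" and psi: "psi M (Aff_class M \<eta>') = Iso_class M \<Gamma> N"
  obtains w \<eta>'' where "w \<in> E" "\<eta>'' \<in> Hom_f M" "Aff_class M \<eta>'' = Aff_class M \<eta>'"
    "pair_conj_class M {\<eta>'' delta1, \<eta>'' delta2} = pair_conj_class M (pair_at w)"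
proof -
  note n1 = \<Phi>_normalizing[OF \<gamma>(1)] and n2 = \<Phi>_normalizing[OF \<gamma>(2)]
  obtain \<eta>'' v1 v2 where \<eta>'': "\<eta>'' \<in> Hom_f M" "Aff_class M \<eta>'' = Aff_class M \<eta>'"
    "v1 \<in> fixed" "lin (\<Phi> \<gamma>1) v1 = - v1" "\<eta>'' delta1 = star UNIV M ((+) v1 \<circ> \<Phi> \<gamma>1)"
    "v2 \<in> fixed" "lin (\<Phi> \<gamma>2) v2 = - v2" "\<eta>'' delta2 = star UNIV M ((+) v2 \<circ> \<Phi> \<gamma>2)"
    using isomorphism_deformation[OF \<eta>_Hom_f \<eta>' psi[unfolded psi_iff[OF \<eta>']] n1 \<eta>_gen(1)[symmetric] n2 \<eta>_gen(2)[symmetric]]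
    by metis
  have lift: "\<exists>w\<in>FixN. A w = v \<and> lin g w = - w" if "g \<in> \<Gamma>" "v \<in> fixed" "lin (\<Phi> g) v = - v" for g v
  proof -
    obtain w where w: "w \<in> V" "A w = v" by (rule A_surj)
    have "A (lin g w) = A (- w)" using lin_\<Phi>(1)[OF that(1) w(1)] that(3) w(2) linear_neg[OF lA] by simp
    then have "lin g w = - w" using A_inj[OF lin_V_mem[OF that(1) w(1)] subspace_neg[OF subspace_V w(1)]] by blast
    moreover have "w \<in> FixN" using FixN_fixed[OF w(1)] w(2) that(2) by simp
    ultimately show ?thesis using w(2) by blast
  qed
  obtain w1 where w1: "w1 \<in> FixN" "A w1 = v1" "lin \<gamma>1 w1 = - w1" using lift[OF \<gamma>(1) \<eta>''(3,4)] by blast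
  obtain w2 where w2: "w2 \<in> FixN" "A w2 = v2" "lin \<gamma>2 w2 = - w2" using lift[OF \<gamma>(2) \<eta>''(6,7)] by blast
  \<comment> \<open>Conjugation by the translation by A u adds u - lin g u to the deformation vector
    of the lift of a generator g, which is the shape of the adjustment.\<close>
  obtain u w where u: "u \<in> FixN" "w1 + u - lin \<gamma>1 u = 0" "w2 + u - lin \<gamma>2 u = w"
    and w: "w \<in> FixN" "lin \<gamma>1 w = - w" "lin \<gamma>2 w = - w"
    using eigenspace_adjustment[OF FixN_subspace G(1)[OF \<gamma>(1)] G(1)[OF \<gamma>(2)] lin_FixN[OF \<gamma>(1)] lin_FixN[OF \<gamma>(2)]
      lin_involution[OF \<gamma>(1) gen_square(1)] lin_involution[OF \<gamma>(2) gen_square(2)] w1(1,3) w2(1,3)] by metis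
  define \<xi> where "\<xi> = (+) (A u)"
  have \<xi>: "\<xi> \<in> normalizing_affinities M" unfolding \<xi>_def by (rule plus_fixed_normalizing[OF FixN_A[OF u(1)]])
  have cj: "conjm \<xi> ((+) (A x) \<circ> \<Phi> g) = (+) (A (x + u - lin g u)) \<circ> \<Phi> g" if g: "g \<in> \<Gamma>" for g x
  proof
    fix y
    have "\<Phi> g (- A u + y) = \<Phi> g y - A (lin g u)"
      using \<Phi>_A[OF g subspace_neg[OF subspace_V FixN_V[OF u(1)]], of y]
      by (simp add: linear_neg[OF lA] linear_neg[OF G(2)[OF g]])
    then show "conjm \<xi> ((+) (A x) \<circ> \<Phi> g) y = ((+) (A (x + u - lin g u)) \<circ> \<Phi> g) y"
      unfolding \<xi>_def inv_plus by (simp add: linear_add[OF lA] linear_diff[OF lA])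
  qed
  have nn: "(+) v1 \<circ> \<Phi> \<gamma>1 \<in> normalizing_affinities M" "(+) v2 \<circ> \<Phi> \<gamma>2 \<in> normalizing_affinities M"
    by (intro normalizing_affinities_comp plus_fixed_normalizing \<eta>''(3,6) n1 n2)+
  have "Aff_conj M (star UNIV M \<xi>) (\<eta>'' delta1) = star UNIV M (\<Phi> \<gamma>1)"
    unfolding \<eta>''(5) Aff_conj_star[OF \<xi> nn(1)] unfolding w1(2)[symmetric] cj[OF \<gamma>(1)] u(2) linear_0[OF lA]
    by (simp only: plus_zero id_comp)
  moreover have "Aff_conj M (star UNIV M \<xi>) (\<eta>'' delta2) = star UNIV M ((+) (A w) \<circ> \<Phi> \<gamma>2)"
    unfolding \<eta>''(8) Aff_conj_star[OF \<xi> nn(2)] unfolding w2(2)[symmetric] cj[OF \<gamma>(2)] u(3) ..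
  ultimately have "Aff_conj M (star UNIV M \<xi>) ` {\<eta>'' delta1, \<eta>'' delta2} = pair_at w"
    unfolding pair_at_def by simp
  moreover have "{\<eta>'' delta1, \<eta>'' delta2} \<subseteq> carrier (Aff M)"
    unfolding \<eta>''(5,8) carrier_Aff using nn by blast
  ultimately have "pair_conj_class M {\<eta>'' delta1, \<eta>'' delta2} = pair_conj_class M (pair_at w)"
    using pair_conj_class_conj[OF \<xi>] by metis
  moreover have "w \<in> E" unfolding E_def using w by blast
  ultimately show thesis using that \<eta>''(1,2) by blast
qed

lemma pair_at_carrier: "w \<in> E \<Longrightarrow> pair_at w \<subseteq> carrier (Aff M)"
  unfolding pair_at_def carrier_Aff E_def
  using \<Phi>_normalizing[OF \<gamma>(1)] normalizing_affinities_comp[OF plus_fixed_normalizing[OF FixN_A] \<Phi>_normalizing[OF \<gamma>(2)]]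
  by blast

lemma pair_at_zero: "pair_at 0 = {\<eta> delta1, \<eta> delta2}"
  unfolding pair_at_def \<eta>_gen linear_0[OF lA] plus_zero id_comp ..

text \<open>By injectivity of the correspondence, a class described by a pair is the class of the
  homomorphism that realizes the pair.\<close>

lemma corresponds_unique:
  assumes "corresponds M c (pair_conj_class M {\<eta>1 delta1, \<eta>1 delta2})" "\<eta>1 \<in> Hom_f M"
  shows "c = Aff_class M \<eta>1"
proof -
  obtain \<eta>2 where "\<eta>2 \<in> Hom_f M" "c = Aff_class M \<eta>2"
    "pair_conj_class M {\<eta>2 delta1, \<eta>2 delta2} = pair_conj_class M {\<eta>1 delta1, \<eta>1 delta2}"
    using assms(1) unfolding corresponds_def by metis
  then show ?thesis using Aff_class_eqI[of \<eta>1 \<eta>2] assms(2) by (simp add: Hom_f_def)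
qed

theorem fibre_description:
  "Aff_class M \<eta> \<in> psi_fibre M (Iso_class M \<Gamma> N)"
  "corresponds M (Aff_class M \<eta>) (pair_conj_class M (pair_at 0))"
  "w \<in> E \<Longrightarrow> \<exists>c\<in>Aff_Delta M. corresponds M c (pair_conj_class M (pair_at w))"
  "psi_fibre M (Iso_class M \<Gamma> N) = {c \<in> Aff_Delta M. \<exists>w\<in>E. corresponds M c (pair_conj_class M (pair_at w))}"
  "E = {0} \<Longrightarrow> psi_fibre M (Iso_class M \<Gamma> N) = {Aff_class M \<eta>}"
proof -
  have \<eta>A: "Aff_class M \<eta> \<in> Aff_Delta M" unfolding Aff_Delta_def by (rule imageI[OF \<eta>_Hom_f])
  have ri: "group_pair_iso (lifted M \<eta>) (extended M) (lifted M \<eta>) (extended M)"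
    by (rule group_pair_iso_trans[OF lifted_\<Gamma> \<Gamma>_lifted])
  show 1: "Aff_class M \<eta> \<in> psi_fibre M (Iso_class M \<Gamma> N)"
    unfolding psi_fibre_def using \<eta>A psi_iff[OF \<eta>_Hom_f] ri by blast
  show 2: "corresponds M (Aff_class M \<eta>) (pair_conj_class M (pair_at 0))"
    unfolding corresponds_def pair_at_zero using \<eta>_Hom_f by blast
  show "\<exists>c\<in>Aff_Delta M. corresponds M c (pair_conj_class M (pair_at w))" if w: "w \<in> E" for w
  proof -
    obtain \<eta>' where "\<eta>' \<in> Hom_f M" "{\<eta>' delta1, \<eta>' delta2} = pair_at w" by (rule pair_at_realized[OF w])
    then show ?thesis unfolding corresponds_def Aff_Delta_def by (metis imageI)
  qed
  show 4: "psi_fibre M (Iso_class M \<Gamma> N) = {c \<in> Aff_Delta M. \<exists>w\<in>E. corresponds M c (pair_conj_class M (pair_at w))}"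
  proof (intro equalityI subsetI)
    fix c assume "c \<in> psi_fibre M (Iso_class M \<Gamma> N)"
    then have c: "c \<in> Aff_Delta M" "psi M c = Iso_class M \<Gamma> N" by (auto simp: psi_fibre_def)
    then obtain \<eta>' where \<eta>': "\<eta>' \<in> Hom_f M" "c = Aff_class M \<eta>'" by (auto simp: Aff_Delta_def)
    obtain w \<eta>'' where "w \<in> E" "\<eta>'' \<in> Hom_f M" "Aff_class M \<eta>'' = Aff_class M \<eta>'"
      "pair_conj_class M {\<eta>'' delta1, \<eta>'' delta2} = pair_conj_class M (pair_at w)"
      by (rule fibre_realized[OF \<eta>'(1) c(2)[unfolded \<eta>'(2)]])
    then have "corresponds M c (pair_conj_class M (pair_at w))" unfolding corresponds_def \<eta>'(2) by metis
    then show "c \<in> {c \<in> Aff_Delta M. \<exists>w\<in>E. corresponds M c (pair_conj_class M (pair_at w))}"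
      using c(1) \<open>w \<in> E\<close> by blast
  next
    fix c assume "c \<in> {c \<in> Aff_Delta M. \<exists>w\<in>E. corresponds M c (pair_conj_class M (pair_at w))}"
    then obtain w where w: "w \<in> E" "c \<in> Aff_Delta M" "corresponds M c (pair_conj_class M (pair_at w))" by blast
    obtain \<eta>' where \<eta>': "\<eta>' \<in> Hom_f M" "{\<eta>' delta1, \<eta>' delta2} = pair_at w" "psi M (Aff_class M \<eta>') = Iso_class M \<Gamma> N"
      by (rule pair_at_realized[OF w(1)])
    have "c = Aff_class M \<eta>'" by (rule corresponds_unique[OF w(3)[folded \<eta>'(2)] \<eta>'(1)])
    then show "c \<in> psi_fibre M (Iso_class M \<Gamma> N)" using w(2) \<eta>'(3) by (simp add: psi_fibre_def)
  qed
  show "psi_fibre M (Iso_class M \<Gamma> N) = {Aff_class M \<eta>}" if "E = {0}"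
  proof -
    have "c = Aff_class M \<eta>" if "corresponds M c (pair_conj_class M (pair_at 0))" for c
      using corresponds_unique[OF that[unfolded pair_at_zero] \<eta>_Hom_f] .
    then show ?thesis using 1 unfolding 4 \<open>E = {0}\<close> by blast
  qed
qed

end

theorem theorem10:
  fixes M :: "('a::euclidean_space \<Rightarrow> 'a) set"
    and \<Gamma> N :: "('a \<times> real \<Rightarrow> 'a \<times> real) set"
    and V E1 E2 :: "('a \<times> real) set"
    and \<alpha> :: "'a \<times> real \<Rightarrow> 'a"
    and \<gamma>1 \<gamma>2 B1 B2 :: "'a \<times> real \<Rightarrow> 'a \<times> real"
    and b1 b2 :: "'a \<times> real"
    and \<beta> :: "(real \<Rightarrow> real) \<Rightarrow> ('a \<times> real \<Rightarrow> 'a \<times> real) set"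
    and \<eta> :: "(real \<Rightarrow> real) \<Rightarrow> 'a set \<Rightarrow> 'a set"
  assumes M: "space_group M"
    and pair: "(\<Gamma>, N) \<in> space_pairs M"
    and V: "V = Span N"
    and \<alpha>: "\<alpha> \<in> affinities V UNIV" "conj_map V UNIV \<alpha> ` bar_group N = M"
    and \<gamma>: "\<gamma>1 \<in> \<Gamma>" "\<gamma>2 \<in> \<Gamma>"
    and Coxeter: "Coxeter_generators (trans_group UNIV \<Gamma> Mod N)
      {N #>\<^bsub>trans_group UNIV \<Gamma>\<^esub> \<gamma>1, N #>\<^bsub>trans_group UNIV \<Gamma>\<^esub> \<gamma>2}"
    and \<beta>: "\<beta> \<in> iso Delta_group (trans_group UNIV \<Gamma> Mod N)"
      "\<beta> delta1 = N #>\<^bsub>trans_group UNIV \<Gamma>\<^esub> \<gamma>1" "\<beta> delta2 = N #>\<^bsub>trans_group UNIV \<Gamma>\<^esub> \<gamma>2"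
    and \<eta>: "\<eta> = (\<lambda>\<delta>\<in>Delta. sharp V (bar_group N) UNIV M \<alpha> (Xi \<Gamma> N (\<beta> \<delta>)))"
    and B: "orthogonal_transformation B1" "orthogonal_transformation B2"
      "\<gamma>1 = (\<lambda>x. b1 + B1 x)" "\<gamma>2 = (\<lambda>x. b2 + B2 x)"
    and E: "E1 = neg_eigenspace (Span (centre (trans_group UNIV N))) B1"
      "E2 = neg_eigenspace (Span (centre (trans_group UNIV N))) B2"
  shows "let pair_of = (\<lambda>v. {star UNIV M (conj_map V UNIV \<alpha> (bar V \<gamma>1)),
            star UNIV M (conj_map V UNIV \<alpha> (\<lambda>x\<in>V. v + bar V \<gamma>2 x))});
        fibre = psi_fibre M (Iso_class M \<Gamma> N)
    in (Aff_class M \<eta> \<in> fibre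
        \<and> corresponds M (Aff_class M \<eta>)
            (pair_conj_class M {star UNIV M (conj_map V UNIV \<alpha> (bar V \<gamma>1)),
               star UNIV M (conj_map V UNIV \<alpha> (bar V \<gamma>2))}))
     \<and> ((\<forall>v \<in> E1 \<inter> E2. pair_of v \<subseteq> carrier (Aff M)
            \<and> (\<exists>c \<in> Aff_Delta M. corresponds M c (pair_conj_class M (pair_of v))))
        \<and> fibre = {c \<in> Aff_Delta M. \<exists>v \<in> E1 \<inter> E2. corresponds M c (pair_conj_class M (pair_of v))})
     \<and> (E1 \<inter> E2 = {0} \<longrightarrow> fibre = {Aff_class M \<eta>})"
proof -
  have \<alpha>b: "bij_betw \<alpha> V UNIV" using \<alpha>(1) by (simp add: affinities_def)
  obtain a A where A: "linear A" "\<And>x. x \<in> V \<Longrightarrow> \<alpha> x = a + A x" using \<alpha>(1) unfolding affinities_def by blast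
  have sV: "subspace V" unfolding V Span_def by (rule subspace_span)
  have "span V = V" unfolding V Span_def by (rule span_span)
  \<comment> \<open>A is injective on V and onto the smaller space, which fixes the dimension of V
    and leaves a single normal direction.\<close>
  have "inj_on A (span V)"
    unfolding \<open>span V = V\<close>
  proof (rule inj_onI)
    fix x y assume xy: "x \<in> V" "y \<in> V" "A x = A y"
    then have "\<alpha> x = \<alpha> y" using A(2) by simp
    then show "x = y" using \<alpha>b xy(1,2) by (auto simp: bij_betw_def dest: inj_onD)
  qed
  then have "dim (A ` V) = dim V" using dim_image_eq[OF A(1)] by blast
  moreover have "A ` V = UNIV"
  proof -
    have "y \<in> A ` V" for y
    proof -
      have "a + y \<in> \<alpha> ` V" using \<alpha>b by (simp add: bij_betw_def)
      then obtain v where "v \<in> V" "a + y = \<alpha> v" by blast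
      then show ?thesis using A(2)[of v] by simp
    qed
    then show ?thesis by blast
  qed
  ultimately have "dim V + 1 = DIM('a \<times> real)" by simp
  then obtain e where e: "norm e = 1" "V = {x. x \<bullet> e = 0}" by (rule codim_one_normal[OF sV])
  \<comment> \<open>The quotient is interpreted first, because the element of infinite order that it
    supplies is an assumption of the geometric locale.\<close>
  interpret q: dihedral_quotient M \<Gamma> N \<gamma>1 \<gamma>2 \<beta>
    by unfold_locales (rule pair \<gamma> \<beta>)+
  have inf: "\<exists>\<gamma>\<in>\<Gamma>. \<forall>j>0. \<gamma> ^^ j \<notin> N"
    using tgroupD(3)[OF q.\<Gamma>tg \<gamma>(2,1)] q.tau_power_N by blast
  interpret p: dihedral_pair M \<Gamma> N \<alpha> a A e \<gamma>1 \<gamma>2 \<beta>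
    by unfold_locales
      (use M pair A(2) linear_add[OF A(1)] linear_scale[OF A(1)] \<alpha>b \<alpha>(2) e inf in \<open>simp_all add: V\<close>)
  have \<eta>': "\<eta> = p.\<eta>" unfolding \<eta> p.\<eta>_def V ..
  have l: "lin \<gamma>1 = B1" "lin \<gamma>2 = B2"
    unfolding B(3,4) by (rule lin_eq[OF orthogonal_transformation_linear[OF B(1)]], rule lin_eq[OF orthogonal_transformation_linear[OF B(2)]])
  have E': "E1 \<inter> E2 = p.E"
    unfolding E neg_eigenspace_def p.Span_centre p.E_def l by blast
  \<comment> \<open>v is added before \<alpha> is applied; it comes out as A v.\<close>
  have p2: "conj_map V UNIV \<alpha> (\<lambda>x\<in>V. v + bar V \<gamma>2 x) = (+) (A v) \<circ> p.\<Phi> \<gamma>2" if v: "v \<in> V" for v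
  proof
    fix y
    obtain x where x: "x \<in> V" "\<alpha> x = y" using p.\<alpha>_surj[of y] unfolding V by blast
    have "inv_into V \<alpha> y = x" using \<alpha>b x by (simp add: bij_betw_def inv_into_f_eq)
    then have "conj_map V UNIV \<alpha> (\<lambda>x\<in>V. v + bar V \<gamma>2 x) y = \<alpha> (v + bar V \<gamma>2 x)" using x(1) by (simp add: conj_map_def)
    also have "\<dots> = A v + \<alpha> (bar V \<gamma>2 x)"
    proof -
      have b: "bar V \<gamma>2 x \<in> V" using p.bar_V[OF x(1)[unfolded V]] unfolding V .
      show ?thesis using A(2)[OF b] A(2)[OF subspace_add[OF sV v b]] by (simp add: linear_add[OF A(1)])
    qed
    also have "\<alpha> (bar V \<gamma>2 x) = p.\<Phi> \<gamma>2 y" using p.\<Phi>_\<alpha>[OF x(1)[unfolded V], of \<gamma>2] x(2) unfolding V by simp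
    finally show "conj_map V UNIV \<alpha> (\<lambda>x\<in>V. v + bar V \<gamma>2 x) y = ((+) (A v) \<circ> p.\<Phi> \<gamma>2) y" unfolding comp_apply .
  qed
  define pair_of where "pair_of v = {star UNIV M (conj_map V UNIV \<alpha> (bar V \<gamma>1)),
            star UNIV M (conj_map V UNIV \<alpha> (\<lambda>x\<in>V. v + bar V \<gamma>2 x))}" for v
  have po: "pair_of v = p.pair_at v" if "v \<in> p.E" for v
  proof -
    have "v \<in> V" using that p.FixN_V unfolding p.E_def V by blast
    from p2[OF this] show ?thesis unfolding pair_of_def p.pair_at_def by (simp add: p.\<Phi>_def V)
  qed
  \<comment> \<open>Part (a) is the member v = 0 of the family.\<close>
  have po0: "{star UNIV M (conj_map V UNIV \<alpha> (bar V \<gamma>1)), star UNIV M (conj_map V UNIV \<alpha> (bar V \<gamma>2))} = p.pair_at 0"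
    unfolding p.pair_at_zero p.\<eta>_gen V p.\<Phi>_def ..
  have "pair_of v \<subseteq> carrier (Aff M) \<and> (\<exists>c \<in> Aff_Delta M. corresponds M c (pair_conj_class M (pair_of v)))"
    if "v \<in> p.E" for v
    using p.fibre_description(3)[OF that] p.pair_at_carrier[OF that] unfolding po[OF that] by blast
  moreover have "(\<exists>v \<in> p.E. corresponds M c (pair_conj_class M (p.pair_at v)))
      \<longleftrightarrow> (\<exists>v \<in> p.E. corresponds M c (pair_conj_class M (pair_of v)))" for c
    using po by (intro bex_cong) simp_all
  ultimately show ?thesis
    unfolding Let_def \<eta>' po0 E' pair_of_def[symmetric]
    using p.fibre_description(1,2,4,5) by simp
qed

end
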